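(* There is an explicit algorithm that computes the binary expansion of an absolutely normal real number $z\in[0,1)$ in nearly linear time: the $n$th bit of $z$ is output after $O(n\log^{c}n)$ computation steps, for some constant $c$.
   Context: A real $\alpha$ is normal in base $b\ge2$ if for every $m\ge1$ and every string $w$ of $m$ base-$b$ digits, the asymptotic frequency of occurrences of $w$ in the base-$b$ expansion of $\alpha$ is $b^{-m}$; it is absolutely normal if it is normal in every base $b\ge2$. Computation steps are measured on a log-cost RAM. *)

theory Defs
  imports Complex_Main
begin

definition digit :: "nat \<Rightarrow> real \<Rightarrow> nat \<Rightarrow> nat" where
  "digit b x k = nat (\<lfloor>x * real b ^ (k + 1)\<rfloor> mod int b)"

definition occ :: "nat \<Rightarrow> real \<Rightarrow> nat list \<Rightarrow> nat \<Rightarrow> nat" where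
  "occ b x w N = card {i. i < N \<and> (\<forall>j < length w. digit b x (i + j) = w ! j)}"

definition normal_in_base :: "nat \<Rightarrow> real \<Rightarrow> bool" where
  "normal_in_base b x \<longleftrightarrow>
     (\<forall>w. w \<noteq> [] \<and> (\<forall>d \<in> set w. d < b) \<longrightarrow>
        (\<lambda>N. real (occ b x w N) / real N) \<longlonglongrightarrow> 1 / real b ^ length w)"

definition absolutely_normal :: "real \<Rightarrow> bool" where
  "absolutely_normal x \<longleftrightarrow> (\<forall>b \<ge> 2. normal_in_base b x)"

datatype instr = Const nat nat | Add nat nat nat | Sub nat nat nat | Load nat nat | Store nat nat
  | Jz nat nat | Out nat

record config =
  pc :: nat
  regs :: "nat \<Rightarrow> nat"
  outp :: "bool list"

fun blen :: "nat \<Rightarrow> nat" where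
  "blen n = (if n < 2 then 1 else 1 + blen (n div 2))"

definition exec :: "instr \<Rightarrow> config \<Rightarrow> config" where
  "exec ins c = (let R = regs c; p = pc c in case ins of
      Const i k \<Rightarrow> c\<lparr>pc := p + 1, regs := R(i := k)\<rparr>
    | Add i j k \<Rightarrow> c\<lparr>pc := p + 1, regs := R(i := R j + R k)\<rparr>
    | Sub i j k \<Rightarrow> c\<lparr>pc := p + 1, regs := R(i := R j - R k)\<rparr>
    | Load i j \<Rightarrow> c\<lparr>pc := p + 1, regs := R(i := R (R j))\<rparr>
    | Store i j \<Rightarrow> c\<lparr>pc := p + 1, regs := R(R i := R j)\<rparr>
    | Jz i l \<Rightarrow> c\<lparr>pc := (if R i = 0 then l else p + 1)\<rparr>
    | Out i \<Rightarrow> c\<lparr>pc := p + 1, outp := outp c @ [R i \<noteq> 0]\<rparr>)"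

definition icost :: "instr \<Rightarrow> config \<Rightarrow> nat" where
  "icost ins c = (let R = regs c in case ins of
      Const i k \<Rightarrow> blen i + blen k
    | Add i j k \<Rightarrow> blen i + blen j + blen k + blen (R j) + blen (R k)
    | Sub i j k \<Rightarrow> blen i + blen j + blen k + blen (R j) + blen (R k)
    | Load i j \<Rightarrow> blen i + blen j + blen (R j) + blen (R (R j))
    | Store i j \<Rightarrow> blen i + blen (R i) + blen j + blen (R j)
    | Jz i l \<Rightarrow> blen i + blen (R i) + blen l
    | Out i \<Rightarrow> blen i + blen (R i))"

definition step :: "instr list \<Rightarrow> config \<Rightarrow> config" where
  "step P c = (if pc c < length P then exec (P ! pc c) c else c)"

definition step_cost :: "instr list \<Rightarrow> config \<Rightarrow> nat" where
  "step_cost P c = (if pc c < length P then icost (P ! pc c) c else 0)"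

definition init :: config where
  "init = \<lparr>pc = 0, regs = (\<lambda>_. 0), outp = []\<rparr>"

definition run :: "instr list \<Rightarrow> nat \<Rightarrow> config" where
  "run P t = (step P ^^ t) init"

definition cost :: "instr list \<Rightarrow> nat \<Rightarrow> nat" where
  "cost P t = (\<Sum>s<t. step_cost P (run P s))"

end

theory Submission
  imports Defs "HOL-Computational_Algebra.Polynomial"
begin

text \<open>
  The number is produced in stages; stage k doubles the number of bits from 2^k to 2^(k + 1). Within
  a stage the new bits are chosen in blocks of about 8 log k bits by exhaustive search: a
  variance estimate shows that for some choice of the block the next digits in each of the bases
  2, ..., log log k + O(1) contain every digit with almost the right frequency. Since only upper
  bounds on digit frequencies are needed, this makes the number simply normal in every base, hence
  absolutely normal.

  To run the search one needs, for every base b and every prefix p of n bits, the fractional part of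
  b^m p/2^n and the slope b^m/2^n to a precision proportional to the length of the block. These
  are propagated down a binary tree of blocks: the left half truncates the state of its parent, the
  right half multiplies it by a power of b. The numbers at a node have length proportional to the number of
  bits below it, so with a quasi-linear multiplication of binary numbers (Nussbaumer's polynomial transform)
  every level of the tree costs 2^k times a power of k.

  The algorithm is written as a functional program on binary trees, run by a small stack machine
  which is in turn compiled to the random access machine.
\<close>

section \<open>Decision trees on binary trees and their compilation to the RAM\<close>

datatype tree = Leaf | Node tree tree

primrec left :: "tree => tree" where
 "left Leaf = Leaf" | "left (Node a b) = a"

primrec right :: "tree => tree" where
 "right Leaf = Leaf" | "right (Node a b) = b"

primrec subtree_at :: "bool list => tree => tree" where
 "subtree_at [] t = t"
| "subtree_at (b # p) t = subtree_at p (if b then right t else left t)"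

datatype expr = Path "bool list" | LeafE | NodeE expr expr

primrec eval_expr :: "expr => tree => tree" where
 "eval_expr (Path p) t = subtree_at p t"
| "eval_expr LeafE t = Leaf"
| "eval_expr (NodeE a b) t = Node (eval_expr a t) (eval_expr b t)"

primrec expr_depth :: "expr => nat" where
 "expr_depth (Path p) = 0" | "expr_depth LeafE = 0"
| "expr_depth (NodeE a b) = Suc (max (expr_depth a) (expr_depth b))"

primrec expr_cells :: "expr => nat" where
 "expr_cells (Path p) = 0" | "expr_cells LeafE = 0"
| "expr_cells (NodeE a b) = expr_cells a + expr_cells b + 2"

datatype dtree = Test "bool list" dtree dtree | Do "bool list option" expr

primrec eval_dtree :: "dtree => tree => tree \<times> bool list" where
 "eval_dtree (Test p a b) t = (if subtree_at p t = Leaf then eval_dtree a t else eval_dtree b t)"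
| "eval_dtree (Do q e) t = (eval_expr e t, case q of None => [] | Some p => [subtree_at p t \<noteq> Leaf])"

primrec dtree_depth :: "dtree => nat" where
 "dtree_depth (Test p a b) = max (dtree_depth a) (dtree_depth b)"
| "dtree_depth (Do q e) = expr_depth e"

primrec dtree_cells :: "dtree => nat" where
 "dtree_cells (Test p a b) = max (dtree_cells a) (dtree_cells b)"
| "dtree_cells (Do q e) = expr_cells e"

definition dtree_step :: "dtree => tree \<times> bool list => tree \<times> bool list" where
 "dtree_step D = (%(t, u). (fst (eval_dtree D t), u @ snd (eval_dtree D t)))"

text \<open>Register conventions: 0 and 1 always hold 0, so that both projections of the null
 pointer 0 are again 0; 2 holds the constant 1, 3 the first free heap cell, 4 the root.\<close>

definition child_code :: "nat => bool => instr list" where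
 "child_code d b = (if b then [Add d d 2] else []) @ [Load d d]"

definition path_code :: "nat => bool list => instr list" where
 "path_code d p = [Add d 4 0] @ concat (map (child_code d) p)"

definition push_code :: "nat => instr list" where
 "push_code d = [Store 3 d, Add 3 3 2]"

definition cons_code :: "nat => instr list" where
 "cons_code d = push_code d @ push_code (d + 1) @ [Sub d 3 2, Sub d d 2]"

primrec expr_code :: "nat => expr => instr list" where
 "expr_code d (Path p) = path_code d p"
| "expr_code d LeafE = [Const d 0]"
| "expr_code d (NodeE a b) = expr_code d a @ expr_code (d + 1) b @ cons_code d"

definition output_code :: "bool list option => instr list" where
 "output_code q = (case q of None => [] | Some p => path_code 5 p @ [Out 5])"

primrec dtree_code :: "nat => nat => dtree => instr list" where
 "dtree_code l i (Test p a b) =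
  (let i' = i + length (path_code 5 p) + 1; cb = dtree_code l i' b
   in path_code 5 p @ [Jz 5 (i' + length cb)] @ cb @ dtree_code l (i' + length cb) a)"
| "dtree_code l i (Do q e) = output_code q @ expr_code 5 e @ [Add 4 5 0, Jz 0 l]"

definition reaches :: "instr list => nat => nat => config => config => bool" where
 "reaches P w n c c' \<longleftrightarrow> (step P ^^ n) c = c' \<and> (\<Sum>s<n. step_cost P ((step P ^^ s) c)) <= n * w"

lemma reaches_refl: "reaches P w 0 c c"
 by (simp add: reaches_def)

lemma reaches_trans:
 assumes "reaches P w n c c'" "reaches P w n' c' c''"
 shows "reaches P w (n + n') c c''"
proof -
 have shift: "(step P ^^ (n + s)) c = (step P ^^ s) c'" for s
  using assms(1) by (simp add: reaches_def add.commute[of n] funpow_add)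
 have "(\<Sum>s<n + n'. step_cost P ((step P ^^ s) c))
  = (\<Sum>s<n. step_cost P ((step P ^^ s) c)) + (\<Sum>s<n'. step_cost P ((step P ^^ (n + s)) c))"
  by (induction n') auto
 moreover have "(step P ^^ (n + n')) c = c''" using shift[of n'] assms(2) by (simp add: reaches_def)
 ultimately show ?thesis using assms by (simp add: reaches_def shift add_mult_distrib)
qed

primrec code_at :: "instr list => nat => instr list => bool" where
 "code_at P i [] \<longleftrightarrow> True"
| "code_at P i (x # xs) \<longleftrightarrow> i < length P \<and> P ! i = x \<and> code_at P (Suc i) xs"

lemma code_at_append [simp]: "code_at P i (a @ b) \<longleftrightarrow> code_at P i a \<and> code_at P (i + length a) b"
 by (induction a arbitrary: i) auto

lemma code_at_infix: "code_at (a @ b @ c) (length a) b"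
proof (induction b arbitrary: a)
 case (Cons x b)
 then show ?case using Cons[of "a @ [x]"] by (simp add: nth_append)
qed simp

lemma blen_mono: "m <= n ==> blen m <= blen n"
proof (induction n arbitrary: m rule: blen.induct)
 case (1 n)
 show ?case
 proof (cases "m < 2")
  case True then show ?thesis by (subst (1 2) blen.simps) auto
 next
  case False
  then have "\<not> n < 2" "m div 2 <= n div 2" using "1.prems" by auto
  then have "blen (m div 2) <= blen (n div 2)" using "1.IH" by blast
  then show ?thesis using False \<open>\<not> n < 2\<close> by (subst (1 2) blen.simps) auto
 qed
qed

declare blen.simps[simp del]

primrec operands :: "instr => nat set" where
 "operands (Const i k) = {i, k}" | "operands (Add i j k) = {i, j, k}" | "operands (Sub i j k) = {i, j, k}"
| "operands (Load i j) = {i, j}" | "operands (Store i j) = {i, j}" | "operands (Jz i l) = {i, l}"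
| "operands (Out i) = {i}"

lemma icost_le:
 assumes "\<forall>a. regs c a <= V" "\<forall>x\<in>operands i. x <= V"
 shows "icost i c <= 5 * blen V"
proof -
 have regs: "blen (regs c a) <= blen V" for a using assms(1) blen_mono by blast
 have operands: "\<forall>x\<in>operands i. blen x <= blen V" using assms(2) blen_mono by blast
 show ?thesis
 proof (cases i)
  case (Load x y)
  then show ?thesis using operands regs[of y] regs[of "regs c y"] by (simp add: icost_def Let_def)
 next
  case (Store x y)
  then show ?thesis using operands regs[of x] regs[of y] by (simp add: icost_def Let_def)
 next
  case (Jz x l)
  then show ?thesis using operands regs[of x] by (simp add: icost_def Let_def)
 next
  case (Out x)
  then show ?thesis using operands regs[of x] by (simp add: icost_def Let_def)
 next
  case (Add x y z)
  then show ?thesis using operands regs[of y] regs[of z] by (simp add: icost_def Let_def)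
 next
  case (Sub x y z)
  then show ?thesis using operands regs[of y] regs[of z] by (simp add: icost_def Let_def)
 qed (use operands in \<open>simp add: icost_def Let_def\<close>)
qed

lemma reaches_instr:
 assumes "code_at P (pc c) [i]" "\<forall>a. regs c a <= V" "\<forall>x\<in>operands i. x <= V"
 shows "reaches P (5 * blen V) 1 c (exec i c)"
 using assms icost_le[OF assms(2,3)] by (simp add: reaches_def step_def step_cost_def)

primrec represents :: "nat => nat => (nat => nat) => nat => tree => bool" where
 "represents h H R p Leaf \<longleftrightarrow> p = 0"
| "represents h H R p (Node a b) \<longleftrightarrow>
  h <= p \<and> p + 1 < H \<and> represents h H R (R p) a \<and> represents h H R (R (p + 1)) b"

lemma represents_mono:
 "represents h H R p t ==> H <= H' ==> (\<And>a. h <= a ==> a < H ==> R' a = R a) ==> represents h H' R' p t"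
 by (induction t arbitrary: p) auto

lemma represents_upd: "d < h ==> represents h H (R(d := v)) p t \<longleftrightarrow> represents h H R p t"
 by (induction t arbitrary: p) auto

definition heap :: "nat => nat => (nat => nat) => bool" where
 "heap h H R \<longleftrightarrow> R 0 = 0 \<and> R 1 = 0 \<and> R 2 = 1 \<and> R 3 = H \<and> 6 <= h \<and> h <= H \<and> (\<forall>a. R a <= H)"

lemma heap_upd: "heap h H R ==> 3 < d ==> v <= H ==> heap h H (R(d := v))"
 by (auto simp: heap_def)

lemma represents_le: "heap h H R ==> represents h H R p t ==> p <= H"
 by (cases t) (auto simp: heap_def)

lemma represents_null_iff: "heap h H R ==> represents h H R p t ==> p = 0 \<longleftrightarrow> t = Leaf"
 by (cases t) (auto simp: heap_def)

definition rooted :: "nat => nat => (nat => nat) => tree => bool" where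
 "rooted h H R t \<longleftrightarrow> heap h H R \<and> represents h H R (R 4) t"

lemma rooted_upd: "rooted h H R t ==> 5 <= d ==> d < h ==> v <= H ==> rooted h H (R(d := v)) t"
 by (auto simp: rooted_def heap_upd represents_upd)

definition preserves :: "nat => nat => nat => (nat => nat) => (nat => nat) => bool" where
 "preserves h H d R R' \<longleftrightarrow> (\<forall>a. a < d \<and> a \<noteq> 3 \<or> h <= a \<and> a < H \<longrightarrow> R' a = R a)"

lemma preserves_trans:
 "preserves h H d R R' ==> preserves h H' d' R' R'' ==> H <= H' ==> d <= d' ==> preserves h H d R R''"
 by (auto simp: preserves_def)

lemma represents_preserves: "represents h H R p t ==> preserves h H d R R' ==> H <= H' ==> represents h H' R' p t"
 by (erule represents_mono) (auto simp: preserves_def)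

abbreviation "conf q R u \<equiv> \<lparr>pc = q, regs = R, outp = u\<rparr>"

context
 fixes P :: "instr list" and h V :: nat
begin

lemma reaches_heap_instr:
 assumes "code_at P q [i]" "heap h H R" "H <= V" "\<forall>x\<in>operands i. x <= V" "exec i (conf q R u) = c"
 shows "reaches P (5 * blen V) 1 (conf q R u) c"
 using reaches_instr[of P "conf q R u" i V] assms by (auto simp: heap_def intro: order_trans)

lemma reaches_child:
 assumes code: "code_at P q (child_code d b)" and heap: "heap h H R" and tree: "represents h H R (R d) t"
  and bounds: "5 <= d" "d < h" "H <= V"
 shows "\<exists>v. reaches P (5 * blen V) (length (child_code d b)) (conf q R u)
   (conf (q + length (child_code d b)) (R(d := v)) u) \<and> represents h H R v (if b then right t else left t)"
proof -
 define p where "p = (if b then R d + 1 else R d)"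
 have regs: "R 0 = 0" "R 1 = 0" "R 2 = 1" "6 <= h" "h <= H" using heap by (auto simp: heap_def)
 have p: "p \<noteq> d" "p <= H" using tree bounds regs by (cases t; auto simp: p_def)+
 have child: "represents h H R (R p) (if b then right t else left t)"
  using tree regs by (cases t) (auto simp: p_def)
 have operands: "d <= V" "2 <= V" using bounds regs by auto
 let ?n = "if b then 1 else 0 :: nat"
 have "reaches P (5 * blen V) ?n (conf q R u) (conf (q + ?n) (R(d := p)) u)"
 proof (cases b)
  case True
  then have "reaches P (5 * blen V) 1 (conf q R u) (conf (q + 1) (R(d := R d + 1)) u)"
   using code operands bounds regs
   by (intro reaches_heap_instr[OF _ heap, of _ "Add d d 2"]) (auto simp: child_code_def exec_def)
  then show ?thesis using True by (simp add: p_def)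
 qed (simp add: p_def reaches_refl)
 moreover have "reaches P (5 * blen V) 1 (conf (q + ?n) (R(d := p)) u) (conf (q + ?n + 1) (R(d := R p)) u)"
  using code operands bounds p
  by (intro reaches_heap_instr[OF _ heap_upd[OF heap, of d p], of _ "Load d d"])
   (auto simp: child_code_def exec_def Let_def)
 ultimately have "reaches P (5 * blen V) (?n + 1) (conf q R u) (conf (q + ?n + 1) (R(d := R p)) u)"
  by (rule reaches_trans)
 then show ?thesis using child by (auto simp: child_code_def add.assoc)
qed

lemma reaches_children:
 assumes "code_at P q (concat (map (child_code d) p))" "heap h H R" "represents h H R (R d) t" "5 <= d" "d < h" "H <= V"
 shows "\<exists>v. reaches P (5 * blen V) (length (concat (map (child_code d) p))) (conf q R u)
   (conf (q + length (concat (map (child_code d) p))) (R(d := v)) u) \<and> represents h H R v (subtree_at p t)"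
 using assms
proof (induction p arbitrary: R t q)
 case Nil
 then show ?case using reaches_refl[of P _ "conf q R u"] by (intro exI[of _ "R d"]) (simp del: fun_upd_apply)
next
 case (Cons b p)
 let ?t = "if b then right t else left t" and ?q = "q + length (child_code d b)"
 obtain v where child: "reaches P (5 * blen V) (length (child_code d b)) (conf q R u) (conf ?q (R(d := v)) u)"
  "represents h H R v ?t"
  using reaches_child[of q d b H R t u] Cons.prems by auto
 have heap: "heap h H (R(d := v))"
  using Cons.prems represents_le[OF _ child(2)] by (intro heap_upd) auto
 have tree: "represents h H (R(d := v)) ((R(d := v)) d) ?t"
  using child(2) Cons.prems by (simp add: represents_upd)
 have code: "code_at P ?q (concat (map (child_code d) p))" using Cons.prems by simp
 from Cons.IH[OF code heap tree Cons.prems(4-6)] obtain w where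
  "reaches P (5 * blen V) (length (concat (map (child_code d) p))) (conf ?q (R(d := v)) u)
   (conf (?q + length (concat (map (child_code d) p))) (R(d := v, d := w)) u)"
  "represents h H (R(d := v)) w (subtree_at p ?t)" by blast
 from reaches_trans[OF child(1) this(1)] this(2) show ?case
  using Cons.prems by (intro exI[of _ w]) (simp add: add.assoc represents_upd del: fun_upd_apply)
qed

lemma reaches_path:
 assumes code: "code_at P q (path_code d p)" and root: "rooted h H R t" and bounds: "5 <= d" "d < h" "H <= V"
 shows "\<exists>v. reaches P (5 * blen V) (length (path_code d p)) (conf q R u)
   (conf (q + length (path_code d p)) (R(d := v)) u) \<and> represents h H R v (subtree_at p t)"
proof -
 have regs: "R 0 = 0" "R 4 <= H" "6 <= h" "h <= H" and heap: "heap h H R"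
  using root by (auto simp: rooted_def heap_def)
 have "reaches P (5 * blen V) 1 (conf q R u) (conf (q + 1) (R(d := R 4)) u)"
  using code bounds regs by (intro reaches_heap_instr[OF _ heap]) (auto simp: path_code_def exec_def)
 moreover obtain v where "reaches P (5 * blen V) (length (concat (map (child_code d) p))) (conf (q + 1) (R(d := R 4)) u)
   (conf (q + 1 + length (concat (map (child_code d) p))) (R(d := v)) u)" "represents h H R v (subtree_at p t)"
  using reaches_children[of "q + 1" d p H "R(d := R 4)" t u] code bounds root heap_upd[OF heap, of d "R 4"] regs
  by (auto simp: path_code_def rooted_def represents_upd)
 ultimately show ?thesis using reaches_trans by (fastforce simp: path_code_def)
qed

lemma reaches_push:
 assumes code: "code_at P q (push_code d)" and heap: "heap h H R" and bounds: "d < h" "H < V"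
 shows "reaches P (5 * blen V) 2 (conf q R u) (conf (q + 2) (R(H := R d, 3 := Suc H)) u)"
  "heap h (Suc H) (R(H := R d, 3 := Suc H))"
proof -
 have regs: "R 2 = 1" "R 3 = H" "6 <= h" "h <= H" "\<And>a. R a <= H" using heap by (auto simp: heap_def)
 show "heap h (Suc H) (R(H := R d, 3 := Suc H))" using heap by (auto simp: heap_def le_SucI)
 have "reaches P (5 * blen V) 1 (conf q R u) (conf (q + 1) (R(H := R d)) u)"
  using code bounds regs by (intro reaches_heap_instr[OF _ heap]) (auto simp: push_code_def exec_def Let_def)
 moreover have "reaches P (5 * blen V) 1 (conf (q + 1) (R(H := R d)) u) (conf (q + 1 + 1) (R(H := R d, 3 := Suc H)) u)"
  using code bounds regs heap_upd[OF heap, of H "R d"]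
  by (intro reaches_heap_instr[where i = "Add 3 3 2" and H = H]) (auto simp: push_code_def exec_def Let_def)
 ultimately have "reaches P (5 * blen V) (1 + 1) (conf q R u) (conf (q + 1 + 1) (R(H := R d, 3 := Suc H)) u)"
  by (rule reaches_trans)
 then show "reaches P (5 * blen V) 2 (conf q R u) (conf (q + 2) (R(H := R d, 3 := Suc H)) u)"
  by (simp add: numeral_2_eq_2)
qed

lemma reaches_cons:
 assumes code: "code_at P q (cons_code d)" and heap: "heap h H R" and bounds: "5 <= d" "d + 1 < h" "H + 2 <= V"
  and trees: "represents h H R (R d) a" "represents h H R (R (d + 1)) b"
 shows "\<exists>R'. reaches P (5 * blen V) (length (cons_code d)) (conf q R u) (conf (q + length (cons_code d)) R' u) \<and>
  heap h (H + 2) R' \<and> represents h (H + 2) R' (R' d) (Node a b) \<and> preserves h H d R R'"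
proof -
 have regs: "R 2 = 1" "6 <= h" "h <= H" using heap by (auto simp: heap_def)
 define R1 where "R1 = R(H := R d, 3 := Suc H)"
 define R2 where "R2 = R1(Suc H := R1 (d + 1), 3 := Suc (Suc H))"
 define R3 where "R3 = R2(d := H)"
 have R3: "R3 a = R a" if "a < d \<and> a \<noteq> 3 \<or> h <= a \<and> a < H" for a
  using that bounds regs by (auto simp: R3_def R2_def R1_def)
 have push: "reaches P (5 * blen V) 2 (conf q R u) (conf (q + 2) R1 u)" "heap h (Suc H) R1"
  using reaches_push(1)[of q d H R u] reaches_push(2)[of q d H R] code heap bounds by (auto simp: R1_def cons_code_def)
 have push': "reaches P (5 * blen V) 2 (conf (q + 2) R1 u) (conf (q + 2 + 2) R2 u)" "heap h (H + 2) R2"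
  using reaches_push(1)[of "q + 2" "d + 1" "Suc H" R1 u] reaches_push(2)[of "q + 2" "d + 1" "Suc H" R1] code push(2) bounds
  by (auto simp: R2_def cons_code_def push_code_def)

 have "reaches P (5 * blen V) 1 (conf (q + 2 + 2) R2 u) (conf (q + 2 + 2 + 1) (R2(d := Suc H)) u)"
  using code bounds regs push'(2)
  by (intro reaches_heap_instr[where i = "Sub d 3 2" and H = "H + 2"])
   (auto simp: cons_code_def push_code_def exec_def R2_def R1_def)
 moreover have "reaches P (5 * blen V) 1 (conf (q + 2 + 2 + 1) (R2(d := Suc H)) u) (conf (q + 2 + 2 + 1 + 1) R3 u)"
  using code bounds regs heap_upd[OF push'(2), of d "Suc H"]
  by (intro reaches_heap_instr[where i = "Sub d d 2" and H = "H + 2"])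
   (auto simp: cons_code_def push_code_def exec_def R3_def R2_def R1_def)
 ultimately have "reaches P (5 * blen V) (2 + (2 + (1 + 1))) (conf q R u) (conf (q + 2 + 2 + 1 + 1) R3 u)"
  by (intro reaches_trans[OF push(1)] reaches_trans[OF push'(1)] reaches_trans)
 moreover have "heap h (H + 2) R3" unfolding R3_def using push'(2) bounds by (intro heap_upd) auto
 moreover have "represents h (H + 2) R3 (R3 d) (Node a b)"
  using trees[THEN represents_mono, of "H + 2" R3] R3 bounds regs by (auto simp: R3_def R2_def R1_def)
 moreover have "preserves h H d R R3" using R3 by (simp add: preserves_def)
 ultimately show ?thesis by (auto simp: cons_code_def push_code_def numeral_2_eq_2)
qed

lemma reaches_expr:
 assumes "code_at P q (expr_code d e)" "rooted h H R t" "5 <= d" "d + expr_depth e < h" "H + expr_cells e <= V"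
 shows "\<exists>R'. reaches P (5 * blen V) (length (expr_code d e)) (conf q R u) (conf (q + length (expr_code d e)) R' u) \<and>
  heap h (H + expr_cells e) R' \<and> represents h (H + expr_cells e) R' (R' d) (eval_expr e t) \<and> preserves h H d R R'"
 using assms
proof (induction e arbitrary: R H d q)
 case (Path p)
 then obtain v where "reaches P (5 * blen V) (length (path_code d p)) (conf q R u)
   (conf (q + length (path_code d p)) (R(d := v)) u)" "represents h H R v (subtree_at p t)"
  using reaches_path[of q d p H R t u] by auto
 moreover from this(2) have "heap h H (R(d := v))"
  using Path.prems represents_le by (intro heap_upd) (auto simp: rooted_def)
 ultimately show ?case using Path.prems
  by (intro exI[of _ "R(d := v)"]) (simp add: preserves_def represents_upd del: fun_upd_apply, simp)
next
 case LeafE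
 then have heap: "heap h H R" and "h <= H" by (auto simp: rooted_def heap_def)
 then have "reaches P (5 * blen V) 1 (conf q R u) (conf (q + 1) (R(d := 0)) u)"
  using LeafE by (intro reaches_heap_instr[OF _ heap]) (auto simp: exec_def)
 then show ?case using LeafE heap_upd[OF heap, of d 0] by (auto simp: preserves_def)
next
 case (NodeE a b)
 let ?Ha = "H + expr_cells a" and ?Hb = "H + expr_cells a + expr_cells b"
 let ?qa = "q + length (expr_code d a)" and ?qb = "q + length (expr_code d a) + length (expr_code (d + 1) b)"
 have "code_at P q (expr_code d a)" "d + expr_depth a < h" "?Ha <= V" using NodeE.prems by auto
 from NodeE.IH(1)[OF this(1) NodeE.prems(2,3) this(2,3)] obtain R1 where
  a: "reaches P (5 * blen V) (length (expr_code d a)) (conf q R u) (conf ?qa R1 u)"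
  "heap h ?Ha R1" "represents h ?Ha R1 (R1 d) (eval_expr a t)" "preserves h H d R R1" by blast
 have "rooted h ?Ha R1 t"
  using a(2) represents_preserves[OF _ a(4), of "R 4" t] a(4) NodeE.prems by (auto simp: rooted_def preserves_def)
 then have "\<exists>R'. reaches P (5 * blen V) (length (expr_code (d + 1) b)) (conf ?qa R1 u) (conf ?qb R' u) \<and>
  heap h ?Hb R' \<and> represents h ?Hb R' (R' (d + 1)) (eval_expr b t) \<and> preserves h ?Ha (d + 1) R1 R'"
  using NodeE.prems by (intro NodeE.IH(2)) auto
 then obtain R2 where b: "reaches P (5 * blen V) (length (expr_code (d + 1) b)) (conf ?qa R1 u) (conf ?qb R2 u)"
  "heap h ?Hb R2" "represents h ?Hb R2 (R2 (d + 1)) (eval_expr b t)" "preserves h ?Ha (d + 1) R1 R2" by blast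
 have "represents h ?Hb R2 (R2 d) (eval_expr a t)"
  using represents_preserves[OF a(3) b(4)] b(4) NodeE.prems by (auto simp: preserves_def)
 then obtain R3 where cons: "reaches P (5 * blen V) (length (cons_code d)) (conf ?qb R2 u)
   (conf (?qb + length (cons_code d)) R3 u)"
  "heap h (?Hb + 2) R3" "represents h (?Hb + 2) R3 (R3 d) (eval_expr (NodeE a b) t)" "preserves h ?Hb d R2 R3"
  using reaches_cons[of ?qb d ?Hb R2 "eval_expr a t" "eval_expr b t" u] b NodeE.prems by auto
 have "preserves h H d R R3"
  by (rule preserves_trans[OF preserves_trans[OF a(4) b(4)] cons(4)]) simp_all
 then show ?case
  using reaches_trans[OF reaches_trans[OF a(1) b(1)] cons(1)] cons(2,3) by (auto simp: add.assoc)
qed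

lemma reaches_rooted_path:
 assumes "code_at P q (path_code 5 p)" "rooted h H R t" "5 < h" "H <= V"
 shows "\<exists>v. reaches P (5 * blen V) (length (path_code 5 p)) (conf q R u)
   (conf (q + length (path_code 5 p)) (R(5 := v)) u) \<and>
  rooted h H (R(5 := v)) t \<and> (v = 0 \<longleftrightarrow> subtree_at p t = Leaf)"
proof -
 have heap: "heap h H R" using assms(2) by (simp add: rooted_def)
 obtain v where v: "reaches P (5 * blen V) (length (path_code 5 p)) (conf q R u)
   (conf (q + length (path_code 5 p)) (R(5 := v)) u)" "represents h H R v (subtree_at p t)"
  using reaches_path[of q 5 p H R t u] assms by auto
 show ?thesis
  using v(1) represents_null_iff[OF heap v(2)] rooted_upd[OF assms(2) _ _ represents_le[OF heap v(2)]] assms(3) by auto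
qed

lemma reaches_test:
 assumes code: "code_at P q (path_code 5 p @ [Jz 5 l])" and root: "rooted h H R t" and bounds: "5 < h" "H <= V" "l <= V"
 shows "\<exists>R'. reaches P (5 * blen V) (length (path_code 5 p) + 1) (conf q R u)
   (conf (if subtree_at p t = Leaf then l else q + length (path_code 5 p) + 1) R' u) \<and> rooted h H R' t"
proof -
 let ?q = "q + length (path_code 5 p)"
 obtain v where v: "reaches P (5 * blen V) (length (path_code 5 p)) (conf q R u) (conf ?q (R(5 := v)) u)"
  "rooted h H (R(5 := v)) t" "v = 0 \<longleftrightarrow> subtree_at p t = Leaf"
  using reaches_rooted_path[of q p H R t u] assms by auto
 have heap: "heap h H (R(5 := v))" "6 <= h" "h <= H" using v(2) by (auto simp: rooted_def heap_def)
 have "reaches P (5 * blen V) 1 (conf ?q (R(5 := v)) u)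
   (conf (if subtree_at p t = Leaf then l else ?q + 1) (R(5 := v)) u)"
  using code bounds heap(2,3) v(3) by (intro reaches_heap_instr[OF _ heap(1)]) (auto simp: exec_def)
 with reaches_trans[OF v(1) this] v(2) show ?thesis by auto
qed

lemma reaches_output:
 assumes code: "code_at P q (output_code p)" and root: "rooted h H R t" and bounds: "5 < h" "H <= V"
 shows "\<exists>R'. reaches P (5 * blen V) (length (output_code p)) (conf q R u)
   (conf (q + length (output_code p)) R' (u @ snd (eval_dtree (Do p e) t))) \<and> rooted h H R' t"
proof (cases p)
 case None
 then show ?thesis using root reaches_refl by (simp add: output_code_def) blast
next
 case (Some p')
 let ?q = "q + length (path_code 5 p')"
 obtain v where v: "reaches P (5 * blen V) (length (path_code 5 p')) (conf q R u) (conf ?q (R(5 := v)) u)"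
  "rooted h H (R(5 := v)) t" "v = 0 \<longleftrightarrow> subtree_at p' t = Leaf"
  using reaches_rooted_path[of q p' H R t u] assms Some by (auto simp: output_code_def)
 have heap: "heap h H (R(5 := v))" "6 <= h" "h <= H" using v(2) by (auto simp: rooted_def heap_def)
 have "reaches P (5 * blen V) 1 (conf ?q (R(5 := v)) u) (conf (?q + 1) (R(5 := v)) (u @ [subtree_at p' t \<noteq> Leaf]))"
  using code bounds heap(2,3) v(3) Some
  by (intro reaches_heap_instr[OF _ heap(1)]) (auto simp: exec_def Let_def output_code_def)
 with reaches_trans[OF v(1) this] v(2) show ?thesis by (auto simp: Some output_code_def)
qed

lemma reaches_assign_root:
 assumes code: "code_at P q (expr_code 5 e @ [Add 4 5 0])" and root: "rooted h H R t"
  and bounds: "5 + expr_depth e < h" "H + expr_cells e <= V"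
 shows "\<exists>R'. reaches P (5 * blen V) (length (expr_code 5 e) + 1) (conf q R u)
   (conf (q + length (expr_code 5 e) + 1) R' u) \<and> rooted h (H + expr_cells e) R' (eval_expr e t)"
proof -
 let ?H = "H + expr_cells e" and ?q = "q + length (expr_code 5 e)"
 obtain R' where R': "reaches P (5 * blen V) (length (expr_code 5 e)) (conf q R u) (conf ?q R' u)"
  "heap h ?H R'" "represents h ?H R' (R' 5) (eval_expr e t)"
  using reaches_expr[of q 5 e H R t u] assms by auto
 have regs: "R' 0 = 0" "6 <= h" "h <= ?H" "R' 5 <= ?H" using R'(2) by (auto simp: heap_def)
 have "reaches P (5 * blen V) 1 (conf ?q R' u) (conf (?q + 1) (R'(4 := R' 5)) u)"
  using code bounds regs by (intro reaches_heap_instr[OF _ R'(2)]) (auto simp: exec_def)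
 moreover have "rooted h ?H (R'(4 := R' 5)) (eval_expr e t)"
  using heap_upd[OF R'(2), of 4 "R' 5"] R'(3) regs by (auto simp: rooted_def represents_upd)
 ultimately show ?thesis using reaches_trans[OF R'(1)] by blast
qed

lemma reaches_do:
 assumes "code_at P i (dtree_code l i (Do p e))" "rooted h H R t" "5 + expr_depth e < h" "H + expr_cells e <= V" "l <= V"
 shows "\<exists>R'. reaches P (5 * blen V) (length (dtree_code l i (Do p e))) (conf i R u)
   (conf l R' (u @ snd (eval_dtree (Do p e) t))) \<and> rooted h (H + expr_cells e) R' (eval_expr e t)"
proof -
 let ?u = "u @ snd (eval_dtree (Do p e) t)"
 let ?q = "i + length (output_code p)" and ?q' = "i + length (output_code p) + length (expr_code 5 e) + 1"
 obtain R1 where R1: "reaches P (5 * blen V) (length (output_code p)) (conf i R u) (conf ?q R1 ?u)" "rooted h H R1 t"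
  using reaches_output[of i p H R t u e] assms by auto
 obtain R2 where R2: "reaches P (5 * blen V) (length (expr_code 5 e) + 1) (conf ?q R1 ?u) (conf ?q' R2 ?u)"
  "rooted h (H + expr_cells e) R2 (eval_expr e t)"
  using reaches_assign_root[of ?q e H R1 t ?u] R1(2) assms by auto
 then have heap: "heap h (H + expr_cells e) R2" "R2 0 = 0" by (auto simp: rooted_def heap_def)
 have "reaches P (5 * blen V) 1 (conf ?q' R2 ?u) (conf l R2 ?u)"
  using assms heap(2) by (intro reaches_heap_instr[OF _ heap(1)]) (auto simp: exec_def add.assoc)
 from reaches_trans[OF reaches_trans[OF R1(1) R2(1)] this]
 have "reaches P (5 * blen V) (length (output_code p) + (length (expr_code 5 e) + 1) + 1) (conf i R u) (conf l R2 ?u)" .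
 then show ?thesis using R2(2) by auto
qed

lemma reaches_dtree:
 assumes "code_at P i (dtree_code l i D)" "rooted h H R t" "5 + dtree_depth D < h" "H + dtree_cells D <= V"
  "length P <= V" "l <= V"
 shows "\<exists>n R' H'. n <= length (dtree_code l i D) \<and>
  reaches P (5 * blen V) n (conf i R u) (conf l R' (u @ snd (eval_dtree D t))) \<and>
  rooted h H' R' (fst (eval_dtree D t)) \<and> H' <= H + dtree_cells D"
 using assms
proof (induction D arbitrary: i R)
 case (Test p a b)
 let ?i = "i + length (path_code 5 p) + 1"
 let ?j = "?i + length (dtree_code l ?i b)"
 define D where "D = (if subtree_at p t = Leaf then a else b)"
 define j where "j = (if subtree_at p t = Leaf then ?j else ?i)"
 have "dtree_code l ?j a \<noteq> []" by (cases a) (auto simp: Let_def)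
 then obtain x xs where "dtree_code l ?j a = x # xs" by (auto simp: neq_Nil_conv)
 then have "?j <= V" using Test.prems(1,5) by (auto simp: Let_def)
 then obtain R1 where R1: "reaches P (5 * blen V) (length (path_code 5 p) + 1) (conf i R u) (conf j R1 u)" "rooted h H R1 t"
  using reaches_test[of i p ?j H R t u] Test.prems by (auto simp: Let_def j_def)
 have "\<exists>n R' H'. n <= length (dtree_code l j D) \<and>
  reaches P (5 * blen V) n (conf j R1 u) (conf l R' (u @ snd (eval_dtree D t))) \<and>
  rooted h H' R' (fst (eval_dtree D t)) \<and> H' <= H + dtree_cells D"
  using Test.IH(1)[of j R1] Test.IH(2)[of j R1] Test.prems R1(2) by (auto simp: D_def j_def Let_def)
 then obtain n R' H' where n: "n <= length (dtree_code l j D)"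
  "reaches P (5 * blen V) n (conf j R1 u) (conf l R' (u @ snd (eval_dtree D t)))"
  "rooted h H' R' (fst (eval_dtree D t))" "H' <= H + dtree_cells D" by blast
 have "length (path_code 5 p) + 1 + n <= length (dtree_code l i (Test p a b))"
  using n(1) by (auto simp: D_def j_def Let_def split: if_splits)
 moreover have "eval_dtree (Test p a b) t = eval_dtree D t" "H' <= H + dtree_cells (Test p a b)"
  using n(4) by (auto simp: D_def split: if_splits)
 ultimately show ?case using reaches_trans[OF R1(1) n(2)] n(3) by metis
next
 case (Do p e)
 then obtain R' where "reaches P (5 * blen V) (length (dtree_code l i (Do p e))) (conf i R u)
   (conf l R' (u @ snd (eval_dtree (Do p e) t)))"
  "rooted h (H + expr_cells e) R' (eval_expr e t)"
  using reaches_do[of i l p e H R t u] by auto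
 then show ?case by (metis eval_dtree.simps(2) fst_conv dtree_cells.simps(2) order_refl)
qed

lemma reaches_boot:
 assumes "code_at P 0 ([Const 2 1, Const 3 h] @ expr_code 5 e @ [Add 4 5 0])"
  and "6 + expr_depth e <= h" "h + expr_cells e <= V"
 shows "\<exists>R. reaches P (5 * blen V) (3 + length (expr_code 5 e)) init (conf (3 + length (expr_code 5 e)) R []) \<and>
  rooted h (h + expr_cells e) R (eval_expr e Leaf)"
proof -
 let ?R = "(%_. 0)(2 := 1, 3 := h)"
 have "reaches P (5 * blen V) 1 init (conf 1 ((%_. 0)(2 := 1)) [])"
  using reaches_instr[of P init "Const 2 1" V] assms by (auto simp: init_def exec_def)
 moreover have "reaches P (5 * blen V) 1 (conf 1 ((%_. 0)(2 := 1)) []) (conf 2 ?R [])"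
  using reaches_instr[of P "conf 1 ((%_. 0)(2 := 1)) []" "Const 3 h" V] assms by (auto simp: exec_def numeral_2_eq_2)
 moreover have "rooted h h ?R Leaf" using assms by (auto simp: rooted_def heap_def)
 then obtain R' where "reaches P (5 * blen V) (length (expr_code 5 e) + 1) (conf 2 ?R [])
   (conf (2 + length (expr_code 5 e) + 1) R' [])" "rooted h (h + expr_cells e) R' (eval_expr e Leaf)"
  using reaches_assign_root[of 2 e h ?R Leaf "[]"] assms by (auto simp: numeral_2_eq_2)
 ultimately show ?thesis using reaches_trans[OF reaches_trans] by (fastforce simp: eval_nat_numeral)
qed

end

lemma reaches_iterate_dtree:
 assumes code: "code_at P l (dtree_code l l D)" and depth: "5 + dtree_depth D < h" and "length P <= V" "l <= V"
  and boot: "reaches P (5 * blen V) k init (conf l R0 [])" "rooted h H0 R0 t0" and k: "k <= length P"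
  and size: "length (dtree_code l l D) <= length P"
 shows "H0 + dtree_cells D * T <= V ==> \<exists>n R H. n <= length P * (T + 1) \<and>
   reaches P (5 * blen V) n init (conf l R (snd ((dtree_step D ^^ T) (t0, [])))) \<and>
   rooted h H R (fst ((dtree_step D ^^ T) (t0, []))) \<and> H <= H0 + dtree_cells D * T"
proof (induction T)
 case 0
 then show ?case using boot k by auto
next
 case (Suc T)
 obtain t u where tu: "(dtree_step D ^^ T) (t0, []) = (t, u)" by fastforce
 obtain n R H where n: "n <= length P * (T + 1)" "reaches P (5 * blen V) n init (conf l R u)"
  "rooted h H R t" "H <= H0 + dtree_cells D * T"
  using Suc by (auto simp: tu)
 obtain n' R' H' where n': "n' <= length (dtree_code l l D)"
  "reaches P (5 * blen V) n' (conf l R u) (conf l R' (u @ snd (eval_dtree D t)))"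
  "rooted h H' R' (fst (eval_dtree D t))" "H' <= H + dtree_cells D"
  using reaches_dtree[OF code n(3) depth _ assms(3,4), of u] n(4) Suc.prems by auto
 have "n + n' <= length P * (Suc T + 1)" "H' <= H0 + dtree_cells D * Suc T" using n(1,4) n'(1,4) size by auto
 moreover have "(dtree_step D ^^ Suc T) (t0, []) = (fst (eval_dtree D t), u @ snd (eval_dtree D t))"
  by (simp add: tu) (simp add: dtree_step_def)
 ultimately show ?case using reaches_trans[OF n(2) n'(2)] n'(3) by (metis fst_conv snd_conv)
qed

theorem ram_simulates_dtree:
 "\<exists>P C. \<forall>T. \<exists>n. outp (run P n) = snd ((dtree_step D ^^ T) (eval_expr e Leaf, []))
   \<and> cost P n <= C * (T + 1) * blen (C * (T + 1))"
proof -
 define h where "h = 7 + expr_depth e + dtree_depth D"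
 define boot where "boot = [Const 2 1, Const 3 h] @ expr_code 5 e @ [Add 4 5 0]"
 define l where "l = 3 + length (expr_code 5 e)"
 define P where "P = boot @ dtree_code l l D"
 define H where "H = h + expr_cells e"
 define C where "C = 5 * length P + H + dtree_cells D"
 have l: "l = length boot" by (simp add: boot_def l_def)
 have code: "code_at P 0 boot" "code_at P l (dtree_code l l D)"
  using code_at_infix[of "[]" boot] code_at_infix[of boot _ "[]"] by (auto simp: P_def l)
 have "\<exists>n. outp (run P n) = snd ((dtree_step D ^^ T) (eval_expr e Leaf, []))
   \<and> cost P n <= C * (T + 1) * blen (C * (T + 1))" for T
 proof -
  define V where "V = C * (T + 1)"
  have V: "H + dtree_cells D * T <= V" "length P <= V" "l <= V"
   by (auto simp: V_def C_def P_def l algebra_simps)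
  obtain R0 where boot: "reaches P (5 * blen V) l init (conf l R0 [])" "rooted h H R0 (eval_expr e Leaf)"
   using reaches_boot[of P h e V] code(1) V(1) by (auto simp: boot_def h_def l_def H_def)
  have depth: "5 + dtree_depth D < h" by (simp add: h_def)
  obtain n R where n: "n <= length P * (T + 1)"
   "reaches P (5 * blen V) n init (conf l R (snd ((dtree_step D ^^ T) (eval_expr e Leaf, []))))"
   using reaches_iterate_dtree[OF code(2) depth V(2,3) boot _ _ V(1)] by (auto simp: P_def l)
  have "cost P n <= n * (5 * blen V)"
   using n(2) by (simp add: reaches_def cost_def run_def)
  also have "... <= length P * (T + 1) * (5 * blen V)" using n(1) by (rule mult_le_mono1)
  also have "... = 5 * length P * (T + 1) * blen V" by simp
  also have "... <= V * blen V" unfolding V_def by (intro mult_le_mono) (auto simp: C_def)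
  finally have "cost P n <= C * (T + 1) * blen (C * (T + 1))" by (simp only: V_def)
  moreover have "outp (run P n) = snd ((dtree_step D ^^ T) (eval_expr e Leaf, []))"
   using n(2) by (simp add: reaches_def run_def)
  ultimately show ?thesis by blast
 qed
 then show ?thesis by blast
qed

section \<open>A stack machine and cost-annotated programs\<close>

datatype ins = IHd | ITl | INil | IPush | ISwap | ICons | IBr "ins list" "ins list"
 | IFix "ins list" | ICall | IOut

primrec unary :: "nat => tree" where
 "unary 0 = Leaf" | "unary (Suc n) = Node Leaf (unary n)"

fun enc_ins :: "ins => tree" and enc_code :: "ins list => tree" where
 "enc_ins IHd = Node (unary 0) Leaf"
| "enc_ins ITl = Node (unary 1) Leaf"
| "enc_ins INil = Node (unary 2) Leaf"
| "enc_ins IPush = Node (unary 3) Leaf"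
| "enc_ins ISwap = Node (unary 4) Leaf"
| "enc_ins ICons = Node (unary 5) Leaf"
| "enc_ins (IBr a b) = Node (unary 6) (Node (enc_code a) (enc_code b))"
| "enc_ins (IFix a) = Node (unary 7) (enc_code a)"
| "enc_ins ICall = Node (unary 8) Leaf"
| "enc_ins IOut = Node (unary 9) Leaf"
| "enc_code [] = Leaf"
| "enc_code (i # c) = Node (enc_ins i) (enc_code c)"

text \<open>A state consists of the remaining code, the current value, a stack of values and
 return frames, and the body of the innermost enclosing recursive function.\<close>

definition machine_state :: "tree => tree => tree => tree => tree" where
 "machine_state c v s f = Node (Node c v) (Node s f)"

definition state_expr :: "expr => expr => expr => expr => expr" where
 "state_expr c v s f = NodeE (NodeE c v) (NodeE s f)"

abbreviation (input) "code_path \<equiv> [False, False]"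
abbreviation (input) "value_path \<equiv> [False, True]"
abbreviation (input) "stack_path \<equiv> [True, False]"
abbreviation (input) "body_path \<equiv> [True, True]"
abbreviation (input) "arg_path \<equiv> code_path @ [False, True]"
abbreviation (input) "tag_path n \<equiv> code_path @ [False, False] @ replicate n True"
abbreviation (input) "rest_expr \<equiv> Path (code_path @ [True])"
abbreviation (input) "top_expr \<equiv> Path (stack_path @ [False])"
abbreviation (input) "popped_expr \<equiv> Path (stack_path @ [True])"
abbreviation (input) "frame_expr \<equiv> NodeE rest_expr (Path body_path)"

definition machine :: dtree where
 "machine =
  Test code_path
   (Do None (state_expr (Path (stack_path @ [False, False])) (Path value_path) popped_expr (Path (stack_path @ [False, True]))))
 (Test (tag_path 0) (Do None (state_expr rest_expr (Path (value_path @ [False])) (Path stack_path) (Path body_path)))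
 (Test (tag_path 1) (Do None (state_expr rest_expr (Path (value_path @ [True])) (Path stack_path) (Path body_path)))
 (Test (tag_path 2) (Do None (state_expr rest_expr LeafE (Path stack_path) (Path body_path)))
 (Test (tag_path 3) (Do None (state_expr rest_expr (Path value_path) (NodeE (Path value_path) (Path stack_path))
  (Path body_path)))
 (Test (tag_path 4) (Do None (state_expr rest_expr top_expr (NodeE (Path value_path) popped_expr) (Path body_path)))
 (Test (tag_path 5) (Do None (state_expr rest_expr (NodeE top_expr (Path value_path)) popped_expr (Path body_path)))
 (Test (tag_path 6) (Test value_path
   (Do None (state_expr (Path (arg_path @ [True])) top_expr (NodeE frame_expr popped_expr) (Path body_path)))
   (Do None (state_expr (Path (arg_path @ [False])) top_expr (NodeE frame_expr popped_expr) (Path body_path))))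
 (Test (tag_path 7) (Do None (state_expr (Path arg_path) (Path value_path) (NodeE frame_expr (Path stack_path)) (Path arg_path)))
 (Test (tag_path 8) (Do None (state_expr (Path body_path) (Path value_path) (NodeE frame_expr (Path stack_path))
  (Path body_path)))
   (Do (Some value_path) (state_expr rest_expr (Path value_path) (Path stack_path) (Path body_path))))))))))))"

definition moves :: "nat => tree \<times> bool list => tree \<times> bool list => bool" where
 "moves n s s' \<longleftrightarrow> (dtree_step machine ^^ n) s = s'"

lemma moves_trans [trans]: "moves n s s' ==> moves m s' s'' ==> moves (n + m) s s''"
 by (simp add: moves_def add.commute[of n] funpow_add)

lemma moves_1: "moves 1 (t, u) (fst (eval_dtree machine t), u @ snd (eval_dtree machine t))"
 by (simp add: moves_def dtree_step_def)

lemma moves_ins: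
 "moves 1 (machine_state (enc_code (IHd # r)) v s f, u) (machine_state (enc_code r) (left v) s f, u)"
 "moves 1 (machine_state (enc_code (ITl # r)) v s f, u) (machine_state (enc_code r) (right v) s f, u)"
 "moves 1 (machine_state (enc_code (INil # r)) v s f, u) (machine_state (enc_code r) Leaf s f, u)"
 "moves 1 (machine_state (enc_code (IPush # r)) v s f, u) (machine_state (enc_code r) v (Node v s) f, u)"
 "moves 1 (machine_state (enc_code (ISwap # r)) v (Node w s) f, u) (machine_state (enc_code r) w (Node v s) f, u)"
 "moves 1 (machine_state (enc_code (ICons # r)) v (Node w s) f, u) (machine_state (enc_code r) (Node w v) s f, u)"
 "moves 1 (machine_state (enc_code (IBr a b # r)) v (Node w s) f, u)
  (machine_state (enc_code (if v = Leaf then b else a)) w (Node (Node (enc_code r) f) s) f, u)"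
 "moves 1 (machine_state (enc_code (IFix a # r)) v s f, u)
  (machine_state (enc_code a) v (Node (Node (enc_code r) f) s) (enc_code a), u)"
 "moves 1 (machine_state (enc_code (ICall # r)) v s f, u) (machine_state f v (Node (Node (enc_code r) f) s) f, u)"
 "moves 1 (machine_state (enc_code (IOut # r)) v s f, u) (machine_state (enc_code r) v s f, u @ [v \<noteq> Leaf])"
 "moves 1 (machine_state (enc_code []) v (Node (Node q g) s) f, u) (machine_state q v s g, u)"
 by (rule subst[of "(fst _, _)" _ "moves 1 _", OF _ moves_1],
  simp add: machine_def machine_state_def state_expr_def eval_nat_numeral)+

definition runs :: "tree => ins list => tree => tree => nat => bool" where
 "runs f c v v' n \<longleftrightarrow>
  (\<forall>r s u. moves n (machine_state (enc_code (c @ r)) v s f, u) (machine_state (enc_code r) v' s f, u))"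

lemma runsD: "runs f c v v' n ==> moves n (machine_state (enc_code (c @ r)) v s f, u) (machine_state (enc_code r) v' s f, u)"
 by (simp add: runs_def)

lemma runs_Nil: "runs f [] v v 0"
 by (simp add: runs_def moves_def)

lemma runs_append: "runs f c v v' n ==> runs f d v' v'' m ==> runs f (c @ d) v v'' (n + m)"
 unfolding runs_def append_assoc using moves_trans by blast

lemma runs_ins:
 "runs f [IHd] v (left v) 1" "runs f [ITl] v (right v) 1" "runs f [INil] v Leaf 1"
 unfolding runs_def append_Cons append_Nil by (blast intro: moves_ins)+

definition pair_code :: "ins list => ins list => ins list" where
 "pair_code c d = [IPush] @ c @ [ISwap] @ d @ [ICons]"

lemma runs_pair:
 assumes "runs f c v a n" "runs f d v b m"
 shows "runs f (pair_code c d) v (Node a b) (n + m + 3)"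
 unfolding runs_def
proof (intro allI)
 fix r s u
 have "moves 1 (machine_state (enc_code (pair_code c d @ r)) v s f, u)
   (machine_state (enc_code (c @ ISwap # d @ ICons # r)) v (Node v s) f, u)"
  using moves_ins(4) by (simp add: pair_code_def)
 also note runsD[OF assms(1)]
 also note moves_ins(5)
 also note runsD[OF assms(2)]
 also note moves_ins(6)
 finally show "moves (n + m + 3) (machine_state (enc_code (pair_code c d @ r)) v s f, u)
   (machine_state (enc_code r) (Node a b) s f, u)"
  by (simp add: eval_nat_numeral)
qed

definition if_code :: "ins list => ins list => ins list => ins list" where
 "if_code c a b = [IPush] @ c @ [IBr a b]"

lemma runs_if:
 assumes "runs f c v w n" "runs f (if w = Leaf then b else a) v v' m"
 shows "runs f (if_code c a b) v v' (n + m + 3)"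
 unfolding runs_def
proof (intro allI)
 fix r s u
 have "moves 1 (machine_state (enc_code (if_code c a b @ r)) v s f, u)
   (machine_state (enc_code (c @ IBr a b # r)) v (Node v s) f, u)"
  using moves_ins(4) by (simp add: if_code_def)
 also note runsD[OF assms(1)]
 also note moves_ins(7)
 also note runsD[OF assms(2), of "[]", unfolded append_Nil2]
 also note moves_ins(11)
 finally show "moves (n + m + 3) (machine_state (enc_code (if_code c a b @ r)) v s f, u)
   (machine_state (enc_code r) v' s f, u)"
  by (simp add: eval_nat_numeral)
qed

lemma runs_call:
 assumes "runs (enc_code c) c v v' n"
 shows "runs (enc_code c) [ICall] v v' (n + 2)" "runs f [IFix c] v v' (n + 2)"
proof -
 have return: "moves (n + 1) (machine_state (enc_code c) v (Node (Node (enc_code r) g) s) (enc_code c), u)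
   (machine_state (enc_code r) v' s g, u)" for r s u g
  using moves_trans[OF runsD[OF assms, of "[]", unfolded append_Nil2] moves_ins(11)] .
 show "runs (enc_code c) [ICall] v v' (n + 2)" "runs f [IFix c] v v' (n + 2)"
  unfolding runs_def append_Cons append_Nil
  using moves_trans[OF moves_ins(9) return] moves_trans[OF moves_ins(8) return] by simp_all
qed

primrec const_code :: "tree => ins list" where
 "const_code Leaf = [INil]"
| "const_code (Node a b) = pair_code (const_code a) (const_code b)"

lemma runs_const: "\<exists>n. \<forall>f v. runs f (const_code t) v t n"
proof (induction t)
 case Leaf
 show ?case using runs_ins(3) by auto
next
 case (Node a b)
 then obtain n m where "\<forall>f v. runs f (const_code a) v a n" "\<forall>f v. runs f (const_code b) v b m" by blast
 then show ?case using runs_pair[of _ "const_code a" _ a n "const_code b" b m] by auto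
qed

class enc = fixes enc :: "'a => tree"

instantiation bool :: enc
begin
definition "enc_bool b = (if b then Node Leaf Leaf else Leaf)"
instance ..
end

instantiation nat :: enc
begin
definition "enc_nat n = unary n"
instance ..
end

instantiation prod :: (enc, enc) enc
begin
definition "enc_prod p = Node (enc (fst p)) (enc (snd p))"
instance ..
end

instantiation list :: (enc) enc
begin
primrec enc_list :: "'a list => tree" where
 "enc_list [] = Leaf" | "enc_list (x # xs) = Node (enc x) (enc_list xs)"
instance ..
end

lemma enc_eq_Leaf_iff [simp]: "enc (n::nat) = Leaf \<longleftrightarrow> n = 0" "enc (xs::'a::enc list) = Leaf \<longleftrightarrow> xs = []"
 "enc (b::bool) = Leaf \<longleftrightarrow> \<not> b"
proof -
 show "enc n = Leaf \<longleftrightarrow> n = 0" by (cases n) (auto simp: enc_nat_def)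
 show "enc xs = Leaf \<longleftrightarrow> xs = []" by (cases xs) auto
 show "enc b = Leaf \<longleftrightarrow> \<not> b" by (simp add: enc_bool_def)
qed

definition evals :: "tree => ins list => 'a::enc => 'b::enc => nat => bool" where
 "evals f c x y N \<longleftrightarrow> (\<exists>n\<le>N. runs f c (enc x) (enc y) n)"

lemma evalsI: "runs f c (enc x) (enc y) n ==> n <= N ==> evals f c x y N"
 by (auto simp: evals_def)

lemma evals_mono: "evals f c x y N ==> N <= M ==> evals f c x y M"
 unfolding evals_def by (meson le_trans)

lemma evals_Nil: "evals f [] x x 0"
 by (auto simp: evals_def runs_Nil)

lemma evals_append: "evals f c x y N ==> evals f d y z M ==> evals f (c @ d) x z (N + M)"
 unfolding evals_def using runs_append add_mono by blast

lemma evals_pair: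
 "evals f c x a N ==> evals f d x b M ==> enc y = Node (enc a) (enc b) ==> evals f (pair_code c d) x y (N + M + 3)"
 unfolding evals_def using runs_pair by (metis add_mono le_refl)

lemma evals_if:
 "evals f c x p N ==> evals f (if enc p = Leaf then b else a) x y M ==> evals f (if_code c a b) x y (N + M + 3)"
 unfolding evals_def using runs_if by (metis add_mono le_refl)

lemma evals_if_le:
 "evals f c x p N ==> evals f (if enc p = Leaf then b else a) x y M ==> N + M + 3 <= S ==> evals f (if_code c a b) x y S"
 by (rule evals_mono[OF evals_if])

lemma evals_call:
 "evals (enc_code c) c x y N ==> evals (enc_code c) [ICall] x y (N + 2)"
 "evals (enc_code c) c x y N ==> evals f [IFix c] x y (N + 2)"
 unfolding evals_def using runs_call by (metis add_le_mono1)+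

lemma evals_recursive_call:
 assumes "evals (enc_code b) c x z N" "evals (enc_code b) b z y M"
 shows "evals (enc_code b) (pair_code [] (c @ [ICall])) x (x, y) (N + M + 5)"
 using evals_pair[OF evals_Nil evals_append[OF assms(1) evals_call(1)[OF assms(2)]], of "(x, y)"]
 by (simp add: enc_prod_def eval_nat_numeral)

definition computes :: "('a::enc => bool) => ('a => 'b::enc) => ('a => nat) => bool" where
 "computes D F T \<longleftrightarrow> (\<exists>c K. \<forall>f x. D x \<longrightarrow> evals f c x (F x) (K * (T x + 1)))"

lemma computesI: "(\<And>f x. D x ==> evals f c x (F x) (K * (T x + 1))) ==> computes D F T"
 unfolding computes_def by blast

lemma computesE:
 assumes "computes D F T"
 obtains c K where "\<And>f x. D x ==> evals f c x (F x) (K * (T x + 1))"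
 using assms unfolding computes_def by blast

lemma computes_mono:
 assumes "computes D F T" "\<And>x. D' x ==> D x" "\<And>x. D' x ==> T x <= K * (T' x + 1)"
 shows "computes D' F T'"
proof -
 from assms(1) obtain c J where c: "\<And>f x. D x ==> evals f c x (F x) (J * (T x + 1))" by (rule computesE) blast
 have "J * (T x + 1) <= (J * (K + 1)) * (T' x + 1)" if "D' x" for x
 proof -
  have "T x + 1 <= (K + 1) * (T' x + 1)" using assms(3)[OF that] by simp
  then have "J * (T x + 1) <= J * ((K + 1) * (T' x + 1))" by (rule mult_le_mono2)
  then show ?thesis by (simp only: mult.assoc)
 qed
 then show ?thesis using c assms(2) by (blast intro: computesI evals_mono)
qed

lemma computes_bound: "computes D F T ==> (\<And>x. D x ==> T x <= K * (T' x + 1)) ==> computes D F T'"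
 by (rule computes_mono)

lemma computes_cong: "computes D F T ==> (\<And>x. D x ==> F x = G x) ==> computes D G T"
 unfolding computes_def by metis

lemma computes_id: "computes D (%x. x) (%x. 0)"
 by (rule computesI[where c = "[]" and K = 1]) (rule evals_mono[OF evals_Nil], simp)

lemma computes_const: "computes D (%x. k) (%x. 0)"
proof -
 from runs_const obtain n where "\<forall>f v. runs f (const_code (enc k)) v (enc k) n" by blast
 then show ?thesis by (intro computesI[where c = "const_code (enc k)" and K = n]) (auto intro: evalsI)
qed

lemma computes_comp:
 assumes "computes E h T" "computes D f Tf" "\<And>x. D x ==> E (f x)"
 shows "computes D (%x. h (f x)) (%x. Tf x + T (f x))"
proof -
 from assms(1) obtain c K where c: "\<And>g x. E x ==> evals g c x (h x) (K * (T x + 1))" by (rule computesE) blast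
 from assms(2) obtain d J where d: "\<And>g x. D x ==> evals g d x (f x) (J * (Tf x + 1))" by (rule computesE) blast
 show ?thesis
 proof (rule computesI[where c = "d @ c" and K = "J + K"])
  fix g x assume "D x"
  then show "evals g (d @ c) x (h (f x)) ((J + K) * (Tf x + T (f x) + 1))"
   using evals_append[OF d c] assms(3) by (rule_tac evals_mono) (auto simp: algebra_simps)
 qed
qed

lemma computes_Node:
 assumes "computes D f Tf" "computes D g Tg" "\<And>x. D x ==> enc (h x) = Node (enc (f x)) (enc (g x))"
 shows "computes D h (%x. Tf x + Tg x)"
proof -
 from assms(1) obtain c K where c: "\<And>e x. D x ==> evals e c x (f x) (K * (Tf x + 1))" by (rule computesE) blast
 from assms(2) obtain d J where d: "\<And>e x. D x ==> evals e d x (g x) (J * (Tg x + 1))" by (rule computesE) blast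
 show ?thesis
 proof (rule computesI[where c = "pair_code c d" and K = "J + K + 3"])
  fix e x assume "D x"
  then show "evals e (pair_code c d) x (h x) ((J + K + 3) * (Tf x + Tg x + 1))"
   using evals_pair[OF c d] assms(3) by (rule_tac evals_mono) (auto simp: algebra_simps)
 qed
qed

lemma computes_unit_time:
 assumes "\<And>g y. E y ==> runs g c (enc y) (enc (h y)) 1" "computes D f T" "\<And>x. D x ==> E (f x)"
 shows "computes D (%x. h (f x)) T"
proof -
 have "computes E h (%_. 0)" by (rule computesI[where K = 1 and c = c]) (auto intro: evalsI assms(1))
 from computes_comp[OF this assms(2,3)] show ?thesis by simp
qed

named_theorems computes_intros

lemma computes_Pair: "computes D f Tf ==> computes D g Tg ==> computes D (%x. (f x, g x)) (%x. Tf x + Tg x)"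
 by (erule computes_Node) (auto simp: enc_prod_def)

lemma computes_Cons: "computes D f Tf ==> computes D g Tg ==> computes D (%x. f x # g x) (%x. Tf x + Tg x)"
 by (erule computes_Node) auto

lemma computes_Suc: "computes D f Tf ==> computes D (%x. Suc (f x)) Tf"
 using computes_Node[OF computes_const[of D False], of f Tf "%x. Suc (f x)"]
 by (simp add: enc_bool_def enc_nat_def)

lemma computes_fst: "computes D f Tf ==> computes D (%x. fst (f x)) Tf"
 by (rule computes_unit_time[where E = "%_. True" and c = "[IHd]"])
  (auto simp: enc_prod_def intro: runs_ins(1)[of _ "Node _ _", simplified])

lemma computes_snd: "computes D f Tf ==> computes D (%x. snd (f x)) Tf"
 by (rule computes_unit_time[where E = "%_. True" and c = "[ITl]"])
  (auto simp: enc_prod_def intro: runs_ins(2)[of _ "Node _ _", simplified])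

lemma computes_hd: "computes D f Tf ==> (\<And>x. D x ==> f x \<noteq> []) ==> computes D (%x. hd (f x)) Tf"
 by (rule computes_unit_time[where E = "%x. x \<noteq> []" and c = "[IHd]"])
  (auto simp: neq_Nil_conv intro: runs_ins(1)[of _ "Node _ _", simplified])

lemma computes_tl: "computes D f Tf ==> computes D (%x. tl (f x)) Tf"
proof (rule computes_unit_time[where h = tl and f = f and E = "%_. True" and c = "[ITl]"])
 show "runs g [ITl] (enc x) (enc (tl x)) 1" for g and x :: "'b list"
  using runs_ins(2)[of g "enc x"] by (cases x) auto
qed auto

lemma computes_pred: "computes D f Tf ==> computes D (%x. f x - Suc 0) Tf"
proof (rule computes_unit_time[where h = "%n. n - Suc 0" and f = f and E = "%_. True" and c = "[ITl]"])
 show "runs g [ITl] (enc x) (enc (x - Suc 0)) 1" for g and x :: nat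
  using runs_ins(2)[of g "enc x"] by (cases x) (auto simp: enc_nat_def)
qed auto

lemma computes_if_enc:
 assumes "computes D p Tp" "computes (%x. D x \<and> enc (p x) \<noteq> Leaf) f Tf" "computes (%x. D x \<and> enc (p x) = Leaf) g Tg"
 shows "computes D (%x. if enc (p x) \<noteq> Leaf then f x else g x)
  (%x. Tp x + (if enc (p x) \<noteq> Leaf then Tf x else Tg x))"
proof -
 from assms(1) obtain c K where c: "\<And>e x. D x ==> evals e c x (p x) (K * (Tp x + 1))" by (rule computesE) blast
 from assms(2) obtain a J where a: "\<And>e x. D x \<and> enc (p x) \<noteq> Leaf ==> evals e a x (f x) (J * (Tf x + 1))"
  by (rule computesE) blast
 from assms(3) obtain b I where b: "\<And>e x. D x \<and> enc (p x) = Leaf ==> evals e b x (g x) (I * (Tg x + 1))"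
  by (rule computesE) blast
 show ?thesis
 proof (rule computesI[where c = "if_code c a b" and K = "K + J + I + 3"])
  fix e x assume x: "D x"
  show "evals e (if_code c a b) x (if enc (p x) \<noteq> Leaf then f x else g x)
   ((K + J + I + 3) * (Tp x + (if enc (p x) \<noteq> Leaf then Tf x else Tg x) + 1))"
  proof (cases "enc (p x) = Leaf")
   case True
   then have "evals e (if_code c a b) x (g x) (K * (Tp x + 1) + I * (Tg x + 1) + 3)"
    by (intro evals_if[OF c[OF x]]) (use b x in simp)
   then show ?thesis using True by (auto elim!: evals_mono simp: algebra_simps)
  next
   case False
   then have "evals e (if_code c a b) x (f x) (K * (Tp x + 1) + J * (Tf x + 1) + 3)"
    by (intro evals_if[OF c[OF x]]) (use a x in simp)
   then show ?thesis using False by (auto elim!: evals_mono simp: algebra_simps)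
  qed
 qed
qed

lemma computes_if:
 assumes "computes D p Tp" "computes (%x. D x \<and> p x) f Tf" "computes (%x. D x \<and> \<not> p x) g Tg"
 shows "computes D (%x. if p x then f x else g x) (%x. Tp x + (if p x then Tf x else Tg x))"
 using computes_if_enc[OF assms(1), of f Tf g Tg] assms(2,3) by simp

lemma computes_enc_eq_Leaf: "computes D f Tf ==> computes D (%x. enc (f x) = Leaf) Tf"
 by (rule computes_cong[OF computes_bound[OF computes_if_enc[OF _ computes_const[of _ False] computes_const[of _ True]],
  where K = 1]]) auto

lemma computes_eq_0: "computes D f Tf ==> computes D (%x. f x = (0::nat)) Tf"
 and computes_eq_Nil: "computes D g Tg ==> computes D (%x. g x = []) Tg"
 and computes_not: "computes D p Tp ==> computes D (%x. \<not> p x) Tp"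
 using computes_enc_eq_Leaf[of D f Tf] computes_enc_eq_Leaf[of D g Tg] computes_enc_eq_Leaf[of D p Tp] by simp_all

lemma computes_and:
 "computes D p Tp ==> computes (%x. D x \<and> p x) q Tq ==> computes D (%x. p x \<and> q x) (%x. Tp x + (if p x then Tq x else 0))"
 by (rule computes_cong[OF computes_if[where p = p and f = q, OF _ _ computes_const[of _ False]]]) auto

lemma computes_or:
 "computes D p Tp ==> computes (%x. D x \<and> \<not> p x) q Tq ==> computes D (%x. p x \<or> q x) (%x. Tp x + (if p x then 0 else Tq x))"
 by (rule computes_cong[OF computes_if[where p = p and g = q, OF _ computes_const[of _ True]]]) auto

lemma computes_bool_eq:
 assumes "computes D p Tp" "computes D q Tq"
 shows "computes D (%x. p x = (q x :: bool)) (%x. Tp x + Tq x)"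
proof -
 have "computes (%x. D x \<and> p x) q Tq" by (rule computes_mono[OF assms(2), where K = 1]) auto
 moreover have "computes (%x. D x \<and> \<not> p x) (%x. \<not> q x) Tq"
  by (rule computes_mono[OF computes_not[OF assms(2)], where K = 1]) auto
 ultimately show ?thesis by (rule computes_cong[OF computes_bound[OF computes_if[OF assms(1)], where K = 1]]) auto
qed

lemmas [computes_intros] = computes_bool_eq computes_or computes_and computes_not computes_eq_Nil computes_eq_0 computes_if
 computes_pred computes_tl computes_hd computes_snd computes_fst computes_Suc computes_Cons computes_Pair computes_const
  computes_id

abbreviation "arg1 x \<equiv> fst x"
abbreviation "arg2 x \<equiv> fst (snd x)"
abbreviation "arg3 x \<equiv> fst (snd (snd x))"
abbreviation "arg4 x \<equiv> fst (snd (snd (snd x)))"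
abbreviation "rst2 x \<equiv> snd x"
abbreviation "rst3 x \<equiv> snd (snd x)"
abbreviation "rst4 x \<equiv> snd (snd (snd x))"
abbreviation "rst5 x \<equiv> snd (snd (snd (snd x)))"

lemma computes_comp2:
 assumes "computes E (%p. h (fst p) (snd p)) (%p. T (fst p) (snd p))" "computes D f Tf" "computes D g Tg"
  "\<And>x. D x ==> E (f x, g x)"
 shows "computes D (%x. h (f x) (g x)) (%x. Tf x + Tg x + T (f x) (g x))"
 using computes_comp[OF assms(1) computes_Pair[OF assms(2,3)]] assms(4) by simp

lemma computes_comp3:
 assumes "computes E (%p. h (fst p) (fst (snd p)) (snd (snd p))) (%p. T (fst p) (fst (snd p)) (snd (snd p)))"
  "computes D f Tf" "computes D g Tg" "computes D k Tk" "\<And>x. D x ==> E (f x, g x, k x)"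
 shows "computes D (%x. h (f x) (g x) (k x)) (%x. Tf x + Tg x + Tk x + T (f x) (g x) (k x))"
 using computes_comp[OF assms(1) computes_Pair[OF assms(2) computes_Pair[OF assms(3,4)]]] assms(5)
 by (simp add: add.assoc)

lemma computes_comp4:
 assumes "computes E (%p. h (fst p) (fst (snd p)) (fst (snd (snd p))) (snd (snd (snd p))))
  (%p. T (fst p) (fst (snd p)) (fst (snd (snd p))) (snd (snd (snd p))))"
  "computes D f Tf" "computes D g Tg" "computes D k Tk" "computes D l Tl" "\<And>x. D x ==> E (f x, g x, k x, l x)"
 shows "computes D (%x. h (f x) (g x) (k x) (l x)) (%x. Tf x + Tg x + Tk x + Tl x + T (f x) (g x) (k x) (l x))"
 using computes_comp[OF assms(1) computes_Pair[OF assms(2) computes_Pair[OF assms(3) computes_Pair[OF assms(4,5)]]]] assms(6)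
 by (simp add: add.assoc)

lemmas computes_total_comp = computes_comp[where E = "%_. True", OF _ _ TrueI]
lemmas computes_total_comp2 = computes_comp2[where E = "%_. True", OF _ _ _ TrueI]
lemmas computes_total_comp3 = computes_comp3[where E = "%_. True", OF _ _ _ _ TrueI]
lemmas computes_total_comp4 = computes_comp4[where E = "%_. True", OF _ _ _ _ _ TrueI]

lemma computes_fixpoint:
 assumes "\<And>x. D x ==> (\<And>y. D y ==> S y < S x ==> evals (enc_code b) b y (F y) (K * (S y + 1)))
   ==> evals (enc_code b) b x (F x) (K * (S x + 1))"
 shows "computes D F S"
proof -
 have body: "D x ==> evals (enc_code b) b x (F x) (K * (S x + 1))" for x
  by (induction "S x" arbitrary: x rule: less_induct) (blast intro: assms)
 show ?thesis
 proof (rule computesI[where c = "[IFix b]" and K = "K + 2"])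
  show "evals f [IFix b] x (F x) ((K + 2) * (S x + 1))" if "D x" for f x
   using evals_mono[OF evals_call(2)[OF body[OF that]]] by (simp add: algebra_simps)
 qed
qed

text \<open>The cost S of a recursive function is any solution of the recurrence given by the cost W of
 one activation; the domain D is the invariant of the recursion.\<close>

theorem computes_double_recursion:
 assumes eq: "\<And>x. D x ==> F x = (if p x then base x else post ((x, F (s x)), F (t (x, F (s x)))))"
  and dom_first: "\<And>x. D x ==> \<not> p x ==> D (s x)"
  and dom_second: "\<And>x. D x ==> \<not> p x ==> D (t (x, F (s x)))"
  and test: "computes D p W" and base: "computes (%x. D x \<and> p x) base W" and first: "computes (%x. D x \<and> \<not> p x) s W"
  and second: "computes (%y. D (fst y) \<and> \<not> p (fst y) \<and> snd y = F (s (fst y))) t (%y. W (fst y))"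
  and post: "computes (%y. D (fst (fst y)) \<and> \<not> p (fst (fst y)) \<and> snd (fst y) = F (s (fst (fst y)))
    \<and> snd y = F (t (fst y))) post (%y. W (fst (fst y)))"
  and cost_base: "\<And>x. D x ==> p x ==> W x <= S x"
  and cost_rec: "\<And>x. D x ==> \<not> p x ==> W x + S (s x) + S (t (x, F (s x))) + 2 <= S x"
 shows "computes D F S"
proof -
 from test obtain cp Kp where cp: "\<And>f x. D x ==> evals f cp x (p x) (Kp * (W x + 1))" by (rule computesE) blast
 from base obtain cb Kb where cb: "\<And>f x. D x \<and> p x ==> evals f cb x (base x) (Kb * (W x + 1))" by (rule computesE) blast
 from first obtain c1 K1 where c1: "\<And>f x. D x \<and> \<not> p x ==> evals f c1 x (s x) (K1 * (W x + 1))" by (rule computesE) blast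
 from second obtain c2 K2 where c2: "\<And>f y. D (fst y) \<and> \<not> p (fst y) \<and> snd y = F (s (fst y)) ==>
  evals f c2 y (t y) (K2 * (W (fst y) + 1))" by (rule computesE) blast
 from post obtain c3 K3 where c3: "\<And>f y. D (fst (fst y)) \<and> \<not> p (fst (fst y)) \<and> snd (fst y) = F (s (fst (fst y)))
  \<and> snd y = F (t (fst y)) ==> evals f c3 y (post y) (K3 * (W (fst (fst y)) + 1))" by (rule computesE) blast
 define b where "b = if_code cp cb (pair_code [] (c1 @ [ICall]) @ pair_code [] (c2 @ [ICall]) @ c3)"
 define K where "K = Kp + Kb + K1 + K2 + K3 + 13"
 show ?thesis
 proof (rule computes_fixpoint)
  fix x assume D: "D x" and IH: "\<And>y. D y ==> S y < S x ==> evals (enc_code b) b y (F y) (K * (S y + 1))"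
  show "evals (enc_code b) b x (F x) (K * (S x + 1))"
  proof (cases "p x")
   case True
   have "K * (W x + 1) <= K * (S x + 1)" using cost_base[OF D True] by (intro mult_le_mono2) simp
   then have bound: "Kp * (W x + 1) + Kb * (W x + 1) + 3 <= K * (S x + 1)" by (simp add: K_def algebra_simps)
   show ?thesis by (subst (2) b_def, rule evals_if_le[OF cp[OF D] _ bound]) (use cb D True eq in simp)
  next
   case False
   define r1 where "r1 = F (s x)"
   define y where "y = (x, r1)"
   define r2 where "r2 = F (t y)"
   note cost = cost_rec[OF D False, folded r1_def, folded y_def]
   have rec1: "evals (enc_code b) b (s x) r1 (K * (S (s x) + 1))"
    and rec2: "evals (enc_code b) b (t y) r2 (K * (S (t y) + 1))"
    using IH dom_first[OF D False] dom_second[OF D False] cost by (auto simp: r1_def r2_def y_def)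
   have "evals (enc_code b) c1 x (s x) (K1 * (W x + 1))" "evals (enc_code b) c2 y (t y) (K2 * (W x + 1))"
    "evals (enc_code b) c3 (y, r2) (F x) (K3 * (W x + 1))"
    using c1[of x] c2[of y] c3[of "(y, r2)"] D False eq[OF D] by (auto simp: r1_def r2_def y_def)
   note steps = evals_append[OF evals_recursive_call[OF this(1) rec1, folded y_def]
     evals_append[OF evals_recursive_call[OF this(2) rec2] this(3)]]
   have "K * (W x + S (s x) + S (t y) + 3) <= K * (S x + 1)" using cost by (intro mult_le_mono2) simp
   then have bound: "Kp * (W x + 1) + (K1 * (W x + 1) + K * (S (s x) + 1) + 5 + (K2 * (W x + 1) + K * (S (t y) + 1) + 5
     + K3 * (W x + 1))) + 3 <= K * (S x + 1)"
    by (simp add: K_def algebra_simps)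
   show ?thesis by (subst (2) b_def, rule evals_if_le[OF cp[OF D] _ bound]) (use steps False in simp)
  qed
 qed
qed

theorem computes_binary_recursion:
 assumes test: "computes D p W" and base: "computes (%x. D x \<and> p x) base W"
  and first: "computes (%x. D x \<and> \<not> p x) s W" and second: "computes (%x. D x \<and> \<not> p x) t W"
  and post: "computes (%y. D (arg1 (fst y)) \<and> \<not> p (arg1 (fst y)) \<and> snd (fst y) = F (s (arg1 (fst y)))
    \<and> snd y = F (t (arg1 (fst y)))) post (%y. W (arg1 (fst y)))"
  and eq: "\<And>x. D x ==> F x = (if p x then base x else post ((x, F (s x)), F (t x)))"
  and dom: "\<And>x. D x ==> \<not> p x ==> D (s x) \<and> D (t x)"
  and cost: "\<And>x. D x ==> p x ==> W x <= S x" "\<And>x. D x ==> \<not> p x ==> W x + S (s x) + S (t x) + 2 <= S x"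
 shows "computes D F S"
proof (rule computes_double_recursion[where p = p and base = base and s = s and t = "%y. t (fst y)" and post = post and W = W])
 have "computes (%y. D (fst y) \<and> \<not> p (fst y) \<and> snd y = F (s (fst y))) (%y. t (fst y)) (%y. 0 + W (fst y))"
  by (rule computes_comp[OF second computes_fst[OF computes_id]]) simp
 then show "computes (%y. D (fst y) \<and> \<not> p (fst y) \<and> snd y = F (s (fst y))) (%y. t (fst y)) (%y. W (fst y))" by simp
qed (use assms in auto)

theorem computes_recursion_uniform:
 assumes test: "computes D p W" and base: "computes (%x. D x \<and> p x) base W" and first: "computes (%x. D x \<and> \<not> p x) s W"
  and post: "computes (%y. D (fst y) \<and> \<not> p (fst y) \<and> snd y = F (s (fst y))) post (%y. W (fst y))"
  and eq: "\<And>x. D x ==> F x = (if p x then base x else post (x, F (s x)))"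
  and dom: "\<And>x. D x ==> \<not> p x ==> D (s x)"
  and cost_base: "\<And>x. D x ==> p x ==> W x <= S x"
  and cost_rec: "\<And>x. D x ==> \<not> p x ==> W x + S (s x) + 1 <= S x"
 shows "computes D F S"
proof -
 from test obtain cp Kp where cp: "\<And>f x. D x ==> evals f cp x (p x) (Kp * (W x + 1))" by (rule computesE) blast
 from base obtain cb Kb where cb: "\<And>f x. D x \<and> p x ==> evals f cb x (base x) (Kb * (W x + 1))" by (rule computesE) blast
 from first obtain cs Ks where cs: "\<And>f x. D x \<and> \<not> p x ==> evals f cs x (s x) (Ks * (W x + 1))" by (rule computesE) blast
 from post obtain co Ko where co: "\<And>f y. D (fst y) \<and> \<not> p (fst y) \<and> snd y = F (s (fst y)) ==>
  evals f co y (post y) (Ko * (W (fst y) + 1))" by (rule computesE) blast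
 define b where "b = if_code cp cb (pair_code [] (cs @ [ICall]) @ co)"
 define L where "L = Kp + Kb + Ks + Ko + 8"
 show ?thesis
 proof (rule computes_fixpoint)
  fix x assume D: "D x" and IH: "\<And>y. D y ==> S y < S x ==> evals (enc_code b) b y (F y) (L * (S y + 1))"
  show "evals (enc_code b) b x (F x) (L * (S x + 1))"
  proof (cases "p x")
   case True
   have "L * (W x + 1) <= L * (S x + 1)" using cost_base[OF D True] by (intro mult_le_mono2) simp
   then have bound: "Kp * (W x + 1) + Kb * (W x + 1) + 3 <= L * (S x + 1)" by (simp add: L_def algebra_simps)
   show ?thesis by (subst (2) b_def, rule evals_if_le[OF cp[OF D] _ bound]) (use cb D True eq in simp)
  next
   case False
   note cost = cost_rec[OF D False]
   have rec: "evals (enc_code b) b (s x) (F (s x)) (L * (S (s x) + 1))" using IH dom[OF D False] cost by simp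
   have "evals (enc_code b) cs x (s x) (Ks * (W x + 1))" "evals (enc_code b) co (x, F (s x)) (F x) (Ko * (W x + 1))"
    using cs[of x] co[of "(x, F (s x))"] D False eq[OF D] by auto
   note steps = evals_append[OF evals_recursive_call[OF this(1) rec] this(2)]
   have "L * (W x + S (s x) + 2) <= L * (S x + 1)" using cost by (intro mult_le_mono2) simp
   then have bound: "Kp * (W x + 1) + (Ks * (W x + 1) + L * (S (s x) + 1) + 5 + Ko * (W x + 1)) + 3 <= L * (S x + 1)"
    by (simp add: L_def algebra_simps)
   show ?thesis by (subst (2) b_def, rule evals_if_le[OF cp[OF D] _ bound]) (use steps False in simp)
  qed
 qed
qed

theorem computes_recursion:
 assumes test: "computes D p Tp" and base: "computes (%x. D x \<and> p x) base Tb" and s: "computes (%x. D x \<and> \<not> p x) s Ts"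
  and post: "computes (%y. D (fst y) \<and> \<not> p (fst y) \<and> snd y = F (s (fst y))) post To"
  and local: "\<And>x. D x ==> Tp x <= K * (W x + 1)" "\<And>x. D x ==> p x ==> Tb x <= K * (W x + 1)"
  "\<And>x. D x ==> \<not> p x ==> Ts x <= K * (W x + 1)" "\<And>x. D x ==> \<not> p x ==> To (x, F (s x)) <= K * (W x + 1)"
  and eq: "\<And>x. D x ==> F x = (if p x then base x else post (x, F (s x)))"
  and dom: "\<And>x. D x ==> \<not> p x ==> D (s x)"
  and cost_base: "\<And>x. D x ==> p x ==> W x <= S x"
  and cost_rec: "\<And>x. D x ==> \<not> p x ==> W x + S (s x) + 1 <= S x"
 shows "computes D F S"
proof (rule computes_recursion_uniform[OF computes_bound[OF test local(1)] _ _ _ eq dom cost_base cost_rec])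
 show "computes (%x. D x \<and> p x) base W" by (rule computes_bound[OF base]) (use local(2) in blast)
 show "computes (%x. D x \<and> \<not> p x) s W" by (rule computes_bound[OF s]) (use local(3) in blast)
 show "computes (%y. D (fst y) \<and> \<not> p (fst y) \<and> snd y = F (s (fst y))) post (%y. W (fst y))"
 proof (rule computes_bound[OF post])
  show "To y <= K * (W (fst y) + 1)" if "D (fst y) \<and> \<not> p (fst y) \<and> snd y = F (s (fst y))" for y
   using local(4)[of "fst y"] that by (metis prod.collapse)
 qed
qed

lemma computes_add_uncurried: "computes (%_. True) (%x. fst x + snd x :: nat) (%x. fst x)"
 by (rule computes_recursion[where p = "%x. fst x = 0" and base = snd and s = "%x. (fst x - Suc 0, snd x)"
  and post = "%y. Suc (snd y)" and W = "%_. 0" and K = 1], (rule computes_intros | force)+)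

lemma computes_diff_uncurried: "computes (%_. True) (%x. fst x - snd x :: nat) (%x. snd x)"
 by (rule computes_recursion[where p = "%x. snd x = 0 \<or> fst x = 0" and base = fst and s = "%x. (fst x - Suc 0, snd x - Suc 0)"
  and post = "%y. snd y" and W = "%_. 0" and K = 1], (rule computes_intros | force)+)

lemma computes_le_uncurried: "computes (%_. True) (%x. fst x <= (snd x :: nat)) (%x. fst x)"
 by (rule computes_recursion[where p = "%x. fst x = 0 \<or> snd x = 0" and base = "%x. fst x = 0"
   and s = "%x. (fst x - Suc 0, snd x - Suc 0)"
  and post = "%y. snd y" and W = "%_. 0" and K = 1], (rule computes_intros | force)+)

lemma computes_length_id: "computes (%_. True) length (%x. length x)"
 by (rule computes_recursion[where p = "%x. x = []" and base = "%x. 0" and s = tl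
  and post = "%y. Suc (snd y)" and W = "%_. 0" and K = 1], (rule computes_intros | force simp: neq_Nil_conv)+)

lemma computes_append_uncurried: "computes (%_. True) (%x. fst x @ snd x) (%x. length (fst x))"
 by (rule computes_recursion[where p = "%x. fst x = []" and base = snd and s = "%x. (tl (fst x), snd x)"
  and post = "%y. hd (fst (fst y)) # snd y" and W = "%_. 0" and K = 1], (rule computes_intros | force simp: neq_Nil_conv)+)

lemma computes_rev_append_uncurried: "computes (%_. True) (%x. rev (fst x) @ snd x) (%x. length (fst x))"
 by (rule computes_recursion[where p = "%x. fst x = []" and base = snd and s = "%x. (tl (fst x), hd (fst x) # snd x)"
  and post = "%y. snd y" and W = "%_. 0" and K = 1], (rule computes_intros | force simp: neq_Nil_conv)+)

lemma computes_take_uncurried: "computes (%_. True) (%x. take (fst x) (snd x)) (%x. fst x)"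
 by (rule computes_recursion[where p = "%x. fst x = 0 \<or> snd x = []" and base = "%x. []" and s = "%x. (fst x - Suc 0, tl (snd x))"
  and post = "%y. hd (snd (fst y)) # snd y" and W = "%_. 0" and K = 1], (rule computes_intros |
   force simp: neq_Nil_conv gr0_conv_Suc)+)

lemma computes_drop_uncurried: "computes (%_. True) (%x. drop (fst x) (snd x)) (%x. fst x)"
 by (rule computes_recursion[where p = "%x. fst x = 0 \<or> snd x = []" and base = snd and s = "%x. (fst x - Suc 0, tl (snd x))"
  and post = "%y. snd y" and W = "%_. 0" and K = 1], (rule computes_intros | force simp: neq_Nil_conv gr0_conv_Suc)+)

lemma computes_replicate_uncurried: "computes (%_. True) (%x. replicate (fst x) (snd x)) (%x. fst x)"
 by (rule computes_recursion[where p = "%x. fst x = 0" and base = "%x. []" and s = "%x. (fst x - Suc 0, snd x)"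
  and post = "%y. snd (fst y) # snd y" and W = "%_. 0" and K = 1], (rule computes_intros | force simp: gr0_conv_Suc)+)

lemma computes_zip_uncurried: "computes (%_. True) (%x. zip (fst x) (snd x)) (%x. length (fst x))"
 by (rule computes_recursion[where p = "%x. fst x = [] \<or> snd x = []" and base = "%x. []" and s = "%x. (tl (fst x), tl (snd x))"
  and post = "%y. (hd (fst (fst y)), hd (snd (fst y))) # snd y" and W = "%_. 0" and K = 1],
  (rule computes_intros | force simp: neq_Nil_conv | (case_tac "fst x"; simp))+)

lemmas computes_add [computes_intros] = computes_total_comp2[OF computes_add_uncurried]
lemmas computes_diff [computes_intros] = computes_total_comp2[OF computes_diff_uncurried]
lemmas computes_le [computes_intros] = computes_total_comp2[OF computes_le_uncurried]
lemmas computes_length [computes_intros] = computes_total_comp[OF computes_length_id]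
lemmas computes_append [computes_intros] = computes_total_comp2[OF computes_append_uncurried]
lemmas computes_take [computes_intros] = computes_total_comp2[OF computes_take_uncurried]
lemmas computes_drop [computes_intros] = computes_total_comp2[OF computes_drop_uncurried]
lemmas computes_replicate [computes_intros] = computes_total_comp2[OF computes_replicate_uncurried]
lemmas computes_zip [computes_intros] = computes_total_comp2[OF computes_zip_uncurried]

lemma computes_less [computes_intros]:
 "computes D f Tf ==> computes D g Tg ==> computes D (%x. f x < (g x :: nat)) (%x. Tg x + Tf x + g x)"
 unfolding not_le[symmetric] by (rule computes_not, rule computes_le)

lemma computes_rev [computes_intros]: "computes D f Tf ==> computes D (%x. rev (f x)) (%x. Tf x + length (f x))"
 using computes_total_comp2[OF computes_rev_append_uncurried, of D f Tf "%x. []" "%x. 0"] computes_const[of D "[]"] by simp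

lemma computes_map:
 assumes "computes E (%p. h (fst p) (snd p)) T" "computes D c Tc" "computes D xs Tx"
  "\<And>x y. D x ==> y \<in> set (xs x) ==> E (c x, y)"
 shows "computes D (%x. map (h (c x)) (xs x)) (%x. Tc x + Tx x + (\<Sum>y\<leftarrow>xs x. T (c x, y) + 1))"
proof -
 let ?D = "%x. \<forall>y\<in>set (snd x). E (fst x, y)"
 let ?W = "%x. if snd x = [] then 0 else T (fst x, hd (snd x))"
 have "computes ?D (%x. map (h (fst x)) (snd x)) (%x. \<Sum>y\<leftarrow>snd x. T (fst x, y) + 1)"
 proof (rule computes_recursion[where p = "%x. snd x = []" and base = "%x. []" and s = "%x. (fst x, tl (snd x))"
   and post = "%y. h (fst (fst y)) (hd (snd (fst y))) # snd y" and W = ?W and K = 1])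
  show "computes (%y. ?D (fst y) \<and> snd (fst y) \<noteq> []
    \<and> snd y = map (h (fst (fst (fst y), tl (snd (fst y))))) (snd (fst (fst y), tl (snd (fst y)))))
   (%y. h (fst (fst y)) (hd (snd (fst y))) # snd y) (%y. 0 + 0 + T (fst (fst y), hd (snd (fst y))) + 0)"
   by (rule computes_Cons, rule computes_comp2[where E = E and T = "%a b. T (a, b)"], simp add: assms(1))
    (rule computes_intros | force)+
 qed ((rule computes_intros | force simp: neq_Nil_conv)+)
 from computes_comp[OF this computes_Pair[OF assms(2,3)]] assms(4) show ?thesis by simp
qed

lemma computes_map_const:
 assumes "computes E h T" "computes D xs Tx" "\<And>x y. D x ==> y \<in> set (xs x) ==> E y"
 shows "computes D (%x. map h (xs x)) (%x. Tx x + (\<Sum>y\<leftarrow>xs x. T y + 1))"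
proof -
 have "computes (%p::bool \<times> _. E (snd p)) (%p. h (snd p)) (%p. 0 + T (snd p))"
  by (rule computes_comp[OF assms(1) computes_snd[OF computes_id]])
 from computes_map[of _ "%_. h", OF this computes_const[of D True] assms(2)] assms(3) show ?thesis by simp
qed

lemma computes_mult_uncurried: "computes (%_. True) (%x. fst x * snd x :: nat) (%x. fst x * (snd x + 1))"
 by (rule computes_recursion[where p = "%x. fst x = 0" and base = "%x. 0" and s = "%x. (fst x - Suc 0, snd x)"
  and post = "%y. snd (fst y) + snd y" and W = "%x. if fst x = 0 then 0 else snd x" and K = 1],
  (rule computes_intros | force simp: gr0_conv_Suc algebra_simps)+)

lemma computes_div_uncurried: "computes (%_. True) (%x. fst x div snd x :: nat) (%x. 3 * fst x + snd x)"
 by (rule computes_recursion[where p = "%x. snd x = 0 \<or> fst x < snd x" and base = "%x. 0" and s = "%x. (fst x - snd x, snd x)"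
  and post = "%y. Suc (snd y)" and W = "%x. snd x" and K = 1], (rule computes_intros | force simp: le_div_geq)+)

lemmas computes_mult [computes_intros] = computes_total_comp2[OF computes_mult_uncurried]
lemmas computes_div [computes_intros] = computes_total_comp2[OF computes_div_uncurried]

lemma computes_mod [computes_intros]:
 assumes "computes D f Tf" "computes D g Tg"
 shows "computes D (%x. f x mod g x :: nat) (%x. Tf x + Tg x + f x + g x)"
 unfolding minus_div_mult_eq_mod[symmetric]
proof (rule computes_bound[where K = 10], (rule computes_intros assms)+, goal_cases)
 case (1 x)
 obtain q where q: "f x div g x = q" by blast
 have "g x * q <= f x" "q <= f x" unfolding q[symmetric] by simp_all
 then show ?case unfolding q by (simp add: algebra_simps)
qed

lemma computes_power_uncurried:
 "computes (%_. True) (%x. fst x ^ snd x :: nat) (%x. snd x * (fst x ^ snd x + fst x + 3))"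
proof (rule computes_recursion[where p = "%x. snd x = 0" and base = "%x. 1" and s = "%x. (fst x, snd x - Suc 0)"
  and post = "%y. fst (fst y) * snd y" and W = "%x. if snd x = 0 then 0 else fst x ^ snd x + fst x" and K = 1])
 fix x :: "nat \<times> nat" assume "snd x \<noteq> 0"
 then obtain a e where x: "x = (a, Suc e)" by (metis not0_implies_Suc prod.collapse)
 have "e * a ^ e <= a * (e * a ^ e)" by (cases "a = 0"; cases e) auto
 then have "a ^ Suc e + a + e * (a ^ e + a + 3) + 1 <= Suc e * (a ^ Suc e + a + 3)"
  by (simp add: algebra_simps, linarith)
 then show "(if snd x = 0 then 0 else fst x ^ snd x + fst x) + snd (fst x, snd x - Suc 0) *
  (fst (fst x, snd x - Suc 0) ^ snd (fst x, snd x - Suc 0) + fst (fst x, snd x - Suc 0) + 3) + 1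
   <= snd x * (fst x ^ snd x + fst x + 3)"
  by (simp add: x)
qed ((rule computes_intros | force simp: gr0_conv_Suc)+)

lemmas computes_power [computes_intros] = computes_total_comp2[OF computes_power_uncurried]

section \<open>Arithmetic of binary numbers\<close>

primrec val :: "bool list => nat" where
 "val [] = 0" | "val (b # bs) = of_bool b + 2 * val bs"

lemma val_append [simp]: "val (xs @ ys) = val xs + 2 ^ length xs * val ys"
 by (induction xs) (auto simp: algebra_simps)

lemma val_replicate_False [simp]: "val (replicate n False) = 0"
 by (induction n) auto

lemma val_less: "val xs < 2 ^ length xs"
 by (induction xs) (auto simp: of_bool_def)

lemma val_drop: "val (drop n xs) = val xs div 2 ^ n"
proof (induction n arbitrary: xs)
 case (Suc n)
 then show ?case by (cases xs) (auto simp: div_mult2_eq of_bool_def)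
qed simp

lemma val_take: "val (take n xs) = val xs mod 2 ^ n"
proof (induction n arbitrary: xs)
 case (Suc n)
 then show ?case by (cases xs) (auto simp: mod_mult2_eq of_bool_def)
qed simp

fun add_bits :: "bool => bool list => bool list => bool list" where
 "add_bits c [] [] = [c]"
| "add_bits c (x # xs) [] = (x \<noteq> c) # add_bits (x \<and> c) xs []"
| "add_bits c [] (y # ys) = (y \<noteq> c) # add_bits (y \<and> c) [] ys"
| "add_bits c (x # xs) (y # ys) = ((x \<noteq> y) \<noteq> c) # add_bits (x \<and> y \<or> c \<and> (x \<or> y)) xs ys"

lemma val_add_bits [simp]: "val (add_bits c xs ys) = of_bool c + val xs + val ys"
 by (induction c xs ys rule: add_bits.induct) (auto simp: of_bool_def)

lemma length_add_bits [simp]: "length (add_bits c xs ys) = Suc (max (length xs) (length ys))"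
 by (induction c xs ys rule: add_bits.induct) auto

lemma add_bits_nonempty [simp]: "add_bits c xs ys \<noteq> []"
 using length_add_bits[of c xs ys] by (metis list.size(3) nat.distinct(1))

abbreviation low_bit :: "bool list => bool" where "low_bit xs \<equiv> xs \<noteq> [] \<and> hd xs"

lemma add_bits_rec: "add_bits c xs ys = (if xs = [] \<and> ys = [] then [c] else
 ((low_bit xs \<noteq> low_bit ys) \<noteq> c)
 # add_bits (low_bit xs \<and> low_bit ys \<or> c \<and> (low_bit xs \<or> low_bit ys)) (tl xs) (tl ys))"
 by (cases xs; cases ys) (auto simp: conj_commute)

lemma computes_add_bits_uncurried:
 "computes (%_. True) (%x. add_bits (fst x) (fst (snd x)) (snd (snd x))) (%x. length (fst (snd x)) + length (snd (snd x)))"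
 by (rule computes_recursion[where p = "%x. fst (snd x) = [] \<and> snd (snd x) = []" and base = "%x. [fst x]"
  and s = "%x. (low_bit (fst (snd x)) \<and> low_bit (snd (snd x)) \<or>
    fst x \<and> (low_bit (fst (snd x)) \<or> low_bit (snd (snd x))), tl (fst (snd x)), tl (snd (snd x)))"
  and post = "%y. ((low_bit (fst (snd (fst y))) \<noteq> low_bit (snd (snd (fst y)))) \<noteq> fst (fst y)) # snd y"
  and W = "%x. 0" and K = 1],
  (rule add_bits_rec[THEN trans] | rule computes_intros | force simp: neq_Nil_conv
   | simp; (case_tac "fst (snd x)"; case_tac "snd (snd x)"; simp))+)

lemmas computes_add_bits [computes_intros] = computes_total_comp3[OF computes_add_bits_uncurried]

fun sub_bits :: "bool => bool list => bool list => bool list" where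
 "sub_bits c [] ys = []"
| "sub_bits c (x # xs) [] = (x \<noteq> c) # sub_bits (\<not> x \<and> c) xs []"
| "sub_bits c (x # xs) (y # ys) = ((x \<noteq> y) \<noteq> c) # sub_bits (\<not> x \<and> (y \<or> c) \<or> y \<and> c) xs ys"

lemma val_sub_bits: "val ys + of_bool c <= val xs ==> val (sub_bits c xs ys) + val ys + of_bool c = val xs"
 by (induction c xs ys rule: sub_bits.induct) (auto simp: of_bool_def split: if_splits)

lemma length_sub_bits [simp]: "length (sub_bits c xs ys) = length xs"
 by (induction c xs ys rule: sub_bits.induct) auto

lemma sub_bits_rec: "sub_bits c xs ys = (if xs = [] then [] else
 ((hd xs \<noteq> low_bit ys) \<noteq> c)
 # sub_bits (\<not> hd xs \<and> (low_bit ys \<or> c) \<or> low_bit ys \<and> c) (tl xs) (tl ys))"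
 by (cases xs; cases ys) auto

lemma computes_sub_bits_uncurried:
 "computes (%_. True) (%x. sub_bits (fst x) (fst (snd x)) (snd (snd x))) (%x. length (fst (snd x)))"
 by (rule computes_recursion[where p = "%x. fst (snd x) = []" and base = "%x. []"
  and s = "%x. (\<not> hd (fst (snd x)) \<and> (low_bit (snd (snd x)) \<or> fst x) \<or> low_bit (snd (snd x)) \<and> fst x,
    tl (fst (snd x)), tl (snd (snd x)))"
  and post = "%y. ((hd (fst (snd (fst y))) \<noteq> low_bit (snd (snd (fst y)))) \<noteq> fst (fst y)) # snd y"
  and W = "%x. 0" and K = 1],
  (rule sub_bits_rec[THEN trans] | rule computes_intros | force simp: neq_Nil_conv | simp; (case_tac "fst (snd x)"; simp))+)

lemmas computes_sub_bits [computes_intros] = computes_total_comp3[OF computes_sub_bits_uncurried]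

primrec naive_mult :: "bool list => bool list => bool list" where
 "naive_mult [] ys = []"
| "naive_mult (x # xs) ys = add_bits False (if x then ys else []) (False # naive_mult xs ys)"

lemma val_naive_mult [simp]: "val (naive_mult xs ys) = val xs * val ys"
 by (induction xs) (auto simp: algebra_simps)

lemma length_naive_mult: "length (naive_mult xs ys) <= length ys + 2 * length xs"
 by (induction xs) auto

lemma computes_naive_mult_uncurried: "computes (%_. True) (%x. naive_mult (fst x) (snd x))
 (%x. length (fst x) * (2 * length (snd x) + 2 * length (fst x) + 3))"
proof (rule computes_recursion[where p = "%x. fst x = []" and base = "%x. []" and s = "%x. (tl (fst x), snd x)"
  and post = "%y. add_bits False (if hd (fst (fst y)) then snd (fst y) else []) (False # snd y)" and K = 3
  and W = "%x. if fst x = [] then 0 else 2 * length (snd x) + 2 * length (fst x)"], (rule computes_intros | force)+, goal_cases)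
 case (1 x)
 then show ?case using length_naive_mult[of "tl (fst x)" "snd x"] by auto
next
 case (2 x)
 then show ?case by (cases "fst x") auto
next
 case (5 x)
 then show ?case by (cases "fst x") (auto simp: algebra_simps)
qed force+

lemmas computes_naive_mult [computes_intros] = computes_total_comp2[OF computes_naive_mult_uncurried]

section \<open>Quasi-linear multiplication\<close>

primrec list_poly :: "('a => complex) => 'a list => complex poly" where
 "list_poly g [] = 0" | "list_poly g (c # cs) = pCons (g c) (list_poly g cs)"

lemma coeff_list_poly: "coeff (list_poly g xs) i = (if i < length xs then g (xs ! i) else 0)"
proof (induction xs arbitrary: i)
 case (Cons x xs)
 then show ?case by (cases i) auto
qed simp

lemma degree_list_poly: "degree (list_poly g xs) <= length xs - 1"
 by (rule degree_le) (auto simp: coeff_list_poly)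

definition bits_poly :: "bool list list => complex poly" where
 "bits_poly = list_poly (%c. of_nat (val c))"

definition eval1 :: "complex => bool list list => complex" where
 "eval1 x u = poly (bits_poly u) x"

definition eval2 :: "complex => complex => bool list list list => complex" where
 "eval2 x y F = poly (list_poly (eval1 x) F) y"

lemma eval1_simps [simp]: "eval1 x [] = 0" "eval1 x (c # u) = of_nat (val c) + x * eval1 x u"
 by (simp_all add: eval1_def bits_poly_def)

lemma eval2_simps [simp]: "eval2 x y [] = 0" "eval2 x y (u # F) = eval1 x u + y * eval2 x y F"
 by (simp_all add: eval2_def)

lemma eval1_append [simp]: "eval1 x (u @ v) = eval1 x u + x ^ length u * eval1 x v"
 by (induction u) (auto simp: algebra_simps)

lemma eval2_append [simp]: "eval2 x y (F @ G) = eval2 x y F + y ^ length F * eval2 x y G"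
 by (induction F) (auto simp: algebra_simps)

lemma eval1_take_drop: "n <= length u ==> eval1 x u = eval1 x (take n u) + x ^ n * eval1 x (drop n u)"
 using eval1_append[of x "take n u" "drop n u"] by simp

lemma eval2_take_drop: "n <= length F ==> eval2 x y F = eval2 x y (take n F) + y ^ n * eval2 x y (drop n F)"
 using eval2_append[of x y "take n F" "drop n F"] by simp

lemma eval1_zeros [simp]: "eval1 x (replicate n []) = 0"
 by (induction n) auto

lemma eval2_zeros [simp]: "eval2 x y (replicate n (replicate m [])) = 0"
 by (induction n) auto

fun poly_add :: "bool list list => bool list list => bool list list" where
 "poly_add [] gs = gs"
| "poly_add (f # fs) [] = f # fs"
| "poly_add (f # fs) (g # gs) = add_bits False f g # poly_add fs gs"

lemma eval1_poly_add [simp]: "eval1 x (poly_add f g) = eval1 x f + eval1 x g"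
 by (induction f g rule: poly_add.induct) (auto simp: algebra_simps)

lemma length_poly_add [simp]: "length (poly_add f g) = max (length f) (length g)"
 by (induction f g rule: poly_add.induct) auto

definition narrow :: "nat => bool list list => bool" where
 "narrow w f \<longleftrightarrow> (\<forall>c\<in>set f. length c <= w)"

lemma narrow_simps [simp]: "narrow w []" "narrow w (c # f) \<longleftrightarrow> length c <= w \<and> narrow w f"
 "narrow w (f @ g) \<longleftrightarrow> narrow w f \<and> narrow w g" "narrow w (replicate n [])"
 by (auto simp: narrow_def)

lemma narrow_mono: "narrow w f ==> w <= w' ==> narrow w' f"
 by (auto simp: narrow_def)

lemma narrow_take: "narrow w f ==> narrow w (take n f)" and narrow_drop: "narrow w f ==> narrow w (drop n f)"
 by (auto simp: narrow_def dest: in_set_takeD in_set_dropD)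

lemma narrow_poly_add: "narrow w f ==> narrow w g ==> narrow (Suc w) (poly_add f g)"
 by (induction f g rule: poly_add.induct) (auto intro: narrow_mono)

definition rotate_right :: "nat => bool list list => bool list list" where
 "rotate_right e f = drop (length f - e) f @ take (length f - e) f"

lemma length_rotate_right [simp]: "length (rotate_right e f) = length f"
 by (simp add: rotate_right_def)

lemma narrow_rotate_right: "narrow w f ==> narrow w (rotate_right e f)"
 by (simp add: rotate_right_def narrow_take narrow_drop)

lemma eval1_rotate_right:
 assumes "x ^ length f = 1" "e <= length f"
 shows "eval1 x (rotate_right e f) = x ^ e * eval1 x f"
proof -
 let ?k = "length f - e"
 have "x ^ e * eval1 x f = x ^ e * eval1 x (take ?k f) + x ^ (e + ?k) * eval1 x (drop ?k f)"
  by (subst eval1_take_drop[of ?k f]) (simp_all add: algebra_simps power_add)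
 then show ?thesis using assms by (simp add: rotate_right_def)
qed

definition family_add :: "bool list list list => bool list list list => bool list list list" where
 "family_add F G = map (%p. poly_add (fst p) (snd p)) (zip F G)"

text \<open>A family of polynomials over Z[x]/(x^n - 1), given by coefficient lists of length n.\<close>
definition family :: "nat => nat => nat => bool list list list => bool" where
 "family N n w F \<longleftrightarrow> length F = N \<and> (\<forall>u\<in>set F. length u = n \<and> narrow w u)"

lemma family_append: "family N n w F ==> family M n w G ==> family (N + M) n w (F @ G)"
 by (auto simp: family_def)

lemma family_take: "family (N + M) n w F ==> family N n w (take N F)"
 and family_drop: "family (N + M) n w F ==> family M n w (drop N F)"
 by (auto simp: family_def dest: in_set_takeD in_set_dropD)

lemma family_rotate_right: "family N n w F ==> family N n w (map (rotate_right e) F)"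
 by (auto simp: family_def narrow_rotate_right)

lemma family_add: "family N n w F ==> family N n w G ==> family N n (Suc w) (family_add F G)"
 unfolding family_def family_add_def
 by auto (metis set_zip_leftD set_zip_rightD max.idem narrow_poly_add)+

lemma family_exists:
 assumes "length F = N" "\<And>u. u \<in> set F ==> length u = n"
 shows "\<exists>w. family N n w F"
proof -
 have "length c <= Max (insert 0 (length ` \<Union> (set ` set F)))" if "u \<in> set F" "c \<in> set u" for u c
  using that by (intro Max_ge) auto
 then show ?thesis using assms unfolding family_def narrow_def by blast
qed

lemma eval2_family_add: "length F = length G ==> eval2 x y (family_add F G) = eval2 x y F + eval2 x y G"
 by (induction F G rule: list_induct2) (auto simp: family_add_def algebra_simps)

lemma eval2_rotate_right:
 "x ^ n = 1 ==> e <= n ==> family N n w F ==> eval2 x y (map (rotate_right e) F) = x ^ e * eval2 x y F"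
 by (induction F arbitrary: N) (auto simp: algebra_simps eval1_rotate_right family_def)

text \<open>Reduction modulo y^k - x^e of a family of 2k polynomials, the coefficients of the powers of y.\<close>
definition fold_halves :: "nat => bool list list list => bool list list list" where
 "fold_halves e F = (let k = length F div 2 in family_add (take k F) (map (rotate_right e) (drop k F)))"

definition unfold_halves :: "nat => nat => bool list list list => bool list list list => bool list list list" where
 "unfold_halves m h A B =
  family_add A B @ map (rotate_right (2 * m - h)) (family_add A (map (rotate_right m) B))"

lemma family_fold_halves: "family (2 * k) n w F ==> family k n (Suc w) (fold_halves e F)"
proof -
 assume "family (2 * k) n w F"
 then have "family (k + k) n w F" "length F div 2 = k" by (simp_all add: mult_2 family_def)
 then show ?thesis
  unfolding fold_halves_def by (auto simp: Let_def intro: family_add family_take family_rotate_right family_drop)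
qed

lemma family_unfold_halves:
 "family k n w A ==> family k n w B ==> family (2 * k) n (Suc w) (unfold_halves m h A B)"
 unfolding unfold_halves_def mult_2 by (intro family_append family_rotate_right family_add)

lemma eval2_fold_halves:
 assumes "family (2 * k) n w F" "x ^ n = 1" "e <= n" "y ^ k = x ^ e"
 shows "eval2 x y (fold_halves e F) = eval2 x y F"
proof -
 have k: "length F = 2 * k" and upper_half: "family k n w (drop k F)"
  using assms(1) family_drop[of k k n w F] by (auto simp: family_def mult_2)
 then show ?thesis
  using eval2_take_drop[of k F x y] eval2_rotate_right[OF assms(2,3) upper_half] assms(4)
  by (simp add: fold_halves_def eval2_family_add)
qed

lemma eval2_unfold_halves:
 assumes x: "x ^ m = -1" and h: "h <= m" and A: "family k (2 * m) w A" and B: "family k (2 * m) w B"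
 shows "y ^ k = x ^ h ==> eval2 x y (unfold_halves m h A B) = 2 * eval2 x y A"
  "y ^ k = x ^ (h + m) ==> eval2 x y (unfold_halves m h A B) = 2 * eval2 x y B"
proof -
 have power_x: "x ^ (2 * m) = 1" using x by (simp add: power_mult mult.commute[of 2])
 have inv: "x ^ h * x ^ (2 * m - h) = 1" using h power_x by (simp add: power_add[symmetric])
 have len: "length A = k" "length B = k" using A B by (auto simp: family_def)
 have "eval2 x y (family_add A (map (rotate_right m) B)) = eval2 x y A - eval2 x y B"
  using eval2_rotate_right[OF power_x _ B, of m] len x by (simp add: eval2_family_add)
 moreover have "length (family_add A B) = k" using len by (simp add: family_add_def)
 ultimately have "eval2 x y (unfold_halves m h A B) =
   eval2 x y A + eval2 x y B + y ^ k * (x ^ (2 * m - h) * (eval2 x y A - eval2 x y B))"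
  using eval2_rotate_right[OF power_x _ family_add[OF A family_rotate_right[OF B]], of "2 * m - h"] len
  by (simp add: unfold_halves_def eval2_family_add)
 then show "y ^ k = x ^ h ==> eval2 x y (unfold_halves m h A B) = 2 * eval2 x y A"
  "y ^ k = x ^ (h + m) ==> eval2 x y (unfold_halves m h A B) = 2 * eval2 x y B"
  using inv x by (simp_all add: power_add mult.assoc[symmetric])
qed

primrec fft :: "nat => nat => nat => bool list list list => bool list list list" where
 "fft m 0 e F = F"
| "fft m (Suc l) e F = (let h = e div 2 in fft m l h (fold_halves h F) @ fft m l (h + m) (fold_halves (h + m) F))"

primrec ifft :: "nat => nat => nat => bool list list list => bool list list list" where
 "ifft m 0 e H = H"
| "ifft m (Suc l) e H = (let h = e div 2; k = length H div 2
  in unfold_halves m h (ifft m l h (take k H)) (ifft m l (h + m) (drop k H)))"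

lemma family_fft: "family (2 ^ l) n w F ==> family (2 ^ l) n (w + l) (fft m l e F)"
proof (induction l arbitrary: e F w)
 case (Suc l)
 have "family (2 ^ l + 2 ^ l) n (Suc w + l) (fft m (Suc l) e F)"
  unfolding fft.simps Let_def using Suc.prems by (intro family_append Suc.IH family_fold_halves) simp_all
 then show ?case by (simp add: mult_2)
qed simp

lemma family_ifft: "family (2 ^ l) n w F ==> family (2 ^ l) n (w + l) (ifft m l e F)"
proof (induction l arbitrary: e F w)
 case (Suc l)
 then have "family (2 ^ l + 2 ^ l) n w F" "length F div 2 = 2 ^ l" by (simp_all add: mult_2 family_def)
 then show ?case using family_unfold_halves Suc.IH family_take family_drop by (simp add: Let_def)
qed simp

lemma family_map_zip:
 assumes A: "family N n w A" and B: "family N n w B"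
  and r: "\<And>u v. length u = n ==> length v = n ==> length (r (u, v)) = n'"
 shows "\<exists>W. family N n' W (map r (zip A B))"
proof (rule family_exists)
 show "length (map r (zip A B)) = N" using A B by (simp add: family_def)
 fix z assume "z \<in> set (map r (zip A B))"
 then obtain u v where "z = r (u, v)" "u \<in> set A" "v \<in> set B" by (auto dest: set_zip_leftD set_zip_rightD)
 then show "length z = n'" using A B r by (auto simp: family_def)
qed

abbreviation pointwise where
 "pointwise r m l e F G \<equiv> map r (zip (fft m l e F) (fft m l e G))"

lemma ifft_pointwise_Suc:
 assumes "family (2 * 2 ^ l) n w F" "family (2 * 2 ^ l) n w G"
 shows "ifft m (Suc l) (2 * h) (pointwise r m (Suc l) (2 * h) F G)
  = unfold_halves m h (ifft m l h (pointwise r m l h (fold_halves h F) (fold_halves h G)))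
   (ifft m l (h + m) (pointwise r m l (h + m) (fold_halves (h + m) F) (fold_halves (h + m) G)))"
proof -
 have len: "length (fft m l e (fold_halves e F)) = 2 ^ l" "length (fft m l e (fold_halves e G)) = 2 ^ l" for e
  using family_fft family_fold_halves assms unfolding family_def by blast+
 have "pointwise r m (Suc l) (2 * h) F G
  = pointwise r m l h (fold_halves h F) (fold_halves h G) @ pointwise r m l (h + m) (fold_halves (h + m) F)
   (fold_halves (h + m) G)"
  by (simp add: len Let_def)
 then show ?thesis by (simp add: len Let_def)
qed

lemma fft_convolution:
 assumes x: "x ^ m = -1"
  and r: "\<And>u v. length u = 2 * m ==> length v = 2 * m ==>
   length (r (u, v)) = 2 * m \<and> eval1 x (r (u, v)) = eval1 x u * eval1 x v"
  and "y ^ (2 ^ l) = x ^ e" "2 ^ l dvd e" "2 ^ l dvd 2 * m" "e <= 2 * m"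
  "family (2 ^ l) (2 * m) w F" "family (2 ^ l) (2 * m) w G"
 shows "eval2 x y (ifft m l e (pointwise r m l e F G)) = 2 ^ l * (eval2 x y F * eval2 x y G)"
 using assms(3-)
proof (induction l arbitrary: e F G w)
 case 0
 then obtain u v where "F = [u]" "G = [v]" by (auto simp: family_def length_Suc_conv)
 then show ?case using 0 r[of u v] by (auto simp: family_def)
next
 case (Suc l)
 define h where "h = e div 2"
 have e: "e = 2 * h" "2 ^ l dvd h" using Suc.prems(2) by (auto simp: h_def dvd_def)
 have m: "2 ^ l dvd m" "2 ^ l dvd 2 * m" "h <= m" using Suc.prems(3,4) e by (auto simp: dvd_def)
 have power_x: "x ^ (2 * m) = 1" using x by (simp add: power_mult mult.commute[of 2])
 have F: "family (2 * 2 ^ l) (2 * m) w F" and G: "family (2 * 2 ^ l) (2 * m) w G" using Suc.prems by simp_all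
 define p where "p e' = pointwise r m l e' (fold_halves e' F) (fold_halves e' G)" for e'
 obtain w1 w2 where "family (2 ^ l) (2 * m) w1 (p h)" "family (2 ^ l) (2 * m) w2 (p (h + m))"
  using family_map_zip[OF family_fft family_fft, OF family_fold_halves[OF F] family_fold_halves[OF G], of r "2 * m"] r
  unfolding p_def by metis
 then have p: "family (2 ^ l) (2 * m) (max w1 w2) (p h)" "family (2 ^ l) (2 * m) (max w1 w2) (p (h + m))"
  by (auto simp: family_def intro: narrow_mono)
 have product: "eval2 x y (ifft m l e' (p e')) = 2 ^ l * (eval2 x y F * eval2 x y G)"
  if "y ^ 2 ^ l = x ^ e'" "2 ^ l dvd e'" "e' <= 2 * m" for e'
  unfolding p_def using that Suc.IH[OF that(1,2) m(2) that(3) family_fold_halves[OF F] family_fold_halves[OF G]]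
  by (simp add: eval2_fold_halves[OF F power_x] eval2_fold_halves[OF G power_x])
 have step: "ifft m (Suc l) e (pointwise r m (Suc l) e F G)
   = unfold_halves m h (ifft m l h (p h)) (ifft m l (h + m) (p (h + m)))"
  unfolding p_def e(1) using F G by (rule ifft_pointwise_Suc)
 have "(y ^ 2 ^ l)\<^sup>2 = (x ^ h)\<^sup>2" using Suc.prems(1) e by (simp add: power_mult[symmetric] mult.commute)
 then consider (low) "y ^ 2 ^ l = x ^ h" | (high) "y ^ 2 ^ l = x ^ (h + m)"
  using x by (auto simp: power2_eq_iff power_add)
 then show ?case
 proof cases
  case low
  then show ?thesis unfolding step using product[of h] e m
   by (simp add: eval2_unfold_halves(1)[OF x m(3) family_ifft[OF p(1)] family_ifft[OF p(2)]])
 next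
  case high
  then show ?thesis unfolding step using product[of "h + m"] e m
   by (simp add: eval2_unfold_halves(2)[OF x m(3) family_ifft[OF p(1)] family_ifft[OF p(2)]])
 qed
qed

text \<open>The coefficient lists represent elements of Z[x]/(x^2m - 1); they are reduced modulo x^m + 1
 and divided by 2^l.\<close>
definition negacyclic_div :: "nat => nat => bool list list => bool list list" where
 "negacyclic_div l m u = map (%p. drop l (sub_bits False (fst p) (snd p))) (zip (take m u) (drop m u))"

lemma bits_poly_negacyclic_div:
 assumes u: "length u = 2 * m" and c: "bits_poly (take m u) - bits_poly (drop m u) = smult (2 ^ l) c"
  and degree: "degree c < m" and nat: "\<And>i. coeff c i \<in> \<nat>"
 shows "bits_poly (negacyclic_div l m u) = c"
proof (rule poly_eqI)
 fix i
 show "coeff (bits_poly (negacyclic_div l m u)) i = coeff c i"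
 proof (cases "i < m")
  case False
  then show ?thesis using degree u by (simp add: bits_poly_def coeff_list_poly negacyclic_div_def coeff_eq_0)
 next
  case True
  let ?a = "val (u ! i)" and ?b = "val (u ! (m + i))"
  obtain N where N: "coeff c i = of_nat N" using nat[of i] by (auto elim: Nats_cases)
  have "coeff (bits_poly (take m u)) i - coeff (bits_poly (drop m u)) i = 2 ^ l * coeff c i"
   using arg_cong[OF c, of "%p. coeff p i"] by simp
  then have "complex_of_nat ?a - of_nat ?b = 2 ^ l * of_nat N"
   using True u by (simp add: bits_poly_def coeff_list_poly N)
  then have "complex_of_nat ?a = of_nat (?b + 2 ^ l * N)" by (simp add: algebra_simps)
  then have "?a = ?b + 2 ^ l * N" by (simp only: of_nat_eq_iff)
  then have "val (sub_bits False (u ! i) (u ! (m + i))) = 2 ^ l * N"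
   using val_sub_bits[of "u ! (m + i)" False "u ! i"] by simp
  then have "val (drop l (sub_bits False (u ! i) (u ! (m + i)))) = N" by (simp add: val_drop)
  then show ?thesis using True u by (simp add: bits_poly_def coeff_list_poly negacyclic_div_def N)
 qed
qed

definition product_coeff :: "bool list list list => bool list list list => nat => complex poly" where
 "product_coeff F G i = (\<Sum>j\<le>i. if j < length F \<and> i - j < length G then bits_poly (F ! j) * bits_poly (G ! (i - j)) else 0)"

lemma poly_product_coeff: "coeff (list_poly (eval1 x) F * list_poly (eval1 x) G) i = poly (product_coeff F G i) x"
 unfolding product_coeff_def coeff_mult poly_sum
 by (rule sum.cong) (auto simp: coeff_list_poly eval1_def)

lemma degree_product_coeff:
 assumes F: "family r s w F" and G: "family r s w' G"
 shows "degree (product_coeff F G i) <= 2 * (s - 1)"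
 unfolding product_coeff_def
proof (rule degree_sum_le)
 fix j
 have "degree (bits_poly (F ! j) * bits_poly (G ! (i - j))) <= 2 * (s - 1)" if "j < length F" "i - j < length G"
 proof -
  have "degree (bits_poly (F ! j)) <= s - 1" "degree (bits_poly (G ! (i - j))) <= s - 1"
   using degree_list_poly[of _ "F ! j"] degree_list_poly[of _ "G ! (i - j)"] F G that
   by (auto simp: bits_poly_def family_def)
  then show ?thesis using degree_mult_le[of "bits_poly (F ! j)" "bits_poly (G ! (i - j))"] by linarith
 qed
 then show "degree (if j < length F \<and> i - j < length G then bits_poly (F ! j) * bits_poly (G ! (i - j)) else 0) <= 2 * (s - 1)"
  by auto
qed simp

lemma product_coeff_Nats: "coeff (product_coeff F G i) t \<in> \<nat>"
proof -
 have sum: "(\<And>i. i \<in> A ==> f i \<in> \<nat>) ==> sum f A \<in> (\<nat> :: complex set)" for f :: "nat => complex" and A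
  by (induction A rule: infinite_finite_induct) auto
 have "coeff (bits_poly f * bits_poly g) t \<in> \<nat>" for f g
  unfolding coeff_mult bits_poly_def by (intro sum Nats_mult) (auto simp: coeff_list_poly)
 then show ?thesis unfolding product_coeff_def coeff_sum by (intro sum) auto
qed

text \<open>An identity that holds at all pairs of an m-th root of -1 and a 2r-th root of unity is an
 identity of polynomials, because of the degree bounds.\<close>

context
 fixes F G H :: "bool list list list" and r s m l w w' w'' :: nat
 assumes F: "family r s w F" and G: "family r s w' G" and H: "family (2 * r) (2 * m) w'' H"
  and m: "m = 2 * s" "0 < s" "0 < r"
  and eval: "\<And>x y. x ^ m = -1 ==> y ^ (2 * r) = 1 ==> eval2 x y H = 2 ^ l * (eval2 x y F * eval2 x y G)"
begin

lemma degree_product_lt: "degree (list_poly (eval1 x) F * list_poly (eval1 x) G) < 2 * r"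
 using degree_mult_le[of "list_poly (eval1 x) F" "list_poly (eval1 x) G"] F G m
  degree_list_poly[of "eval1 x" F] degree_list_poly[of "eval1 x" G]
 by (auto simp: family_def)

lemma list_poly_eq_product:
 assumes x: "x ^ m = -1"
 shows "list_poly (eval1 x) H = smult (2 ^ l) (list_poly (eval1 x) F * list_poly (eval1 x) G)"
proof (rule poly_eqI_degree[where A = "{y::complex. y ^ (2 * r) = 1}"])
 have card: "card {y::complex. y ^ (2 * r) = 1} = 2 * r" using m by (intro card_roots_unity_eq) simp
 show "card {y::complex. y ^ (2 * r) = 1} > degree (list_poly (eval1 x) H)"
  using degree_list_poly[of "eval1 x" H] H m card by (simp add: family_def)
 show "card {y::complex. y ^ (2 * r) = 1} > degree (smult (2 ^ l) (list_poly (eval1 x) F * list_poly (eval1 x) G))"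
  using degree_product_lt[of x] card by simp
qed (use eval[OF x] in \<open>auto simp: eval2_def\<close>)

lemma halves_eq_product_coeff:
 assumes i: "i < 2 * r"
 shows "bits_poly (take m (H ! i)) - bits_poly (drop m (H ! i)) = smult (2 ^ l) (product_coeff F G i)"
proof (rule poly_eqI_degree[where A = "{x::complex. x ^ m = -1}"])
 let ?u = "H ! i"
 have u: "length ?u = 2 * m" and H': "length H = 2 * r" using i H by (auto simp: family_def)
 have card: "card {x::complex. x ^ m = -1} = m" using m by (intro card_nth_roots) auto
 have "degree (bits_poly v) < m" if "length v = m" for v
  using degree_list_poly[of "%c. of_nat (val c)" v] that m unfolding bits_poly_def by linarith
 then have "degree (bits_poly (take m ?u)) < m" "degree (bits_poly (drop m ?u)) < m" using u by auto
 then show "card {x::complex. x ^ m = -1} > degree (bits_poly (take m ?u) - bits_poly (drop m ?u))"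
  unfolding card by (rule degree_diff_less)
 show "card {x::complex. x ^ m = -1} > degree (smult (2 ^ l) (product_coeff F G i))"
  using card degree_product_coeff[OF F G, of i] m by simp
 fix x :: complex assume "x \<in> {x. x ^ m = -1}"
 then have x: "x ^ m = -1" by simp
 have "eval1 x ?u = 2 ^ l * poly (product_coeff F G i) x"
  using arg_cong[OF list_poly_eq_product[OF x], of "%p. coeff p i"] i H' poly_product_coeff[of x F G i]
  by (simp add: coeff_list_poly)
 then show "poly (bits_poly (take m ?u) - bits_poly (drop m ?u)) x = poly (smult (2 ^ l) (product_coeff F G i)) x"
  using x eval1_take_drop[of m ?u x] u by (simp add: eval1_def)
qed

lemma list_poly_negacyclic_div:
 "list_poly (eval1 x) (map (negacyclic_div l m) H) = list_poly (eval1 x) F * list_poly (eval1 x) G"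
proof (rule poly_eqI)
 fix i
 have H': "length H = 2 * r" using H by (simp add: family_def)
 show "coeff (list_poly (eval1 x) (map (negacyclic_div l m) H)) i = coeff (list_poly (eval1 x) F * list_poly (eval1 x) G) i"
 proof (cases "i < 2 * r")
  case True
  have "length (H ! i) = 2 * m" using True H by (simp add: family_def)
  moreover have "degree (product_coeff F G i) < m" using degree_product_coeff[OF F G, of i] m by simp
  ultimately have "bits_poly (negacyclic_div l m (H ! i)) = product_coeff F G i"
   using halves_eq_product_coeff[OF True] product_coeff_Nats by (rule_tac bits_poly_negacyclic_div)
  then show ?thesis using poly_product_coeff[of x F G i] True H' by (simp add: coeff_list_poly eval1_def)
 next
  case False
  then show ?thesis using degree_product_lt[of x] H' by (simp add: coeff_list_poly coeff_eq_0)
 qed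
qed

lemma eval2_butlast_negacyclic_div:
 "eval2 x y (take (2 * r - 1) (map (negacyclic_div l m) H)) = eval2 x y F * eval2 x y G"
proof -
 let ?H = "map (negacyclic_div l m) H"
 have len: "length ?H = 2 * r" "length F = r" "length G = r" using H F G by (auto simp: family_def)
 have "coeff (list_poly (eval1 x) F) j * coeff (list_poly (eval1 x) G) (2 * r - 1 - j) = 0" for j
  using len by (cases "j < r") (auto simp: coeff_list_poly)
 then have "coeff (list_poly (eval1 x) ?H) (2 * r - 1) = 0"
  unfolding list_poly_negacyclic_div coeff_mult by (intro sum.neutral ballI)
 then have last: "eval1 x (?H ! (2 * r - 1)) = 0" using m len by (simp add: coeff_list_poly)
 have "drop (2 * r - 1) ?H = [?H ! (2 * r - 1)]"
  using len m Cons_nth_drop_Suc[of "2 * r - 1" ?H] by simp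
 then have "eval2 x y ?H = eval2 x y (take (2 * r - 1) ?H)"
  using last len eval2_take_drop[of "2 * r - 1" ?H x y] by simp
 then show ?thesis by (simp add: eval2_def list_poly_negacyclic_div)
qed

end

primrec chunks :: "nat => nat => bool list list => bool list list list" where
 "chunks 0 s f = []" | "chunks (Suc r) s f = take s f # chunks r s (drop s f)"

lemma family_chunks: "length f = r * s ==> narrow w f ==> family r s w (chunks r s f)"
proof (induction r arbitrary: f)
 case (Suc r)
 have "length (drop s f) = r * s" "narrow w (drop s f)" using Suc.prems by (auto simp: narrow_drop)
 from Suc.IH[OF this] show ?case using Suc.prems by (auto simp: family_def narrow_take)
qed (simp add: family_def)

lemma eval2_chunks: "length f = r * s ==> eval2 x (x ^ s) (chunks r s f) = eval1 x f"
proof (induction r arbitrary: f)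
 case (Suc r)
 then show ?case using eval1_take_drop[of s f x] by simp
qed simp

definition padded_chunks :: "nat => nat => bool list list => bool list list list" where
 "padded_chunks r s f = map (%u. u @ replicate (3 * s) []) (chunks r s f) @ replicate r (replicate (4 * s) [])"

lemma eval2_padded_chunks: "eval2 x y (padded_chunks r s f) = eval2 x y (chunks r s f)"
proof -
 have "eval2 x y (map (%u. u @ replicate (3 * s) []) F) = eval2 x y F" for F by (induction F) auto
 then show ?thesis by (simp add: padded_chunks_def)
qed

lemma family_padded_chunks:
 "length f = r * s ==> narrow w f ==> family (2 * r) (4 * s) w (padded_chunks r s f)"
 using family_chunks[of f r s w] by (auto simp: family_def padded_chunks_def)

primrec overlap_add :: "nat => bool list list => bool list list list => bool list list" where
 "overlap_add s acc [] = acc"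
| "overlap_add s acc (u # H) = poly_add (take s u) acc @ overlap_add s (drop s u) H"

lemma overlap_add:
 "length acc = s ==> (\<And>u. u \<in> set H ==> length u = 2 * s) ==>
  eval1 x (overlap_add s acc H) = eval1 x acc + eval2 x (x ^ s) H \<and> length (overlap_add s acc H) = s * length H + s"
proof (induction H arbitrary: acc)
 case (Cons u H)
 then show ?case using eval1_take_drop[of s u x] by (simp add: algebra_simps)
qed simp

lemma narrow_overlap_add:
 "narrow w acc ==> (\<And>u. u \<in> set H ==> narrow w u) ==> narrow (Suc w) (overlap_add s acc H)"
 by (induction H arbitrary: acc) (auto simp: narrow_take narrow_drop narrow_poly_add intro: narrow_mono)

primrec naive_poly_mult :: "bool list list => bool list list => bool list list" where
 "naive_poly_mult [] g = []"
| "naive_poly_mult (a # f) g = poly_add (map (naive_mult a) g) ([] # naive_poly_mult f g)"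

lemma eval1_naive_poly_mult: "eval1 x (naive_poly_mult f g) = eval1 x f * eval1 x g"
proof -
 have "eval1 x (map (naive_mult a) g) = of_nat (val a) * eval1 x g" for a
  by (induction g) (auto simp: algebra_simps)
 then show ?thesis by (induction f) (auto simp: algebra_simps)
qed

lemma length_naive_poly_mult: "f \<noteq> [] ==> g \<noteq> [] ==> length (naive_poly_mult f g) = length f + length g - 1"
proof (induction f)
 case (Cons a f)
 then show ?case by (cases f) (auto simp: max_def Suc_diff_le neq_Nil_conv)
qed simp

lemma narrow_map_naive_mult: "length a <= w ==> narrow w g ==> narrow (3 * w) (map (naive_mult a) g)"
 unfolding narrow_def
proof clarsimp
 fix c assume "length a <= w" "\<forall>c\<in>set g. length c <= w" "c \<in> set g"
 then show "length (naive_mult a c) <= 3 * w" using length_naive_mult[of a c] by fastforce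
qed

lemma narrow_naive_poly_mult: "narrow w f ==> narrow w g ==> narrow (3 * w + length f) (naive_poly_mult f g)"
proof (induction f)
 case (Cons a f)
 then have "narrow (Suc (3 * w + length f)) (poly_add (map (naive_mult a) g) ([] # naive_poly_mult f g))"
  using narrow_map_naive_mult[of a w g] by (intro narrow_poly_add) (auto intro: narrow_mono)
 then show ?case by simp
qed simp

text \<open>A polynomial of length 2^k is cut into blocks, which are multiplied modulo x^n - 1 for a
 power n of 2 with four times the length of a block.\<close>

definition block_count :: "nat => nat" where "block_count k = 2 ^ (k div 2)"
definition block_length :: "nat => nat" where "block_length k = 2 ^ (k - k div 2)"

lemma block_count_length: "block_count k * block_length k = 2 ^ k"
 by (simp add: block_count_def block_length_def power_add[symmetric])

lemma block_pos: "0 < block_count k" "0 < block_length k"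
 by (simp_all add: block_count_def block_length_def)

definition transform :: "nat => bool list list => bool list list list" where
 "transform k f = fft (2 * block_length k) (Suc (k div 2)) (4 * block_length k)
  (padded_chunks (block_count k) (block_length k) f)"

definition cyclic_reduce :: "nat => bool list list => bool list list" where
 "cyclic_reduce n p = poly_add (take n p) (drop n p)"

definition reassemble :: "nat => bool list list list => bool list list list" where
 "reassemble k ps = ifft (2 * block_length k) (Suc (k div 2)) (4 * block_length k) (map (cyclic_reduce (4 * block_length k)) ps)"

definition combine :: "nat => bool list list list => bool list list" where
 "combine k ps = overlap_add (block_length k) (replicate (block_length k) [])
  (take (2 * block_count k - 1) (map (negacyclic_div (Suc (k div 2)) (2 * block_length k)) (reassemble k ps)))"

text \<open>A product of two polynomials f and g of length 2^k; w is only a bound on the coefficient widths.\<close>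
type_synonym task = "nat \<times> nat \<times> bool list list \<times> bool list list"

definition split_task :: "task => task list" where
 "split_task z = map (%p. (fst z - fst z div 2 + 2, fst (snd z) + Suc (fst z div 2), p))
  (zip (transform (fst z) (fst (snd (snd z)))) (transform (fst z) (snd (snd (snd z)))))"

function poly_mult :: "task => bool list list" where
 "poly_mult z = (if fst z < 10 then naive_poly_mult (fst (snd (snd z))) (snd (snd (snd z))) @ [[]]
  else combine (fst z) (map poly_mult (split_task z)))"
 by pat_completeness auto
termination by (relation "measure fst") (auto simp: split_task_def)

declare poly_mult.simps [simp del]

lemma length_narrow_cyclic_reduce:
 "length p = 2 * n ==> narrow V p ==> length (cyclic_reduce n p) = n \<and> narrow (Suc V) (cyclic_reduce n p)"
 by (simp add: cyclic_reduce_def narrow_poly_add narrow_take narrow_drop)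

lemma family_transform:
 assumes "length f = 2 ^ k" "narrow w f"
 shows "family (2 * block_count k) (4 * block_length k) (w + Suc (k div 2)) (transform k f)"
proof -
 have "family (2 ^ Suc (k div 2)) (4 * block_length k) w (padded_chunks (block_count k) (block_length k) f)"
  using family_padded_chunks[of f "block_count k" "block_length k" w] assms block_count_length[of k]
  by (simp add: block_count_def)
 from family_fft[OF this] show ?thesis by (simp add: transform_def block_count_def del: fft.simps)
qed

lemma family_reassemble:
 assumes "length ps = 2 * block_count k" "\<And>p. p \<in> set ps ==> length p = 8 * block_length k \<and> narrow V p"
 shows "family (2 * block_count k) (4 * block_length k) (Suc V + Suc (k div 2)) (reassemble k ps)"
proof -
 have "family (2 ^ Suc (k div 2)) (4 * block_length k) (Suc V) (map (cyclic_reduce (4 * block_length k)) ps)"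
  using assms length_narrow_cyclic_reduce[of _ "4 * block_length k" V] by (auto simp: family_def block_count_def)
 from family_ifft[OF this] show ?thesis by (simp add: reassemble_def block_count_def del: ifft.simps)
qed

lemma length_narrow_negacyclic_div:
 "length u = 2 * m ==> narrow (w + l) u ==> length (negacyclic_div l m u) = m \<and> narrow w (negacyclic_div l m u)"
 by (auto simp: negacyclic_div_def narrow_def dest!: set_zip_leftD in_set_takeD)

lemma narrow_combine:
 assumes "length ps = 2 * block_count k" "\<And>p. p \<in> set ps ==> length p = 8 * block_length k \<and> narrow V p"
 shows "narrow (V + 2) (combine k ps)"
proof -
 have "narrow (Suc V) (negacyclic_div (Suc (k div 2)) (2 * block_length k) u)" if "u \<in> set (reassemble k ps)" for u
  using family_reassemble[of ps k V, OF assms] that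
   length_narrow_negacyclic_div[of u "2 * block_length k" "Suc V" "Suc (k div 2)"]
  by (auto simp: family_def)
 then have "narrow (Suc (Suc V)) (combine k ps)"
  unfolding combine_def by (intro narrow_overlap_add) (auto dest!: in_set_takeD)
 then show ?thesis by simp
qed

lemma eval1_cyclic_reduce: "length p = 2 * n ==> x ^ n = 1 ==> eval1 x (cyclic_reduce n p) = eval1 x p"
 using eval1_take_drop[of n p x] by (simp add: cyclic_reduce_def)

context
 fixes f g :: "bool list list" and k w :: nat and r :: "bool list list \<times> bool list list => bool list list"
 assumes f: "length f = 2 ^ k" "narrow w f" and g: "length g = 2 ^ k" "narrow w g" and k: "2 <= k"
  and r: "\<And>u v x. length u = 4 * block_length k ==> length v = 4 * block_length k ==>
   length (r (u, v)) = 8 * block_length k \<and> eval1 x (r (u, v)) = eval1 x u * eval1 x v"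
begin

lemma eval2_reassemble_transforms:
 assumes x: "x ^ (2 * block_length k) = -1" and y: "y ^ (2 * block_count k) = 1"
 shows "eval2 x y (reassemble k (map r (zip (transform k f) (transform k g)))) = 2 ^ Suc (k div 2) *
  (eval2 x y (chunks (block_count k) (block_length k) f) * eval2 x y (chunks (block_count k) (block_length k) g))"
proof -
 define m where "m = 2 * block_length k"
 define l where "l = Suc (k div 2)"
 define R where "R = (%p. cyclic_reduce (2 * m) (r p))"
 let ?F = "padded_chunks (block_count k) (block_length k) f" and ?G = "padded_chunks (block_count k) (block_length k) g"
 have power_x: "x ^ (2 * m) = 1" using x[folded m_def] by (simp add: power_mult mult.commute[of 2])
 have "l <= k - k div 2 + 2" using k by (simp add: l_def)
 then have dvd: "2 ^ l dvd 2 * m"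
  by (simp add: m_def block_length_def le_imp_power_dvd flip: power_Suc)
 have R: "length (R (u, v)) = 2 * m \<and> eval1 x (R (u, v)) = eval1 x u * eval1 x v"
  if "length u = 2 * m" "length v = 2 * m" for u v
  using r[of u v] that eval1_cyclic_reduce[OF _ power_x, of "r (u, v)"] by (simp add: R_def cyclic_reduce_def m_def)
 have "family (2 ^ l) (2 * m) w ?F" "family (2 ^ l) (2 * m) w ?G"
  using family_padded_chunks[of f "block_count k" "block_length k" w] family_padded_chunks[of g "block_count k"
   "block_length k" w]
   f g block_count_length[of k] by (simp_all add: m_def l_def block_count_def)
 moreover have "y ^ 2 ^ l = x ^ (2 * m)" using power_x y by (simp add: l_def block_count_def)
 ultimately have "eval2 x y (ifft m l (2 * m) (map R (zip (fft m l (2 * m) ?F) (fft m l (2 * m) ?G))))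
   = 2 ^ l * (eval2 x y ?F * eval2 x y ?G)"
  using x R dvd by (intro fft_convolution) (simp_all add: m_def)
 then show ?thesis
  by (simp add: reassemble_def transform_def R_def comp_def m_def l_def eval2_padded_chunks del: fft.simps ifft.simps)
qed

lemma combine_transforms:
 "eval1 x (combine k (map r (zip (transform k f) (transform k g)))) = eval1 x f * eval1 x g"
 "length (combine k (map r (zip (transform k f) (transform k g)))) = 2 * 2 ^ k"
proof -
 let ?s = "block_length k" and ?r = "block_count k"
 define H where "H = reassemble k (map r (zip (transform k f) (transform k g)))"
 define T where "T = take (2 * ?r - 1) (map (negacyclic_div (Suc (k div 2)) (2 * ?s)) H)"
 have len: "length f = ?r * ?s" "length g = ?r * ?s" using f g by (simp_all add: block_count_length)
 obtain V where "family (2 * ?r) (8 * ?s) V (map r (zip (transform k f) (transform k g)))"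
  using family_map_zip[OF family_transform[OF f] family_transform[OF g], of r "8 * ?s"] r by blast
 then obtain W where H: "family (2 * ?r) (2 * (2 * ?s)) W H"
  using family_reassemble[of "map r (zip (transform k f) (transform k g))" k V] by (auto simp: H_def family_def)
 have "length u = 2 * ?s" if "u \<in> set T" for u
  using that H by (auto simp: T_def family_def negacyclic_div_def dest!: in_set_takeD)
 moreover have "length T = 2 * ?r - 1" using H by (simp add: T_def family_def)
 moreover have "eval2 x (x ^ ?s) T = eval2 x (x ^ ?s) (chunks ?r ?s f) * eval2 x (x ^ ?s) (chunks ?r ?s g)"
  unfolding T_def by (rule eval2_butlast_negacyclic_div[OF family_chunks[OF len(1) f(2)] family_chunks[OF len(2) g(2)]
    H refl block_pos(2,1) eval2_reassemble_transforms[folded H_def]])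
 then have "eval2 x (x ^ ?s) T = eval1 x f * eval1 x g" by (simp add: eval2_chunks len)
 ultimately have "eval1 x (overlap_add ?s (replicate ?s []) T) = eval1 x f * eval1 x g"
   "length (overlap_add ?s (replicate ?s []) T) = 2 * (?r * ?s)"
  using overlap_add[of "replicate ?s []" ?s T x] block_pos[of k]
  by (auto simp: diff_mult_distrib2 mult.commute mult.left_commute)
 then show "eval1 x (combine k (map r (zip (transform k f) (transform k g)))) = eval1 x f * eval1 x g"
  "length (combine k (map r (zip (transform k f) (transform k g)))) = 2 * 2 ^ k"
  by (simp_all add: combine_def T_def H_def block_count_length)
qed

end

lemma poly_mult_recursion:
 "\<not> k < 10 ==> poly_mult (k, w, f, g) = combine k
  (map (%p. poly_mult (k - k div 2 + 2, w + Suc (k div 2), p)) (zip (transform k f) (transform k g)))"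
 by (subst poly_mult.simps) (simp add: split_task_def comp_def)

lemma four_block_length: "4 * block_length k = 2 ^ (k - k div 2 + 2)"
 by (simp add: block_length_def)

theorem poly_mult_correct:
 assumes "length f = 2 ^ k" "length g = 2 ^ k"
 shows "eval1 x (poly_mult (k, w, f, g)) = eval1 x f * eval1 x g \<and> length (poly_mult (k, w, f, g)) = 2 * 2 ^ k"
 using assms
proof (induction k arbitrary: w f g x rule: less_induct)
 case (less k)
 show ?case
 proof (cases "k < 10")
  case True
  have "f \<noteq> []" "g \<noteq> []" using less.prems by auto
  then show ?thesis
   using True length_naive_poly_mult[of f g] less.prems by (simp add: poly_mult.simps eval1_naive_poly_mult)
 next
  case False
  have rec: "length (poly_mult (k - k div 2 + 2, w + Suc (k div 2), u, v)) = 8 * block_length k \<and>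
    eval1 x (poly_mult (k - k div 2 + 2, w + Suc (k div 2), u, v)) = eval1 x u * eval1 x v"
   if "length u = 4 * block_length k" "length v = 4 * block_length k" for u v x
   using less.IH[of "k - k div 2 + 2" u v] that False by (simp add: block_length_def)
  obtain V where "narrow V f" "narrow V g"
   using family_exists[of "[f, g]" 2 "2 ^ k"] less.prems by (auto simp: family_def)
  from combine_transforms[OF less.prems(1) this(1) less.prems(2) this(2), of
   "%p. poly_mult (k - k div 2 + 2, w + Suc (k div 2), p)"]
  show ?thesis unfolding poly_mult_recursion[OF False] using False rec by auto
 qed
qed

definition valid_task :: "task => bool" where
 "valid_task z \<longleftrightarrow> (case z of (k, w, f, g) => length f = 2 ^ k \<and> length g = 2 ^ k \<and> narrow w f \<and> narrow w g)"

lemma split_task_valid: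
 assumes "valid_task (k, w, f, g)"
 shows "length (split_task (k, w, f, g)) = 2 * block_count k"
  "z \<in> set (split_task (k, w, f, g)) ==> \<exists>u v. z = (k - k div 2 + 2, w + Suc (k div 2), u, v) \<and> valid_task z"
proof -
 have "family (2 * block_count k) (4 * block_length k) (w + Suc (k div 2)) (transform k f)"
  "family (2 * block_count k) (4 * block_length k) (w + Suc (k div 2)) (transform k g)"
  using assms family_transform[of f k w] family_transform[of g k w] by (simp_all add: valid_task_def)
 then show "length (split_task (k, w, f, g)) = 2 * block_count k"
  "z \<in> set (split_task (k, w, f, g)) ==> \<exists>u v. z = (k - k div 2 + 2, w + Suc (k div 2), u, v) \<and> valid_task z"
  by (auto simp: split_task_def family_def valid_task_def four_block_length dest: set_zip_leftD set_zip_rightD)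
qed

lemma poly_mult_split_task:
 assumes "valid_task (k, w, f, g)" "p \<in> set (map poly_mult (split_task (k, w, f, g)))"
 shows "length p = 8 * block_length k \<and> (\<exists>u v. p = poly_mult (k - k div 2 + 2, w + Suc (k div 2), u, v) \<and>
  valid_task (k - k div 2 + 2, w + Suc (k div 2), u, v))"
proof -
 obtain z where "z \<in> set (split_task (k, w, f, g))" "p = poly_mult z" using assms(2) unfolding set_map by blast
 then obtain u v where p: "p = poly_mult (k - k div 2 + 2, w + Suc (k div 2), u, v)"
   "valid_task (k - k div 2 + 2, w + Suc (k div 2), u, v)"
  using split_task_valid(2)[OF assms(1)] by blast
 then have "length p = 2 * 2 ^ (k - k div 2 + 2)"
  using poly_mult_correct[of u "k - k div 2 + 2" v] by (simp add: valid_task_def)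
 then show ?thesis using p four_block_length[of k] by auto
qed

lemma narrow_poly_mult: "valid_task (k, w, f, g) ==> narrow (3 * w + 600 + 10 * k) (poly_mult (k, w, f, g))"
proof (induction k arbitrary: w f g rule: less_induct)
 case (less k)
 show ?case
 proof (cases "k < 10")
  case True
  then have "(2::nat) ^ k <= 2 ^ 9" by (intro power_increasing) auto
  then have "length f <= 600" using less.prems by (simp add: valid_task_def)
  then have "narrow (3 * w + 600 + 10 * k) (naive_poly_mult f g)"
   using narrow_naive_poly_mult[of w f g] less.prems by (auto simp: valid_task_def intro: narrow_mono)
  then show ?thesis using True by (simp add: poly_mult.simps)
 next
  case False
  let ?V = "3 * (w + Suc (k div 2)) + 600 + 10 * (k - k div 2 + 2)"
  have "length p = 8 * block_length k \<and> narrow ?V p" if "p \<in> set (map poly_mult (split_task (k, w, f, g)))" for p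
   using poly_mult_split_task[OF less.prems that] less.IH[of "k - k div 2 + 2" "w + Suc (k div 2)"] False by auto
  then have "narrow (?V + 2) (combine k (map poly_mult (split_task (k, w, f, g))))"
   using split_task_valid(1)[OF less.prems] by (intro narrow_combine) auto
  then have "narrow (?V + 2) (poly_mult (k, w, f, g))" using False by (subst poly_mult.simps) simp
  then show ?thesis by (rule narrow_mono) (use False in simp)
 qed
qed

section \<open>Cost of the multiplication\<close>

definition poly_size :: "bool list list => nat" where
 "poly_size f = (\<Sum>c\<leftarrow>f. length c + 1)"

definition family_size :: "bool list list list => nat" where
 "family_size F = (\<Sum>u\<leftarrow>F. poly_size u + 1)"

lemma poly_size_simps [simp]: "poly_size [] = 0" "poly_size (c # f) = length c + 1 + poly_size f"
 "poly_size (f @ g) = poly_size f + poly_size g" "poly_size (replicate n []) = n"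
 by (simp_all add: poly_size_def sum_list_replicate)

lemma family_size_simps [simp]: "family_size [] = 0" "family_size (u # F) = poly_size u + 1 + family_size F"
 "family_size (F @ G) = family_size F + family_size G"
 by (simp_all add: family_size_def)

lemma poly_size_take: "poly_size (take k f) <= poly_size f" and poly_size_drop: "poly_size (drop k f) <= poly_size f"
 using poly_size_simps(3)[of "take k f" "drop k f"] by simp_all

lemma length_le_poly_size: "length f <= poly_size f"
 by (induction f) auto

lemma poly_size_rotate_right [simp]: "poly_size (rotate_right e f) = poly_size f"
 using poly_size_simps(3)[of "take (length f - e) f" "drop (length f - e) f"] by (simp add: rotate_right_def)

lemma family_size_rotate_right [simp]: "family_size (map (rotate_right e) F) = family_size F"
 by (induction F) auto

lemma sum_list_bound: "(\<And>u. u \<in> set F ==> T u <= B) ==> (\<Sum>u\<leftarrow>F. T u) <= length F * (B::nat)"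
 by (induction F) (auto intro: add_mono)

lemma poly_size_narrow: "narrow w f ==> poly_size f <= length f * (w + 1)"
 unfolding poly_size_def by (rule sum_list_bound) (auto simp: narrow_def)

lemma family_size_le:
 assumes "family N n w F" "1 <= n"
 shows "family_size F <= 2 * (N * (n * (w + 1)))"
proof -
 have "poly_size u + 1 <= 2 * (n * (w + 1))" if "u \<in> set F" for u
  using poly_size_narrow[of w u] assms that by (fastforce simp: family_def)
 then have "(\<Sum>u\<leftarrow>F. poly_size u + 1) <= length F * (2 * (n * (w + 1)))" by (rule sum_list_bound)
 then show ?thesis using assms(1) by (simp add: family_size_def family_def algebra_simps)
qed

lemma computes_poly_add_uncurried:
 "computes (%_. True) (%x. poly_add (fst x) (snd x)) (%x. poly_size (fst x) + poly_size (snd x))"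
proof (rule computes_recursion[where p = "%x. fst x = [] \<or> snd x = []" and base = "%x. if fst x = [] then snd x else fst x"
  and s = "%x. (tl (fst x), tl (snd x))" and post = "%y. add_bits False (hd (fst (fst y))) (hd (snd (fst y))) # snd y"
  and W = "%x. if fst x = [] \<or> snd x = [] then 0 else length (hd (fst x)) + length (hd (snd x))" and K = 1],
  (rule computes_intros | (simp; fail) | force)+)
qed (auto simp: neq_Nil_conv; (case_tac "fst x"; case_tac "snd x"; simp; fail))+

lemmas computes_poly_add [computes_intros] = computes_total_comp2[OF computes_poly_add_uncurried]

lemma computes_rotate_right_uncurried:
 "computes (%_. True) (%x. rotate_right (fst x) (snd x)) (%x. fst x + length (snd x))"
 unfolding rotate_right_def by (rule computes_bound[where K = 10], (rule computes_intros | force)+)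

lemma computes_family_add [computes_intros]:
 assumes "computes D f Tf" "computes D g Tg"
 shows "computes D (%x. family_add (f x) (g x)) (%x. Tf x + Tg x + family_size (f x) + family_size (g x))"
proof -
 have "computes (%_. True) (%p. poly_add (fst (snd p)) (snd (snd p))) (%p. poly_size (fst (snd p)) + poly_size (snd (snd p)))"
  by (rule computes_bound[where K = 1], (rule computes_intros | force)+)
 note map = computes_map[of _ "%_ q. poly_add (fst q) (snd q)", OF this computes_const[of D False], of "%x. zip (f x) (g x)"]
 have sizes: "(\<Sum>p\<leftarrow>zip F G. poly_size (fst p) + poly_size (snd p) + 1) <= family_size F + family_size G"
  "length F <= family_size F" for F G
 proof (induction F arbitrary: G)
  case (Cons u F)
  {
   case 1 show ?case using Cons(1)[of "tl G"] by (cases G) auto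
  next
   case 2 show ?case using Cons(2) by simp
  }
 qed simp_all
 show ?thesis unfolding family_add_def
 proof (rule computes_bound[where K = 2], (rule map computes_intros assms TrueI)+, goal_cases)
  case (1 x)
  show ?case using sizes(1)[of "f x" "g x"] sizes(2)[of "f x"] by simp
 qed
qed

lemma computes_map_rotate_right [computes_intros]:
 assumes "computes D e Te" "computes D F TF"
 shows "computes D (%x. map (rotate_right (e x)) (F x)) (%x. Te x + TF x + (\<Sum>u\<leftarrow>F x. e x + length u + 1))"
 using computes_map[OF computes_rotate_right_uncurried assms] by simp

lemma computes_fold_halves:
 assumes "computes D e Te" "computes D F TF"
  and "\<And>x. D x ==> family (2 * N x) (n x) (w x) (F x) \<and> e x <= n x \<and> 1 <= n x"
 shows "computes D (%x. fold_halves (e x) (F x)) (%x. Te x + TF x + N x * (n x * (w x + 1)))"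
 unfolding fold_halves_def Let_def
proof (rule computes_bound[where K = 40], (rule computes_intros assms(1,2))+, goal_cases)
 case (1 x)
 define U where "U = N x * (n x * (w x + 1))"
 define k where "k = length (F x) div 2"
 have F: "family (2 * N x) (n x) (w x) (F x)" "e x <= n x" "1 <= n x" using assms(3)[OF 1] by auto
 have "N x * 1 <= U" unfolding U_def using F(3) by (intro mult_le_mono2) simp
 then have len: "length (F x) = 2 * k" "k <= U" using F(1) by (simp_all add: k_def family_def)
 have "family_size (F x) <= 4 * U" using family_size_le[OF F(1,3)] by (simp add: U_def)
 then have "family_size (take k (F x)) + family_size (drop k (F x)) <= 4 * U"
  using family_size_simps(3)[of "take k (F x)" "drop k (F x)"] by simp
 moreover have "(\<Sum>u\<leftarrow>drop k (F x). e x + length u + 1) <= length (drop k (F x)) * (3 * n x)"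
  using F by (intro sum_list_bound) (auto simp: family_def dest!: in_set_dropD)
 moreover have "length (drop k (F x)) * (3 * n x) <= N x * (3 * (n x * (w x + 1)))"
  using F(1) by (intro mult_le_mono) (auto simp: k_def family_def)
 then have "length (drop k (F x)) * (3 * n x) <= 3 * U" by (simp add: U_def mult.left_commute)
 ultimately show ?case using len unfolding U_def[symmetric] k_def[symmetric] by simp
qed

lemma computes_unfold_halves:
 assumes "computes D m Tm" "computes D h Th" "computes D A TA" "computes D B TB"
  and "\<And>x. D x ==> family (N x) (2 * m x) (w x) (A x) \<and> family (N x) (2 * m x) (w x) (B x) \<and> 1 <= m x \<and> 1 <= N x"
 shows "computes D (%x. unfold_halves (m x) (h x) (A x) (B x)) (%x. Tm x + Th x + TA x + TB x + h x + N x * (m x * (w x + 1)))"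
 unfolding unfold_halves_def
proof (rule computes_bound[where K = 100], (rule computes_intros assms(1-4))+, goal_cases)
 case (1 x)
 define U where "U = N x * (m x * (w x + 1))"
 let ?C = "family_add (A x) (map (rotate_right (m x)) (B x))"
 have A: "family (N x) (2 * m x) (w x) (A x)" and B: "family (N x) (2 * m x) (w x) (B x)" and m: "1 <= m x" "1 <= N x"
  using assms(5)[OF 1] by auto
 have C: "family (N x) (2 * m x) (Suc (w x)) ?C" by (intro family_add family_rotate_right A B)
 have size: "family_size (A x) <= 4 * U" "family_size (B x) <= 4 * U"
  using family_size_le[OF A] family_size_le[OF B] m by (simp_all add: U_def algebra_simps)
 have rotate: "(\<Sum>u\<leftarrow>F. e + length u + 1) <= 5 * U" if "family (N x) (2 * m x) w' F" "e <= 2 * m x" for F e w'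
 proof -
  have "(\<Sum>u\<leftarrow>F. e + length u + 1) <= length F * (5 * m x)"
   using that m by (intro sum_list_bound) (auto simp: family_def)
  also have "... <= N x * (5 * (m x * (w x + 1)))" using that by (intro mult_le_mono) (auto simp: family_def)
  finally show ?thesis by (simp add: U_def algebra_simps)
 qed
 have "N x * 1 <= U" "1 * (m x * 1) <= U" unfolding U_def using m by (intro mult_le_mono; simp)+
 moreover have "length (family_add (A x) (B x)) = N x" using A B by (simp add: family_def family_add_def)
 moreover note rotate[OF B, of "m x"] rotate[OF C, of "2 * m x - h x"]
 ultimately show ?case using size unfolding U_def[symmetric] by simp
qed

definition fft_cost :: "nat => nat => nat => nat" where
 "fft_cost w m l = 2 ^ l * ((m * (w + l + 1) + 2) * (l + 1))"

lemma fft_cost_mono: "w <= w' ==> fft_cost w m l <= fft_cost w' m l"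
 unfolding fft_cost_def by (intro mult_le_mono add_mono) auto

lemma fft_cost_Suc: "2 ^ Suc l * (m * (w + Suc l + 1)) + 2 * fft_cost (Suc w) m l + 2 <= fft_cost w m (Suc l)"
proof -
 have "2 ^ Suc l * (m * (w + Suc l + 1)) + 2 <= 2 ^ Suc l * (m * (w + Suc l + 1) + 2)"
  using mult_le_mono[of 1 "2 ^ Suc l" "2" 2] by (simp add: algebra_simps)
 then show ?thesis by (simp add: fft_cost_def algebra_simps)
qed

definition fft_input :: "nat \<times> nat \<times> nat \<times> nat \<times> bool list list list => bool" where
 "fft_input x \<longleftrightarrow> family (2 ^ arg3 x) (2 * arg2 x) (arg1 x) (rst5 x) \<and> arg4 x <= 2 * arg2 x \<and> 1 <= arg2 x"

lemma fft_input_halves: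
 assumes "fft_input (w, m, Suc l, e, F)"
 shows "family (2 ^ l + 2 ^ l) (2 * m) w F" "length F div 2 = 2 ^ l" "e div 2 <= m" "1 <= m"
proof -
 show F: "family (2 ^ l + 2 ^ l) (2 * m) w F" and e: "e div 2 <= m" and m: "1 <= m"
  using assms by (auto simp: fft_input_def mult_2)
 show "length F div 2 = 2 ^ l" using F by (simp add: family_def)
qed

abbreviation fft_arg where
 "fft_arg e x \<equiv> (Suc (arg1 x), arg2 x, arg3 x - Suc 0, e, fold_halves e (rst5 x))"

abbreviation fft_local_cost where
 "fft_local_cost x \<equiv> (if arg3 x = 0 then 0 else 2 ^ arg3 x * (arg2 x * (arg1 x + 1)))"

lemma computes_fft_arg:
 assumes e: "computes (%x. fft_input x \<and> arg3 x \<noteq> 0) e arg2" "\<And>x. fft_input x \<and> arg3 x \<noteq> 0 ==> e x <= 2 * arg2 x"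
 shows "computes (%x. fft_input x \<and> arg3 x \<noteq> 0) (%x. fft_arg (e x) x) (%x. fft_local_cost x)"
proof -
 let ?D = "%x. fft_input x \<and> arg3 x \<noteq> 0"
 have fold: "computes ?D (%x. fold_halves (e x) (rst5 x)) (%x. arg2 x + 0 + 2 ^ (arg3 x - Suc 0) * (2 * arg2 x * (arg1 x + 1)))"
 proof (rule computes_fold_halves[OF e(1)], (rule computes_intros)+, goal_cases)
  case (1 x)
  then show ?case using e(2)[OF 1] by (cases "arg3 x") (auto simp: fft_input_def)
 qed
 show ?thesis
 proof (rule computes_bound[where K = 5], (rule e(1) fold computes_intros)+, goal_cases)
  case (1 x)
  then obtain w m l e F where x: "x = (w, m, Suc l, e, F)" by (metis not0_implies_Suc prod.collapse)
  have "1 * (m * 1) <= 2 ^ l * (m * (w + 1))" by (intro mult_le_mono) auto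
  then show ?case using e(2)[OF 1] by (simp add: x algebra_simps)
 qed
qed

lemma length_fft_half:
 assumes "fft_input (w, m, Suc l, e, F)"
 shows "length (fft m l (e div 2) (fold_halves (e div 2) F)) <= 2 ^ Suc l * (m * (w + 1))"
proof -
 have "family (2 ^ l) (2 * m) (Suc w) (fold_halves (e div 2) F)"
  using fft_input_halves(1)[OF assms] assms by (auto simp: fft_input_def mult_2 intro: family_fold_halves)
 from family_fft[OF this, of m "e div 2"]
 have "length (fft m l (e div 2) (fold_halves (e div 2) F)) = 2 ^ l * (1 * 1)" using assms by (simp add: fft_input_def family_def)
 also have "... <= 2 ^ Suc l * (m * (w + 1))" using assms by (intro mult_le_mono) (auto simp: fft_input_def)
 finally show ?thesis .
qed

lemma computes_fft:
 "computes fft_input (%x. fft (arg2 x) (arg3 x) (arg4 x) (rst5 x)) (%x. fft_cost (arg1 x) (arg2 x) (arg3 x))"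
 (is "computes _ ?F ?S")
proof -
 let ?D = "%x. fft_input x \<and> arg3 x \<noteq> 0"
 let ?s = "%x. fft_arg (arg4 x div 2) x" and ?t = "%x. fft_arg (arg4 x div 2 + arg2 x) x"
 have half: "computes ?D (%x. arg4 x div 2) arg2" "computes ?D (%x. arg4 x div 2 + arg2 x) arg2"
  by (rule computes_bound[where K = 20], (rule computes_intros)+, force simp: fft_input_def)+
 have args: "computes ?D ?s (%x. fft_local_cost x)" "computes ?D ?t (%x. fft_local_cost x)"
  by (rule computes_fft_arg[OF half(1)], force simp: fft_input_def) (rule computes_fft_arg[OF half(2)], force simp: fft_input_def)
 have dom: "fft_input (?s x) \<and> fft_input (?t x)" if "fft_input x" "arg3 x \<noteq> 0" for x
  using that by (cases "arg3 x") (auto simp: fft_input_def intro: family_fold_halves)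
 show ?thesis
 proof (rule computes_binary_recursion[where p = "%x. arg3 x = 0" and base = "%x. rst5 x" and post = "%y. snd (fst y) @ snd y",
   OF _ _ args _ _ dom])
  show "computes (%y. fft_input (fst (fst y)) \<and> arg3 (fst (fst y)) \<noteq> 0 \<and> snd (fst y) = ?F (?s (fst (fst y)))
    \<and> snd y = ?F (?t (fst (fst y)))) (%y. snd (fst y) @ snd y) (%y. fft_local_cost (fst (fst y)))"
  proof (rule computes_bound[where K = 1], (rule computes_intros)+, goal_cases)
   case (1 y)
   then obtain w m l e F r q where y: "y = (((w, m, Suc l, e, F), r), q)" by (metis not0_implies_Suc prod.collapse)
   show ?case using length_fft_half[of w m l e F] 1 by (simp add: y)
  qed
  fix x assume "fft_input x"
  show "?F x = (if arg3 x = 0 then rst5 x else snd (fst ((x, ?F (?s x)), ?F (?t x))) @ snd ((x, ?F (?s x)), ?F (?t x)))"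
   by (cases "arg3 x") (auto simp: Let_def)
  assume "arg3 x \<noteq> 0"
  then obtain w m l e F where x: "x = (w, m, Suc l, e, F)" by (metis not0_implies_Suc prod.collapse)
  have "2 ^ Suc l * (m * (w + 1)) <= 2 ^ Suc l * (m * (w + Suc l + 1))" by (intro mult_le_mono) auto
  then have "2 ^ Suc l * (m * (w + 1)) + 2 * fft_cost (Suc w) m l + 2 <= fft_cost w m (Suc l)"
   using fft_cost_Suc[of l m w] by linarith
  then show "fft_local_cost x + ?S (?s x) + ?S (?t x) + 2 <= ?S x" by (simp add: x)
 qed ((rule computes_bound[where K = 1], (rule computes_intros)+, force) | force)+
qed

abbreviation ifft_left_arg where
 "ifft_left_arg x \<equiv> (arg1 x, arg2 x, arg3 x - Suc 0, arg4 x div 2, take (length (rst5 x) div 2) (rst5 x))"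

abbreviation ifft_right_arg where
 "ifft_right_arg x \<equiv> (arg1 x, arg2 x, arg3 x - Suc 0, arg4 x div 2 + arg2 x, drop (length (rst5 x) div 2) (rst5 x))"

abbreviation ifft_local_cost where
 "ifft_local_cost x \<equiv> (if arg3 x = 0 then 0 else 2 ^ arg3 x * (arg2 x * (arg1 x + arg3 x + 1)))"

lemma ifft_local_cost_bounds:
 assumes "fft_input x" "arg3 x \<noteq> 0"
 shows "arg2 x <= ifft_local_cost x" "length (rst5 x) <= ifft_local_cost x"
proof -
 have "1 * (arg2 x * 1) <= 2 ^ arg3 x * (arg2 x * (arg1 x + arg3 x + 1))"
  "2 ^ arg3 x * (1 * 1) <= 2 ^ arg3 x * (arg2 x * (arg1 x + arg3 x + 1))"
  using assms by (intro mult_le_mono; simp add: fft_input_def)+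
 then show "arg2 x <= ifft_local_cost x" "length (rst5 x) <= ifft_local_cost x"
  using assms by (simp_all add: fft_input_def family_def)
qed

lemma fft_input_ifft_args:
 assumes "fft_input x" "arg3 x \<noteq> 0"
 shows "fft_input (ifft_left_arg x) \<and> fft_input (ifft_right_arg x)"
proof -
 obtain w m l e F where x: "x = (w, m, Suc l, e, F)" using \<open>arg3 x \<noteq> 0\<close> by (metis not0_implies_Suc prod.collapse)
 note F = fft_input_halves[of w m l e F, folded x, OF assms(1)]
 show ?thesis using F(2-4) family_take[OF F(1)] family_drop[OF F(1)] by (simp add: x fft_input_def)
qed

lemma computes_ifft_args:
 "computes (%x. fft_input x \<and> arg3 x \<noteq> 0) (%x. ifft_left_arg x) (%x. ifft_local_cost x)"
 "computes (%x. fft_input x \<and> arg3 x \<noteq> 0) (%x. ifft_right_arg x) (%x. ifft_local_cost x)"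
proof -
 have bounds: "arg2 x <= ifft_local_cost x" "length (rst5 x) <= ifft_local_cost x" "length (rst5 x) div 2 <= ifft_local_cost x"
  "arg4 x <= 2 * arg2 x" if "fft_input x \<and> arg3 x \<noteq> 0" for x
  using ifft_local_cost_bounds[of x] that by (auto simp: fft_input_def intro: order_trans[OF div_le_dividend])
 show "computes (%x. fft_input x \<and> arg3 x \<noteq> 0) (%x. ifft_left_arg x) (%x. ifft_local_cost x)"
 proof (rule computes_bound[where K = 60], (rule computes_intros)+, goal_cases)
  case (1 x)
  show ?case using 1 bounds[OF 1] by simp
 qed
 show "computes (%x. fft_input x \<and> arg3 x \<noteq> 0) (%x. ifft_right_arg x) (%x. ifft_local_cost x)"
 proof (rule computes_bound[where K = 60], (rule computes_intros)+, goal_cases)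
  case (1 x)
  show ?case using 1 bounds[OF 1] by simp
 qed
qed

lemma computes_ifft_merge:
 defines "F x \<equiv> ifft (arg2 x) (arg3 x) (arg4 x) (rst5 x)"
 shows "computes (%y. fft_input (fst (fst y)) \<and> arg3 (fst (fst y)) \<noteq> 0 \<and> snd (fst y) = F (ifft_left_arg (fst (fst y)))
   \<and> snd y = F (ifft_right_arg (fst (fst y))))
  (%y. unfold_halves (arg2 (fst (fst y))) (arg4 (fst (fst y)) div 2) (snd (fst y)) (snd y)) (%y. ifft_local_cost (fst (fst y)))"
 (is "computes ?D ?merge _")
proof -
 have half: "computes ?D (%y. arg4 (fst (fst y)) div 2) (%y. arg2 (fst (fst y)))"
  by (rule computes_bound[where K = 20], (rule computes_intros)+, force simp: fft_input_def)
 have "computes ?D ?merge (%y. 0 + arg2 (fst (fst y)) + 0 + 0 + arg4 (fst (fst y)) div 2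
   + 2 ^ (arg3 (fst (fst y)) - Suc 0) * (arg2 (fst (fst y)) * (arg1 (fst (fst y)) + (arg3 (fst (fst y)) - Suc 0) + 1)))"
 proof (rule computes_unfold_halves[OF _ half], (rule computes_intros)+, goal_cases)
  case (1 y)
  let ?x = "fst (fst y)"
  have "fft_input (ifft_left_arg ?x)" "fft_input (ifft_right_arg ?x)" using 1 fft_input_ifft_args by blast+
  from family_ifft[OF conjunct1[OF this(1)[unfolded fft_input_def]], of "arg2 ?x" "arg4 ?x div 2"]
   family_ifft[OF conjunct1[OF this(2)[unfolded fft_input_def]], of "arg2 ?x" "arg4 ?x div 2 + arg2 ?x"]
  show ?case using 1 by (auto simp: fft_input_def F_def)
 qed
 then show ?thesis
 proof (rule computes_bound[where K = 4], goal_cases)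
  case (1 y)
  let ?x = "fst (fst y)"
  have x: "fft_input ?x" "arg3 ?x \<noteq> 0" using 1 by auto
  then have "2 ^ (arg3 ?x - Suc 0) * (arg2 ?x * (arg1 ?x + (arg3 ?x - Suc 0) + 1)) <= ifft_local_cost ?x"
   by simp (intro mult_le_mono power_increasing; simp)
  moreover have "arg4 ?x div 2 <= arg2 ?x" using x(1) by (auto simp: fft_input_def)
  ultimately show ?case using ifft_local_cost_bounds[OF x] by simp
 qed
qed

lemma computes_ifft:
 "computes fft_input (%x. ifft (arg2 x) (arg3 x) (arg4 x) (rst5 x)) (%x. fft_cost (arg1 x) (arg2 x) (arg3 x))"
 (is "computes _ ?F ?S")
proof (rule computes_binary_recursion[where p = "%x. arg3 x = 0" and base = "%x. rst5 x",
  OF _ _ computes_ifft_args computes_ifft_merge _ fft_input_ifft_args])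
 fix x assume "fft_input x"
 let ?y = "((x, ?F (ifft_left_arg x)), ?F (ifft_right_arg x))"
 show "?F x = (if arg3 x = 0 then rst5 x
   else unfold_halves (arg2 (fst (fst ?y))) (arg4 (fst (fst ?y)) div 2) (snd (fst ?y)) (snd ?y))"
  by (cases "arg3 x") (auto simp: Let_def)
 assume "arg3 x \<noteq> 0"
 then obtain w m l e F where x: "x = (w, m, Suc l, e, F)" by (metis not0_implies_Suc prod.collapse)
 show "ifft_local_cost x + ?S (ifft_left_arg x) + ?S (ifft_right_arg x) + 2 <= ?S x"
  using fft_cost_Suc[of l m w] fft_cost_mono[of w "Suc w" m l] by (simp add: x)
qed ((rule computes_bound[where K = 1], (rule computes_intros)+, force) | force)+

lemma computes_negacyclic_div_uncurried:
 "computes (%_. True) (%x. negacyclic_div (fst (fst x)) (snd (fst x)) (snd x))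
  (%x. snd (fst x) + poly_size (snd x) + length (snd x) * fst (fst x))"
proof -
 have "computes (%_. True) (%q. drop (fst q) (sub_bits False (fst (snd q)) (snd (snd q)))) (%q. length (fst (snd q)) + fst q)"
  by (rule computes_bound[where K = 2], (rule computes_intros)+, force)
 note map = computes_map[of _ "%l p. drop l (sub_bits False (fst p) (snd p))", OF this]
 have zip: "(\<Sum>p\<leftarrow>zip A B. length (fst p) + l + 1) <= poly_size A + length A * l" for A B l
 proof (induction A arbitrary: B)
  case (Cons u A)
  show ?case using Cons[of "tl B"] by (cases B) auto
 qed simp
 show ?thesis unfolding negacyclic_div_def
 proof (rule computes_bound[where K = 4], (rule computes_intros TrueI map)+, goal_cases)
  case (1 x)
  obtain l m u where x: "x = ((l, m), u)" by (metis prod.collapse)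
  have "length (take m u) * l <= length u * l" by (intro mult_le_mono1) simp
  then have "(\<Sum>p\<leftarrow>zip (take m u) (drop m u). length (fst p) + l + 1) <= poly_size u + length u * l"
   using zip[of l "take m u" "drop m u"] poly_size_take[of m u] by linarith
  then show ?case using length_le_poly_size[of u] unfolding x by simp
 qed
qed

lemma computes_chunks_uncurried:
 "computes (%_. True) (%x. chunks (arg1 x) (arg2 x) (rst3 x)) (%x. arg1 x * (arg2 x + 1))"
proof (rule computes_recursion[where p = "%x. arg1 x = 0" and base = "%x. []"
  and s = "%x. (arg1 x - Suc 0, arg2 x, drop (arg2 x) (rst3 x))"
  and post = "%y. take (arg2 (fst y)) (rst3 (fst y)) # snd y" and W = "%x. if arg1 x = 0 then 0 else arg2 x" and K = 1],
  (rule computes_intros | force)+)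
qed ((case_tac "arg1 x"; simp) | force)+

lemmas computes_chunks [computes_intros] = computes_total_comp3[OF computes_chunks_uncurried]

lemma computes_padded_chunks_uncurried:
 "computes (%x. length (rst3 x) = arg1 x * arg2 x) (%x. padded_chunks (arg1 x) (arg2 x) (rst3 x)) (%x. (arg1 x + 1)
   * (arg2 x + 1))"
proof -
 have "computes (%_. True) (%q. (snd q :: bool list list) @ replicate (3 * fst q) []) (%q. length (snd q) + fst q)"
  by (rule computes_bound[where K = 10], (rule computes_intros)+, force)
 note map = computes_map[of _ "%s u. u @ replicate (3 * s) []", OF this]
 show ?thesis unfolding padded_chunks_def
 proof (rule computes_bound[where K = 40], (rule computes_intros TrueI map)+, goal_cases)
  case (1 x)
  obtain r s f where x: "x = (r, s, f)" by (metis prod.collapse)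
  obtain w where "family r s w (chunks r s f)"
   using family_chunks[of f r s] family_exists[of "[f]" 1 "length f"] 1 by (auto simp: x family_def)
  then have "(\<Sum>u\<leftarrow>chunks r s f. length u + s + 1) <= r * (2 * s + 1)" "length (chunks r s f) = r"
   using sum_list_bound[of "chunks r s f" "%u. length u + s + 1" "2 * s + 1"] by (auto simp: family_def)
  then show ?case unfolding x by (simp add: algebra_simps)
 qed
qed

lemma computes_overlap_add_uncurried: "computes (%_. True) (%x. overlap_add (arg1 x) (arg2 x) (rst3 x))
 (%x. 2 * poly_size (arg2 x) + (\<Sum>u\<leftarrow>rst3 x. 4 * poly_size u + arg1 x + 1))"
proof (rule computes_recursion[where p = "%x. rst3 x = []" and base = "%x. arg2 x" and K = 4
  and s = "%x. (arg1 x, drop (arg1 x) (hd (rst3 x)), tl (rst3 x))"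
  and post = "%y. poly_add (take (arg1 (fst y)) (hd (rst3 (fst y)))) (arg2 (fst y)) @ snd y"
  and W = "%x. if rst3 x = [] then 0 else arg1 x + 2 * poly_size (hd (rst3 x)) + 2 * poly_size (arg2 x)"],
  (rule computes_intros | force)+, goal_cases)
 case (1 x)
 then show ?case using poly_size_take[of "arg1 x" "hd (rst3 x)"] length_le_poly_size[of "take (arg1 x) (hd (rst3 x))"]
   length_le_poly_size[of "arg2 x"]
  by (simp add: max_def)
next
 case (2 x)
 then show ?case by (cases "rst3 x") auto
next
 case (5 x)
 then show ?case using poly_size_drop[of "arg1 x" "hd (rst3 x)"] by (cases "rst3 x") auto
qed force+

lemma computes_map_naive_mult:
 assumes "computes D a Ta" "computes D g Tg"
  and "\<And>x. D x ==> length (a x) <= w x \<and> narrow (w x) (g x) \<and> length (g x) <= 600"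
 shows "computes D (%x. map (naive_mult (a x)) (g x)) (%x. Ta x + Tg x + (w x + 1)\<^sup>2)"
proof (rule computes_bound[where K = 5000], rule computes_map[OF computes_naive_mult_uncurried assms(1,2) TrueI], goal_cases)
 case (1 x)
 have w: "length (a x) <= w x" "narrow (w x) (g x)" "length (g x) <= 600" using assms(3)[OF 1] by auto
 have "(\<Sum>c\<leftarrow>g x. length (a x) * (2 * length c + 2 * length (a x) + 3) + 1) <= length (g x) * (w x * (4 * w x + 3) + 1)"
 proof (rule sum_list_bound)
  fix c assume "c \<in> set (g x)"
  then have "length c <= w x" using w(2) by (simp add: narrow_def)
  then show "length (a x) * (2 * length c + 2 * length (a x) + 3) + 1 <= w x * (4 * w x + 3) + 1"
   using w(1) by (intro add_mono mult_le_mono) auto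
 qed
 also have "... <= 600 * (7 * (w x + 1)\<^sup>2)"
  using w(3) by (intro mult_le_mono) (auto simp: power2_eq_square algebra_simps)
 finally show ?case by simp
qed

lemma length_naive_poly_mult_le: "length (naive_poly_mult f g) <= length f + length g"
 by (induction f) auto

lemma poly_size_naive_poly_mult:
 assumes "narrow w f" "narrow w g" "length f <= 600" "length g <= 600"
 shows "poly_size (naive_poly_mult f g) <= 721200 * (w + 1)"
proof -
 have "narrow (3 * w + 600) (naive_poly_mult f g)"
  using narrow_naive_poly_mult[OF assms(1,2)] assms(3) by (auto intro: narrow_mono)
 then have "poly_size (naive_poly_mult f g) <= length (naive_poly_mult f g) * (3 * w + 600 + 1)" by (rule poly_size_narrow)
 also have "... <= 1200 * (601 * (w + 1))"
  using length_naive_poly_mult_le[of f g] assms(3,4) by (intro mult_le_mono) auto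
 finally show ?thesis by simp
qed

lemma computes_naive_poly_mult_uncurried:
 "computes (%x. narrow (arg1 x) (arg2 x) \<and> narrow (arg1 x) (rst3 x) \<and> length (arg2 x) <= 600 \<and> length (rst3 x) <= 600)
  (%x. naive_poly_mult (arg2 x) (rst3 x)) (%x. length (arg2 x) * ((arg1 x + 1)\<^sup>2 + 1))" (is "computes ?D ?F ?S")
proof -
 let ?s = "%x. (arg1 x, tl (arg2 x), rst3 x)"
 let ?Dy = "%y. ?D (fst y) \<and> arg2 (fst y) \<noteq> [] \<and> snd y = ?F (?s (fst y))"
 have "computes ?Dy (%y. map (naive_mult (hd (arg2 (fst y)))) (rst3 (fst y))) (%y. 0 + 0 + (arg1 (fst y) + 1)\<^sup>2)"
  by (rule computes_map_naive_mult) (rule computes_intros | force simp: narrow_def)+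
 then have row: "computes ?Dy (%y. map (naive_mult (hd (arg2 (fst y)))) (rst3 (fst y))) (%y. (arg1 (fst y) + 1)\<^sup>2)" by simp
 have post: "computes ?Dy (%y. poly_add (map (naive_mult (hd (arg2 (fst y)))) (rst3 (fst y))) ([] # snd y))
   (%y. (arg1 (fst y) + 1)\<^sup>2)"
 proof (rule computes_bound[where K = 1000000], (rule row computes_poly_add computes_intros)+, goal_cases)
  case (1 y)
  obtain w f g r where y: "y = ((w, f, g), r)" by (metis prod.collapse)
  have n: "narrow w (tl f)" "length (hd f) <= w" "narrow w g" "length (tl f) <= 600" "length g <= 600"
   using 1 by (auto simp: y narrow_def dest: list.set_sel(2))
  have "poly_size (map (naive_mult (hd f)) g) <= length (map (naive_mult (hd f)) g) * (3 * w + 1)"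
   by (intro poly_size_narrow narrow_map_naive_mult n)
  also have "... <= 600 * (3 * (w + 1))" using n by (intro mult_le_mono) auto
  finally have "poly_size (map (naive_mult (hd f)) g) <= 1800 * (w + 1)" by simp
  moreover have "poly_size r <= 721200 * (w + 1)" using poly_size_naive_poly_mult[OF n(1,3,4,5)] 1 by (simp add: y)
  moreover have "w + 1 <= (w + 1)\<^sup>2" by (simp add: power2_eq_square)
  ultimately show ?case unfolding y by simp
 qed
 show ?thesis
 proof (rule computes_recursion[where p = "%x. arg2 x = []" and base = "%x. []" and s = ?s and K = 1
   and W = "%x. if arg2 x = [] then 0 else (arg1 x + 1)\<^sup>2", OF _ _ _ post], (rule computes_intros)+, goal_cases)
  case (5 x)
  then show ?case by (cases "arg2 x") auto
 next
  case (6 x)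
  then show ?case by (auto simp: narrow_def dest: list.set_sel(2))
 next
  case (8 x)
  then show ?case by (cases "arg2 x") auto
 qed simp_all
qed

definition block_cost :: "nat => nat => nat" where
 "block_cost V k = 2 ^ k * ((V + k + 1) * (k + 1))"

lemma block_cost_bounds:
 "2 ^ k * (V + k + 1) <= block_cost V k" "2 ^ k * (k + 1) <= block_cost V k" "2 ^ k <= block_cost V k"
 "V <= block_cost V k" "k <= block_cost V k" "block_cost (Suc V) k <= 2 * block_cost V k"
proof -
 have "2 ^ k * ((V + k + 1) * 1) <= block_cost V k" "2 ^ k * (1 * (k + 1)) <= block_cost V k"
  unfolding block_cost_def by (intro mult_le_mono; simp)+
 then show linear: "2 ^ k * (V + k + 1) <= block_cost V k" "2 ^ k * (k + 1) <= block_cost V k" by simp_all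
 have "1 * (V + k + 1) <= 2 ^ k * (V + k + 1)" "2 ^ k * 1 <= 2 ^ k * (V + k + 1)" by (intro mult_le_mono; simp)+
 from order_trans[OF this(1) linear(1)] order_trans[OF this(2) linear(1)]
 show "2 ^ k <= block_cost V k" "V <= block_cost V k" "k <= block_cost V k" by simp_all
 have "block_cost (Suc V) k <= 2 ^ k * ((2 * (V + k + 1)) * (k + 1))"
  unfolding block_cost_def by (intro mult_le_mono) auto
 then show "block_cost (Suc V) k <= 2 * block_cost V k" by (simp add: block_cost_def algebra_simps)
qed

lemma block_sum_le:
 assumes "\<And>u. u \<in> set H ==> T u <= c * (block_length k * (V + k + 1))" "length H <= 2 * block_count k"
 shows "(\<Sum>u\<leftarrow>H. T u) <= 2 * c * block_cost V k"
proof -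
 have "(\<Sum>u\<leftarrow>H. T u) <= length H * (c * (block_length k * (V + k + 1)))" by (rule sum_list_bound) (rule assms)
 also have "... <= 2 * block_count k * (c * (block_length k * (V + k + 1)))" using assms(2) by (rule mult_le_mono1)
 also have "... = 2 * c * (2 ^ k * (V + k + 1))" by (simp add: block_count_length[symmetric] mult_ac)
 also have "... <= 2 * c * block_cost V k" by (intro mult_le_mono2 block_cost_bounds)
 finally show ?thesis .
qed

lemma fft_cost_block: "fft_cost V (2 * block_length k) (Suc (k div 2)) <= 32 * block_cost V k"
proof -
 have "2 * block_length k * (V + Suc (k div 2) + 1) + 2 <= 4 * (block_length k * (V + Suc (k div 2) + 1))"
  using block_pos[of k] mult_le_mono[of 1 "block_length k" 1 "V + Suc (k div 2) + 1"] by simp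
 also have "... <= 4 * (block_length k * (2 * (V + k + 1)))" by (intro mult_le_mono) auto
 finally have "fft_cost V (2 * block_length k) (Suc (k div 2))
   <= 2 * block_count k * ((4 * (block_length k * (2 * (V + k + 1)))) * (2 * (k + 1)))"
  unfolding fft_cost_def block_count_def power_Suc by (intro mult_le_mono) auto
 also have "... = 32 * block_cost V k" by (simp add: block_cost_def block_count_length[symmetric] algebra_simps)
 finally show ?thesis .
qed

lemma power_cost_le: "e <= k ==> e * (2 ^ e + 2 + 3) <= 6 * (2 ^ k * (k + 1))" for e k :: nat
proof -
 assume "e <= k"
 then have "(2::nat) ^ e <= 2 ^ k" by (intro power_increasing) auto
 moreover have "(1::nat) <= 2 ^ k" by simp
 ultimately have "2 ^ e + 2 + 3 <= 6 * (2::nat) ^ k" by linarith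
 then have "e * (2 ^ e + 2 + 3) <= (k + 1) * (6 * 2 ^ k)" using \<open>e <= k\<close> by (intro mult_le_mono) auto
 then show ?thesis by (simp add: algebra_simps)
qed

lemma computes_block_count: "computes D k T ==> computes D (%x. block_count (k x)) (%x. T x + 2 ^ k x * (k x + 1))"
 and computes_block_length: "computes D k T ==> computes D (%x. block_length (k x)) (%x. T x + 2 ^ k x * (k x + 1))"
proof -
 assume k: "computes D k T"
 have k_le: "k x <= 2 ^ k x * (k x + 1)" for x using mult_le_mono[of 1 "2 ^ k x" "k x" "k x + 1"] by simp
 show "computes D (%x. block_count (k x)) (%x. T x + 2 ^ k x * (k x + 1))" unfolding block_count_def
 proof (rule computes_bound[where K = 10], (rule k computes_intros)+, goal_cases)
  case (1 x)
  obtain e where e: "k x div 2 = e" "e <= k x" using div_le_dividend by blast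
  show ?case using k_le[of x] power_cost_le[OF e(2)] unfolding e(1) by (simp add: algebra_simps)
 qed
 show "computes D (%x. block_length (k x)) (%x. T x + 2 ^ k x * (k x + 1))" unfolding block_length_def
 proof (rule computes_bound[where K = 20], (rule k computes_intros)+, goal_cases)
  case (1 x)
  obtain e where e: "k x div 2 = e" "e <= k x" using div_le_dividend by blast
  obtain d where d: "k x - e = d" "d <= k x" using diff_le_self by blast
  show ?case using k_le[of x] power_cost_le[OF d(2)] e(2) unfolding e(1) d(1) by (simp add: algebra_simps)
 qed
qed

lemmas computes_block_intros = computes_block_count computes_block_length computes_intros

lemma computes_transform_uncurried:
 "computes (%x. length (rst3 x) = 2 ^ arg2 x \<and> narrow (arg1 x) (rst3 x)) (%x. transform (arg2 x) (rst3 x))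
  (%x. block_cost (arg1 x) (arg2 x))" (is "computes ?D _ ?T")
proof -
 let ?padded = "%x. padded_chunks (block_count (arg2 x)) (block_length (arg2 x)) (rst3 x)"
 let ?in = "%x. (arg1 x, 2 * block_length (arg2 x), Suc (arg2 x div 2), 4 * block_length (arg2 x), ?padded x)"
 have block_le: "block_count k <= 2 ^ k" "block_length k <= 2 ^ k" for k
  by (auto simp: block_count_def block_length_def intro: power_increasing)
 have "computes ?D ?in ?T"
 proof (rule computes_bound[where K = 30], (rule computes_comp3[OF computes_padded_chunks_uncurried] computes_block_intros
    | simp add: block_count_length)+, goal_cases)
  case (1 x)
  have "(block_count (arg2 x) + 1) * (block_length (arg2 x) + 1) <= (2 * block_count (arg2 x)) * (2 * block_length (arg2 x))"
   using block_pos[of "arg2 x"] by (intro mult_le_mono) auto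
  also have "... = 4 * 2 ^ arg2 x" by (simp add: block_count_length[symmetric])
  finally show ?case using block_le[of "arg2 x"] block_cost_bounds[where V = "arg1 x" and k = "arg2 x"] by (simp add: algebra_simps)
 qed
 from computes_comp[OF computes_fft this]
 have "computes ?D (%x. fft (arg2 (?in x)) (arg3 (?in x)) (arg4 (?in x)) (rst5 (?in x))) ?T"
 proof (rule computes_bound[where K = 40])
  show "fft_input (?in x)" if "?D x" for x
   using that family_padded_chunks[of "rst3 x" "block_count (arg2 x)" "block_length (arg2 x)" "arg1 x"]
    block_count_length[of "arg2 x"] block_pos[of "arg2 x"]
   by (simp add: fft_input_def block_count_def)
  show "?T x + fft_cost (arg1 (?in x)) (arg2 (?in x)) (arg3 (?in x)) <= 40 * (?T x + 1)" for x
   using fft_cost_block[of "arg1 x" "arg2 x"] by simp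
 qed
 then show ?thesis by (simp add: transform_def del: fft.simps)
qed

lemma computes_cyclic_reduce_uncurried:
 "computes (%_. True) (%q. cyclic_reduce (fst q) (snd q)) (%q. fst q + poly_size (snd q))"
 unfolding cyclic_reduce_def
proof (rule computes_bound[where K = 5], (rule computes_intros)+, goal_cases)
 case (1 x)
 show ?case using poly_size_take[of "fst x" "snd x"] poly_size_drop[of "fst x" "snd x"] by simp
qed

abbreviation combine_input :: "nat \<times> nat \<times> bool list list list => bool" where
 "combine_input x \<equiv> length (rst3 x) = 2 * block_count (arg2 x) \<and>
  (\<forall>p\<in>set (rst3 x). length p = 8 * block_length (arg2 x) \<and> narrow (arg1 x) p)"

lemma computes_reassemble:
 "computes combine_input (%x. reassemble (arg2 x) (rst3 x)) (%x. block_cost (arg1 x) (arg2 x))" (is "computes _ _ ?T")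
proof -
 let ?reduced = "%x. map (cyclic_reduce (4 * block_length (arg2 x))) (rst3 x)"
 let ?in = "%x. (Suc (arg1 x), 2 * block_length (arg2 x), Suc (arg2 x div 2), 4 * block_length (arg2 x), ?reduced x)"
 have "computes combine_input ?in ?T"
 proof (rule computes_bound[where K = 200], (rule computes_map[OF computes_cyclic_reduce_uncurried] computes_block_intros
  TrueI)+, goal_cases)
  case (1 x)
  obtain V k ps where x: "x = (V, k, ps)" by (metis prod.collapse)
  have "(\<Sum>p\<leftarrow>ps. 4 * block_length k + poly_size p + 1) <= 2 * 13 * block_cost V k"
  proof (rule block_sum_le)
   fix p assume "p \<in> set ps"
   then have "length p = 8 * block_length k" "narrow V p" using 1 by (auto simp: x)
   then have "4 * block_length k + poly_size p + 1 <= block_length k * (4 + 8 * (V + 1) + 1)"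
    using poly_size_narrow[of V p] block_pos[of k] by (simp add: algebra_simps)
   also have "... <= block_length k * (13 * (V + k + 1))" by (intro mult_le_mono2) simp
   finally show "4 * block_length k + poly_size p + 1 <= 13 * (block_length k * (V + k + 1))" by (simp only: mult_ac)
  qed (use 1 in \<open>simp add: x\<close>)
  moreover have "block_length k <= 2 ^ k" by (auto simp: block_length_def intro: power_increasing)
  ultimately show ?case using block_cost_bounds[where V = V and k = k] by (simp add: x algebra_simps)
 qed
 from computes_comp[OF computes_ifft this]
 have "computes combine_input (%x. ifft (arg2 (?in x)) (arg3 (?in x)) (arg4 (?in x)) (rst5 (?in x))) ?T"
 proof (rule computes_bound[where K = 70])
  show "fft_input (?in x)" if "combine_input x" for x
   using that length_narrow_cyclic_reduce[of _ "4 * block_length (arg2 x)" "arg1 x"] block_pos[of "arg2 x"]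
   by (auto simp: fft_input_def family_def block_count_def)
  show "?T x + fft_cost (arg1 (?in x)) (arg2 (?in x)) (arg3 (?in x)) <= 70 * (?T x + 1)" for x
   using fft_cost_block[of "Suc (arg1 x)" "arg2 x"] block_cost_bounds(6)[of "arg1 x" "arg2 x"] by simp
 qed
 then show ?thesis by (simp add: reassemble_def del: ifft.simps)
qed

lemma computes_map_negacyclic_div:
 "computes combine_input (%x. map (negacyclic_div (Suc (arg2 x div 2)) (2 * block_length (arg2 x)))
   (reassemble (arg2 x) (rst3 x)))
  (%x. block_cost (arg1 x) (arg2 x))" (is "computes _ _ ?T")
proof -
 have "computes combine_input (%x. map ((%c. negacyclic_div (fst c) (snd c)) (Suc (arg2 x div 2), 2 * block_length (arg2 x)))
   (reassemble (arg2 x) (rst3 x))) ?T"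
 proof (rule computes_bound[where K = 200], rule computes_map[where h = "%c. negacyclic_div (fst c) (snd c)",
  OF computes_negacyclic_div_uncurried],
   (rule computes_reassemble computes_block_intros TrueI)+, goal_cases)
  case (1 x)
  obtain V k ps where x: "x = (V, k, ps)" by (metis prod.collapse)
  have H: "family (2 * block_count k) (4 * block_length k) (Suc V + Suc (k div 2)) (reassemble k ps)"
   using family_reassemble[of ps k V] 1 by (simp add: x)
  have "(\<Sum>u\<leftarrow>reassemble k ps. 2 * block_length k + poly_size u + length u * Suc (k div 2) + 1) <= 2 * 30 * block_cost V k"
  proof (rule block_sum_le)
   fix u assume "u \<in> set (reassemble k ps)"
   then have u: "length u = 4 * block_length k" "narrow (Suc V + Suc (k div 2)) u" using H by (auto simp: family_def)
   then have "2 * block_length k + poly_size u + length u * Suc (k div 2) + 1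
     <= block_length k * (2 + 4 * (Suc V + Suc (k div 2) + 1) + 4 * Suc (k div 2) + 1)"
    using poly_size_narrow[OF u(2)] block_pos[of k] by (simp add: algebra_simps)
   also have "... <= block_length k * (30 * (V + k + 1))" by (intro mult_le_mono2) simp
   finally show "2 * block_length k + poly_size u + length u * Suc (k div 2) + 1 <= 30 * (block_length k * (V + k + 1))"
    by (simp only: mult_ac)
  qed (use H in \<open>simp add: family_def\<close>)
  moreover have "block_length k <= 2 ^ k" by (auto simp: block_length_def intro: power_increasing)
  ultimately show ?case using block_cost_bounds[where V = V and k = k] by (simp add: x algebra_simps)
 qed
 then show ?thesis by simp
qed

lemma computes_combine_uncurried:
 "computes combine_input (%x. combine (arg2 x) (rst3 x)) (%x. block_cost (arg1 x) (arg2 x))"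
 unfolding combine_def
proof (rule computes_bound[where K = 300], rule computes_comp3[OF computes_overlap_add_uncurried],
  (rule computes_map_negacyclic_div computes_block_intros TrueI)+, goal_cases)
 case (1 x)
 obtain V k ps where x: "x = (V, k, ps)" by (metis prod.collapse)
 let ?T = "take (2 * block_count k - 1) (map (negacyclic_div (Suc (k div 2)) (2 * block_length k)) (reassemble k ps))"
 have H: "family (2 * block_count k) (4 * block_length k) (Suc V + Suc (k div 2)) (reassemble k ps)"
  using family_reassemble[of ps k V] 1 by (simp add: x)
 have "(\<Sum>u\<leftarrow>?T. 4 * poly_size u + block_length k + 1) <= 2 * 30 * block_cost V k"
 proof (rule block_sum_le)
  fix u assume "u \<in> set ?T"
  then obtain v where v: "v \<in> set (reassemble k ps)" "u = negacyclic_div (Suc (k div 2)) (2 * block_length k) v"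
   by (auto dest!: in_set_takeD)
  then have u: "length u = 2 * block_length k" "narrow (Suc V) u"
   using H length_narrow_negacyclic_div[of v "2 * block_length k" "Suc V" "Suc (k div 2)"] by (auto simp: family_def)
  then have "4 * poly_size u + block_length k + 1 <= block_length k * (8 * (Suc V + 1) + 1 + 1)"
   using poly_size_narrow[OF u(2)] block_pos[of k] by (simp add: algebra_simps)
  also have "... <= block_length k * (30 * (V + k + 1))" by (intro mult_le_mono2) simp
  finally show "4 * poly_size u + block_length k + 1 <= 30 * (block_length k * (V + k + 1))" by (simp only: mult_ac)
 qed simp
 moreover have "block_length k <= 2 ^ k" "block_count k <= 2 ^ k"
  by (auto simp: block_length_def block_count_def intro: power_increasing)
 ultimately show ?case using block_cost_bounds[where V = V and k = k] by (simp add: x algebra_simps)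
qed

definition task_work :: "task => nat" where
 "task_work z = 2 ^ arg1 z * ((arg1 z + 1) * (arg2 z + arg1 z + 1)\<^sup>2)"

definition task_cost :: "task => nat" where
 "task_cost z = 2 ^ arg1 z * ((arg1 z + 1) ^ 13 * (arg2 z + 20 * arg1 z + 1)\<^sup>2)"

lemma task_work_bounds:
 "block_cost (arg2 z) (arg1 z) <= task_work z" "2 ^ arg1 z * (arg2 z + 1)\<^sup>2 <= task_work z"
proof -
 have square: "arg2 z + arg1 z + 1 <= (arg2 z + arg1 z + 1)\<^sup>2" by (simp add: power2_eq_square)
 have "2 ^ arg1 z * ((arg1 z + 1) * (arg2 z + arg1 z + 1)) <= task_work z"
  unfolding task_work_def using square by (intro mult_le_mono) auto
 then show "block_cost (arg2 z) (arg1 z) <= task_work z" by (simp add: block_cost_def mult_ac)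
 have "2 ^ arg1 z * (1 * (arg2 z + 1)\<^sup>2) <= task_work z" unfolding task_work_def by (intro mult_le_mono power_mono) auto
 then show "2 ^ arg1 z * (arg2 z + 1)\<^sup>2 <= task_work z" by simp
qed

lemma computes_split_task: "computes valid_task split_task task_work"
proof -
 have transform: "computes valid_task (%z. transform (arg1 z) (h z)) (%z. block_cost (arg2 z) (arg1 z))"
  if h: "computes valid_task h (%_. 0)" "\<And>z. valid_task z ==> length (h z) = 2 ^ arg1 z \<and> narrow (arg2 z) (h z)" for h
 proof -
  have "computes valid_task (%z. (arg2 z, arg1 z, h z)) (%_. 0)"
   by (rule computes_bound[where K = 1], (rule h(1) computes_intros)+, simp)
  from computes_comp[OF computes_transform_uncurried this] h(2) show ?thesis by simp
 qed
 have transforms: "computes valid_task (%z. transform (arg1 z) (arg3 z)) (%z. block_cost (arg2 z) (arg1 z))"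
  "computes valid_task (%z. transform (arg1 z) (rst4 z)) (%z. block_cost (arg2 z) (arg1 z))"
  by (rule transform; (rule computes_intros | force simp: valid_task_def)+)+
 have "computes (%_. True) (%q::(nat \<times> nat) \<times> bool list list \<times> bool list list. (fst (fst q), snd (fst q), snd q)) (%_. 0)"
  by (rule computes_bound[where K = 1], (rule computes_intros)+, force)
 note map = computes_map[of _ "%c p. (fst c, snd c, p)", OF this]
 have "computes valid_task (%z. map ((%c p. (fst c, snd c, p)) (arg1 z - arg1 z div 2 + 2, arg2 z + Suc (arg1 z div 2)))
   (zip (transform (arg1 z) (arg3 z)) (transform (arg1 z) (rst4 z)))) task_work"
 proof (rule computes_bound[where K = 20], rule map, (rule transforms computes_intros TrueI)+, goal_cases)
  case (1 z)
  obtain k w f g where z: "z = (k, w, f, g)" by (metis prod.collapse)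
  have "length f = 2 ^ k" "narrow w f" "length g = 2 ^ k" "narrow w g" using 1 by (auto simp: z valid_task_def)
  from family_transform[OF this(1,2)] family_transform[OF this(3,4)]
  have "length (transform k f) = 2 * block_count k" "length (transform k g) = 2 * block_count k" by (simp_all add: family_def)
  moreover have "block_count k <= 2 ^ k" by (auto simp: block_count_def intro: power_increasing)
  ultimately show ?case
   using block_cost_bounds[where V = w and k = k] task_work_bounds(1)[of z] by (simp add: z sum_list_triv)
 qed
 then show ?thesis by (simp add: split_task_def[abs_def])
qed

lemma computes_combine_tasks:
 "computes (%q. valid_task (fst q) \<and> snd q = map poly_mult (split_task (fst q)))
  (%q. combine (arg1 (fst q)) (snd q)) (%q. task_work (fst q))" (is "computes ?D _ _")
proof -
 let ?V = "%z. 3 * (arg2 z + Suc (arg1 z div 2)) + 600 + 10 * (arg1 z - arg1 z div 2 + 2)"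
 have "computes ?D (%q. (?V (fst q), arg1 (fst q), snd q)) (%q. task_work (fst q))"
 proof (rule computes_bound[where K = 1000], (rule computes_intros)+, goal_cases)
  case (1 q)
  obtain e where e: "arg1 (fst q) div 2 = e" "e <= arg1 (fst q)" using div_le_dividend by blast
  show ?case
   using e(2) block_cost_bounds(4,5)[where V = "arg2 (fst q)" and k = "arg1 (fst q)"] task_work_bounds(1)[of "fst q"]
   unfolding e(1) by simp
 qed
 from computes_comp[OF computes_combine_uncurried this]
 have "computes ?D (%q. combine (arg2 (?V (fst q), arg1 (fst q), snd q)) (rst3 (?V (fst q), arg1 (fst q), snd q)))
   (%q. task_work (fst q))"
 proof (rule computes_bound[where K = 1001])
  fix q assume q: "?D q"
  obtain k w f g ps where q': "q = ((k, w, f, g), ps)" by (metis prod.collapse)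
  then have z: "valid_task (k, w, f, g)" and ps: "ps = map poly_mult (split_task (k, w, f, g))" using q by auto
  have "length p = 8 * block_length k \<and> narrow (?V (k, w, f, g)) p" if "p \<in> set ps" for p
   using poly_mult_split_task[OF z that[unfolded ps]] narrow_poly_mult by fastforce
  then show "combine_input (?V (fst q), arg1 (fst q), snd q)"
   using split_task_valid(1)[OF z] by (simp add: q' ps)
  have "block_cost (?V (k, w, f, g)) k <= 2 ^ k * ((1000 * (w + k + 1)) * (k + 1))"
   unfolding block_cost_def by (intro mult_le_mono) auto
  also have "... = 1000 * block_cost w k" by (simp only: block_cost_def mult_ac)
  also have "... <= 1000 * task_work (k, w, f, g)" using task_work_bounds(1)[of "(k, w, f, g)"] by simp
  finally show "task_work (fst q) + block_cost (arg1 (?V (fst q), arg1 (fst q), snd q)) (arg2 (?V (fst q), arg1 (fst q), snd q))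
    <= 1001 * (task_work (fst q) + 1)" by (simp add: q')
 qed
 then show ?thesis by simp
qed

lemma computes_base_task: "computes (%z. valid_task z \<and> arg1 z < 10) (%z. naive_poly_mult (arg3 z) (rst4 z) @ [[]]) task_work"
proof -
 let ?D = "%z. valid_task z \<and> arg1 z < 10"
 have short: "length (arg3 z) <= 600" "length (rst4 z) <= 600" if "?D z" for z
 proof -
  have "(2::nat) ^ arg1 z <= 2 ^ 9" using that by (intro power_increasing) auto
  then show "length (arg3 z) <= 600" "length (rst4 z) <= 600" using that by (auto simp: valid_task_def split: prod.splits)
 qed
 have "computes ?D (%z. naive_poly_mult (arg2 (snd z)) (rst3 (snd z)))
   (%z. 0 + length (arg2 (snd z)) * ((arg1 (snd z) + 1)\<^sup>2 + 1))"
  by (rule computes_comp[OF computes_naive_poly_mult_uncurried], (rule computes_intros)+)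
   (use short in \<open>auto simp: valid_task_def split: prod.splits\<close>)
 then have product: "computes ?D (%z. naive_poly_mult (arg3 z) (rst4 z)) task_work"
 proof (rule computes_bound[where K = 2])
  fix z assume "?D z"
  then have "length (arg3 z) * ((arg2 z + 1)\<^sup>2 + 1) <= 2 ^ arg1 z * (2 * (arg2 z + 1)\<^sup>2)"
   by (intro mult_le_mono) (auto simp: valid_task_def split: prod.splits)
  then show "0 + length (arg2 (snd z)) * ((arg1 (snd z) + 1)\<^sup>2 + 1) <= 2 * (task_work z + 1)"
   using task_work_bounds(2)[of z] by simp
 qed
 show ?thesis
 proof (rule computes_bound[where K = 5], (rule product computes_append computes_const)+, goal_cases)
  case (1 z)
  have "length (naive_poly_mult (arg3 z) (rst4 z)) <= 2 * 2 ^ arg1 z"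
   using length_naive_poly_mult_le[of "arg3 z" "rst4 z"] 1 by (auto simp: valid_task_def split: prod.splits)
  then show ?case using block_cost_bounds(3)[of "arg1 z" "arg2 z"] task_work_bounds(1)[of z] by simp
 qed
qed

text \<open>The exponent 13 makes the cost of the subtasks, whose total length is eight times 2^k, at most
 half of the cost of the task: (5/4)^13 > 16, and 5 (k' + 1) <= 4 (k + 1) for the exponent k' of a subtask.\<close>
lemma task_cost_recurrence:
 assumes k: "10 <= k" and k': "k' = k - k div 2 + 2"
 shows "2 ^ k * ((k + 1) * (w + k + 1)\<^sup>2)
   + 2 * 2 ^ (k div 2) * (2 ^ k' * ((k' + 1) ^ 13 * (w + Suc (k div 2) + 20 * k' + 1)\<^sup>2) + 3) + 5
  <= 2 ^ k * ((k + 1) ^ 13 * (w + 20 * k + 1)\<^sup>2)"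
proof -
 define a where "a = k div 2"
 define X where "X = (k' + 1) ^ 13"
 define Y where "Y = (k + 1) ^ 13"
 define Q where "Q = (w + 20 * k + 1)\<^sup>2"
 define E where "E = 2 ^ k * Q"
 have a: "5 <= a" "k = 2 * a \<or> k = 2 * a + 1" and k'_eq: "k' = k - a + 2" using k k' by (auto simp: a_def)
 have "5 * (k' + 1) <= 4 * (k + 1)" using a k'_eq by auto
 then have "(5 * (k' + 1)) ^ 13 <= (4 * (k + 1)) ^ 13" by (rule power_mono) simp
 then have "5 ^ 13 * X <= 4 ^ 13 * Y" by (simp only: power_mult_distrib X_def Y_def)
 then have "16 * X <= Y" by simp
 then have quarter: "16 * (E * X) <= E * Y" using mult_le_mono2[of "16 * X" Y E] by simp
 have "(w + Suc a + 20 * k' + 1)\<^sup>2 <= Q" unfolding Q_def using a k'_eq by (intro power_mono) auto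
 then have "2 * 2 ^ a * (2 ^ k' * (X * (w + Suc a + 20 * k' + 1)\<^sup>2)) <= 2 * 2 ^ a * (2 ^ k' * (X * Q))"
  by (intro mult_le_mono) auto
 also have "... = 2 * (2 ^ a * 2 ^ k') * (X * Q)" by (simp add: algebra_simps)
 also have "2 ^ a * 2 ^ k' = 4 * (2::nat) ^ k" using a k'_eq by (auto simp flip: power_add)
 finally have subtasks: "2 * 2 ^ a * (2 ^ k' * (X * (w + Suc a + 20 * k' + 1)\<^sup>2)) <= 8 * (E * X)"
  by (simp add: E_def algebra_simps)
 have Q: "1 <= Q" "(w + k + 1)\<^sup>2 <= Q" unfolding Q_def by (simp, intro power_mono, auto)
 then have "2 ^ k * ((k + 1) * (w + k + 1)\<^sup>2) <= 2 ^ k * ((k + 1) * Q)" by (intro mult_le_mono) auto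
 then have work: "2 ^ k * ((k + 1) * (w + k + 1)\<^sup>2) <= E * (k + 1)" by (simp only: E_def mult_ac)
 have "2 ^ a * 1 <= E" unfolding E_def using Q a by (intro mult_le_mono power_increasing) auto
 then have overhead: "2 ^ a <= E" "1 <= E" using one_le_power[of "2::nat" a] by linarith+
 have "2 * k + 24 <= (k + 1)\<^sup>2" using mult_le_mono[OF k k] by (simp add: power2_eq_square)
 also have "... <= Y" unfolding Y_def by (intro power_increasing) auto
 finally have "E * (2 * k + 24) <= E * Y" by (rule mult_le_mono2)
 then have EY: "2 * (E * k) + 24 * E <= E * Y" by (simp add: algebra_simps)
 have "2 ^ k * (Y * Q) = E * Y" by (simp add: E_def algebra_simps)
 then show ?thesis
  using subtasks work overhead EY quarter unfolding a_def[symmetric] X_def[symmetric] Y_def[symmetric] Q_def[symmetric] distrib_left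
  by linarith
qed

lemma task_cost_split:
 assumes "\<not> arg1 z < 10" "valid_task z"
 shows "task_work z + (\<Sum>y\<leftarrow>split_task z. task_cost y + 3) + 5 <= task_cost z"
proof -
 obtain k w f g where z: "z = (k, w, f, g)" by (metis prod.collapse)
 define k' where "k' = k - k div 2 + 2"
 let ?c = "2 ^ k' * ((k' + 1) ^ 13 * (w + Suc (k div 2) + 20 * k' + 1)\<^sup>2) + 3"
 note split = split_task_valid[of k w f g, folded z, OF assms(2)]
 have "map (%y. task_cost y + 3) (split_task z) = map (%_. ?c) (split_task z)"
  using split(2) by (fastforce simp: task_cost_def k'_def)
 then have "(\<Sum>y\<leftarrow>split_task z. task_cost y + 3) = 2 * 2 ^ (k div 2) * ?c"
  using split(1) by (simp only: sum_list_triv of_nat_id block_count_def)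
 then show ?thesis
  using task_cost_recurrence[of k k' w] assms(1) unfolding task_work_def task_cost_def k'_def[symmetric] z by simp
qed

lemma task_cost_children:
 assumes "valid_task z"
 shows "task_work z + (\<Sum>y\<leftarrow>(if arg1 z < 10 then [] else split_task z). task_cost y + 3) <= task_cost z"
proof (cases "arg1 z < 10")
 case True
 have "task_work z <= task_cost z"
  unfolding task_work_def task_cost_def by (intro mult_le_mono power_mono self_le_power) auto
 then show ?thesis using True by simp
next
 case False
 then show ?thesis using task_cost_split[OF False assms] by simp
qed

lemma computes_poly_mults:
 "computes (%zs. \<forall>z\<in>set zs. valid_task z) (map poly_mult) (%zs. \<Sum>z\<leftarrow>zs. task_cost z + 3)" (is "computes ?D ?F ?S")
proof -
 let ?s = "%zs. if arg1 (hd zs) < 10 then [] else split_task (hd zs)"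
 let ?post = "%y. (if arg1 (hd (fst (fst y))) < 10 then naive_poly_mult (arg3 (hd (fst (fst y)))) (rst4 (hd (fst (fst y)))) @ [[]]
  else combine (arg1 (hd (fst (fst y)))) (snd (fst y))) # snd y"
 let ?W = "%zs. if zs = [] then 0 else task_work (hd zs)"
 let ?Dy = "%y. ?D (fst (fst y)) \<and> fst (fst y) \<noteq> [] \<and> snd (fst y) = ?F (?s (fst (fst y))) \<and> snd y = ?F (tl (fst (fst y)))"
 have first: "computes (%zs. ?D zs \<and> zs \<noteq> []) ?s ?W"
  by (rule computes_bound[where K = 30], (rule computes_comp[OF computes_split_task] computes_intros | force)+)
 have hd: "computes E (%y. hd (fst (fst y))) (%_. 0)" if "\<And>y. E y ==> ?Dy y" for E
  by (rule computes_bound[where K = 20], (rule computes_intros | (use that in force))+)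
 have test: "computes ?Dy (%y. arg1 (hd (fst (fst y))) < 10) (%_. 0)"
  by (rule computes_bound[where K = 20], (rule computes_intros | force)+)
 have base: "computes (%y. ?Dy y \<and> arg1 (hd (fst (fst y))) < 10)
   (%y. naive_poly_mult (arg3 (hd (fst (fst y)))) (rst4 (hd (fst (fst y)))) @ [[]]) (%y. 0 + task_work (hd (fst (fst y))))"
  by (rule computes_comp[OF computes_base_task hd]) auto
 have combine: "computes (%y. ?Dy y \<and> \<not> arg1 (hd (fst (fst y))) < 10) (%y. combine (arg1 (hd (fst (fst y)))) (snd (fst y)))
   (%y. 0 + 0 + task_work (hd (fst (fst y))))"
  by (rule computes_comp2[where h = "%z. combine (arg1 z)" and T = "%z _. task_work z", OF computes_combine_tasks hd])
   (auto intro!: computes_snd computes_fst computes_id)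
 have post: "computes ?Dy ?post (%y. ?W (fst (fst y)))"
  by (rule computes_bound[OF computes_Cons[OF computes_if[OF test base combine] computes_snd[OF computes_id]], where K = 1]) auto
 show ?thesis
 proof (rule computes_binary_recursion[where p = "%zs. zs = []" and base = "%zs. []" and W = ?W and t = tl, OF _ _ first _ post])
  fix zs :: "task list" assume D: "?D zs"
  show "?F zs = (if zs = [] then [] else ?post ((zs, ?F (?s zs)), ?F (tl zs)))"
   by (cases zs) (auto simp: poly_mult.simps)
  assume "zs \<noteq> []"
  then obtain z zs' where zs: "zs = z # zs'" "valid_task z" using D by (cases zs) auto
  obtain k w f g where z: "z = (k, w, f, g)" by (metis prod.collapse)
  have "valid_task y" if "y \<in> set (split_task z)" for y
   using split_task_valid(2)[of k w f g y] zs(2) that unfolding z by blast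
  then show "?D (?s zs) \<and> ?D (tl zs)" using D by (simp add: zs(1))
  show "?W zs + ?S (?s zs) + ?S (tl zs) + 2 <= ?S zs" using task_cost_children[OF zs(2)] by (auto simp: zs(1) split: if_splits)
 qed ((rule computes_bound[where K = 1], (rule computes_intros)+, force) | simp)+
qed

primrec carry :: "bool list => bool list list => bool list" where
 "carry acc [] = acc"
| "carry acc (c # cs) = hd (add_bits False acc c) # carry (tl (add_bits False acc c)) cs"

lemma val_carry: "of_nat (val (carry acc cs)) = of_nat (val acc) + eval1 2 cs"
proof (induction cs arbitrary: acc)
 case (Cons c cs)
 obtain t ts where t: "add_bits False acc c = t # ts" using add_bits_nonempty by (metis neq_Nil_conv)
 have "of_bool t + 2 * val ts = val acc + val c" using val_add_bits[of False acc c] by (simp add: t)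
 then have "(of_nat (of_bool t + 2 * val ts) :: complex) = of_nat (val acc + val c)" by simp
 then show ?case by (simp add: t Cons algebra_simps)
qed simp

lemma length_carry: "length cs <= length (carry acc cs)"
 by (induction cs arbitrary: acc) auto

definition bit_poly :: "nat => bool list => bool list list" where
 "bit_poly n xs = map (%b. [b]) (xs @ replicate (n - length xs) False)"

lemma eval1_bit_poly: "eval1 2 (bit_poly n xs) = of_nat (val xs)"
proof -
 have "eval1 2 (map (%b. [b]) ys) = of_nat (val ys)" for ys by (induction ys) auto
 then show ?thesis by (simp add: bit_poly_def del: map_append)
qed

lemma valid_task_bit_poly:
 "length xs <= 2 ^ k ==> length ys <= 2 ^ k ==> valid_task (k, 1, bit_poly (2 ^ k) xs, bit_poly (2 ^ k) ys)"
 by (auto simp: valid_task_def bit_poly_def narrow_def)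

definition fast_mult :: "nat => bool list => bool list => bool list" where
 "fast_mult k xs ys = take (2 * 2 ^ k) (carry [] (poly_mult (k, 1, bit_poly (2 ^ k) xs, bit_poly (2 ^ k) ys)))"

lemma fast_mult:
 assumes "length xs <= 2 ^ k" "length ys <= 2 ^ k"
 shows "val (fast_mult k xs ys) = val xs * val ys" "length (fast_mult k xs ys) = 2 * 2 ^ k"
proof -
 let ?p = "poly_mult (k, 1, bit_poly (2 ^ k) xs, bit_poly (2 ^ k) ys)"
 have p: "eval1 2 ?p = of_nat (val xs) * of_nat (val ys)" "length ?p = 2 * 2 ^ k"
  using poly_mult_correct[of "bit_poly (2 ^ k) xs" k "bit_poly (2 ^ k) ys"] valid_task_bit_poly[OF assms]
  by (simp_all add: valid_task_def eval1_bit_poly)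
 have "(of_nat (val (carry [] ?p)) :: complex) = of_nat (val xs * val ys)" using val_carry[of "[]" ?p] p(1) by simp
 then have carry: "val (carry [] ?p) = val xs * val ys" by (simp only: of_nat_eq_iff)
 have "val xs < 2 ^ 2 ^ k" "val ys < 2 ^ 2 ^ k"
  using less_le_trans[OF val_less power_increasing] assms by simp_all
 then have "val xs * val ys < 2 ^ 2 ^ k * 2 ^ 2 ^ k" by (intro mult_strict_mono) auto
 then have "val xs * val ys < 2 ^ (2 * 2 ^ k)" by (simp add: power_add[symmetric] mult_2)
 then show "val (fast_mult k xs ys) = val xs * val ys" unfolding fast_mult_def val_take carry by simp
 show "length (fast_mult k xs ys) = 2 * 2 ^ k" using length_carry[of ?p "[]"] p(2) by (simp add: fast_mult_def)
qed

lemma computes_carry_uncurried: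
 "computes (%x. length (arg2 x) <= arg1 x \<and> narrow (arg1 x) (rst3 x)) (%x. carry (arg2 x) (rst3 x))
  (%x. length (rst3 x) * (2 * arg1 x + 1))"
proof (rule computes_recursion[where p = "%x. rst3 x = []" and base = "%x. arg2 x"
  and s = "%x. (arg1 x, tl (add_bits False (arg2 x) (hd (rst3 x))), tl (rst3 x))"
  and post = "%y. hd (add_bits False (arg2 (fst y)) (hd (rst3 (fst y)))) # snd y"
  and W = "%x. if rst3 x = [] then 0 else 2 * arg1 x" and K = 2], (rule computes_intros | force)+)
qed ((case_tac "rst3 x"; simp) | force)+

definition mult_cost :: "nat => nat" where "mult_cost k = 2 ^ k * (k + 1) ^ 15"

lemma mult_cost_mono: "i <= j ==> mult_cost i <= mult_cost j"
 unfolding mult_cost_def by (intro mult_le_mono power_mono power_increasing) auto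

lemma mult_cost_bounds: "2 ^ k * (k + 1) <= mult_cost k" "k <= mult_cost k" "2 ^ k <= mult_cost k"
proof -
 show linear: "2 ^ k * (k + 1) <= mult_cost k" unfolding mult_cost_def by (intro mult_le_mono2 self_le_power) auto
 have "1 * k <= 2 ^ k * (k + 1)" "2 ^ k * 1 <= 2 ^ k * (k + 1)" by (intro mult_le_mono; simp)+
 then show "k <= mult_cost k" "2 ^ k <= mult_cost k" using linear by linarith+
qed

lemma task_cost_unit_width: "task_cost (k, 1, f, g) <= 400 * mult_cost k"
proof -
 have "task_cost (k, 1, f, g) <= 2 ^ k * ((k + 1) ^ 13 * (20 * (k + 1))\<^sup>2)"
  unfolding task_cost_def by (intro mult_le_mono power_mono) auto
 also have "... = 400 * (2 ^ k * ((k + 1) ^ 13 * (k + 1)\<^sup>2))" by (simp only: power_mult_distrib) simp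
 also have "(k + 1) ^ 13 * (k + 1)\<^sup>2 = (k + 1) ^ 15" using power_add[of "k + 1" 13 2] by simp
 finally show ?thesis by (simp add: mult_cost_def)
qed

abbreviation fast_mult_input :: "nat \<times> bool list \<times> bool list => bool" where
 "fast_mult_input x \<equiv> length (arg2 x) <= 2 ^ arg1 x \<and> length (rst3 x) <= 2 ^ arg1 x"

lemma computes_bit_poly:
 assumes h: "computes fast_mult_input h (%_. 0)" "\<And>x. fast_mult_input x ==> length (h x) <= 2 ^ arg1 x"
 shows "computes fast_mult_input (%x. bit_poly (2 ^ arg1 x) (h x)) (%x. mult_cost (arg1 x))"
proof -
 have "computes (%_. True) (%q::nat \<times> bool. [snd q]) (%_. 0)"
  by (rule computes_bound[where K = 1], (rule computes_intros)+, force)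
 note map = computes_map[of _ "%_ b. [b]", OF this computes_const[of _ 0]]
 show ?thesis unfolding bit_poly_def
 proof (rule computes_bound[where K = 50], rule map, (rule h(1) computes_intros TrueI)+, goal_cases)
  case (1 x)
  show ?case using h(2)[OF 1] mult_cost_bounds[of "arg1 x"] power_cost_le[OF order_refl, of "arg1 x"]
   by (simp add: sum_list_triv sum_list_replicate)
 qed
qed

lemma computes_bit_poly_mult:
 "computes fast_mult_input (%x. poly_mult (arg1 x, 1, bit_poly (2 ^ arg1 x) (arg2 x), bit_poly (2 ^ arg1 x) (rst3 x)))
  (%x. mult_cost (arg1 x))"
proof -
 let ?z = "%x. (arg1 x, 1, bit_poly (2 ^ arg1 x) (arg2 x), bit_poly (2 ^ arg1 x) (rst3 x))"
 have factors: "computes fast_mult_input (%x. bit_poly (2 ^ arg1 x) (arg2 x)) (%x. mult_cost (arg1 x))"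
  "computes fast_mult_input (%x. bit_poly (2 ^ arg1 x) (rst3 x)) (%x. mult_cost (arg1 x))"
  by (rule computes_bit_poly; (rule computes_intros | simp)+)+
 have "computes fast_mult_input (%x. hd (map poly_mult [?z x])) (%x. mult_cost (arg1 x))"
 proof (rule computes_bound[where K = 600], rule computes_hd, rule computes_comp[OF computes_poly_mults],
   (rule factors computes_Cons computes_Pair computes_fst computes_snd computes_const computes_id)+, goal_cases)
  case (1 x)
  then show ?case using valid_task_bit_poly by simp
 next
  case (3 x)
  show ?case using task_cost_unit_width[of "arg1 x" "bit_poly (2 ^ arg1 x) (arg2 x)" "bit_poly (2 ^ arg1 x) (rst3 x)"] by simp
 qed simp
 then show ?thesis by simp
qed

lemma computes_fast_mult_uncurried:
 "computes fast_mult_input (%x. fast_mult (arg1 x) (arg2 x) (rst3 x)) (%x. mult_cost (arg1 x))"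
proof -
 let ?p = "%x. poly_mult (arg1 x, 1, bit_poly (2 ^ arg1 x) (arg2 x), bit_poly (2 ^ arg1 x) (rst3 x))"
 let ?in = "%x. (3 * 1 + 600 + 10 * arg1 x, [] :: bool list, ?p x)"
 have input: "computes fast_mult_input ?in (%x. mult_cost (arg1 x))"
 proof (rule computes_bound[where K = 1000], (rule computes_bit_poly_mult computes_intros)+, goal_cases)
  case (1 x)
  show ?case using mult_cost_bounds(2)[of "arg1 x"] by simp
 qed
 have carry: "computes fast_mult_input (%x. (%y. carry (arg2 y) (rst3 y)) (?in x)) (%x. mult_cost (arg1 x))"
 proof (rule computes_bound[OF computes_comp[OF computes_carry_uncurried input], where K = 5000])
  fix x assume x: "fast_mult_input x"
  note valid = valid_task_bit_poly[OF conjunct1[OF x] conjunct2[OF x]]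
  show "length (arg2 (?in x)) <= arg1 (?in x) \<and> narrow (arg1 (?in x)) (rst3 (?in x))"
   using narrow_poly_mult[OF valid] by simp
  have "length (?p x) * (2 * (603 + 10 * arg1 x) + 1) <= 2 * 2 ^ arg1 x * (1300 * (arg1 x + 1))"
   using poly_mult_correct[of "bit_poly (2 ^ arg1 x) (arg2 x)" "arg1 x" "bit_poly (2 ^ arg1 x) (rst3 x)"] valid
   by (intro mult_le_mono) (auto simp: valid_task_def)
  also have "... = 2600 * (2 ^ arg1 x * (arg1 x + 1))" by (simp add: algebra_simps)
  finally show "mult_cost (arg1 x) + length (rst3 (?in x)) * (2 * arg1 (?in x) + 1) <= 5000 * (mult_cost (arg1 x) + 1)"
   using mult_cost_bounds(1)[of "arg1 x"] by simp
 qed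
 show ?thesis unfolding fast_mult_def
 proof (rule computes_bound[where K = 50], (rule carry[unfolded fst_conv snd_conv] computes_intros)+, goal_cases)
  case (1 x)
  show ?case using mult_cost_bounds[of "arg1 x"] power_cost_le[OF order_refl, of "arg1 x"] by simp
 qed
qed

lemmas computes_fast_mult = computes_comp3[OF computes_fast_mult_uncurried]

section \<open>Digit counts of blocks\<close>

primrec nat_digit_count :: "nat => nat => nat => nat => nat" where
 "nat_digit_count b d 0 s = 0"
| "nat_digit_count b d (Suc M) s = (if s mod b = d then Suc (nat_digit_count b d M (s div b))
  else nat_digit_count b d M (s div b))"

lemma nat_digit_count_le: "nat_digit_count b d M s <= M"
 by (induction M arbitrary: s) (auto simp: le_SucI)

lemma nat_digit_count_mod: "0 < b ==> nat_digit_count b d M (s mod b ^ M) = nat_digit_count b d M s"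
proof (induction M arbitrary: s)
 case (Suc M)
 have "s mod b ^ Suc M mod b = s mod b" by (simp add: mod_mod_cancel)
 moreover have "s mod b ^ Suc M div b = s div b mod b ^ M"
  using Suc.prems by (simp add: mod_mult2_eq)
 ultimately show ?case using Suc by simp
qed simp

lemma sum_digit_split:
 fixes g :: "nat => 'a::comm_monoid_add"
 shows "(\<Sum>s<b * n. g s) = (\<Sum>u<n. \<Sum>e<b. g (u * b + e))"
proof -
 have "sum g {m * b..<m * b + b} = (\<Sum>e<b. g (m * b + e))" for m
  using sum.shift_bounds_nat_ivl[of g 0 "m * b" b] by (simp add: lessThan_atLeast0 add.commute)
 then show ?thesis using sum.nat_group[of g b n] by (simp add: mult.commute)
qed

text \<open>The deviations of the single digits of a random string are independent, with mean 0 and variance b - 1.\<close>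
lemma nat_digit_count_variance:
 fixes b d :: nat
 assumes b: "0 < b" "d < b"
 defines "f M s \<equiv> real b * real (nat_digit_count b d M s) - real M"
 shows "(\<Sum>s<b ^ M. (f M s)\<^sup>2) = real b ^ M * (real M * (real b - 1))"
proof (induction M)
 case 0
 then show ?case by (simp add: f_def)
next
 case (Suc M)
 define g :: "nat => real" where "g e = (if e = d then real b else 0) - 1" for e
 have split: "f (Suc M) (u * b + e) = g e + f M u" if "e < b" for u e
  using that b by (simp add: f_def g_def algebra_simps)
 have mean: "(\<Sum>e<b. g e) = 0" using b by (simp add: g_def sum_subtractf)
 have "(\<Sum>e<b. (g e)\<^sup>2) = (\<Sum>e<b. (if e = d then (real b)\<^sup>2 - 2 * real b else 0) + 1)"
  by (intro sum.cong) (auto simp: g_def power2_eq_square algebra_simps)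
 also have "... = real b * (real b - 1)" using b by (simp add: sum.distrib power2_eq_square algebra_simps)
 finally have variance: "(\<Sum>e<b. (g e)\<^sup>2) = real b * (real b - 1)" .
 have "(\<Sum>e<b. (g e + f M u)\<^sup>2) = real b * (real b - 1) + real b * (f M u)\<^sup>2" for u
 proof -
  have "(\<Sum>e<b. (g e + f M u)\<^sup>2) = (\<Sum>e<b. (g e)\<^sup>2 + 2 * f M u * g e + (f M u)\<^sup>2)"
   by (intro sum.cong) (auto simp: power2_eq_square algebra_simps)
  then show ?thesis by (simp add: sum.distrib mean variance sum_distrib_left[symmetric])
 qed
 moreover have "(\<Sum>s<b ^ Suc M. (f (Suc M) s)\<^sup>2) = (\<Sum>u<b ^ M. \<Sum>e<b. (g e + f M u)\<^sup>2)"
  using sum_digit_split[of "%s. (f (Suc M) s)\<^sup>2" b "b ^ M"] by (simp add: split)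
 ultimately have "(\<Sum>s<b ^ Suc M. (f (Suc M) s)\<^sup>2) = real b ^ M * (real b * (real b - 1)) + real b * (\<Sum>u<b ^ M. (f M u)\<^sup>2)"
  by (simp add: sum.distrib sum_distrib_left)
 also have "... = real b ^ Suc M * (real (Suc M) * (real b - 1))" unfolding Suc by (simp add: algebra_simps)
 finally show ?case .
qed

definition balanced :: "nat => nat => nat => nat => bool" where
 "balanced b M B s \<longleftrightarrow> (\<forall>d<b. B * b * nat_digit_count b d M s <= (B + 1) * M)"

lemma balanced_mod: "0 < b ==> balanced b M B (s mod b ^ M) \<longleftrightarrow> balanced b M B s"
 by (simp add: balanced_def nat_digit_count_mod)

lemma card_frequent_digit_strings:
 assumes d: "d < b" and M: "0 < M"
 shows "card {s. s < b ^ M \<and> (B + 1) * M < B * b * nat_digit_count b d M s} * M <= B\<^sup>2 * (b ^ M * b)"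
proof -
 let ?A = "{s. s < b ^ M \<and> (B + 1) * M < B * b * nat_digit_count b d M s}"
 let ?f = "%s. real B * (real b * real (nat_digit_count b d M s) - real M)"
 have "real (card ?A) * (real M)\<^sup>2 = (\<Sum>s\<in>?A. (real M)\<^sup>2)" by simp
 also have "... <= (\<Sum>s\<in>?A. (?f s)\<^sup>2)"
 proof (rule sum_mono, rule power_mono)
  fix s assume "s \<in> ?A"
  then have "real ((B + 1) * M) < real (B * b * nat_digit_count b d M s)" unfolding of_nat_less_iff by simp
  then show "real M <= ?f s" by (simp add: algebra_simps)
 qed simp
 also have "... <= (\<Sum>s<b ^ M. (?f s)\<^sup>2)" by (rule sum_mono2) auto
 also have "... = (real B)\<^sup>2 * (real b ^ M * (real M * (real b - 1)))"
  using nat_digit_count_variance[OF _ d, of M] d by (simp add: power_mult_distrib sum_distrib_left[symmetric])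
 also have "... <= (real B)\<^sup>2 * (real b ^ M * (real M * real b))" by (intro mult_left_mono) auto
 finally have "real (card ?A * M) * real M <= real (B\<^sup>2 * (b ^ M * b)) * real M"
  by (simp add: power2_eq_square mult_ac)
 then show ?thesis using M by (simp only: mult_le_cancel_right_pos of_nat_0_less_iff of_nat_le_iff)
qed

lemma card_unbalanced_strings:
 assumes M: "0 < M"
 shows "card {s. s < b ^ M \<and> \<not> balanced b M B s} * M <= b ^ M * b\<^sup>2 * B\<^sup>2"
proof -
 define A where "A d = {s. s < b ^ M \<and> (B + 1) * M < B * b * nat_digit_count b d M s}" for d
 have "{s. s < b ^ M \<and> \<not> balanced b M B s} \<subseteq> (\<Union>d<b. A d)" by (auto simp: balanced_def A_def not_le)
 then have "card {s. s < b ^ M \<and> \<not> balanced b M B s} <= card (\<Union>d<b. A d)"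
  by (intro card_mono finite_UN_I) (auto simp: A_def)
 also have "... <= (\<Sum>d<b. card (A d))" by (rule card_UN_le) simp
 finally have "card {s. s < b ^ M \<and> \<not> balanced b M B s} * M <= (\<Sum>d<b. card (A d) * M)"
  by (simp add: sum_distrib_right[symmetric])
 also have "... <= (\<Sum>d<b. B\<^sup>2 * (b ^ M * b))"
  using card_frequent_digit_strings[OF _ M] by (intro sum_mono) (simp add: A_def)
 finally show ?thesis by (simp add: power2_eq_square mult_ac)
qed

lemma card_le_card_image_fibres:
 assumes "finite S" "finite T" "f ` S \<subseteq> T" and fibre: "\<And>t. t \<in> T ==> card {s \<in> S. f s = t} * c <= (d::nat)"
 shows "card S * c <= card T * d"
proof -
 have "card S = (\<Sum>t\<in>T. card {s \<in> S. f s = t})" using sum.group[OF assms(1-3), of "%_. 1::nat"] by simp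
 then have "card S * c = (\<Sum>t\<in>T. card {s \<in> S. f s = t} * c)" by (simp add: sum_distrib_right)
 also have "... <= (\<Sum>t\<in>T. d)" by (rule sum_mono[OF fibre])
 finally show ?thesis by simp
qed

lemma card_affine_div_fibre_le:
 fixes a c D v :: nat
 assumes D: "0 < D"
 shows "card {y. y < R \<and> (c + a * y) div D = v} * a <= D + a"
proof (cases "{y. y < R \<and> (c + a * y) div D = v} = {}")
 case True
 then show ?thesis by (simp only: True) simp
next
 case False
 let ?Y = "{y. y < R \<and> (c + a * y) div D = v}"
 have min: "Min ?Y \<in> ?Y" by (rule Min_in[OF _ False]) simp
 have max: "Max ?Y \<in> ?Y" by (rule Max_in[OF _ False]) simp
 have "card ?Y <= card {Min ?Y..Max ?Y}" by (intro card_mono) auto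
 then have "card ?Y * a <= (Suc (Max ?Y) - Min ?Y) * a" by (intro mult_le_mono1) simp
 also have "... <= (a * Max ?Y - a * Min ?Y) + a" by (cases "Min ?Y <= Max ?Y") (auto simp: algebra_simps Suc_diff_le)
 also have "a * Max ?Y - a * Min ?Y <= D"
 proof -
  have "c + a * Max ?Y < (v + 1) * D" using max dividend_less_div_times[OF D, of "c + a * Max ?Y"] by auto
  moreover have "v * D <= c + a * Min ?Y" using min div_times_less_eq_dividend[of "c + a * Min ?Y" D] by auto
  ultimately show ?thesis by simp
 qed
 finally show ?thesis by simp
qed

lemma card_shifted_residues_le:
 fixes N \<delta> :: nat
 assumes N: "0 < N"
 shows "card {v. v < 2 * N \<and> P ((v + \<delta>) mod N)} <= 2 * card {v. v < N \<and> P v}"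
proof -
 let ?S = "{v. v < 2 * N \<and> P ((v + \<delta>) mod N)}" and ?f = "%v. (v div N, (v + \<delta>) mod N)"
 have "inj_on ?f ?S"
 proof (rule inj_onI)
  fix v v' assume eq: "?f v = ?f v'"
  then have "(v + \<delta>) mod N = (v' + \<delta>) mod N" by simp
  then have "v mod N = v' mod N" unfolding nat_mod_eq_iff[of "v + \<delta>"] nat_mod_eq_iff[of v] by (simp add: ac_simps)
  then show "v = v'" using eq by (metis Pair_inject div_mult_mod_eq)
 qed
 moreover have "?f ` ?S \<subseteq> {0, 1} \<times> {v. v < N \<and> P v}"
 proof (rule image_subsetI)
  fix v assume v: "v \<in> ?S"
  then have "v div N < 2" by (simp add: less_mult_imp_div_less)
  then show "?f v \<in> {0, 1} \<times> {v. v < N \<and> P v}" using v N by (auto simp: less_2_cases_iff)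
 qed
 ultimately have "card ?S <= card ({0::nat, 1} \<times> {v. v < N \<and> P v})" by (intro card_inj_on_le) auto
 then show ?thesis by (simp add: card_cartesian_product)
qed

text \<open>The map from the choices y to the strings they produce has small fibres, so that few
 choices are bad.\<close>
lemma card_unbalanced_choices:
 fixes b M B R C K Z :: nat
 assumes b: "2 <= b" "0 < M" and Z: "Z < C" and K: "K <= C" "C <= 2 * b * K" and R: "b ^ M <= R"
 defines "s y \<equiv> b ^ M * (Z * R + K * y) div (C * R)"
 shows "card {y. y < R \<and> \<not> balanced b M B (s y + \<delta>)} * M <= 6 * b ^ 3 * B\<^sup>2 * R" (is "card ?S * M <= _")
proof -
 let ?T = "{v. v < 2 * b ^ M \<and> \<not> balanced b M B ((v + \<delta>) mod b ^ M)}"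
 let ?bad = "{v. v < b ^ M \<and> \<not> balanced b M B v}"
 have pos: "0 < C" "0 < R" "0 < K" "0 < b ^ M" using assms b by (auto intro: gr0I)
 have range: "s y < 2 * b ^ M" if "y < R" for y
 proof -
  have "Z * R + K * y < C * R + C * R" using Z K that pos by (intro add_less_le_mono mult_less_mono1 mult_le_mono) auto
  then have "b ^ M * (Z * R + K * y) < b ^ M * (2 * (C * R))" using pos by simp
  then show ?thesis unfolding s_def using pos by (simp add: less_mult_imp_div_less algebra_simps)
 qed
 have fibre: "card {y \<in> ?S. s y = v} * b ^ M <= 3 * b * R" for v
 proof -
  have "card {y \<in> ?S. s y = v} <= card {y. y < R \<and> (b ^ M * Z * R + b ^ M * K * y) div (C * R) = v}"
   by (intro card_mono) (auto simp: s_def algebra_simps)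
  then have "card {y \<in> ?S. s y = v} * (b ^ M * K) <= C * R + b ^ M * K"
   using card_affine_div_fibre_le[of "C * R" R "b ^ M * Z * R" "b ^ M * K" v] pos
   by (meson mult_le_mono1 nat_0_less_mult_iff order_trans)
  also have "... <= 2 * b * K * R + R * K" using K(2) R by (intro add_mono mult_le_mono1)
  finally have "K * (card {y \<in> ?S. s y = v} * b ^ M) <= K * (2 * b * R + R)" by (simp add: algebra_simps)
  then have "card {y \<in> ?S. s y = v} * b ^ M <= 2 * b * R + 1 * R" using pos(3) by simp
  also have "... <= 2 * b * R + b * R" using b by (intro add_left_mono mult_le_mono1) simp
  finally show ?thesis by (simp add: algebra_simps)
 qed
 have "card ?S * b ^ M <= card ?T * (3 * b * R)"
  by (rule card_le_card_image_fibres[OF _ _ _ fibre]) (use range balanced_mod b in auto)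
 also have "... <= 2 * card ?bad * (3 * b * R)"
  by (intro mult_le_mono1 card_shifted_residues_le pos)
 finally have "card ?S * b ^ M * M <= 2 * card ?bad * (3 * b * R) * M" by (rule mult_le_mono1)
 also have "... = 6 * b * R * (card ?bad * M)" by simp
 also have "... <= 6 * b * R * (b ^ M * b\<^sup>2 * B\<^sup>2)" by (intro mult_le_mono2 card_unbalanced_strings b)
 also have "... = b ^ M * (6 * b ^ 3 * B\<^sup>2 * R)" by (simp add: power2_eq_square power3_eq_cube)
 finally have "b ^ M * (card ?S * M) <= b ^ M * (6 * b ^ 3 * B\<^sup>2 * R)" by (simp only: mult_ac)
 then show ?thesis using pos(4) by (subst (asm) mult_le_cancel1) blast
qed

section \<open>Simple normality in all bases implies absolute normality\<close>

lemma frequencies_tendsto_uniform: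
 fixes f :: "nat => nat => real"
 assumes M: "0 < M" and sum: "\<And>N. 0 < N ==> (\<Sum>W<M. f W N) = 1"
  and bound: "\<And>W \<epsilon>. W < M ==> 0 < \<epsilon> ==> \<forall>\<^sub>F N in sequentially. \<sigma> * (f W N - 1 / M) <= \<epsilon>"
  and sign: "\<sigma> = 1 \<or> \<sigma> = -1" and W: "W < M"
 shows "f W \<longlonglongrightarrow> 1 / M"
proof (rule tendstoI)
 fix \<epsilon> :: real assume \<epsilon>: "0 < \<epsilon>"
 define \<eta> where "\<eta> = \<epsilon> / (2 * M)"
 have \<eta>: "0 < \<eta>" "real M * \<eta> < \<epsilon>" using \<epsilon> M by (auto simp: \<eta>_def)
 have "\<forall>\<^sub>F N in sequentially. \<forall>V\<in>{..<M}. \<sigma> * (f V N - 1 / M) <= \<eta>"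
  using bound \<eta>(1) by (intro eventually_ball_finite) auto
 then show "\<forall>\<^sub>F N in sequentially. dist (f W N) (1 / M) < \<epsilon>"
  using eventually_gt_at_top[of 0]
 proof eventually_elim
  case (elim N)
  have "(\<Sum>V<M. \<sigma> * (f V N - 1 / M)) = 0"
   using sum[OF elim(2)] M by (simp add: sum_distrib_left[symmetric] sum_subtractf)
  moreover have "(\<Sum>V<M. \<sigma> * (f V N - 1 / M)) = \<sigma> * (f W N - 1 / M) + (\<Sum>V\<in>{..<M} - {W}. \<sigma> * (f V N - 1 / M))"
   using W by (subst sum.remove[of _ W]) auto
  moreover have "(\<Sum>V\<in>{..<M} - {W}. \<sigma> * (f V N - 1 / M)) <= real (card ({..<M} - {W})) * \<eta>"
   by (rule sum_bounded_above) (use elim in auto)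
  moreover have "real (card ({..<M} - {W})) * \<eta> <= real M * \<eta>"
   using \<eta> by (intro mult_right_mono) (auto intro: order_trans[OF card_Diff1_le])
  moreover have "\<sigma> * (f W N - 1 / M) <= \<eta>" using elim W by auto
  moreover have "\<eta> <= real M * \<eta>" using \<eta> M by simp
  ultimately have "\<bar>\<sigma> * (f W N - 1 / M)\<bar> < \<epsilon>" using \<eta>(2) by linarith
  then show ?case using sign by (auto simp: dist_real_def)
 qed
qed

definition word_val :: "nat => nat list => nat" where
 "word_val b w = foldl (%a d. a * b + d) 0 w"

lemma word_val_snoc: "word_val b (w @ [d]) = word_val b w * b + d"
 by (simp add: word_val_def)

lemma word_val_less: "0 < b ==> \<forall>d\<in>set w. d < b ==> word_val b w < b ^ length w"
proof (induction w rule: rev_induct)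
 case (snoc d w)
 then have "word_val b w + 1 <= b ^ length w" by auto
 then have "(word_val b w + 1) * b <= b ^ length w * b" by (rule mult_le_mono1)
 then show ?case using snoc.prems by (simp add: word_val_snoc mult.commute)
qed (simp add: word_val_def)

lemma floor_mult_power_div:
 fixes x :: real and b :: nat
 assumes "0 < b"
 shows "\<lfloor>x * real b ^ n\<rfloor> = \<lfloor>x * real b ^ (n + s)\<rfloor> div int (b ^ s)"
proof -
 have "x * real b ^ n = x * real b ^ (n + s) / real_of_int (int (b ^ s))" using assms by (simp add: power_add)
 then show ?thesis using floor_divide_real_eq_div[of "int (b ^ s)" "x * real b ^ (n + s)"] by simp
qed

lemma word_at_iff:
 assumes b: "0 < b" and w: "\<forall>d\<in>set w. d < b"
 shows "(\<forall>j<length w. digit b x (p + j) = w ! j) \<longleftrightarrow> \<lfloor>x * real b ^ (p + length w)\<rfloor> mod int (b ^ length w) = int (word_val b w)"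
 using w
proof (induction w rule: rev_induct)
 case Nil
 then show ?case by (simp add: word_val_def)
next
 case (snoc d w)
 let ?L = "length w"
 define Q where "Q = \<lfloor>x * real b ^ (p + ?L + 1)\<rfloor>"
 have front: "\<lfloor>x * real b ^ (p + ?L)\<rfloor> = Q div int b"
  using floor_mult_power_div[OF b, of x "p + ?L" 1] by (simp add: Q_def)
 have last: "digit b x (p + ?L) = nat (Q mod int b)" by (simp add: digit_def Q_def)
 have digits: "Q mod int (b ^ (?L + 1)) = (Q div int b mod int (b ^ ?L)) * int b + Q mod int b"
  using b by (simp add: zmod_zmult2_eq mult.commute)
 have "(\<forall>j<length (w @ [d]). digit b x (p + j) = (w @ [d]) ! j) \<longleftrightarrow>
  (\<forall>j<?L. digit b x (p + j) = w ! j) \<and> digit b x (p + ?L) = d"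
  by (auto simp: nth_append less_Suc_eq)
 also have "... \<longleftrightarrow> Q div int b mod int (b ^ ?L) = int (word_val b w) \<and> Q mod int b = int d"
  using snoc b by (simp add: front last nat_eq_iff)
 also have "... \<longleftrightarrow> (Q div int b mod int (b ^ ?L)) * int b + Q mod int b = int (word_val b w) * int b + int d"
 proof
  assume eq: "(Q div int b mod int (b ^ ?L)) * int b + Q mod int b = int (word_val b w) * int b + int d"
  have "d < b" using snoc.prems by simp
  have "Q mod int b = ((Q div int b mod int (b ^ ?L)) * int b + Q mod int b) mod int b" by simp
  also have "... = int d" unfolding eq using \<open>d < b\<close> by (simp add: zmod_int[symmetric])
  finally have "Q mod int b = int d" .
  then show "Q div int b mod int (b ^ ?L) = int (word_val b w) \<and> Q mod int b = int d" using eq b by simp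
 qed simp
 also have "... \<longleftrightarrow> Q mod int (b ^ length (w @ [d])) = int (word_val b (w @ [d]))"
  using digits by (simp add: word_val_snoc)
 finally show ?case by (simp add: Q_def add.assoc)
qed

definition block_occ :: "nat => real => nat => nat => nat => nat" where
 "block_occ b x L W N = card {p. p < N \<and> \<lfloor>x * real b ^ (p + L)\<rfloor> mod int (b ^ L) = int W}"

lemma sum_block_occ:
 assumes b: "0 < b"
 shows "(\<Sum>W<b ^ L. block_occ b x L W N) = N"
proof -
 let ?g = "%p. nat (\<lfloor>x * real b ^ (p + L)\<rfloor> mod int (b ^ L))"
 have "block_occ b x L W N = card {p \<in> {..<N}. ?g p = W}" for W
  unfolding block_occ_def using b by (intro arg_cong[where f = card]) (auto simp: nat_eq_iff)
 then have "(\<Sum>W<b ^ L. block_occ b x L W N) = (\<Sum>W<b ^ L. \<Sum>p\<in>{p \<in> {..<N}. ?g p = W}. 1)" by simp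
 also have "... = (\<Sum>p<N. 1)" by (rule sum.group) (use b in \<open>auto simp: nat_less_iff\<close>)
 finally show ?thesis by simp
qed

lemma card_block_strings:
 fixes b t L s W :: nat
 assumes b: "0 < b" and W: "W < b ^ L"
 shows "card {u. u < b ^ (t + L + s) \<and> u div b ^ s mod b ^ L = W} = b ^ t * b ^ s" (is "card ?U = _")
proof -
 let ?join = "%(h, l). (h * b ^ L + W) * b ^ s + l" and ?split = "%u. (u div b ^ s div b ^ L, u mod b ^ s)"
 have "bij_betw ?join ({..<b ^ t} \<times> {..<b ^ s}) ?U"
 proof (rule bij_betw_byWitness[where f' = ?split])
  show "?join ` ({..<b ^ t} \<times> {..<b ^ s}) \<subseteq> ?U"
  proof (clarsimp, intro conjI)
   fix h l assume h: "h < b ^ t" and l: "l < b ^ s"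
   have "(h + 1) * b ^ L <= b ^ t * b ^ L" using h by (intro mult_le_mono1) simp
   then have "h * b ^ L + W + 1 <= b ^ t * b ^ L" using W by simp
   then have "(h * b ^ L + W + 1) * b ^ s <= b ^ t * b ^ L * b ^ s" by (rule mult_le_mono1)
   then show "(h * b ^ L + W) * b ^ s + l < b ^ (t + L + s)" using l by (simp add: power_add add_mult_distrib)
  qed (use W b in auto)
  show "?split ` ?U \<subseteq> {..<b ^ t} \<times> {..<b ^ s}"
   using b by (auto simp: power_add less_mult_imp_div_less algebra_simps)
 qed (use W b in \<open>auto simp: div_mult_mod_eq\<close>)
 from bij_betw_same_card[OF this] show ?thesis by (simp add: card_cartesian_product)
qed

definition inner_occ :: "nat => nat => nat => nat => nat => nat" where
 "inner_occ b r L W u = card {t. t + L <= r \<and> u div b ^ (r - t - L) mod b ^ L = W}"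

lemma sum_inner_occ:
 assumes b: "0 < b" and W: "W < b ^ L" and r: "L <= r"
 shows "(\<Sum>u<b ^ r. inner_occ b r L W u) = (r - L + 1) * b ^ (r - L)"
proof -
 let ?hit = "%t u. if u div b ^ (r - t - L) mod b ^ L = W then 1 else (0::nat)"
 have "inner_occ b r L W u = (\<Sum>t\<le>r - L. ?hit t u)" for u
 proof -
  have "{t. t + L <= r \<and> u div b ^ (r - t - L) mod b ^ L = W} = {t \<in> {..r - L}. u div b ^ (r - t - L) mod b ^ L = W}"
   using r by auto
  then show ?thesis unfolding inner_occ_def by (simp add: sum.If_cases Int_def)
 qed
 then have "(\<Sum>u<b ^ r. inner_occ b r L W u) = (\<Sum>t\<le>r - L. \<Sum>u<b ^ r. ?hit t u)"
  by (simp only: sum.swap[of _ "{..<b ^ r}"])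
 also have "... = (\<Sum>t\<le>r - L. b ^ (r - L))"
 proof (rule sum.cong[OF refl])
  fix t assume "t \<in> {..r - L}"
  then have t: "t + L + (r - t - L) = r" using r by simp
  have "(\<Sum>u<b ^ r. ?hit t u) = card {u. u < b ^ r \<and> u div b ^ (r - t - L) mod b ^ L = W}"
   by (simp add: sum.If_cases Int_def)
  also have "... = b ^ t * b ^ (r - t - L)" using card_block_strings[OF b W, of t "r - t - L"] t by simp
  also have "... = b ^ (r - L)" using t by (simp add: power_add[symmetric])
  finally show "(\<Sum>u<b ^ r. ?hit t u) = b ^ (r - L)" .
 qed
 finally show ?thesis by simp
qed

lemma floor_mod_eq_digit_power_base:
 assumes b: "0 < b" and t: "t + L <= r"
 shows "\<lfloor>x * real b ^ (i * r + t + L)\<rfloor> mod int (b ^ L) = int (digit (b ^ r) x i div b ^ (r - t - L) mod b ^ L)"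
proof -
 define Q where "Q = \<lfloor>x * real (b ^ r) ^ (i + 1)\<rfloor>"
 define s where "s = r - t - L"
 have r: "r = t + L + s" using t by (simp add: s_def)
 have "real (b ^ r) ^ (i + 1) = real b ^ (r * (i + 1))" by (simp only: of_nat_power power_mult)
 also have "r * (i + 1) = i * r + t + L + s" using r by (simp add: algebra_simps)
 finally have "real (b ^ r) ^ (i + 1) = real b ^ (i * r + t + L + s)" .
 then have floor: "\<lfloor>x * real b ^ (i * r + t + L)\<rfloor> = Q div int (b ^ s)"
  using floor_mult_power_div[OF b, of x "i * r + t + L" s] by (simp add: Q_def)
 have "int (digit (b ^ r) x i) = Q mod int (b ^ r)" unfolding digit_def Q_def using b by simp
 then have "int (digit (b ^ r) x i div b ^ s mod b ^ L) = Q mod int (b ^ r) div int (b ^ s) mod int (b ^ L)"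
  by (metis zdiv_int zmod_int)
 also have "Q mod int (b ^ r) = Q mod (int (b ^ s) * int (b ^ (t + L)))" by (simp add: r power_add algebra_simps)
 also have "... div int (b ^ s) = Q div int (b ^ s) mod int (b ^ (t + L))" using b by (simp add: zmod_zmult2_eq)
 also have "... mod int (b ^ L) = Q div int (b ^ s) mod int (b ^ L)" by (rule mod_mod_cancel) (simp add: power_add)
 finally show ?thesis unfolding floor s_def by simp
qed

text \<open>An occurrence of a word inside an aligned block of length r is visible in the digit in base
 b^r; only the fraction (L - 1)/r of the positions is lost.\<close>
lemma sum_inner_occ_le_block_occ:
 assumes b: "0 < b" and L: "0 < L" and n: "n * r <= N"
 shows "(\<Sum>u<b ^ r. inner_occ b r L W u * card {i. i < n \<and> digit (b ^ r) x i = u}) <= block_occ b x L W N"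
proof -
 let ?dg = "digit (b ^ r) x"
 let ?S = "SIGMA i:{..<n}. {t. t + L <= r \<and> ?dg i div b ^ (r - t - L) mod b ^ L = W}"
 have "finite {t. t + L <= r \<and> u div b ^ (r - t - L) mod b ^ L = W}" for u
  by (rule finite_subset[of _ "{..r}"]) auto
 then have card_S: "card ?S = (\<Sum>i<n. inner_occ b r L W (?dg i))" unfolding inner_occ_def by (subst card_SigmaI) auto
 have "(\<Sum>u<b ^ r. inner_occ b r L W u * card {i. i < n \<and> ?dg i = u})
   = (\<Sum>u<b ^ r. \<Sum>i\<in>{i \<in> {..<n}. ?dg i = u}. inner_occ b r L W (?dg i))"
  by (intro sum.cong) (auto simp: mult.commute)
 also have "... = card ?S"
  unfolding card_S by (rule sum.group) (use b in \<open>auto simp: digit_def nat_less_iff\<close>)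
 also have "... <= block_occ b x L W N" unfolding block_occ_def
 proof (rule card_inj_on_le[where f = "%(i, t). i * r + t"])
  show "inj_on (%(i, t). i * r + t) ?S"
  proof (rule inj_onI, clarsimp)
   fix i t i' t' assume "t + L <= r" "t' + L <= r" and eq: "i * r + t = i' * r + t'"
   then have "t < r" "t' < r" using L by auto
   then have "i = (i * r + t) div r" "i' = (i' * r + t') div r" by auto
   then have "i = i'" using eq by simp
   then show "i = i' \<and> t = t'" using eq by simp
  qed
  show "(%(i, t). i * r + t) ` ?S \<subseteq> {p. p < N \<and> \<lfloor>x * real b ^ (p + L)\<rfloor> mod int (b ^ L) = int W}"
  proof
   fix p assume "p \<in> (%(i, t). i * r + t) ` ?S"
   then obtain i t where p: "p = i * r + t" "i < n" "t + L <= r" "?dg i div b ^ (r - t - L) mod b ^ L = W" by auto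
   have "i * r + t < (i + 1) * r" using p L by simp
   also have "... <= n * r" using p(2) by (intro mult_le_mono1) simp
   finally show "p \<in> {p. p < N \<and> \<lfloor>x * real b ^ (p + L)\<rfloor> mod int (b ^ L) = int W}"
    using floor_mod_eq_digit_power_base[OF b p(3)] p n by simp
  qed
 qed simp
 finally show ?thesis .
qed

lemma filterlim_div_nat_at_top:
 fixes r :: nat
 assumes "0 < r"
 shows "filterlim (%N. N div r) at_top sequentially"
 unfolding filterlim_at_top
proof
 fix Z show "\<forall>\<^sub>F N in sequentially. Z <= N div r"
  using eventually_ge_at_top[of "Z * r"] by eventually_elim (use assms in \<open>simp add: less_eq_div_iff_mult_less_eq\<close>)
qed

lemma tendsto_div_nat_ratio:
 assumes r: "0 < r"
 shows "(%N. real (N div r) / real N) \<longlonglongrightarrow> 1 / real r"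
proof (rule real_tendsto_sandwich)
 show "\<forall>\<^sub>F N in sequentially. 1 / real r - 1 / real N <= real (N div r) / real N"
  using eventually_gt_at_top[of 0]
 proof eventually_elim
  case (elim N)
  have "N < (N div r + 1) * r" using r dividend_less_div_times[of r N] by simp
  then have "real N <= real ((N div r + 1) * r)" unfolding of_nat_le_iff by simp
  then have "real N / real r <= real (N div r) + 1" using r by (simp add: divide_le_eq algebra_simps)
  then have "(real N / real r - 1) / real N <= real (N div r) / real N" by (intro divide_right_mono) auto
  then show ?case using elim by (simp add: diff_divide_distrib)
 qed
 show "\<forall>\<^sub>F N in sequentially. real (N div r) / real N <= 1 / real r"
  using eventually_gt_at_top[of 0]
 proof eventually_elim
  case (elim N)
  have "real (N div r) * real r <= real N" by (metis div_times_less_eq_dividend of_nat_le_iff of_nat_mult)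
  then show ?case using elim r by (simp add: field_simps)
 qed
 show "(%N. 1 / real r - 1 / real N) \<longlonglongrightarrow> 1 / real r"
  using tendsto_diff[OF tendsto_const lim_1_over_n, of "1 / real r"] by simp
qed simp

lemma eventually_inner_occ_le_block_occ:
 assumes simply_normal: "\<And>d. d < b ^ r ==> (%N. real (card {i. i < N \<and> digit (b ^ r) x i = d}) / real N) \<longlonglongrightarrow> 1 / real (b ^ r)"
  and b: "0 < b" and W: "W < b ^ L" and L: "0 < L" "L <= r" and c: "c < real (r - L + 1) / real (b ^ L) * (1 / real r)"
 shows "\<forall>\<^sub>F N in sequentially. c < real (block_occ b x L W N) / real N"
proof -
 define G where "G n = (\<Sum>u<b ^ r. real (inner_occ b r L W u) * (real (card {i. i < n \<and> digit (b ^ r) x i = u}) / real n))" for n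
 have "G \<longlonglongrightarrow> (\<Sum>u<b ^ r. real (inner_occ b r L W u) * (1 / real (b ^ r)))"
  unfolding G_def by (intro tendsto_sum tendsto_mult tendsto_const simply_normal) auto
 also have "(\<Sum>u<b ^ r. real (inner_occ b r L W u) * (1 / real (b ^ r)))
   = real ((r - L + 1) * b ^ (r - L)) / real (b ^ (L + (r - L)))"
  unfolding sum_inner_occ[OF b W L(2), symmetric] using L by (simp add: sum_divide_distrib)
 also have "... = real (r - L + 1) / real (b ^ L)" using b by (simp add: power_add add_divide_distrib[symmetric] field_simps)
 finally have "(%N. G (N div r) * (real (N div r) / real N)) \<longlonglongrightarrow> real (r - L + 1) / real (b ^ L) * (1 / real r)"
  using L by (intro tendsto_mult filterlim_compose[OF _ filterlim_div_nat_at_top] tendsto_div_nat_ratio) auto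
 from order_tendstoD(1)[OF this c] eventually_gt_at_top[of r] show ?thesis
 proof eventually_elim
  case (elim N)
  have "0 < N div r" using elim L by (simp add: div_greater_zero_iff)
  then have "G (N div r) * real (N div r) = real (\<Sum>u<b ^ r. inner_occ b r L W u * card {i. i < N div r \<and> digit (b ^ r) x i = u})"
   unfolding G_def sum_distrib_right by (simp add: of_nat_sum)
  also have "... <= real (block_occ b x L W N)"
   using sum_inner_occ_le_block_occ[OF b L(1), of "N div r" r N] by (simp only: of_nat_le_iff) simp
  finally have "G (N div r) * (real (N div r) / real N) <= real (block_occ b x L W N) / real N"
   by (simp add: divide_right_mono)
  then show ?case using elim by simp
 qed
qed

lemma eventually_block_occ_lower_bound:
 assumes simply_normal: "\<And>b d. 2 <= b ==> d < b ==> (%N. real (card {i. i < N \<and> digit b x i = d}) / real N) \<longlonglongrightarrow> 1 / real b"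
  and b: "2 <= b" and W: "W < b ^ L" and L: "0 < L" and \<epsilon>: "0 < \<epsilon>"
 shows "\<forall>\<^sub>F N in sequentially. - 1 * (real (block_occ b x L W N) / real N - 1 / real (b ^ L)) <= \<epsilon>"
proof -
 obtain q :: nat where q: "real L / \<epsilon> < real q" using reals_Archimedean2 by blast
 define r where "r = q + L + 1"
 have r: "L <= r" "0 < r" by (auto simp: r_def)
 have base: "2 <= b ^ r" using b r power_increasing[of 1 r b] by simp
 have "real L < \<epsilon> * real q" using q \<epsilon> by (simp add: divide_less_eq mult.commute)
 also have "... <= \<epsilon> * real r" using \<epsilon> by (intro mult_left_mono) (auto simp: r_def)
 finally have "real L / real r <= \<epsilon>" using r by (simp add: divide_le_eq)
 moreover have "real (r - L + 1) * (1 / real r) > 1 - real L / real r" using r by (simp add: of_nat_diff field_simps)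
 ultimately have "(1 - \<epsilon>) / real (b ^ L) < real (r - L + 1) * (1 / real r) / real (b ^ L)"
  using b by (intro divide_strict_right_mono) auto
 moreover have "\<epsilon> / real (b ^ L) <= \<epsilon>"
  using b \<epsilon> one_le_power[of "real b" L] by (simp add: divide_le_eq)
 ultimately have "1 / real (b ^ L) - \<epsilon> < real (r - L + 1) / real (b ^ L) * (1 / real r)"
  by (simp add: diff_divide_distrib mult.commute)
 from eventually_inner_occ_le_block_occ[OF simply_normal[OF base] _ W L r(1) this] b show ?thesis
  by (auto elim!: eventually_mono)
qed

theorem absolutely_normal_if_simply_normal:
 assumes simply_normal: "\<And>b d. 2 <= b ==> d < b ==> (%N. real (card {i. i < N \<and> digit b x i = d}) / real N) \<longlonglongrightarrow> 1 / real b"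
 shows "absolutely_normal x"
 unfolding absolutely_normal_def normal_in_base_def
proof (intro allI impI)
 fix b :: nat and w :: "nat list"
 assume b: "2 <= b" and w: "w \<noteq> [] \<and> (\<forall>d\<in>set w. d < b)"
 define L where "L = length w"
 have L: "0 < L" using w by (simp add: L_def)
 have pos: "0 < b" using b by simp
 have "(%N. real (block_occ b x L (word_val b w) N) / real N) \<longlonglongrightarrow> 1 / real (b ^ L)"
 proof (rule frequencies_tendsto_uniform[where \<sigma> = "-1" and M = "b ^ L"])
  show "(\<Sum>W<b ^ L. real (block_occ b x L W N) / real N) = 1" if "0 < N" for N
   using sum_block_occ[OF pos, of x L N] that by (metis of_nat_sum sum_divide_distrib divide_self of_nat_0_less_iff less_irrefl)
  show "word_val b w < b ^ L" using word_val_less[OF pos] w by (simp add: L_def)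
 qed (use pos eventually_block_occ_lower_bound[OF simply_normal b _ L] in auto)
 moreover have "occ b x w N = block_occ b x L (word_val b w) N" for N
  unfolding occ_def block_occ_def L_def using word_at_iff[OF pos] w by simp
 ultimately show "(%N. real (occ b x w N) / real N) \<longlonglongrightarrow> 1 / real b ^ length w" by (simp add: L_def)
qed

section \<open>The algorithm\<close>

function floor_log :: "nat => nat => nat" where
 "floor_log b X = (if b < 2 \<or> X < b then 0 else Suc (floor_log b (X div b)))"
 by pat_completeness auto
termination by (relation "measure snd") auto

declare floor_log.simps [simp del]

lemma floor_log_bounds: "2 <= b ==> 0 < X ==> b ^ floor_log b X <= X \<and> X < b ^ Suc (floor_log b X)"
proof (induction b X rule: floor_log.induct)
 case (1 b X)
 show ?case
 proof (cases "X < b")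
  case True
  then show ?thesis using 1 by (simp add: floor_log.simps[of b X])
 next
  case False
  then have "0 < X div b" using 1 by (simp add: div_greater_zero_iff)
  then have IH: "b ^ floor_log b (X div b) <= X div b \<and> X div b < b ^ Suc (floor_log b (X div b))" using 1 False by auto
  have log: "floor_log b X = Suc (floor_log b (X div b))" using 1 False by (simp add: floor_log.simps[of b X])
  have "b * b ^ floor_log b (X div b) <= b * (X div b)" using IH by simp
  also have "... <= X" by simp
  finally have lower: "b ^ floor_log b X <= X" by (simp add: log)
  have "X < b * (X div b + 1)" using 1 dividend_less_times_div[of b X] by simp
  also have "... <= b * b ^ Suc (floor_log b (X div b))" using IH by (intro mult_le_mono2) simp
  finally show ?thesis using lower log by simp
 qed
qed

lemma floor_log_ge: "2 ^ a <= X ==> a <= floor_log 2 X"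
proof -
 assume a: "2 ^ a <= X"
 then have "0 < X" by (rule less_le_trans[rotated]) simp
 then have "2 ^ a < (2::nat) ^ Suc (floor_log 2 X)" using a floor_log_bounds[of 2 X] by linarith
 then have "a < Suc (floor_log 2 X)" by (rule power_less_imp_less_exp[rotated]) simp
 then show ?thesis by simp
qed

text \<open>A stage extends a prefix of 2^k bits to twice its length. With j = leaf_level k it takes
 care of the bases 2, ..., j + 1 and is split by halving into blocks of 2^j bits.\<close>
definition leaf_level :: "nat => nat" where
 "leaf_level k = floor_log 2 (floor_log 2 k) + 3"

definition block_string :: "nat => nat => nat => nat => nat \<times> nat => nat" where
 "block_string R y b M v = b ^ M * (fst v * R + snd v * y) div (R * R * R)"

definition block_ok :: "nat => nat => nat => nat => nat \<times> nat => bool" where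
 "block_ok R B y b v = (let M = floor_log b (R div 4); s = block_string R y b M v
  in balanced b M B s \<and> balanced b M B (Suc s))"

primrec blocks_ok :: "nat => nat => nat => nat => (nat \<times> nat) list => bool" where
 "blocks_ok R B y b [] = True"
| "blocks_ok R B y b (v # vs) = (block_ok R B y b v \<and> blocks_ok R B y (Suc b) vs)"

primrec search :: "nat => nat => (nat \<times> nat) list => nat => nat" where
 "search R B vs 0 = 0"
| "search R B vs (Suc y) = (if blocks_ok R B y 2 vs then y else search R B vs y)"

primrec nat_bits :: "nat => nat => bool list" where
 "nat_bits 0 y = []"
| "nat_bits (Suc l) y = (y mod 2 = 1) # nat_bits l (y div 2)"

type_synonym state = "bool list \<times> bool list"

definition leaf_block :: "nat => state list => bool list" where
 "leaf_block lam sts = nat_bits lam (search (2 ^ lam) (length sts) (map (%w. (val (fst w), val (snd w))) sts) (2 ^ lam))"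

text \<open>An entry holds a base b, the largest power of b below 2^h, and b times this power.\<close>
type_synonym entry = "bool list \<times> bool list \<times> bool list"
type_synonym table = "(nat \<times> nat \<times> entry list) list"

definition all_zero :: "bool list => bool" where "all_zero xs \<longleftrightarrow> True \<notin> set xs"

definition next_power :: "nat => nat => entry => entry" where
 "next_power j h e = (let bb = fst e; Q = fast_mult j (arg2 e) (arg2 e); Qb = naive_mult bb Q;
  T = (if all_zero (drop (2 * h) Qb) then take (2 * h) Qb else Q) in (bb, T, naive_mult bb T))"

primrec power_table :: "bool list list => nat => table" where
 "power_table bbs 0 = [(0, 1, map (%bb. (bb, [True], bb)) bbs)]"
| "power_table bbs (Suc j) = (let t = power_table bbs j; h = arg2 (hd t) in
  (Suc j, 2 * h, map (next_power j h) (rst3 (hd t))) # t)"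

definition left_state :: "nat => state => state" where
 "left_state h w = (drop (2 * h) (fst w), drop (2 * h) (snd w))"

definition right_factor :: "nat => nat => bool list => entry => bool list" where
 "right_factor j h K e = (if all_zero (drop (5 * h) (fast_mult (j + 2) K (rst3 e))) then rst3 e else arg2 e)"

definition right_state :: "nat => nat => bool list => entry \<times> state => state" where
 "right_state j h y q = (let Z = arg2 q; K = rst3 q; T = right_factor j h K (fst q);
  X = take (8 * h) (add_bits False (replicate h False @ Z) (fast_mult (j + 2) K y))
  in (take (2 * h) (drop (3 * h) (fast_mult (j + 3) X T)), take (2 * h) (drop (3 * h) (fast_mult (j + 2) K T))))"

primrec solve :: "nat => table => state list => bool list" where
 "solve lam [] sts = leaf_block lam sts"
| "solve lam (e # tab) sts = (let h = arg2 e;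
  y = solve lam tab (map (left_state h) sts);
  y' = solve lam tab (map (right_state (fst e) h y) (zip (rst3 e) sts)) in y' @ y)"

primrec base_list :: "nat => bool list => bool list list" where
 "base_list 0 bb = []"
| "base_list (Suc n) bb = bb # base_list n (add_bits False bb [True])"

definition start_state :: "nat => nat => bool list => entry => state" where
 "start_state k n P e = (replicate n False @ take n (fast_mult k (arg2 e) P), replicate n False @ arg2 e)"

definition stage :: "nat => bool list => bool list" where
 "stage k P = (let j = leaf_level k; t = power_table (base_list j [False, True]) k in
  solve (2 ^ j) (take (k - j) (tl t)) (map (start_state k (arg2 (hd t)) P) (rst3 (hd t))))"

primrec prefix_bits :: "nat => bool list" where
 "prefix_bits 0 = replicate 16 False"
| "prefix_bits (Suc t) = stage (t + 4) (prefix_bits t) @ prefix_bits t"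

lemma all_zero_iff_val: "all_zero xs \<longleftrightarrow> val xs = 0"
 unfolding all_zero_def by (induction xs) auto

lemma all_zero_drop: "all_zero (drop n xs) \<longleftrightarrow> val xs < 2 ^ n"
 by (simp add: all_zero_iff_val val_drop div_eq_0_iff)

lemma length_nat_bits [simp]: "length (nat_bits l y) = l"
 by (induction l arbitrary: y) auto

lemma val_nat_bits [simp]: "val (nat_bits l y) = y mod 2 ^ l"
proof (induction l arbitrary: y)
 case (Suc l)
 have "y mod 2 ^ Suc l = y mod 2 + 2 * (y div 2 mod 2 ^ l)" by (simp add: mod_mult2_eq)
 moreover have "of_bool (y mod 2 = 1) = y mod 2" by (simp add: of_bool_def)
 ultimately show ?case using Suc by simp
qed simp

lemma blocks_ok_iff: "blocks_ok R B y b vs \<longleftrightarrow> (\<forall>i<length vs. block_ok R B y (b + i) (vs ! i))"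
proof (induction vs arbitrary: b)
 case (Cons v vs)
 have "(\<forall>i<length (v # vs). block_ok R B y (b + i) ((v # vs) ! i)) \<longleftrightarrow>
  block_ok R B y b v \<and> (\<forall>i<length vs. block_ok R B y (Suc b + i) (vs ! i))"
  unfolding length_Cons All_less_Suc2 by simp
 then show ?case using Cons by simp
qed simp

lemma search_less: "0 < n ==> search R B vs n < n"
proof (induction n)
 case (Suc n)
 then show ?case by (cases n) auto
qed simp

lemma search_ok: "y < n ==> blocks_ok R B y 2 vs ==> blocks_ok R B (search R B vs n) 2 vs"
 by (induction n) (auto simp: less_Suc_eq)

lemma length_solve: "length (solve lam tab sts) = lam * 2 ^ length tab"
 by (induction tab arbitrary: sts) (auto simp: leaf_block_def Let_def)

lemma length_power_table: "length (power_table bbs k) = Suc k"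
 by (induction k) (auto simp: Let_def)

definition powers :: "bool list list => nat => entry list" where
 "powers bbs j = rst3 (hd (power_table bbs j))"

lemma hd_power_table: "power_table bbs j \<noteq> [] \<and> hd (power_table bbs j) = (j, 2 ^ j, powers bbs j)"
proof (induction j)
 case (Suc j)
 then obtain l where "hd (power_table bbs j) = (j, 2 ^ j, l)" by blast
 then show ?case by (simp add: powers_def Let_def)
qed (simp add: powers_def)

lemma powers_0: "powers bbs 0 = map (%bb. (bb, [True], bb)) bbs"
 by (simp add: powers_def)

lemma powers_Suc: "powers bbs (Suc j) = map (next_power j (2 ^ j)) (powers bbs j)"
proof -
 obtain l where "hd (power_table bbs j) = (j, 2 ^ j, l)" using hd_power_table[of bbs j] by blast
 then show ?thesis by (simp add: powers_def Let_def)
qed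

definition power_entry :: "nat => nat => bool list => entry => bool" where
 "power_entry b h bb e \<longleftrightarrow> fst e = bb \<and> val bb = b \<and>
  (\<exists>m. val (arg2 e) = b ^ m) \<and> val (arg2 e) < 2 ^ h \<and> 2 ^ h <= b * val (arg2 e) \<and>
  val (rst3 e) = b * val (arg2 e) \<and> length (arg2 e) <= h \<and> length (rst3 e) <= h + 2 * length bb"

lemma power_entry_next_power:
 assumes entry: "power_entry b (2 ^ j) bb e" and b: "2 <= b"
 shows "power_entry b (2 * 2 ^ j) bb (next_power j (2 ^ j) e)"
proof -
 define h :: nat where "h = 2 ^ j"
 define T where "T = arg2 e"
 obtain m where m: "val T = b ^ m" using entry by (auto simp: power_entry_def T_def)
 have e: "fst e = bb" "val bb = b" "val T < 2 ^ h" "2 ^ h <= b * val T" "length T <= h"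
  using entry by (auto simp: power_entry_def T_def h_def)
 define Q where "Q = fast_mult j T T"
 have Q: "val Q = val T * val T" "length Q = 2 * h" using fast_mult[of T j T] e by (auto simp: Q_def h_def)
 define Qb where "Qb = naive_mult bb Q"
 have Qb: "val Qb = b * (val T * val T)" using Q e by (simp add: Qb_def)
 have square: "(2::nat) ^ (2 * h) = 2 ^ h * 2 ^ h" by (simp add: power_add mult_2)
 define U where "U = (if val Qb < 2 ^ (2 * h) then take (2 * h) Qb else Q)"
 have step: "next_power j h e = (bb, U, naive_mult bb U)"
  using e by (simp add: next_power_def Let_def U_def Qb_def Q_def T_def all_zero_drop)
 have "(\<exists>m. val U = b ^ m) \<and> val U < 2 ^ (2 * h) \<and> 2 ^ (2 * h) <= b * val U \<and> length U <= 2 * h"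
 proof (cases "val Qb < 2 ^ (2 * h)")
  case True
  have "2 ^ h * 2 ^ h <= (b * val T) * (b * val T)" using e by (intro mult_le_mono)
  moreover have "val U = b * (val T * val T)" using True Qb by (simp add: U_def val_take)
  moreover have "\<exists>k. b * (val T * val T) = b ^ k" by (rule exI[of _ "Suc (m + m)"]) (simp add: m power_add)
  ultimately show ?thesis using True Qb square by (simp add: U_def algebra_simps)
 next
  case False
  have "val T * val T < 2 ^ h * 2 ^ h" using e by (intro mult_strict_mono) auto
  moreover have "\<exists>k. val T * val T = b ^ k" by (rule exI[of _ "m + m"]) (simp add: m power_add)
  ultimately show ?thesis using False Q Qb square by (simp add: U_def)
 qed
 then show ?thesis using e step length_naive_mult[of bb U] unfolding power_entry_def h_def[symmetric] by auto
qed

lemma power_entry_powers: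
 assumes "\<And>bb. bb \<in> set bbs ==> 2 <= val bb"
 shows "length (powers bbs j) = length bbs" "i < length bbs ==> power_entry (val (bbs ! i)) (2 ^ j) (bbs ! i) (powers bbs j ! i)"
proof -
 have "length (powers bbs j) = length bbs \<and> (\<forall>i<length bbs. power_entry (val (bbs ! i)) (2 ^ j) (bbs ! i) (powers bbs j ! i))"
 proof (induction j)
  case 0
  have "power_entry (val bb) 1 bb (bb, [True], bb)" if "bb \<in> set bbs" for bb
   using assms[OF that] by (auto simp: power_entry_def intro: exI[of _ 0])
  then show ?case by (simp add: powers_0)
 next
  case (Suc j)
  then show ?case using assms power_entry_next_power by (auto simp: powers_Suc)
 qed
 then show "length (powers bbs j) = length bbs"
  "i < length bbs ==> power_entry (val (bbs ! i)) (2 ^ j) (bbs ! i) (powers bbs j ! i)"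
  by auto
qed

lemma length_powers_entry:
 assumes "\<And>bb. bb \<in> set bbs ==> 2 <= val bb" "e \<in> set (powers bbs j)"
 shows "length (arg2 e) <= 2 ^ j" "fst e \<in> set bbs" "length (rst3 e) <= 2 ^ j + 2 * length (fst e)"
proof -
 obtain i where i: "i < length bbs" "e = powers bbs j ! i"
  using assms(2) power_entry_powers(1)[of bbs j, OF assms(1)] by (auto simp: in_set_conv_nth)
 then have "power_entry (val (bbs ! i)) (2 ^ j) (bbs ! i) e" using power_entry_powers(2)[of bbs i j, OF assms(1)] by auto
 then show "length (arg2 e) <= 2 ^ j" "fst e \<in> set bbs" "length (rst3 e) <= 2 ^ j + 2 * length (fst e)"
  using i(1) by (auto simp: power_entry_def)
qed

lemma length_base_list [simp]: "length (base_list n bb) = n"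
 by (induction n arbitrary: bb) auto

lemma val_nth_base_list: "i < n ==> val (base_list n bb ! i) = val bb + i"
 by (induction n arbitrary: bb i) (auto simp: nth_Cons split: nat.split)

lemma length_nth_base_list: "i < n ==> bb \<noteq> [] ==> length (base_list n bb ! i) = length bb + i"
proof (induction n arbitrary: bb i)
 case (Suc n)
 have "max (length bb) 1 = length bb" using Suc.prems by (cases bb) auto
 then show ?case using Suc.prems Suc.IH[of _ "add_bits False bb [True]"] by (auto simp: nth_Cons split: nat.split)
qed simp

lemma in_base_list: "bb \<in> set (base_list j [False, True]) ==> 2 <= val bb \<and> length bb <= j + 1"
 by (auto simp: in_set_conv_nth val_nth_base_list length_nth_base_list)

definition base_powers :: "nat => nat => entry list" where
 "base_powers j k = powers (base_list j [False, True]) k"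

lemma length_base_powers [simp]: "length (base_powers j k) = j"
 unfolding base_powers_def using power_entry_powers(1)[of "base_list j [False, True]"] in_base_list by simp

lemma power_entry_base_powers:
 assumes "i < j"
 shows "power_entry (i + 2) (2 ^ k) (base_list j [False, True] ! i) (base_powers j k ! i)"
 unfolding base_powers_def
 using power_entry_powers(2)[of "base_list j [False, True]" i k] in_base_list assms by (simp add: val_nth_base_list)

lemma length_base_powers_entry:
 assumes "e \<in> set (base_powers j k)"
 shows "length (arg2 e) <= 2 ^ k" "length (rst3 e) <= 2 ^ k + 2 * (j + 1)"
 using length_powers_entry[of "base_list j [False, True]" e k] in_base_list assms
 unfolding base_powers_def by (blast, fastforce)

definition lower_powers :: "nat => nat => table" where
 "lower_powers j t = take t (tl (power_table (base_list j [False, True]) (j + t)))"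

lemma lower_powers_simps [simp]:
 "lower_powers j 0 = []"
 "lower_powers j (Suc t) = (j + t, 2 ^ (j + t), base_powers j (j + t)) # lower_powers j t"
proof -
 show "lower_powers j (Suc t) = (j + t, 2 ^ (j + t), base_powers j (j + t)) # lower_powers j t"
  using hd_power_table[of "base_list j [False, True]" "j + t"]
  by (cases "power_table (base_list j [False, True]) (j + t)") (auto simp: lower_powers_def base_powers_def Let_def)
qed (simp add: lower_powers_def)

lemma length_lower_powers [simp]: "length (lower_powers j t) = t"
 by (induction t) auto

lemma stage_eq:
 assumes "leaf_level k <= k"
 shows "stage k P = solve (2 ^ leaf_level k) (lower_powers (leaf_level k) (k - leaf_level k))
  (map (start_state k (2 ^ k) P) (base_powers (leaf_level k) k))"
 using hd_power_table[of "base_list (leaf_level k) [False, True]" k] assms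
 by (simp add: stage_def lower_powers_def base_powers_def Let_def)

section \<open>Balanced blocks exist\<close>

lemma power_beats_poly: "100 <= j ==> 13 * (j + 1) ^ 7 <= (2::nat) ^ j"
proof (induction j rule: nat_induct_at_least)
 case base
 then show ?case by simp
next
 case (Suc j)
 have "100 * (j + 2) <= 101 * (j + 1)" using Suc by simp
 then have "(100 * (j + 2)) ^ 7 <= (101 * (j + 1)) ^ 7" by (rule power_mono) simp
 then have "100 ^ 7 * (j + 2) ^ 7 <= 101 ^ 7 * (j + 1) ^ 7" unfolding power_mult_distrib .
 also have "... <= (2 * 100 ^ 7) * (j + 1) ^ 7" by (rule mult_le_mono1) simp
 finally have "100 ^ 7 * (j + 2) ^ 7 <= 100 ^ 7 * (2 * (j + 1) ^ 7)" by (simp only: mult.assoc mult.left_commute)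
 then have "(j + 2) ^ 7 <= 2 * (j + 1) ^ 7" by (subst (asm) mult_le_cancel1) simp
 then have "13 * (j + 2) ^ 7 <= 2 * (13 * (j + 1) ^ 7)" by linarith
 also have "... <= 2 * 2 ^ j" using Suc by simp
 finally show ?case by simp
qed

lemma leaf_block_precision:
 assumes j: "100 <= j" and b: "2 <= b" "b <= j + 1"
 defines "M \<equiv> floor_log b (2 ^ 2 ^ j div 4)"
 shows "12 * (j + 1) ^ 6 < M" "M <= 2 ^ j" "4 * b ^ M <= 2 ^ 2 ^ j" "(2::nat) ^ 2 ^ j < 4 * b ^ Suc M"
proof -
 define E :: nat where "E = 2 ^ j - 2"
 have "(2::nat) ^ 1 <= 2 ^ j" using j by (intro power_increasing) auto
 then have E: "2 ^ j = E + 2" by (simp add: E_def)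
 have R: "(2::nat) ^ 2 ^ j = 4 * 2 ^ E" unfolding E by simp
 have M: "b ^ M <= 2 ^ E" "2 ^ E < b ^ Suc M" using floor_log_bounds[OF b(1), of "2 ^ E"] by (auto simp: M_def R)
 show "4 * b ^ M <= 2 ^ 2 ^ j" "(2::nat) ^ 2 ^ j < 4 * b ^ Suc M" using M by (simp_all add: R)
 have "(2::nat) ^ M <= b ^ M" using b by (intro power_mono) auto
 also have "... <= 2 ^ E" by (rule M)
 finally show "M <= 2 ^ j" by (simp add: E)
 have "2 ^ E < b ^ Suc M" by (rule M)
 also have "... <= (2 ^ b) ^ Suc M" by (rule power_mono) (simp_all add: less_imp_le)
 also have "... = 2 ^ (b * Suc M)" by (simp only: power_mult)
 finally have "E < b * Suc M" by simp
 also have "... <= (j + 1) * Suc M" using b by (intro mult_le_mono1)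
 finally have upper: "2 ^ j < (j + 1) * (M + 1) + 2" by (simp add: E)
 show "12 * (j + 1) ^ 6 < M"
 proof (rule ccontr)
  assume "\<not> ?thesis"
  then have "(j + 1) * (M + 1) <= (j + 1) * (12 * (j + 1) ^ 6 + 1)" by (intro mult_le_mono2) simp
  also have "... = 12 * (j + 1) ^ 7 + (j + 1)" by (simp add: power_Suc[of "j + 1" 6, simplified] algebra_simps del: power_Suc)
  finally have "13 * (j + 1) ^ 7 < 12 * (j + 1) ^ 7 + (j + 1) + 2" using upper power_beats_poly[OF j] by linarith
  moreover have "(j + 1) * (j + 1) <= (j + 1) ^ 7" using power_increasing[of 2 7 "j + 1"] by (simp add: power2_eq_square)
  moreover have "(j + 1) * 3 <= (j + 1) * (j + 1)" using j by (intro mult_le_mono2) simp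
  moreover obtain U where "(j + 1) ^ 7 = U" by blast
  ultimately show False using j by simp
 qed
qed

lemma card_unbalanced_leaf_blocks:
 assumes j: "100 <= j" and i: "i < j" and R: "R = 2 ^ 2 ^ j"
  and v: "Z < R * R" "K <= R * R" "R * R <= 2 * (i + 2) * K"
 defines "M \<equiv> floor_log (i + 2) (R div 4)"
 shows "card {y. y < R \<and> \<not> balanced (i + 2) M j ((i + 2) ^ M * (Z * R + K * y) div (R * R * R) + \<delta>)} * (2 * j) < R"
  (is "card ?S * _ < _")
proof (rule ccontr)
 assume many: "\<not> ?thesis"
 have M: "12 * (j + 1) ^ 6 < M" "4 * (i + 2) ^ M <= R"
  using leaf_block_precision[OF j, of "i + 2"] i by (auto simp: M_def R)
 have "card ?S * M <= 6 * (i + 2) ^ 3 * j\<^sup>2 * R"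
  using card_unbalanced_choices[of "i + 2" M Z "R * R" K R j \<delta>] v M by simp
 also have "... <= 6 * (j + 1) ^ 3 * (j + 1)\<^sup>2 * R" using i by (intro mult_le_mono power_mono) auto
 also have "... = 6 * (j + 1) ^ 5 * R" by (simp only: mult.assoc power_add[symmetric]) simp
 finally have unbalanced: "card ?S * M <= 6 * (j + 1) ^ 5 * R" .
 have "R * M <= card ?S * (2 * j) * M" using many by (intro mult_le_mono1) simp
 also have "... = (card ?S * M) * (2 * j)" by simp
 also have "... <= (6 * (j + 1) ^ 5 * R) * (2 * (j + 1))" by (rule mult_le_mono[OF unbalanced]) simp
 also have "... = R * (12 * (j + 1) ^ 6)" by (simp add: power_Suc[of "Suc j" 5, simplified] algebra_simps del: power_Suc)
 finally have "M <= 12 * (j + 1) ^ 6" unfolding mult_le_cancel1 by (simp add: R)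
 then show False using M(1) by simp
qed

lemma balanced_block_exists:
 fixes j :: nat
 assumes j: "100 <= j" and l: "length vs = j" and R: "R = 2 ^ 2 ^ j"
  and v: "\<And>i. i < j ==> fst (vs ! i) < R * R \<and> snd (vs ! i) <= R * R \<and> R * R <= 2 * (i + 2) * snd (vs ! i)"
 shows "\<exists>y<R. blocks_ok R j y 2 vs"
proof (rule ccontr)
 assume none: "\<not> ?thesis"
 define S where "S i \<delta> = (let M = floor_log (i + 2) (R div 4) in
  {y. y < R \<and> \<not> balanced (i + 2) M j ((i + 2) ^ M * (fst (vs ! i) * R + snd (vs ! i) * y) div (R * R * R) + \<delta>)})" for i \<delta>
 have small: "card (S i \<delta>) * (2 * j) < R" if "i < j" for i \<delta>
  unfolding S_def Let_def using card_unbalanced_leaf_blocks[OF j that R] v[OF that] by blast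
 have "{..<R} \<subseteq> (\<Union>i<j. S i 0 \<union> S i 1)"
 proof
  fix y assume "y \<in> {..<R}"
  then obtain i where "i < j" "\<not> block_ok R j y (2 + i) (vs ! i)" "y < R" using none l by (auto simp: blocks_ok_iff)
  then have "y \<in> S i 0 \<union> S i 1" by (auto simp: block_ok_def block_string_def S_def Let_def add.commute)
  then show "y \<in> (\<Union>i<j. S i 0 \<union> S i 1)" using \<open>i < j\<close> by blast
 qed
 then have "card {..<R} <= card (\<Union>i<j. S i 0 \<union> S i 1)" by (intro card_mono finite_UN_I) (auto simp: S_def Let_def)
 also have "... <= (\<Sum>i<j. card (S i 0 \<union> S i 1))" by (rule card_UN_le) simp
 also have "... <= (\<Sum>i<j. card (S i 0) + card (S i 1))" by (intro sum_mono card_Un_le)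
 finally have "R * (2 * j) <= (\<Sum>i<j. card (S i 0) + card (S i 1)) * (2 * j)" by (simp only: card_lessThan mult_le_mono1)
 also have "... = (\<Sum>i<j. card (S i 0) * (2 * j) + card (S i 1) * (2 * j))" by (simp only: sum_distrib_right distrib_right)
 also have "... < (\<Sum>i<j. R + R)" using j small by (intro sum_strict_mono add_strict_mono) (auto simp: lessThan_empty_iff)
 also have "... = R * (2 * j)" by simp
 finally show False by simp
qed

section \<open>Approximations of the fractional parts\<close>

definition near_power :: "nat => nat => nat => bool" where
 "near_power b m n \<longleftrightarrow> 2 ^ n <= b ^ Suc m \<and> b ^ m <= 2 * 2 ^ n"

text \<open>The state of a node that extends the prefix p of n bits by l bits holds the fractional part of
 b^m p/2^n and the slope b^m/2^n with 2l bits of precision.\<close>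
definition approx :: "nat => nat => nat => nat => nat => nat => state => bool" where
 "approx b p n l m I w \<longleftrightarrow> length (fst w) <= 2 * l \<and> length (snd w) <= 2 * l \<and> 2 ^ n <= b ^ Suc m \<and>
  val (snd w) * 2 ^ n <= 2 ^ (2 * l) * b ^ m \<and> 2 ^ (2 * l) * b ^ m <= (val (snd w) + 2) * 2 ^ n \<and>
  (I * 2 ^ (2 * l) + val (fst w)) * 2 ^ n <= 2 ^ (2 * l) * (b ^ m * p) \<and>
  2 ^ (2 * l) * (b ^ m * p) <= (I * 2 ^ (2 * l) + val (fst w) + 2) * 2 ^ n"

lemma val_less_power: "length xs <= n ==> val xs < 2 ^ n"
 by (rule less_le_trans[OF val_less power_increasing]) auto

lemma approx_near_power:
 assumes state: "approx b p n l m I w"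
 shows "near_power b m n"
proof -
 have "val (snd w) < 2 ^ (2 * l)" using state by (intro val_less_power) (simp add: approx_def)
 then have slope: "val (snd w) + 2 <= 2 ^ (2 * l) * 2" by simp
 have "2 ^ (2 * l) * b ^ m <= (val (snd w) + 2) * 2 ^ n" using state by (simp add: approx_def)
 also have "... <= 2 ^ (2 * l) * 2 * 2 ^ n" using slope by (rule mult_le_mono1)
 finally have "2 ^ (2 * l) * b ^ m <= 2 ^ (2 * l) * (2 * 2 ^ n)" by (simp only: mult.assoc)
 then have "b ^ m <= 2 * 2 ^ n" by (subst (asm) mult_le_cancel1) simp
 then show ?thesis using state by (simp add: near_power_def approx_def)
qed

lemma truncation_bounds:
 fixes X Y Z D :: nat
 assumes D: "0 < D" and lower: "X * Y <= D * D * Z" and upper: "D * D * Z <= (X + 2) * Y"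
 shows "X div D * Y <= D * Z" "D * Z <= (X div D + 2) * Y"
proof -
 have "D * (X div D * Y) = (D * (X div D)) * Y" by simp
 also have "... <= X * Y" by (intro mult_le_mono1) simp
 also have "... <= D * (D * Z)" using lower by (simp add: mult.assoc)
 finally show "X div D * Y <= D * Z" using D by simp
 have "X < D * (X div D + 1)" using D dividend_less_times_div[of D X] by simp
 then have "X + 2 <= D * (X div D + 2)" using D by simp
 then have "(X + 2) * Y <= D * (X div D + 2) * Y" by (rule mult_le_mono1)
 then have "D * (D * Z) <= D * ((X div D + 2) * Y)" using upper by (simp only: mult.assoc)
 then show "D * Z <= (X div D + 2) * Y" using D by simp
qed

lemma approx_left_state:
 assumes "approx b p n (2 * h) m I w"
 shows "approx b p n h m I (left_state h w)"
proof -
 define D :: nat where "D = 2 ^ (2 * h)"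
 have D: "0 < D" "2 ^ (2 * (2 * h)) = D * D" by (auto simp: D_def power_add[symmetric])
 have bounds: "val (snd w) * 2 ^ n <= D * D * b ^ m" "D * D * b ^ m <= (val (snd w) + 2) * 2 ^ n"
  "(I * (D * D) + val (fst w)) * 2 ^ n <= D * D * (b ^ m * p)"
  "D * D * (b ^ m * p) <= (I * (D * D) + val (fst w) + 2) * 2 ^ n"
  using assms unfolding approx_def D(2) by blast+
 have split: "(I * (D * D) + val (fst w)) div D = I * D + val (fst w) div D"
  using D(1) div_mult_self3[of D "I * D" "val (fst w)"] by (simp add: mult.assoc)
 show ?thesis using assms truncation_bounds[OF D(1) bounds(1,2)] truncation_bounds[OF D(1) bounds(3,4)]
  unfolding split by (auto simp: approx_def left_state_def val_drop D_def[symmetric])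
qed

lemma right_slope_bounds:
 fixes K N \<beta> T H b :: nat
 assumes H: "0 < H" and K: "K * N <= H ^ 4 * \<beta>" "H ^ 4 * \<beta> <= (K + 2) * N" and T: "T <= b * H" "4 * b <= H"
 shows "K * T div H ^ 3 * (N * H) <= H ^ 2 * (\<beta> * T)" "H ^ 2 * (\<beta> * T) <= (K * T div H ^ 3 + 2) * (N * H)"
proof -
 define Q where "Q = K * T div H ^ 3"
 have Q: "H ^ 3 * Q <= K * T" "K * T < H ^ 3 * (Q + 1)"
  using H dividend_less_times_div[of "H ^ 3" "K * T"] by (auto simp: Q_def)
 have "H ^ 2 * (Q * (N * H)) = (H ^ 3 * Q) * N" by (simp add: power2_eq_square power3_eq_cube)
 also have "... <= K * T * N" using Q by (intro mult_le_mono1)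
 also have "... = T * (K * N)" by simp
 also have "... <= T * (H ^ 4 * \<beta>)" using K by (intro mult_le_mono2)
 also have "... = H ^ 2 * (H ^ 2 * (\<beta> * T))" by (simp add: power2_eq_square power4_eq_xxxx)
 finally show "Q * (N * H) <= H ^ 2 * (\<beta> * T)" using H by (subst (asm) mult_le_cancel1) simp
 have "2 * T <= 2 * (b * H)" using T(1) by (rule mult_le_mono2)
 also have "... <= (4 * b) * H" by simp
 also have "... <= H * H" using T by (intro mult_le_mono1)
 also have "... <= H ^ 3" using H by (simp add: power3_eq_cube)
 finally have error: "(K + 2) * T <= H ^ 3 * (Q + 2)" using Q by (simp add: algebra_simps)
 have "H ^ 2 * (H ^ 2 * (\<beta> * T)) = T * (H ^ 4 * \<beta>)" by (simp add: power2_eq_square power4_eq_xxxx)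
 also have "... <= T * ((K + 2) * N)" using K by (intro mult_le_mono2)
 also have "... = ((K + 2) * T) * N" by (simp only: ac_simps)
 also have "... <= H ^ 3 * (Q + 2) * N" using error by (rule mult_le_mono1)
 also have "... = H ^ 2 * ((Q + 2) * (N * H))" by (simp add: power2_eq_square power3_eq_cube algebra_simps)
 finally show "H ^ 2 * (\<beta> * T) <= (Q + 2) * (N * H)" using H by (subst (asm) mult_le_cancel1) simp
qed

lemma right_offset_bounds:
 fixes K N \<beta> T H b Z I y p :: nat
 assumes H: "0 < H" and K: "K * N <= H ^ 4 * \<beta>" "H ^ 4 * \<beta> <= (K + 2) * N" and T: "T <= b * H" "4 * b <= H"
  and Z: "(I * H ^ 4 + Z) * N <= H ^ 4 * (\<beta> * p)" "H ^ 4 * (\<beta> * p) <= (I * H ^ 4 + Z + 2) * N" and y: "y <= H"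
 defines "X \<equiv> (Z * H + K * y) * T div H ^ 3"
 shows "(I * T * H ^ 2 + X) * (N * H) <= H ^ 2 * (\<beta> * T * (p * H + y))"
  "H ^ 2 * (\<beta> * T * (p * H + y)) <= (I * T * H ^ 2 + X + 2) * (N * H)"
proof -
 define W where "W = Z * H + K * y"
 have X: "H ^ 3 * X <= W * T" "W * T < H ^ 3 * (X + 1)"
  using H dividend_less_times_div[of "H ^ 3" "W * T"] by (auto simp: X_def W_def)
 have expand: "H ^ 2 * (H ^ 2 * (\<beta> * T * (p * H + y))) = T * (H * (H ^ 4 * (\<beta> * p)) + y * (H ^ 4 * \<beta>))"
  by (simp add: power2_eq_square power4_eq_xxxx algebra_simps)
 have "H ^ 2 * ((I * T * H ^ 2 + X) * (N * H)) = (I * T * H ^ 5 + H ^ 3 * X) * N"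
  by (simp add: power2_eq_square power3_eq_cube eval_nat_numeral algebra_simps)
 also have "... <= (I * T * H ^ 5 + W * T) * N" using X by (intro mult_le_mono1 add_left_mono)
 also have "... = T * (H * ((I * H ^ 4 + Z) * N) + y * (K * N))"
  by (simp add: W_def eval_nat_numeral algebra_simps)
 also have "... <= H ^ 2 * (H ^ 2 * (\<beta> * T * (p * H + y)))"
  unfolding expand using K Z by (intro mult_le_mono2 add_mono) auto
 finally show "(I * T * H ^ 2 + X) * (N * H) <= H ^ 2 * (\<beta> * T * (p * H + y))" using H by (subst (asm) mult_le_cancel1) simp
 have "2 * H * T + 2 * y * T <= 2 * H * T + 2 * H * T" using y by (intro add_mono mult_le_mono) auto
 also have "... <= (4 * H) * (b * H)" using T by simp
 also have "... = (4 * b) * (H * H)" by simp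
 also have "... <= H * (H * H)" using T by (intro mult_le_mono1)
 finally have error: "W * T + 2 * H * T + 2 * y * T <= H ^ 3 * (X + 2)"
  using X by (simp add: power3_eq_cube algebra_simps)
 have "H ^ 2 * (H ^ 2 * (\<beta> * T * (p * H + y))) <= T * (H * ((I * H ^ 4 + Z + 2) * N) + y * ((K + 2) * N))"
  unfolding expand using K Z by (intro mult_le_mono2 add_mono) auto
 also have "... = (I * T * H ^ 5 + (W * T + 2 * H * T + 2 * y * T)) * N" by (simp add: W_def eval_nat_numeral algebra_simps)
 also have "... <= (I * T * H ^ 5 + H ^ 3 * (X + 2)) * N" using error by (intro mult_le_mono1 add_left_mono)
 also have "... = H ^ 2 * ((I * T * H ^ 2 + X + 2) * (N * H))"
  by (simp add: eval_nat_numeral algebra_simps)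
 finally show "H ^ 2 * (\<beta> * T * (p * H + y)) <= (I * T * H ^ 2 + X + 2) * (N * H)" using H by (subst (asm) mult_le_cancel1) simp
qed

abbreviation right_input :: "nat => nat => bool list => entry => state => bool" where
 "right_input j h y e w \<equiv> h = 2 ^ j \<and> length y <= h \<and> length (arg2 e) <= h \<and> length (rst3 e) <= 4 * h \<and>
  length (fst w) <= 4 * h \<and> length (snd w) <= 4 * h"

lemma fast_mult_right:
 assumes "h = 2 ^ j" "length K <= 4 * h" "length T <= 4 * h"
 shows "val (fast_mult (j + 2) K T) = val K * val T" "length (fast_mult (j + 2) K T) = 8 * h"
 using fast_mult[of K "j + 2" T] assms by (simp_all add: power_add)

lemma right_factor_eq:
 assumes "right_input j h y e w"
 shows "right_factor j h (snd w) e = (if val (snd w) * val (rst3 e) < 2 ^ (5 * h) then rst3 e else arg2 e)"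
 using assms by (simp add: right_factor_def all_zero_drop fast_mult_right[of h] del: add_2_eq_Suc')

lemma length_right_factor:
 assumes "right_input j h y e w"
 shows "length (right_factor j h (snd w) e) <= 4 * h"
 using assms by (simp add: right_factor_def)

lemma val_right_state:
 assumes input: "right_input j h y e w" and H: "H = 2 ^ h" "2 <= H"
  and small: "val (snd w) * val (right_factor j h (snd w) e) < H ^ 5"
 shows "val (fst (right_state j h y (e, w))) = (val (fst w) * H + val (snd w) * val y)
   * val (right_factor j h (snd w) e) div H ^ 3 mod H ^ 2"
  "val (snd (right_state j h y (e, w))) = val (snd w) * val (right_factor j h (snd w) e) div H ^ 3"
proof -
 define Z where "Z = fst w"
 define K where "K = snd w"
 define T where "T = right_factor j h K e"
 have h: "h = 2 ^ j" and lens: "length Z <= 4 * h" "length K <= 4 * h" "length y <= 4 * h" "length y <= h" "length T <= 4 * h"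
  using input length_right_factor[OF input] by (auto simp: Z_def K_def T_def)
 have powers: "2 ^ (2 * h) = H ^ 2" "2 ^ (3 * h) = H ^ 3" "2 ^ (4 * h) = H ^ 4" "2 ^ (8 * h) = H ^ 8"
  by (auto simp: H(1) power_mult[symmetric] mult.commute)
 define X where "X = take (8 * h) (add_bits False (replicate h False @ Z) (fast_mult (j + 2) K y))"
 have "val Z * H < H ^ 4 * H" using val_less_power[OF lens(1)] H(2) unfolding powers by simp
 moreover have "val K * val y <= H ^ 4 * H"
  using val_less_power[OF lens(2)] val_less_power[OF lens(4)] unfolding powers H(1)[symmetric] by (intro mult_le_mono) auto
 ultimately have "val Z * H + val K * val y < H ^ 4 * H + H ^ 4 * H" by linarith
 also have "... = 2 * H ^ 5" by (simp add: eval_nat_numeral)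
 also have "... <= H * H ^ 5" using H(2) by (intro mult_le_mono1)
 also have "... <= H ^ 8" using H(2) power_increasing[of 6 8 H] by (simp add: eval_nat_numeral)
 finally have X: "val X = val Z * H + val K * val y"
  unfolding X_def val_take val_add_bits fast_mult_right(1)[OF h lens(2,3)] powers by (simp add: H(1)[symmetric] mult.commute)
 have "length X = 8 * h"
  unfolding X_def length_take length_add_bits fast_mult_right(2)[OF h lens(2,3)] length_append length_replicate
   using lens(1) by linarith
 then have "val (fast_mult (j + 3) X T) = (val Z * H + val K * val y) * val T"
  using fast_mult(1)[of X "j + 3" T] lens(5) X by (simp add: h power_add)
 then show "val (fst (right_state j h y (e, w))) = (val (fst w) * H + val (snd w) * val y)
   * val (right_factor j h (snd w) e) div H ^ 3 mod H ^ 2"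
  unfolding Z_def[symmetric] K_def[symmetric] T_def[symmetric]
  by (simp add: right_state_def Let_def val_take val_drop powers Z_def[symmetric] K_def[symmetric] T_def[symmetric]
   X_def[symmetric] del: add_2_eq_Suc')
 have "val K * val T div H ^ 3 < H ^ 2"
  using small H(2) unfolding K_def[symmetric] T_def[symmetric] by (intro less_mult_imp_div_less) (simp add: power_add[symmetric])
 then show "val (snd (right_state j h y (e, w))) = val (snd w) * val (right_factor j h (snd w) e) div H ^ 3"
  unfolding K_def[symmetric] T_def[symmetric]
  by (simp add: right_state_def Let_def val_take val_drop powers K_def[symmetric] T_def[symmetric]
   fast_mult_right(1)[OF h lens(2,5)] del: add_2_eq_Suc')
qed

lemma right_factor_bounds:
 assumes input: "right_input j h y e w" and entry: "power_entry b h bb e" and b: "0 < b" and H: "H = 2 ^ h"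
  and slope: "val (snd w) * N <= H ^ 4 * \<beta>" and N: "N <= b * \<beta>"
 defines "T \<equiv> val (right_factor j h (snd w) e)"
 shows "\<exists>q. T = b ^ q" "T <= b * H" "val (snd w) * T < H ^ 5" "N * H <= b * (\<beta> * T)"
proof -
 define K where "K = val (snd w)"
 define T0 where "T0 = val (arg2 e)"
 have T0: "T0 < H" "H <= b * T0" "val (rst3 e) = b * T0" using entry H by (auto simp: power_entry_def T0_def)
 obtain q where q: "T0 = b ^ q" using entry by (auto simp: power_entry_def T0_def)
 have "T = (if K * (b * T0) < H ^ 5 then b * T0 else T0)"
  unfolding T_def right_factor_eq[OF input] using T0(3) by (simp add: K_def T0_def H power_mult[symmetric] mult.commute)
 then consider "T = b * T0" "K * (b * T0) < H ^ 5" | "T = T0" "H ^ 5 <= K * (b * T0)" by (cases "K * (b * T0) < H ^ 5") auto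
 then have "(\<exists>q. T = b ^ q) \<and> T <= b * H \<and> K * T < H ^ 5 \<and> N * H <= b * (\<beta> * T)"
 proof cases
  assume T: "T = b * T0" "K * (b * T0) < H ^ 5"
  have "N * H <= (b * \<beta>) * (b * T0)" using N T0 by (intro mult_le_mono)
  then show ?thesis using T T0 q by (auto intro: exI[of _ "Suc q"] simp: mult_ac)
 next
  assume T: "T = T0" "H ^ 5 <= K * (b * T0)"
  have "K < H ^ 4" using val_less_power[of "snd w" "4 * h"] input by (simp add: K_def H power_mult[symmetric] mult.commute)
  then have "K * T0 < H ^ 4 * H" using T0 by (intro mult_strict_mono) auto
  then have small: "K * T < H ^ 5" using T by (simp add: eval_nat_numeral)
  have "H ^ 5 * N <= K * (b * T0) * N" using T by (intro mult_le_mono1)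
  also have "... = (b * T0) * (K * N)" by simp
  also have "... <= (b * T0) * (H ^ 4 * \<beta>)" using slope by (intro mult_le_mono2) (simp add: K_def)
  finally have "H ^ 4 * (N * H) <= H ^ 4 * (b * (\<beta> * T))" by (simp add: T eval_nat_numeral algebra_simps)
  moreover have "T <= b * H" using T(1) T0(1) b by (simp add: order_trans[OF less_imp_le])
  ultimately show ?thesis using T small q H by auto
 qed
 then show "\<exists>q. T = b ^ q" "T <= b * H" "val (snd w) * T < H ^ 5" "N * H <= b * (\<beta> * T)" by (simp_all add: K_def)
qed

lemma approx_right_state:
 assumes h: "h = 2 ^ j" and state: "approx b p n (2 * h) m I w" and entry: "power_entry b h bb e" and b: "2 <= b" "4 * b <= 2 ^ h"
  and bb: "2 * length bb <= 3 * h" and y: "length y = h"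
 shows "\<exists>m' I'. approx b (p * 2 ^ h + val y) (n + h) h m' I' (right_state j h y (e, w))"
proof -
 define H :: nat where "H = 2 ^ h"
 define N :: nat where "N = 2 ^ n"
 have H: "0 < H" "2 <= H" "4 * b <= H" "2 ^ (2 * (2 * h)) = H ^ 4" "2 ^ (2 * h) = H ^ 2" "val y <= H"
  using b val_less[of y] by (auto simp: H_def power_mult[symmetric] mult.commute y)
 have input: "right_input j h y e w" using h state entry bb y by (auto simp: approx_def power_entry_def)
 have w: "N <= b * b ^ m" "val (snd w) * N <= H ^ 4 * b ^ m" "H ^ 4 * b ^ m <= (val (snd w) + 2) * N"
  "(I * H ^ 4 + val (fst w)) * N <= H ^ 4 * (b ^ m * p)" "H ^ 4 * (b ^ m * p) <= (I * H ^ 4 + val (fst w) + 2) * N"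
  using state unfolding approx_def H(4) N_def power_Suc by auto
 define T where "T = val (right_factor j h (snd w) e)"
 have "0 < b" using b by simp
 note factor = right_factor_bounds[OF input entry this H_def w(2,1), folded T_def]
 obtain q where q: "T = b ^ q" using factor(1) by blast
 note vals = val_right_state[OF input H_def H(2), folded T_def, OF factor(3)]
 define X where "X = (val (fst w) * H + val (snd w) * val y) * T div H ^ 3"
 have shift: "(2::nat) ^ (n + h) = N * H" "b ^ (m + q) = b ^ m * T" by (simp_all add: N_def H_def power_add q)
 have integral: "(I * T + X div H ^ 2) * H ^ 2 + X mod H ^ 2 = I * T * H ^ 2 + X"
  by (simp only: add_mult_distrib add.assoc div_mult_mod_eq)
 have "approx b (p * H + val y) (n + h) h (m + q) (I * T + X div H ^ 2) (right_state j h y (e, w))"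
  unfolding approx_def vals X_def[symmetric] shift power_Suc H(5) integral
  using right_slope_bounds[OF H(1) w(2,3) factor(2) H(3)] factor(4)
   right_offset_bounds[OF H(1) w(2,3) factor(2) H(3) w(4,5) H(6), folded X_def]
  by (simp add: right_state_def Let_def)
 then show ?thesis unfolding H_def by blast
qed

lemma approx_start_state:
 assumes entry: "power_entry b (2 ^ k) bb e" and m: "val (arg2 e) = b ^ m" and P: "length P <= 2 ^ k"
 shows "approx b (val P) (2 ^ k) (2 ^ k) m (b ^ m * val P div 2 ^ 2 ^ k) (start_state k (2 ^ k) P e)"
proof -
 define n :: nat where "n = 2 ^ k"
 define N :: nat where "N = 2 ^ n"
 define Q where "Q = b ^ m * val P"
 have T: "length (arg2 e) <= n" "N <= b * b ^ m" using entry m by (auto simp: power_entry_def n_def N_def)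
 have mult: "val (fast_mult k (arg2 e) P) = b ^ m * val P" using fast_mult[of "arg2 e" k P] T P m by (auto simp: n_def)
 have square: "2 ^ (2 * n) = N * N" by (simp add: N_def power_add mult_2)
 have "N * Q = N * (Q div N * N + Q mod N)" by simp
 also have "... = Q div N * (N * N) + N * (Q mod N)" by (simp only: distrib_left ac_simps)
 finally have Q: "Q div N * (N * N) + N * (Q mod N) = N * Q" by simp
 have state: "val (fst (start_state k n P e)) = N * (Q mod N)" "val (snd (start_state k n P e)) = N * b ^ m"
  "length (fst (start_state k n P e)) <= 2 * n" "length (snd (start_state k n P e)) <= 2 * n"
  using T mult m unfolding start_state_def by (auto simp: val_take N_def[symmetric] Q_def)
 show ?thesis unfolding approx_def n_def[symmetric] N_def[symmetric] square state Q_def[symmetric] Q power_Suc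
  using state(3,4) T(2) by (simp add: Q_def algebra_simps)
qed

section \<open>Fair extensions\<close>

lemma near_power_window:
 assumes b: "2 <= b" and m: "near_power b m n" and m': "near_power b m' (n + l)" and M: "4 * b ^ M <= 2 ^ l"
  "2 ^ l < 4 * b ^ Suc M"
 shows "m + M <= m'" "m' <= m + M + 5"
proof -
 have "4 * b ^ M * b ^ m <= 2 ^ l * (2 * 2 ^ n)" using M m by (intro mult_le_mono) (auto simp: near_power_def)
 also have "... = 2 * 2 ^ (n + l)" by (simp add: power_add)
 also have "... <= 2 * b ^ Suc m'" using m' by (simp only: near_power_def mult_le_mono2)
 finally have "4 * b ^ (m + M) <= 2 * b ^ Suc m'" by (simp add: power_add mult_ac)
 moreover have "0 < b ^ (m + M)" using b by simp
 ultimately have "b ^ (m + M) < b ^ Suc m'" by linarith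
 then have "m + M < Suc m'" by (rule power_less_imp_less_exp[rotated]) (use b in simp)
 then show "m + M <= m'" by simp
 have "b ^ m' <= 2 * 2 ^ (n + l)" using m' by (simp add: near_power_def)
 also have "... = 2 * 2 ^ n * 2 ^ l" by (simp add: power_add)
 also have "... <= 2 * b ^ Suc m * (4 * b ^ Suc M)" using M m by (intro mult_le_mono) (auto simp: near_power_def)
 also have "... = 2 ^ 3 * b ^ (m + M + 2)" by (simp add: power_add)
 also have "... <= b ^ 3 * b ^ (m + M + 2)" using b by (intro mult_le_mono1 power_mono) auto
 also have "... = b ^ (m + M + 5)" by (simp only: power_add[symmetric]) (simp add: add.commute)
 finally show "m' <= m + M + 5" by (rule power_le_imp_le_exp[rotated]) (use b in simp)
qed

definition digit_count :: "nat => nat => real => nat => nat => nat" where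
 "digit_count b d z m N = card {i. m <= i \<and> i < N \<and> digit b z i = d}"

lemma digit_count_le: "digit_count b d z m N <= N - m"
proof -
 have "digit_count b d z m N <= card {m..<N}" unfolding digit_count_def by (rule card_mono) auto
 then show ?thesis by simp
qed

lemma digit_count_split:
 assumes "m <= k" "k <= N"
 shows "digit_count b d z m N = digit_count b d z m k + digit_count b d z k N"
proof -
 have "{i. m <= i \<and> i < N \<and> digit b z i = d} = {i. m <= i \<and> i < k \<and> digit b z i = d} \<union> {i. k <= i \<and> i < N \<and> digit b z i = d}"
  using assms by auto
 then have "digit_count b d z m N = card ({i. m <= i \<and> i < k \<and> digit b z i = d} \<union> {i. k <= i \<and> i < N \<and> digit b z i = d})"
  by (simp only: digit_count_def)
 also have "... = digit_count b d z m k + digit_count b d z k N" unfolding digit_count_def by (rule card_Un_disjoint) auto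
 finally show ?thesis .
qed

lemma digit_count_eq_nat_digit_count:
 assumes "0 <= z" "0 < b"
 shows "digit_count b d z m (m + M) = nat_digit_count b d M (nat \<lfloor>z * real b ^ (m + M)\<rfloor>)"
proof (induction M)
 case 0
 then show ?case by (simp add: digit_count_def)
next
 case (Suc M)
 define s where "s = nat \<lfloor>z * real b ^ (m + Suc M)\<rfloor>"
 have s: "\<lfloor>z * real b ^ (m + Suc M)\<rfloor> = int s" using assms by (simp add: s_def)
 then have "\<lfloor>z * real b ^ (m + M)\<rfloor> = int s div int b" using floor_mult_power_div[OF assms(2), of z "m + M" 1] by simp
 then have front: "nat \<lfloor>z * real b ^ (m + M)\<rfloor> = s div b" by (simp add: zdiv_int[symmetric])
 have "digit b z (m + M) = s mod b" using s by (simp add: digit_def zmod_int[symmetric])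
 then have "{i. m + M <= i \<and> i < m + Suc M \<and> digit b z i = d} = (if s mod b = d then {m + M} else {})"
  by (auto simp: less_Suc_eq)
 then have last: "digit_count b d z (m + M) (m + Suc M) = (if s mod b = d then 1 else 0)" by (simp add: digit_count_def)
 have "digit_count b d z m (m + Suc M) = digit_count b d z m (m + M) + digit_count b d z (m + M) (m + Suc M)"
  by (rule digit_count_split) auto
 then show ?case unfolding last s_def[symmetric] using Suc front by simp
qed

definition truncation :: "real => nat => nat => bool" where
 "truncation z n x \<longleftrightarrow> real x <= z * 2 ^ n \<and> z * 2 ^ n <= real (x + 1)"

lemma truncation_prefix:
 assumes trunc: "truncation z (n + l) (x * 2 ^ l + y)" and y: "y < 2 ^ l"
 shows "truncation z n x"
proof -
 have pos: "(0::real) < 2 ^ l" by simp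
 have "real x * 2 ^ l <= real (x * 2 ^ l + y)" by simp
 also have "... <= (z * 2 ^ n) * 2 ^ l" using trunc by (simp add: truncation_def power_add mult.assoc)
 finally have lower: "real x <= z * 2 ^ n" using pos by (simp only: mult_le_cancel_right_pos)
 have "(z * 2 ^ n) * 2 ^ l <= real (x * 2 ^ l + y + 1)" using trunc by (simp add: truncation_def power_add mult.assoc)
 also have "... <= real ((x + 1) * 2 ^ l)" using y by (intro of_nat_mono) simp
 also have "... = real (x + 1) * 2 ^ l" by (simp only: of_nat_mult of_nat_power of_nat_numeral)
 finally have "z * 2 ^ n <= real (x + 1)" using pos by (simp only: mult_le_cancel_right_pos)
 then show ?thesis using lower by (simp add: truncation_def)
qed

lemma approx_scaled_bounds:
 fixes z :: real
 assumes state: "approx b p n l m I w" and l: "2 <= l" and y: "y < 2 ^ l" and trunc: "truncation z (n + l) (p * 2 ^ l + y)"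
 defines "R \<equiv> 2 ^ l :: nat"
 defines "Q \<equiv> val (fst w) * R + val (snd w) * y"
 shows "real (I * (R * R) * R + Q) <= real (R * R * R) * (z * real b ^ m)"
  "real (R * R * R) * (z * real b ^ m) <= real (I * (R * R) * R + Q + 2 * (R * R))"
proof -
 define C where "C = R * R"
 define N :: nat where "N = 2 ^ n"
 define \<beta> where "\<beta> = b ^ m"
 define Z where "Z = val (fst w)"
 define K where "K = val (snd w)"
 have R: "4 <= R" using l power_increasing[of 2 l "2::nat"] by (simp add: R_def)
 have "2 ^ (2 * l) = C" by (simp add: C_def R_def power_add[symmetric] mult_2)
 then have bounds: "K * N <= C * \<beta>" "C * \<beta> <= (K + 2) * N" "(I * C + Z) * N <= C * (\<beta> * p)"
  "C * (\<beta> * p) <= (I * C + Z + 2) * N" "K <= C"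
  using state val_less_power[of "snd w" "2 * l"] unfolding approx_def N_def \<beta>_def Z_def K_def by auto
 have pos: "0 < real N" by (simp add: N_def)
 have z: "real (p * R + y) <= z * (real N * real R)" "z * (real N * real R) <= real (p * R + y + 1)"
  using trunc by (simp_all add: truncation_def R_def N_def power_add)
 have "(I * C * R + Q) * N = R * ((I * C + Z) * N) + y * (K * N)" by (simp add: Q_def Z_def K_def algebra_simps)
 also have "... <= R * (C * (\<beta> * p)) + y * (C * \<beta>)" using bounds by (intro add_mono mult_le_mono2)
 also have "... = C * \<beta> * (p * R + y)" by (simp add: algebra_simps)
 finally have "real ((I * C * R + Q) * N) <= real (C * \<beta> * (p * R + y))" by (simp only: of_nat_le_iff)
 also have "... = real (C * \<beta>) * real (p * R + y)" by simp
 also have "... <= real (C * \<beta>) * (z * (real N * real R))" using z by (intro mult_left_mono) auto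
 finally have "real (I * C * R + Q) * real N <= (real (C * R) * (z * real \<beta>)) * real N" by (simp add: ac_simps)
 then show "real (I * (R * R) * R + Q) <= real (R * R * R) * (z * real b ^ m)"
  using pos by (simp only: mult_le_cancel_right_pos C_def \<beta>_def of_nat_power)
 have "4 * R <= C" "y + 1 <= R" using R y by (simp_all add: C_def R_def)
 then have "(I * C + Z + 2) * R + (K + 2) * (y + 1) <= I * C * R + Q + 2 * C"
  using bounds(5) by (simp add: Q_def Z_def K_def algebra_simps)
 then have error: "((I * C + Z + 2) * R + (K + 2) * (y + 1)) * N <= (I * C * R + Q + 2 * C) * N" by (rule mult_le_mono1)
 have "C * \<beta> * (p * R + y + 1) = R * (C * (\<beta> * p)) + (y + 1) * (C * \<beta>)" by (simp add: algebra_simps)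
 also have "... <= R * ((I * C + Z + 2) * N) + (y + 1) * ((K + 2) * N)" using bounds by (intro add_mono mult_le_mono2)
 also have "... <= (I * C * R + Q + 2 * C) * N" using error by (simp add: algebra_simps)
 finally have upper: "real (C * \<beta> * (p * R + y + 1)) <= real ((I * C * R + Q + 2 * C) * N)" by (simp only: of_nat_le_iff)
 have "real (C * \<beta>) * (z * (real N * real R)) <= real (C * \<beta>) * real (p * R + y + 1)" using z by (intro mult_left_mono) auto
 also have "... <= real ((I * C * R + Q + 2 * C) * N)" using upper by (simp only: of_nat_mult)
 finally have "(real (C * R) * (z * real \<beta>)) * real N <= real (I * C * R + Q + 2 * C) * real N"
  by (simp only: of_nat_mult ac_simps)
 then show "real (R * R * R) * (z * real b ^ m) <= real (I * (R * R) * R + Q + 2 * (R * R))"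
  using pos by (simp only: mult_le_cancel_right_pos C_def \<beta>_def of_nat_power)
qed

lemma floor_mult_approx:
 fixes x :: real and A C I Q R :: nat
 assumes R: "0 < R" "0 < C" "2 * A <= R"
  and lower: "real (I * C * R + Q) <= real (C * R) * x" and upper: "real (C * R) * x <= real (I * C * R + Q + 2 * C)"
 defines "s \<equiv> A * Q div (C * R)"
 shows "\<lfloor>real A * x\<rfloor> = int (I * A + s) \<or> \<lfloor>real A * x\<rfloor> = int (I * A + Suc s)"
proof -
 have s: "s * (C * R) <= A * Q" "A * Q < (s + 1) * (C * R)"
  using R dividend_less_div_times[of "C * R" "A * Q"] by (auto simp: s_def)
 have pos: "0 < real (C * R)" using R by simp
 have "real (I * A + s) * real (C * R) = real (I * A * C * R + s * (C * R))" by (simp add: algebra_simps)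
 also have "... <= real (I * A * C * R + A * Q)" using s by (simp only: of_nat_le_iff add_left_mono)
 also have "... = real A * real (I * C * R + Q)" by (simp add: algebra_simps)
 also have "... <= real A * (real (C * R) * x)" using lower by (intro mult_left_mono) auto
 also have "... = real A * x * real (C * R)" by simp
 finally have "real (I * A + s) <= real A * x" using pos by (simp only: mult_le_cancel_right_pos)
 then have "int (I * A + s) <= \<lfloor>real A * x\<rfloor>" by (simp add: le_floor_iff)
 moreover have "real A * x < real (I * A + s + 2)"
 proof -
  have "real A * x * real (C * R) = real A * (real (C * R) * x)" by simp
  also have "... <= real A * real (I * C * R + Q + 2 * C)" using upper by (intro mult_left_mono) auto
  also have "... = real (I * A * C * R + A * Q + 2 * A * C)" by (simp add: algebra_simps)
  also have "... < real (I * A * C * R + (s + 1) * (C * R) + R * C)"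
   using s(2) mult_le_mono1[OF R(3), of C] by (simp only: of_nat_less_iff)
  also have "... = real (I * A + s + 2) * real (C * R)" by (simp add: algebra_simps)
  finally show ?thesis using pos by (simp only: mult_less_cancel_right_pos)
 qed
 then have "\<lfloor>real A * x\<rfloor> < int (I * A + s + 2)" by (simp add: floor_less_iff)
 ultimately show ?thesis by linarith
qed

lemma digit_count_leaf_block:
 assumes b: "0 < b" "d < b" and z: "0 <= z" and state: "approx b p n l m I w" and l: "2 <= l" and y: "y < 2 ^ l"
  and trunc: "truncation z (n + l) (p * 2 ^ l + y)" and ok: "block_ok (2 ^ l) B y b (val (fst w), val (snd w))"
  and M: "4 * b ^ M <= 2 ^ l" "M = floor_log b (2 ^ l div 4)"
 shows "B * b * digit_count b d z m (m + M) <= (B + 1) * M"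
proof -
 define R :: nat where "R = 2 ^ l"
 define s where "s = b ^ M * (val (fst w) * R + val (snd w) * y) div (R * R * R)"
 have balanced: "balanced b M B s" "balanced b M B (Suc s)" using ok M(2)
  by (auto simp: block_ok_def block_string_def Let_def s_def R_def)
 note scaled = approx_scaled_bounds[OF state l y trunc, folded R_def]
 have "\<lfloor>real (b ^ M) * (z * real b ^ m)\<rfloor> = int (I * b ^ M + s) \<or> \<lfloor>real (b ^ M) * (z * real b ^ m)\<rfloor> = int (I * b ^ M + Suc s)"
  unfolding s_def by (rule floor_mult_approx[OF _ _ _ scaled]) (use M(1) in \<open>auto simp: R_def\<close>)
 moreover have "real (b ^ M) * (z * real b ^ m) = z * real b ^ (m + M)" by (simp add: power_add)
 ultimately have "nat \<lfloor>z * real b ^ (m + M)\<rfloor> = I * b ^ M + s \<or> nat \<lfloor>z * real b ^ (m + M)\<rfloor> = I * b ^ M + Suc s"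
  by (metis nat_int)
 moreover have "nat_digit_count b d M (I * b ^ M + s') = nat_digit_count b d M s'" for s'
  using nat_digit_count_mod[OF b(1), of d M "I * b ^ M + s'"] nat_digit_count_mod[OF b(1), of d M s'] by simp
 ultimately have "digit_count b d z m (m + M) = nat_digit_count b d M s \<or> digit_count b d z m (m + M)
   = nat_digit_count b d M (Suc s)"
  unfolding digit_count_eq_nat_digit_count[OF z b(1)] by metis
 then show ?thesis using balanced b(2) unfolding balanced_def by metis
qed

definition fair :: "nat => nat => real => nat => nat => bool" where
 "fair j b z m m' \<longleftrightarrow> m <= m' \<and> (\<forall>d<b. j * b * digit_count b d z m m' <= (j + 6) * (m' - m) \<and>
  (\<forall>N. m <= N \<and> N <= m' \<longrightarrow> j * b * digit_count b d z m N <= (j + 6) * (N - m) + j * b * (2 ^ j + 5)))"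

lemma fair_trans:
 assumes fair: "fair j b z m k" "fair j b z k m'"
 shows "fair j b z m m'"
 unfolding fair_def
proof (intro conjI allI impI)
 have order: "m <= k" "k <= m'" using fair by (auto simp: fair_def)
 then show "m <= m'" by simp
 fix d assume d: "d < b"
 have first: "j * b * digit_count b d z m k <= (j + 6) * (k - m)" using fair d by (simp add: fair_def)
 have "j * b * digit_count b d z k m' <= (j + 6) * (m' - k)" using fair d by (simp add: fair_def)
 then have "j * b * digit_count b d z m m' <= (j + 6) * (k - m) + (j + 6) * (m' - k)"
  using first digit_count_split[OF order, of b d z] by (simp add: distrib_left)
 also have "... = (j + 6) * (m' - m)" using order by (simp only: add_mult_distrib2[symmetric]) simp
 finally show "j * b * digit_count b d z m m' <= (j + 6) * (m' - m)" .
 fix N assume N: "m <= N \<and> N <= m'"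
 show "j * b * digit_count b d z m N <= (j + 6) * (N - m) + j * b * (2 ^ j + 5)"
 proof (cases "N <= k")
  case True
  then show ?thesis using fair(1) d N unfolding fair_def by blast
 next
  case False
  then have k: "k <= N" by simp
  have "j * b * digit_count b d z k N <= (j + 6) * (N - k) + j * b * (2 ^ j + 5)"
   using fair(2) d N k unfolding fair_def by blast
  then have "j * b * digit_count b d z m N <= (j + 6) * (k - m) + (j + 6) * (N - k) + j * b * (2 ^ j + 5)"
   using first digit_count_split[OF order(1) k, of b d z] by (simp only: distrib_left)
  also have "(j + 6) * (k - m) + (j + 6) * (N - k) = (j + 6) * (N - m)" using order k
   by (simp only: add_mult_distrib2[symmetric]) simp
  finally show ?thesis .
 qed
qed

lemma fair_leaf_block:
 assumes j: "100 <= j" and b: "2 <= b" "b <= j + 1" and z: "0 <= z"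
  and state: "approx b p n (2 ^ j) m I w" and near: "near_power b m' (n + 2 ^ j)" and y: "y < 2 ^ 2 ^ j"
  and trunc: "truncation z (n + 2 ^ j) (p * 2 ^ 2 ^ j + y)" and ok: "block_ok (2 ^ 2 ^ j) j y b (val (fst w), val (snd w))"
 shows "fair j b z m m'"
proof -
 define M where "M = floor_log b (2 ^ 2 ^ j div 4)"
 have M: "12 * (j + 1) ^ 6 < M" "M <= 2 ^ j" "4 * b ^ M <= 2 ^ 2 ^ j" "(2::nat) ^ 2 ^ j < 4 * b ^ Suc M"
  using leaf_block_precision[OF j b] by (auto simp: M_def)
 have window: "m + M <= m'" "m' <= m + M + 5" using near_power_window[OF b(1) approx_near_power[OF state] near M(3,4)] by auto
 have "j * b <= (j + 1) * (j + 1)" using b by (intro mult_le_mono) auto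
 also have "... <= (j + 1) ^ 6" using power_increasing[of 2 6 "j + 1"] by (simp add: power2_eq_square)
 finally have block_large: "j * b <= M" using M(1) by linarith
 have "(2::nat) ^ 1 <= 2 ^ j" using j by (intro power_increasing) auto
 then have count: "j * b * digit_count b d z m (m + M) <= (j + 1) * M" if "d < b" for d
  using digit_count_leaf_block[OF _ that z state _ y trunc ok M(3) M_def] b by simp
 show ?thesis unfolding fair_def
 proof (intro conjI allI impI)
  show "m <= m'" using window by simp
  fix d assume d: "d < b"
  have "digit_count b d z m m' <= digit_count b d z m (m + M) + 5"
   using digit_count_split[of m "m + M" m' b d z] digit_count_le[of b d z "m + M" m'] window by simp
  then have "j * b * digit_count b d z m m' <= j * b * (digit_count b d z m (m + M) + 5)" by (rule mult_le_mono2)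
  also have "... = j * b * digit_count b d z m (m + M) + 5 * (j * b)" by (simp only: distrib_left mult.commute)
  also have "... <= (j + 1) * M + 5 * M" using count[OF d] block_large by (intro add_mono mult_le_mono2)
  also have "... = (j + 6) * M" by (simp add: algebra_simps)
  also have "... <= (j + 6) * (m' - m)" using window by (intro mult_le_mono2) simp
  finally show "j * b * digit_count b d z m m' <= (j + 6) * (m' - m)" .
  fix N assume N: "m <= N \<and> N <= m'"
  have "digit_count b d z m N <= 2 ^ j + 5" using digit_count_le[of b d z m N] N window M(2) by linarith
  then show "j * b * digit_count b d z m N <= (j + 6) * (N - m) + j * b * (2 ^ j + 5)" by (rule trans_le_add2[OF mult_le_mono2])
 qed
qed

lemma base_size_bounds:
 assumes "100 <= j" "b <= j + 1"
 shows "4 * b <= 2 ^ 2 ^ (j + t)" "2 * b <= 3 * 2 ^ (j + t)"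
proof -
 obtain U where U: "(j + 1) ^ 7 = U" by blast
 have "j + 1 <= U" unfolding U[symmetric] by (rule self_le_power) auto
 then have "4 * b <= 2 ^ j" using power_beats_poly[OF assms(1), unfolded U] assms(2) by linarith
 moreover have "(2::nat) ^ j <= 2 ^ (j + t)" by (rule power_increasing) auto
 moreover have "(2::nat) ^ (j + t) < 2 ^ 2 ^ (j + t)" by (rule less_exp)
 ultimately show "4 * b <= 2 ^ 2 ^ (j + t)" "2 * b <= 3 * 2 ^ (j + t)" by linarith+
qed

definition approx_all :: "nat => nat => nat => nat => state list => bool" where
 "approx_all j p n l sts \<longleftrightarrow> length sts = j \<and> (\<forall>i<j. \<exists>m I. approx (i + 2) p n l m I (sts ! i))"

lemma leaf_block_ok:
 assumes j: "100 <= j" and states: "approx_all j p n (2 ^ j) sts"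
 shows "val (leaf_block (2 ^ j) sts) < 2 ^ 2 ^ j"
  "i < j ==> block_ok (2 ^ 2 ^ j) j (val (leaf_block (2 ^ j) sts)) (i + 2) (val (fst (sts ! i)), val (snd (sts ! i)))"
proof -
 define R :: nat where "R = 2 ^ 2 ^ j"
 define vs where "vs = map (%w. (val (fst w), val (snd w))) sts"
 have square: "(2::nat) ^ (2 * 2 ^ j) = R * R" by (simp add: R_def power_add[symmetric] mult_2)
 have l: "length sts = j" using states by (simp add: approx_all_def)
 have vs: "fst (vs ! i) < R * R \<and> snd (vs ! i) <= R * R \<and> R * R <= 2 * (i + 2) * snd (vs ! i)" if i: "i < j" for i
 proof -
  obtain m I where state: "approx (i + 2) p n (2 ^ j) m I (sts ! i)" using states i by (auto simp: approx_all_def)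
  define K where "K = val (snd (sts ! i))"
  have len: "length (fst (sts ! i)) <= 2 * 2 ^ j" "length (snd (sts ! i)) <= 2 * 2 ^ j" using state by (auto simp: approx_def)
  have "R * R * (i + 2) ^ m <= (K + 2) * 2 ^ n" using state by (simp only: approx_def square K_def)
  also have "... <= (K + 2) * (i + 2) ^ Suc m" using state by (intro mult_le_mono2) (simp only: approx_def)
  finally have "(i + 2) ^ m * (R * R) <= (i + 2) ^ m * ((K + 2) * (i + 2))" by (simp only: power_Suc ac_simps)
  then have "R * R <= (K + 2) * (i + 2)" by (subst (asm) mult_le_cancel1) simp
  then have slope: "R * R <= (i + 2) * K + 2 * (i + 2)" by (simp add: algebra_simps)
  have "4 * (i + 2) <= R" using base_size_bounds(1)[OF j, of "i + 2" 0] i by (simp add: R_def)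
  also have "... <= R * R" by (simp add: R_def)
  finally have "R * R <= 2 * ((i + 2) * K)" using slope by linarith
  then show ?thesis using i l val_less_power[OF len(1)] val_less_power[OF len(2)]
   by (simp add: vs_def square K_def mult.assoc less_imp_le)
 qed
 obtain y where y: "y < R" "blocks_ok R j y 2 vs" using balanced_block_exists[OF j _ R_def vs] l by (auto simp: vs_def)
 have less: "search R j vs R < R" by (rule search_less) (simp add: R_def)
 then have block: "val (leaf_block (2 ^ j) sts) = search R j vs R" using l by (simp add: leaf_block_def vs_def R_def)
 show "val (leaf_block (2 ^ j) sts) < 2 ^ 2 ^ j" using less unfolding block R_def .
 show "block_ok (2 ^ 2 ^ j) j (val (leaf_block (2 ^ j) sts)) (i + 2) (val (fst (sts ! i)), val (snd (sts ! i)))" if "i < j"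
  using search_ok[OF y] that l unfolding block blocks_ok_iff R_def[symmetric] by (auto simp: vs_def add.commute)
qed

lemma approx_all_left_states:
 "approx_all j p n (2 * h) sts ==> approx_all j p n h (map (left_state h) sts)"
 unfolding approx_all_def by (auto, meson approx_left_state)

lemma approx_right_state_nth:
 assumes j: "100 <= j" and i: "i < j" and h: "h = 2 ^ (j + t)" and y: "length y = h"
  and state: "approx (i + 2) p n (2 * h) m I w"
 shows "\<exists>m' I'. approx (i + 2) (p * 2 ^ h + val y) (n + h) h m' I' (right_state (j + t) h y (base_powers j (j + t) ! i, w))"
 using approx_right_state[OF h state, of "base_list j [False, True] ! i" "base_powers j (j + t) ! i" y]
  power_entry_base_powers[OF i, of "j + t"] base_size_bounds[OF j, of "i + 2" t] i y h
 by (simp add: length_nth_base_list)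

lemma approx_all_right_states:
 assumes "100 <= j" "h = 2 ^ (j + t)" "length y = h" and states: "approx_all j p n (2 * h) sts"
 shows "approx_all j (p * 2 ^ h + val y) (n + h) h (map (right_state (j + t) h y) (zip (base_powers j (j + t)) sts))"
 unfolding approx_all_def
proof (intro conjI allI impI)
 fix i assume i: "i < j"
 then obtain m I where "approx (i + 2) p n (2 * h) m I (sts ! i)" using states by (auto simp: approx_all_def)
 from approx_right_state_nth[OF assms(1) i assms(2,3) this] show "\<exists>m I. approx (i + 2) (p * 2 ^ h + val y) (n + h) h m I
  (map (right_state (j + t) h y) (zip (base_powers j (j + t)) sts) ! i)"
  using states i by (simp add: approx_all_def)
qed (use states in \<open>simp add: approx_all_def\<close>)

lemma fair_solve:
 fixes z :: real
 assumes j: "100 <= j" and z: "0 <= z" and i: "i < j"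
 shows "approx_all j p n (2 ^ (j + t)) sts ==> approx (i + 2) p n (2 ^ (j + t)) m I (sts ! i) ==>
  truncation z (n + 2 ^ (j + t)) (p * 2 ^ 2 ^ (j + t) + val (solve (2 ^ j) (lower_powers j t) sts)) ==>
  near_power (i + 2) m' (n + 2 ^ (j + t)) ==> fair j (i + 2) z m m'"
proof (induction t arbitrary: sts p n m I m')
 case 0
 then show ?case
  using fair_leaf_block[OF j _ _ z, of "i + 2" p n m I "sts ! i" m' "val (leaf_block (2 ^ j) sts)"]
   leaf_block_ok[OF j, of p n sts] i by simp
next
 case (Suc t)
 define h :: nat where "h = 2 ^ (j + t)"
 define y where "y = solve (2 ^ j) (lower_powers j t) (map (left_state h) sts)"
 define sts' where "sts' = map (right_state (j + t) h y) (zip (base_powers j (j + t)) sts)"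
 define y' where "y' = solve (2 ^ j) (lower_powers j t) sts'"
 have double: "2 ^ (j + Suc t) = 2 * h" by (simp add: h_def)
 note prems = Suc.prems[unfolded double]
 have len: "length y = h" "length y' = h" by (simp_all add: y_def y'_def length_solve h_def power_add)
 have l: "length sts = j" using prems(1) by (simp add: approx_all_def)
 have append: "solve (2 ^ j) (lower_powers j (Suc t)) sts = y' @ y" by (simp add: Let_def y_def y'_def sts'_def h_def)
 have "p * 2 ^ (h + h) + val (y' @ y) = (p * 2 ^ h + val y) * 2 ^ h + val y'"
  by (simp add: len power_add algebra_simps)
 then have trunc: "truncation z (n + h + h) ((p * 2 ^ h + val y) * 2 ^ h + val y')"
  using prems(3) by (simp only: append mult_2 add.assoc)
 have "val y' < 2 ^ h" using val_less[of y'] by (simp add: len)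
 note trunc_left = truncation_prefix[OF trunc this]
 obtain m' I' where right: "approx (i + 2) (p * 2 ^ h + val y) (n + h) h m' I' (sts' ! i)"
  using approx_right_state_nth[OF j i h_def len(1) prems(2)] i l by (auto simp: sts'_def)
 have "approx (i + 2) p n h m I (map (left_state h) sts ! i)" using approx_left_state[OF prems(2)] i l by simp
 from Suc.IH[folded h_def, OF approx_all_left_states[OF prems(1)] this trunc_left[unfolded y_def] approx_near_power[OF right]]
 have "fair j (i + 2) z m m'" .
 moreover have "fair j (i + 2) z m' m''" if "near_power (i + 2) m'' (n + h + h)" for m''
  using Suc.IH[folded h_def, OF approx_all_right_states[OF j h_def len(1) prems(1)], folded sts'_def, OF right
   trunc[unfolded y'_def] that] .
 ultimately show ?case using prems(4) by (auto intro: fair_trans simp: mult_2 add.assoc)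
qed

definition digits_known :: "nat => nat => nat" where "digits_known b k = floor_log b (2 ^ 2 ^ k - 1)"

lemma digits_known: "2 <= b ==> b ^ digits_known b k < 2 ^ 2 ^ k \<and> 2 ^ 2 ^ k <= b ^ Suc (digits_known b k)"
proof -
 assume b: "2 <= b"
 have "(1::nat) < 2 ^ 2 ^ k" by (rule one_less_power) auto
 then show ?thesis using floor_log_bounds[OF b, of "2 ^ 2 ^ k - 1"] unfolding digits_known_def by linarith
qed

lemma digits_known_unique:
 assumes b: "2 <= b" and m: "b ^ m < 2 ^ 2 ^ k" "2 ^ 2 ^ k <= b * b ^ m"
 shows "m = digits_known b k"
proof -
 have "b ^ m < b ^ Suc (digits_known b k)" using m digits_known[OF b, of k] by linarith
 then have "m < Suc (digits_known b k)" by (rule power_less_imp_less_exp[rotated]) (use b in simp)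
 moreover have "b ^ digits_known b k < b ^ Suc m" using m digits_known[OF b, of k] unfolding power_Suc by linarith
 then have "digits_known b k < Suc m" by (rule power_less_imp_less_exp[rotated]) (use b in simp)
 ultimately show ?thesis by simp
qed

lemma leaf_level_ge: "2 ^ 2 ^ a <= k ==> a + 3 <= leaf_level k"
 unfolding leaf_level_def by (intro add_mono floor_log_ge) auto

lemma leaf_level_le:
 assumes k: "4 <= k"
 shows "2 ^ leaf_level k <= 8 * k" "leaf_level k <= k" "4 <= leaf_level k" "2 ^ leaf_level k <= 8 * floor_log 2 k"
proof -
 define l where "l = floor_log 2 k"
 define a where "a = floor_log 2 l"
 have l: "2 <= l" using floor_log_ge[of 2 k] k by (simp add: l_def)
 have a: "1 <= a" using floor_log_ge[of 1 l] l by (simp add: a_def)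
 have pow_a: "2 ^ a <= l" using floor_log_bounds[of 2 l] l by (simp add: a_def)
 have pow_l: "2 ^ l <= k" using floor_log_bounds[of 2 k] k by (simp add: l_def)
 have level: "leaf_level k = a + 3" by (simp add: leaf_level_def a_def l_def)
 have l_less: "l < 2 ^ l" by (rule less_exp)
 show "4 <= leaf_level k" using a level by simp
 show "2 ^ leaf_level k <= 8 * floor_log 2 k" using pow_a by (simp add: level power_add l_def)
 then show "2 ^ leaf_level k <= 8 * k" using l_less pow_l unfolding l_def by linarith
 have "a + 3 <= 2 ^ (a + 1)" using a by (induction a rule: nat_induct_at_least) auto
 also have "... <= 2 ^ l" using less_le_trans[OF less_exp pow_a] by (intro power_increasing) auto
 finally show "leaf_level k <= k" using pow_l level by linarith
qed

lemma length_stage: "4 <= k ==> length (stage k P) = 2 ^ k"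
 using leaf_level_le(2)[of k] by (simp add: stage_eq length_solve power_add[symmetric])

lemma length_prefix_bits: "length (prefix_bits t) = 2 ^ (t + 4)"
 by (induction t) (auto simp: length_stage power_add)

lemma approx_start_state_nth:
 assumes i: "i < j" and P: "length P = 2 ^ k"
 shows "\<exists>I. approx (i + 2) (val P) (2 ^ k) (2 ^ k) (digits_known (i + 2) k) I (start_state k (2 ^ k) P (base_powers j k ! i))"
proof -
 note entry = power_entry_base_powers[OF i, of k]
 obtain m where m: "val (arg2 (base_powers j k ! i)) = (i + 2) ^ m" using entry by (auto simp: power_entry_def)
 have "m = digits_known (i + 2) k" using entry m by (intro digits_known_unique) (auto simp: power_entry_def)
 then show ?thesis using approx_start_state[OF entry m eq_refl[OF P]] by blast
qed

lemma fair_stage: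
 fixes z :: real
 assumes k: "4 <= k" and j: "j = leaf_level k" "100 <= j" and b: "2 <= b" "b <= j + 1" and P: "length P = 2 ^ k" and z: "0 <= z"
  and trunc: "truncation z (2 ^ k + 2 ^ k) (val P * 2 ^ 2 ^ k + val (stage k P))"
 shows "fair j b z (digits_known b k) (digits_known b (Suc k))"
proof -
 define i where "i = b - 2"
 have i: "b = i + 2" "i < j" using b by (auto simp: i_def)
 define t where "t = k - j"
 have t: "j + t = k" using leaf_level_le(2)[OF k] j by (simp add: t_def)
 define sts where "sts = map (start_state k (2 ^ k) P) (base_powers j k)"
 have stage: "stage k P = solve (2 ^ j) (lower_powers j t) sts"
  using leaf_level_le(2)[OF k] by (simp add: stage_eq j(1) t_def sts_def)
 obtain I where I: "approx (i + 2) (val P) (2 ^ k) (2 ^ k) (digits_known (i + 2) k) I (sts ! i)"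
  using approx_start_state_nth[OF i(2) P] i(2) by (auto simp: sts_def)
 have states: "approx_all j (val P) (2 ^ k) (2 ^ k) sts"
  unfolding approx_all_def using approx_start_state_nth[OF _ P, of _ j] by (force simp: sts_def)
 have near: "near_power (i + 2) (digits_known (i + 2) (Suc k)) (2 ^ k + 2 ^ k)"
  using digits_known[of "i + 2" "Suc k"] by (simp add: near_power_def mult_2)
 show ?thesis unfolding i(1) using fair_solve[OF j(2) z i(2), of _ _ t, unfolded t, OF states I trunc[unfolded stage] near] .
qed

section \<open>Cost of the algorithm\<close>

lemma computes_all_zero_id: "computes (%_. True) all_zero (%x. length x)"
 by (rule computes_recursion[where p = "%x. x = []" and base = "%x. True" and s = tl
  and post = "%y. snd y \<and> \<not> hd (fst y)" and W = "%_. 0" and K = 1],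
  (rule computes_intros | force simp: all_zero_def neq_Nil_conv)+)

lemmas computes_all_zero [computes_intros] = computes_total_comp[OF computes_all_zero_id]

lemma computes_floor_log_uncurried: "computes (%_. True) (%x. floor_log (fst x) (snd x)) (%x. 8 * snd x + fst x)"
proof (rule computes_recursion[where p = "%x. fst x < 2 \<or> snd x < fst x" and base = "%x. 0" and s = "%x. (fst x, snd x div fst x)"
  and post = "%y. Suc (snd y)" and W = "%x. snd x + fst x" and K = 10], (rule computes_intros)+, goal_cases)
 case (5 x)
 then show ?case using floor_log.simps[of "fst x" "snd x"] by simp
next
 case (8 x)
 obtain q where q: "snd x div fst x = q" by blast
 have "2 * q <= fst x * q" using 8 by (intro mult_le_mono1) simp
 also have "... <= snd x" unfolding q[symmetric] by simp
 finally show ?case using 8 by (simp add: q)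
qed auto

lemmas computes_floor_log [computes_intros] = computes_total_comp2[OF computes_floor_log_uncurried]

lemma computes_nat_digit_count_uncurried:
 "computes (%_. True) (%x. nat_digit_count (arg1 x) (arg2 x) (arg3 x) (rst4 x)) (%x. arg3 x * (rst4 x + arg1 x + arg2 x + 1))"
proof (rule computes_recursion[where p = "%x. arg3 x = 0" and base = "%x. 0"
  and s = "%x. (arg1 x, arg2 x, arg3 x - Suc 0, rst4 x div arg1 x)"
  and post = "%y. if rst4 (fst y) mod arg1 (fst y) <= arg2 (fst y) \<and> arg2 (fst y) <= rst4 (fst y) mod arg1 (fst y)
    then Suc (snd y) else snd y"
  and W = "%x. if arg3 x = 0 then 0 else rst4 x + arg1 x + arg2 x" and K = 10], (rule computes_intros)+, goal_cases)
 case (4 x)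
 obtain r where "rst4 x mod arg1 x = r" "r <= rst4 x" using mod_less_eq_dividend by blast
 then show ?case using 4 by simp
next
 case (5 x)
 then show ?case by (cases "arg3 x") auto
next
 case (8 x)
 then obtain n where n: "arg3 x = Suc n" by (cases "arg3 x") auto
 have "rst4 x div arg1 x <= rst4 x" by (rule div_le_dividend)
 then have "n * (rst4 x div arg1 x + arg1 x + arg2 x + 1) <= n * (rst4 x + arg1 x + arg2 x + 1)" by (intro mult_le_mono2) simp
 then show ?case by (simp add: n)
qed auto

lemmas computes_nat_digit_count [computes_intros] = computes_total_comp4[OF computes_nat_digit_count_uncurried]

definition digit_cost :: "nat => nat => nat => nat => nat" where
 "digit_cost b M B s = (b + M + B + s + 2) ^ 3"

lemma digit_cost_bounds:
 assumes d: "d <= b" and c: "c <= M"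
 shows "B * (b + 1) <= digit_cost b M B s" "(B + 1) * (M + 1) <= digit_cost b M B s"
  "M * (s + b + d + 1) <= 2 * digit_cost b M B s" "B * b * (c + 1) <= digit_cost b M B s" "B <= digit_cost b M B s"
proof -
 define A where "A = b + M + B + s + 2"
 have cost: "digit_cost b M B s = A ^ 3" by (simp add: digit_cost_def A_def)
 have "A ^ 1 <= A ^ 3" "A ^ 2 <= A ^ 3" by (intro power_increasing; simp add: A_def)+
 then have A: "A <= A ^ 3" "A * A <= A ^ 3" by (simp_all add: power2_eq_square)
 show "B <= digit_cost b M B s" using A(1) unfolding cost by (simp add: A_def)
 have "B * (b + 1) <= A * A" "(B + 1) * (M + 1) <= A * A" "M * (s + b + d + 1) <= A * (2 * A)"
  using d by (intro mult_le_mono; simp add: A_def)+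
 then show "B * (b + 1) <= digit_cost b M B s" "(B + 1) * (M + 1) <= digit_cost b M B s"
  "M * (s + b + d + 1) <= 2 * digit_cost b M B s"
  using A(2) unfolding cost by linarith+
 have "B * b * (c + 1) <= A * A * A" using c by (intro mult_le_mono) (auto simp: A_def)
 then show "B * b * (c + 1) <= digit_cost b M B s" unfolding cost by (simp add: power3_eq_cube)
qed

lemma computes_balanced_upto:
 "computes (%x. arg1 x <= arg2 x) (%x. \<forall>d<arg1 x. arg4 x * arg2 x * nat_digit_count (arg2 x) d (arg3 x) (rst5 x)
   <= (arg4 x + 1) * arg3 x)
  (%x. (arg1 x + 1) * (digit_cost (arg2 x) (arg3 x) (arg4 x) (rst5 x) + 1))" (is "computes _ ?F _")
proof -
 let ?W = "%x. digit_cost (arg2 x) (arg3 x) (arg4 x) (rst5 x)"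
 let ?check = "%x. arg4 x * arg2 x * nat_digit_count (arg2 x) (arg1 x - Suc 0) (arg3 x) (rst5 x) <= (arg4 x + 1) * arg3 x"
 have check: "computes (%x. arg1 x <= arg2 x) ?check ?W"
 proof (rule computes_bound[where K = 10], (rule computes_intros)+, goal_cases)
  case (1 x)
  obtain c where c: "nat_digit_count (arg2 x) (arg1 x - Suc 0) (arg3 x) (rst5 x) = c" "c <= arg3 x" using nat_digit_count_le
   by blast
  have d: "arg1 x - Suc 0 <= arg2 x" using 1 by simp
  show ?case using digit_cost_bounds[OF d c(2), where B = "arg4 x" and s = "rst5 x"] unfolding c(1) by simp
 qed
 show ?thesis
 proof (rule computes_recursion[where p = "%x. arg1 x = 0" and base = "%x. True" and s = "%x. (arg1 x - Suc 0, snd x)"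
   and post = "%y. ?check (fst y) \<and> snd y" and W = ?W and K = 1])
  show "computes (%y. arg1 (fst y) <= arg2 (fst y) \<and> arg1 (fst y) \<noteq> 0 \<and> snd y = ?F (arg1 (fst y) - Suc 0, snd (fst y)))
    (%y. ?check (fst y) \<and> snd y) (%y. ?W (fst y))"
   by (rule computes_bound[where K = 1], rule computes_and, rule computes_comp[OF check], (rule computes_intros | force)+)
  fix x :: "nat \<times> nat \<times> nat \<times> nat \<times> nat"
  show "?F x = (if arg1 x = 0 then True else ?check (fst (x, ?F (arg1 x - Suc 0, snd x))) \<and> snd (x, ?F (arg1 x - Suc 0, snd x)))"
   by (cases "arg1 x") (auto simp: All_less_Suc)
  show "?W x + (arg1 (arg1 x - Suc 0, snd x) + 1) * (?W (arg1 x - Suc 0, snd x) + 1) + 1 <= (arg1 x + 1) * (?W x + 1)"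
   if "arg1 x \<noteq> 0"
   using that by (cases "arg1 x") (auto simp: algebra_simps)
 qed ((rule computes_intros | force)+)
qed

lemma computes_balanced_uncurried:
 "computes (%_. True) (%x. balanced (arg1 x) (arg2 x) (arg3 x) (rst4 x))
  (%x. (arg1 x + 1) * (digit_cost (arg1 x) (arg2 x) (arg3 x) (rst4 x) + 1))"
proof -
 have "computes (%_. True) (%x::nat \<times> nat \<times> nat \<times> nat. (arg1 x, x)) (%_. 0)"
  by (rule computes_bound[where K = 1], (rule computes_intros)+) simp
 from computes_comp[OF computes_balanced_upto this] show ?thesis by (simp add: balanced_def)
qed

lemmas computes_balanced = computes_total_comp4[OF computes_balanced_uncurried]

abbreviation block_input :: "nat => nat => nat => nat => nat \<times> nat => bool" where
 "block_input R B y b v \<equiv> 4 <= R \<and> B <= R \<and> y <= R \<and> 2 <= b \<and> b <= R \<and> fst v <= R * R \<and> snd v <= R * R"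

lemma floor_log_quarter_bounds:
 assumes "4 <= R" "2 <= b"
 shows "b ^ floor_log b (R div 4) <= R" "floor_log b (R div 4) <= R"
proof -
 have "0 < R div 4" using assms by simp
 then have power: "b ^ floor_log b (R div 4) <= R div 4" using floor_log_bounds[OF assms(2)] by blast
 then show "b ^ floor_log b (R div 4) <= R" by simp
 have "floor_log b (R div 4) < b ^ floor_log b (R div 4)" using assms(2) by (intro power_gt_expt) auto
 then show "floor_log b (R div 4) <= R" using power by simp
qed

lemma block_string_products:
 fixes R y b m u v :: nat
 assumes R: "4 <= R" and bounds: "y <= R" "b <= R" "b ^ m <= R" "m <= R" "u <= R * R" "v <= R * R"
 shows "b ^ m * (u * R + v * y) <= 2 * R ^ 4" "b ^ m * (u * R + v * y + 1) <= 3 * R ^ 4" "m * (b ^ m + b + 3) <= 5 * R ^ 4"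
  "u * (R + 1) <= 2 * R ^ 4" "v * (y + 1) <= 2 * R ^ 4" "R * (R + 1) <= 2 * R ^ 4" "R * R * (R + 1) <= 2 * R ^ 4"
  "R <= R ^ 4" "R * R * R <= R ^ 4" "u * R <= R ^ 4"
proof -
 have "R ^ 1 <= R ^ 4" "R ^ 2 <= R ^ 4" "R ^ 3 <= R ^ 4" using R by (intro power_increasing; simp)+
 then have pow: "R <= R ^ 4" "R * R <= R ^ 4" "R * R * R <= R ^ 4" by (simp_all add: power2_eq_square power3_eq_cube)
 then show "R <= R ^ 4" "R * R * R <= R ^ 4" by simp_all
 have products: "u * R <= R * R * R" "v * y <= R * R * R" using bounds by (intro mult_le_mono; simp)+
 then show "u * R <= R ^ 4" using pow by linarith
 have "1 <= R * R * R" using R by (simp add: Suc_le_eq)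
 then have sum: "u * R + v * y <= 2 * (R * R * R)" "u * R + v * y + 1 <= 3 * (R * R * R)" using products by linarith+
 show "b ^ m * (u * R + v * y) <= 2 * R ^ 4" "b ^ m * (u * R + v * y + 1) <= 3 * R ^ 4"
  using mult_le_mono[OF bounds(3) sum(1)] mult_le_mono[OF bounds(3) sum(2)] by (simp_all add: power4_eq_xxxx)
 have "m * (b ^ m + b + 3) <= R * (5 * R)" "u * (R + 1) <= R * R * (2 * R)" "v * (y + 1) <= R * R * (2 * R)"
  "R * (R + 1) <= R * (2 * R)" "R * R * (R + 1) <= R * R * (2 * R)"
  using R bounds by (intro mult_le_mono; simp)+
 moreover have "R * (5 * R) = 5 * (R * R)" "R * (2 * R) = 2 * (R * R)" "R * R * (2 * R) = 2 * (R * R * R)" by simp_all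
 ultimately show "m * (b ^ m + b + 3) <= 5 * R ^ 4" "u * (R + 1) <= 2 * R ^ 4" "v * (y + 1) <= 2 * R ^ 4"
  "R * (R + 1) <= 2 * R ^ 4"
  "R * R * (R + 1) <= 2 * R ^ 4" using pow by linarith+
qed

lemma computes_block_string:
 "computes (%x. block_input (arg1 x) (arg2 x) (arg3 x) (arg4 x) (rst5 x))
  (%x. block_string (arg1 x) (arg3 x) (arg4 x) (floor_log (arg4 x) (arg1 x div 4)) (rst5 x))
   (%x. arg1 x ^ 4)" (is "computes ?D _ _")
proof -
 let ?s = "%q. block_string (arg1 (fst q)) (arg3 (fst q)) (arg4 (fst q)) (snd q) (rst5 (fst q))"
 let ?E = "%q. ?D (fst q) \<and> snd q = floor_log (arg4 (fst q)) (arg1 (fst q) div 4)"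
 have log: "computes ?D (%x. (x, floor_log (arg4 x) (arg1 x div 4))) (%x. arg1 x)"
 proof (rule computes_bound[where K = 20], (rule computes_intros)+, goal_cases)
  case (1 x)
  moreover obtain q where "arg1 x div 4 = q" "q <= arg1 x" using div_le_dividend by blast
  ultimately show ?case by simp
 qed
 have string: "computes ?E ?s (%q. arg1 (fst q) ^ 4)"
  unfolding block_string_def
 proof (rule computes_bound[where K = 60], (rule computes_intros)+, goal_cases)
  case (1 q)
  obtain R B y b u v m where q: "q = ((R, B, y, b, u, v), m)" by (cases q) auto
  have bounds: "4 <= R" "y <= R" "b <= R" "b ^ m <= R" "m <= R" "u <= R * R" "v <= R * R"
   using 1 floor_log_quarter_bounds[of R b] unfolding q by auto
  note products = block_string_products[OF bounds]
  obtain A1 A2 A3 A4 A5 where outer: "b ^ m * (u * R + v * y) = A1" "b ^ m * (u * R + v * y + 1) = A2" "m * (b ^ m + b + 3) = A3"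
   "R * R * (R + 1) = A4" "R * R * R = A5" by blast
  obtain B1 B2 B3 B4 C where inner: "u * (R + 1) = B1" "v * (y + 1) = B2" "R * (R + 1) = B3" "u * R = B4" "R ^ 4 = C" by blast
  show ?case using products unfolding q fst_conv snd_conv unfolding outer unfolding inner by simp
 qed
 have "computes ?D (%x. ?s (x, floor_log (arg4 x) (arg1 x div 4))) (%x. arg1 x + arg1 x ^ 4)"
  using computes_comp[OF string log] by simp
 then have "computes ?D (%x. ?s (x, floor_log (arg4 x) (arg1 x div 4))) (%x. arg1 x ^ 4)"
 proof (rule computes_bound[where K = 2])
  fix x assume "?D x"
  then have "arg1 x ^ 1 <= arg1 x ^ 4" by (intro power_increasing) auto
  then show "arg1 x + arg1 x ^ 4 <= 2 * (arg1 x ^ 4 + 1)" by simp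
 qed
 then show ?thesis by simp
qed

lemma balanced_cost_le:
 fixes R b M B s :: nat
 assumes "4 <= R" "b <= R" "M <= R" "B <= R" "s <= 2 * R ^ 4 + 1"
 shows "(b + 1) * (digit_cost b M B s + 1) <= 1460 * R ^ 13"
proof -
 have "R ^ 1 <= R ^ 4" "1 <= R ^ 12" using assms(1) power_increasing[of 1 4 R] by auto
 then have "b + M + B + s + 2 <= 9 * R ^ 4" using assms by simp
 then have "digit_cost b M B s <= (9 * R ^ 4) ^ 3" unfolding digit_cost_def by (rule power_mono) simp
 also have "... = 729 * R ^ 12" by (simp add: power_mult_distrib power_mult[symmetric])
 finally have "digit_cost b M B s + 1 <= 730 * R ^ 12" using \<open>1 <= R ^ 12\<close> by linarith
 moreover have "b + 1 <= 2 * R" using assms by simp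
 ultimately have "(b + 1) * (digit_cost b M B s + 1) <= (2 * R) * (730 * R ^ 12)" by (intro mult_le_mono)
 also have "... = 1460 * R ^ 13" by (simp add: power_Suc[of R 12, simplified] del: power_Suc)
 finally show ?thesis .
qed

lemma computes_block_ok:
 "computes (%x. block_input (arg1 x) (arg2 x) (arg3 x) (arg4 x) (rst5 x))
  (%x. block_ok (arg1 x) (arg2 x) (arg3 x) (arg4 x) (rst5 x)) (%x. arg1 x ^ 13)" (is "computes ?D _ _")
proof -
 let ?M = "%x. floor_log (arg4 x) (arg1 x div 4)"
 let ?s = "%x. block_string (arg1 x) (arg3 x) (arg4 x) (?M x) (rst5 x)"
 have M: "?M x <= arg1 x" if "?D x" for x using floor_log_quarter_bounds that by blast
 have s: "?s x <= 2 * arg1 x ^ 4" if "?D x" for x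
 proof -
  have "?s x <= arg4 x ^ ?M x * (fst (rst5 x) * arg1 x + snd (rst5 x) * arg3 x)"
   unfolding block_string_def by (rule div_le_dividend)
  also have "... <= 2 * arg1 x ^ 4" using that floor_log_quarter_bounds[of "arg1 x" "arg4 x"]
   by (intro block_string_products) auto
  finally show ?thesis .
 qed
 have tuple: "computes ?D (%x. (arg4 x, ?M x, arg2 x, ?s x)) (%x. arg1 x ^ 4)"
 proof (rule computes_bound[where K = 100], (rule computes_block_string computes_intros)+, goal_cases)
  case (1 x)
  moreover obtain q where "arg1 x div 4 = q" "q <= arg1 x" using div_le_dividend by blast
  moreover have "arg1 x ^ 1 <= arg1 x ^ 4" using 1 by (intro power_increasing) auto
  ultimately show ?case by simp
 qed
 have check: "computes (%_. True) (%q. balanced (arg1 q) (arg2 q) (arg3 q) (rst4 q)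
   \<and> balanced (arg1 q) (arg2 q) (arg3 q) (Suc (rst4 q)))
  (%q. (arg1 q + 1) * (digit_cost (arg1 q) (arg2 q) (arg3 q) (rst4 q) + 1)
   + (arg1 q + 1) * (digit_cost (arg1 q) (arg2 q) (arg3 q) (Suc (rst4 q)) + 1))"
  by (rule computes_bound[where K = 1], (rule computes_balanced computes_intros)+) simp
 from computes_comp[OF check tuple]
 have "computes ?D (%x. block_ok (arg1 x) (arg2 x) (arg3 x) (arg4 x) (rst5 x))
  (%x. arg1 x ^ 4 + ((arg4 x + 1) * (digit_cost (arg4 x) (?M x) (arg2 x) (?s x) + 1)
   + (arg4 x + 1) * (digit_cost (arg4 x) (?M x) (arg2 x) (Suc (?s x)) + 1)))"
  by (simp add: block_ok_def Let_def)
 then show ?thesis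
 proof (rule computes_bound[where K = 3000])
  fix x assume D: "?D x"
  have cost: "(arg4 x + 1) * (digit_cost (arg4 x) (?M x) (arg2 x) r + 1) <= 1460 * arg1 x ^ 13" if "r <= 2 * arg1 x ^ 4 + 1" for r
   by (rule balanced_cost_le) (use D M[OF D] that in auto)
  have "arg1 x ^ 4 <= arg1 x ^ 13" using D by (intro power_increasing) auto
  then show "arg1 x ^ 4 + ((arg4 x + 1) * (digit_cost (arg4 x) (?M x) (arg2 x) (?s x) + 1)
   + (arg4 x + 1) * (digit_cost (arg4 x) (?M x) (arg2 x) (Suc (?s x)) + 1)) <= 3000 * (arg1 x ^ 13 + 1)"
   using cost[of "?s x", OF trans_le_add1[OF s[OF D]]] cost[of "Suc (?s x)"] s[OF D] by simp
 qed
qed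

lemma computes_blocks_ok:
 "computes (%x. (\<forall>v\<in>set (rst5 x). block_input (arg1 x) (arg2 x) (arg3 x) (arg4 x) v) \<and> arg4 x + length (rst5 x) <= arg1 x + 1)
 (%x. blocks_ok (arg1 x) (arg2 x) (arg3 x) (arg4 x) (rst5 x)) (%x. length (rst5 x) * (arg1 x ^ 13 + 1))" (is "computes ?D ?F ?S")
proof -
 let ?s = "%x. (arg1 x, arg2 x, arg3 x, Suc (arg4 x), tl (rst5 x))"
 let ?W = "%x. if rst5 x = [] then 0 else arg1 x ^ 13"
 let ?post = "%y. block_ok (arg1 (fst y)) (arg2 (fst y)) (arg3 (fst y)) (arg4 (fst y)) (hd (rst5 (fst y))) \<and> snd y"
 let ?E = "%y. ?D (fst y) \<and> rst5 (fst y) \<noteq> [] \<and> snd y = ?F (?s (fst y))"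
 have tuple: "computes ?E (%y. (arg1 (fst y), arg2 (fst y), arg3 (fst y), arg4 (fst y), hd (rst5 (fst y)))) (%_. 0)"
  by (rule computes_bound[where K = 1], (rule computes_intros | force)+)
 have dom: "block_input (arg1 (fst y)) (arg2 (fst y)) (arg3 (fst y)) (arg4 (fst y)) (hd (rst5 (fst y)))" if "?E y" for y
  using that by (cases "rst5 (fst y)") auto
 have "computes ?E (%y. block_ok (arg1 (fst y)) (arg2 (fst y)) (arg3 (fst y)) (arg4 (fst y)) (hd (rst5 (fst y))))
   (%y. arg1 (fst y) ^ 13)"
  using computes_comp[OF computes_block_ok tuple, unfolded fst_conv snd_conv, OF dom[unfolded fst_conv snd_conv]] by simp
 then have post: "computes ?E ?post (%y. ?W (fst y))"
  by (rule computes_bound[OF computes_and[OF _ computes_snd[OF computes_id]], where K = 1]) simp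
 show ?thesis
 proof (rule computes_recursion[where p = "%x. rst5 x = []" and base = "%x. True" and s = ?s and K = 1, OF _ _ _ post])
  fix x :: "nat \<times> nat \<times> nat \<times> nat \<times> (nat \<times> nat) list"
  show "?F x = (if rst5 x = [] then True else ?post (x, ?F (?s x)))"
   by (cases "rst5 x") auto
  assume D: "?D x"
  show "?D (?s x)" if "rst5 x \<noteq> []" using D that by (cases "rst5 x"; cases "tl (rst5 x)") auto
  show "?W x + ?S (?s x) + 1 <= ?S x" if "rst5 x \<noteq> []" using that by (cases "rst5 x") auto
 qed ((rule computes_intros)+ | force)+
qed

lemma computes_search:
 "computes (%x. 4 <= arg1 x \<and> arg2 x <= arg1 x \<and> rst4 x <= arg1 x \<and> length (arg3 x) + 1 <= arg1 x \<and>
  (\<forall>v\<in>set (arg3 x). fst v <= arg1 x * arg1 x \<and> snd v <= arg1 x * arg1 x))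
 (%x. search (arg1 x) (arg2 x) (arg3 x) (rst4 x)) (%x. rst4 x * (length (arg3 x) * (arg1 x ^ 13 + 1) + 1))"
 (is "computes ?D ?F ?S")
proof -
 let ?s = "%x. (arg1 x, arg2 x, arg3 x, rst4 x - Suc 0)"
 let ?post = "%y. if blocks_ok (arg1 (fst y)) (arg2 (fst y)) (rst4 (fst y) - Suc 0) 2 (arg3 (fst y))
   then rst4 (fst y) - Suc 0 else snd y"
 let ?W = "%x. if rst4 x = 0 then 0 else length (arg3 x) * (arg1 x ^ 13 + 1)"
 let ?E = "%y. ?D (fst y) \<and> rst4 (fst y) \<noteq> 0 \<and> snd y = ?F (?s (fst y))"
 have tuple: "computes ?E (%y. (arg1 (fst y), arg2 (fst y), rst4 (fst y) - Suc 0, 2 :: nat, arg3 (fst y))) (%_. 0)"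
  by (rule computes_bound[where K = 1], (rule computes_intros)+) simp
 have check: "computes ?E (%y. blocks_ok (arg1 (fst y)) (arg2 (fst y)) (rst4 (fst y) - Suc 0) 2 (arg3 (fst y)))
   (%y. 0 + length (arg3 (fst y)) * (arg1 (fst y) ^ 13 + 1))"
  using computes_comp[OF computes_blocks_ok tuple] by fastforce
 have post: "computes ?E ?post (%y. ?W (fst y))"
  by (rule computes_bound[where K = 1], (rule check computes_intros)+) simp
 show ?thesis
 proof (rule computes_recursion[where p = "%x. rst4 x = 0" and base = "%x. 0" and s = ?s and K = 1, OF _ _ _ post])
  fix x :: "nat \<times> nat \<times> (nat \<times> nat) list \<times> nat"
  show "?F x = (if rst4 x = 0 then 0 else ?post (x, ?F (?s x)))"
   by (cases "rst4 x") auto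
  show "?W x + ?S (?s x) + 1 <= ?S x" if "rst4 x \<noteq> 0" using that by (cases "rst4 x") auto
 qed ((rule computes_intros)+ | force)+
qed

lemma computes_val: "computes (%_. True) val (%x. 2 * 2 ^ length x)"
proof (rule computes_recursion[where p = "%x. x = []" and base = "%x. 0" and s = tl
  and post = "%y. if hd (fst y) then Suc (snd y + snd y) else snd y + snd y" and W = "%x. 2 ^ length (tl x)" and K = 3],
  (rule computes_intros | simp; fail)+, goal_cases)
 case (1 x)
 then show ?case using val_less[of "tl x"] by simp
next
 case (2 x)
 then show ?case by (cases x) auto
next
 case (5 x)
 then show ?case by (cases x) (auto simp: Suc_le_eq)
qed auto

lemma computes_nat_bits_uncurried: "computes (%_. True) (%x. nat_bits (fst x) (snd x)) (%x. fst x * (snd x + 1))"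
proof (rule computes_recursion[where p = "%x. fst x = 0" and base = "%x. []" and s = "%x. (fst x - Suc 0, snd x div 2)"
  and post = "%y. (\<not> snd (fst y) mod 2 = 0) # snd y" and W = "%x. if fst x = 0 then 0 else snd x" and K = 10],
  (rule computes_intros)+, goal_cases)
 case (5 x)
 then show ?case by (cases "fst x") auto
next
 case (8 x)
 then obtain n where n: "fst x = Suc n" by (cases "fst x") auto
 have "n * (snd x div 2 + 1) <= n * (snd x + 1)" by (intro mult_le_mono2) simp
 then show ?case by (simp add: n)
qed auto

lemma power_16_bounds:
 fixes R l :: nat
 assumes "R = 2 ^ l" "2 <= l"
 shows "4 <= R" "R <= R ^ 16" "l <= R" "l * R <= R ^ 16" "R * R * R <= R ^ 16" "R * (R * (R ^ 13 + 1) + 1) <= 3 * R ^ 16"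
proof -
 show R: "4 <= R" using power_increasing[of 2 l "2::nat"] assms by simp
 have pow: "R ^ 1 <= R ^ 16" "R ^ 2 <= R ^ 16" "R ^ 3 <= R ^ 16" "R ^ 15 <= R ^ 16" using R by (intro power_increasing; simp)+
 then show linear: "R <= R ^ 16" and "R * R * R <= R ^ 16" by (simp_all add: power3_eq_cube)
 show l: "l <= R" unfolding assms(1) by (rule less_imp_le, rule less_exp)
 have "l * R <= R * R" using l by (rule mult_le_mono1)
 also have "... <= R ^ 16" using pow(2) by (simp add: power2_eq_square)
 finally show "l * R <= R ^ 16" .
 have "R * (R * (R ^ 13 + 1) + 1) = R ^ 15 + R ^ 2 + R"
  by (simp add: power2_eq_square algebra_simps power_Suc[symmetric] del: power_Suc)
 then show "R * (R * (R ^ 13 + 1) + 1) <= 3 * R ^ 16" using pow linear by linarith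
qed

abbreviation leaf_input :: "nat \<times> state list => bool" where
 "leaf_input x \<equiv> 2 <= fst x \<and> length (snd x) + 1 <= 2 ^ fst x
   \<and> (\<forall>w\<in>set (snd x). length (fst w) <= 2 * fst x \<and> length (snd w) <= 2 * fst x)"

lemma computes_state_vals:
 "computes leaf_input (%x. map (%w. (val (fst w), val (snd w))) (snd x)) (%x. (2 ^ fst x) ^ 16)"
proof -
 have vals: "computes (%_. True) (%w. (val (fst w), val (snd w))) (%w. 2 * 2 ^ length (fst w) + 2 * 2 ^ length (snd w))"
  by (rule computes_bound[where K = 1], (rule computes_total_comp[OF computes_val] computes_intros)+) simp
 show ?thesis
 proof (rule computes_bound[OF computes_map_const[OF vals computes_snd[OF computes_id] TrueI], where K = 10])
  fix x assume x: "leaf_input x"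
  define R :: nat where "R = 2 ^ fst x"
  have R: "1 <= R * R" "R * R * R <= R ^ 16" using power_16_bounds[OF R_def] x by (auto simp: R_def)
  have "(\<Sum>w\<leftarrow>snd x. 2 * 2 ^ length (fst w) + 2 * 2 ^ length (snd w) + 1) <= length (snd x) * (5 * (R * R))"
  proof (rule sum_list_bound)
   fix w assume "w \<in> set (snd x)"
   then have "(2::nat) ^ length (fst w) <= 2 ^ (2 * fst x)" "(2::nat) ^ length (snd w) <= 2 ^ (2 * fst x)" using x
    by (intro power_increasing; simp)+
   moreover have "(2::nat) ^ (2 * fst x) = R * R" by (simp add: R_def power_add[symmetric] mult_2)
   ultimately show "2 * 2 ^ length (fst w) + 2 * 2 ^ length (snd w) + 1 <= 5 * (R * R)" using R(1) by linarith
  qed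
  also have "... <= R * (5 * (R * R))" using x by (intro mult_le_mono1) (simp add: R_def)
  also have "... <= 10 * (R ^ 16 + 1)" using R(2) by simp
  finally show "0 + (\<Sum>w\<leftarrow>snd x. 2 * 2 ^ length (fst w) + 2 * 2 ^ length (snd w) + 1) <= (10::nat) * ((2 ^ fst x) ^ 16 + 1)"
   by (simp add: R_def)
 qed
qed

lemma computes_leaf_search:
 "computes leaf_input (%x. search (2 ^ fst x) (length (snd x)) (map (%w. (val (fst w), val (snd w))) (snd x)) (2 ^ fst x))
   (%x. (2 ^ fst x) ^ 16)"
 (is "computes _ _ ?T")
proof -
 let ?in = "%x. (2 ^ fst x :: nat, length (snd x), map (%w. (val (fst w), val (snd w))) (snd x), 2 ^ fst x :: nat)"
 have input: "computes leaf_input ?in ?T"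
 proof (rule computes_bound[where K = 40], (rule computes_state_vals computes_intros)+, goal_cases)
  case (1 x)
  define R :: nat where "R = 2 ^ fst x"
  have R: "R <= R ^ 16" "fst x * R <= R ^ 16" "fst x <= R" using power_16_bounds[OF R_def] 1 by auto
  have "fst x * (2 ^ fst x + 2 + 3) = fst x * R + 5 * fst x" by (simp add: R_def algebra_simps)
  then show ?case using R 1 unfolding R_def[symmetric] by (simp add: algebra_simps)
 qed
 have dom: "4 <= (2::nat) ^ fst x \<and> length (snd x) <= 2 ^ fst x \<and> length (map (%w. (val (fst w), val (snd w))) (snd x)) + 1 <= 2 ^ fst x
   \<and> (\<forall>v\<in>set (map (%w. (val (fst w), val (snd w))) (snd x)). fst v <= 2 ^ fst x * 2 ^ fst x
    \<and> snd v <= 2 ^ fst x * 2 ^ fst x)" if x: "leaf_input x" for x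
 proof -
  have "val (fst w) <= 2 ^ fst x * 2 ^ fst x" "val (snd w) <= 2 ^ fst x * 2 ^ fst x" if "w \<in> set (snd x)" for w
   using x that val_less_power[of "fst w" "2 * fst x"] val_less_power[of "snd w" "2 * fst x"]
    by (auto simp: power_add[symmetric] mult_2)
  then show ?thesis using x power_16_bounds(1)[OF refl, of "fst x"] by auto
 qed
 have "computes leaf_input (%x. search (2 ^ fst x) (length (snd x)) (map (%w. (val (fst w), val (snd w))) (snd x)) (2 ^ fst x))
  (%x. ?T x + 2 ^ fst x * (length (snd x) * ((2 ^ fst x) ^ 13 + 1) + 1))"
  using computes_comp[OF computes_search input] dom by simp
 then show ?thesis
 proof (rule computes_bound[where K = 6])
  fix x assume x: "leaf_input x"
  define R :: nat where "R = 2 ^ fst x"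
  have "R * (length (snd x) * (R ^ 13 + 1) + 1) <= R * (R * (R ^ 13 + 1) + 1)"
   using x by (intro mult_le_mono2 add_mono mult_le_mono1) (auto simp: R_def)
  also have "... <= 3 * R ^ 16" using x by (intro power_16_bounds[OF R_def]) simp
  finally show "?T x + 2 ^ fst x * (length (snd x) * ((2 ^ fst x) ^ 13 + 1) + 1) <= 6 * (?T x + 1)"
   unfolding R_def[symmetric] by simp
 qed
qed

lemma computes_leaf_block: "computes leaf_input (%x. leaf_block (fst x) (snd x)) (%x. (2 ^ fst x) ^ 16)"
proof -
 show ?thesis unfolding leaf_block_def
 proof (rule computes_bound[where K = 4], rule computes_total_comp2[OF computes_nat_bits_uncurried
  computes_fst[OF computes_id] computes_leaf_search])
  fix x assume x: "leaf_input x"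
  define R :: nat where "R = 2 ^ fst x"
  let ?y = "search R (length (snd x)) (map (%w. (val (fst w), val (snd w))) (snd x)) R"
  have "?y < R" by (rule search_less) (simp add: R_def)
  then have "fst x * (?y + 1) <= fst x * R" by (intro mult_le_mono2) simp
  also have "... <= R ^ 16" using x by (intro power_16_bounds[OF R_def]) simp
  finally show "0 + (2 ^ fst x) ^ 16
    + fst x * (search (2 ^ fst x) (length (snd x)) (map (%w. (val (fst w), val (snd w))) (snd x)) (2 ^ fst x) + 1)
    <= 4 * ((2 ^ fst x) ^ 16 + 1)"
   unfolding R_def[symmetric] by simp
 qed
qed

abbreviation next_input :: "(nat \<times> nat \<times> nat) \<times> entry => bool" where
 "next_input x \<equiv> arg2 (fst x) = 2 ^ fst (fst x) \<and> length (arg2 (snd x)) <= 2 ^ fst (fst x) \<and> length (fst (snd x)) <= rst3 (fst x)"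

definition next_cost :: "nat => nat => nat" where
 "next_cost j g = mult_cost j * (g + 2)\<^sup>2"

lemma next_cost_bounds:
 assumes "l <= g"
 shows "2 ^ j <= next_cost j g" "mult_cost j <= next_cost j g" "l <= next_cost j g"
  "l * (2 * (2 * 2 ^ j) + 2 * l + 3) <= 9 * next_cost j g" "l * (2 * (2 * 2 ^ j + 2 * l) + 2 * l + 3) <= 13 * next_cost j g"
proof -
 define G where "G = (g + 2)\<^sup>2"
 have "(g + 2) * 1 <= (g + 2) * (g + 2)" "l * l <= (g + 2) * (g + 2)" using assms by (intro mult_le_mono; simp)+
 then have G: "1 <= G" "l <= G" "l * l <= G" using assms by (auto simp: G_def power2_eq_square)
 have V: "1 <= mult_cost j" "2 ^ j <= mult_cost j" using mult_cost_bounds(3)[of j] by (auto intro: order_trans[rotated])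
 have "1 * l <= mult_cost j * G" "mult_cost j * 1 <= mult_cost j * G" "2 ^ j * l <= mult_cost j * G"
  "1 * (l * l) <= mult_cost j * G"
  using G V by (intro mult_le_mono; simp)+
 then have products: "l <= next_cost j g" "mult_cost j <= next_cost j g" "2 ^ j * l <= next_cost j g" "l * l <= next_cost j g"
  by (simp_all add: next_cost_def G_def)
 then show "l <= next_cost j g" "mult_cost j <= next_cost j g" "2 ^ j <= next_cost j g" using V by linarith+
 have "l * (2 * (2 * 2 ^ j) + 2 * l + 3) = 4 * (2 ^ j * l) + 2 * (l * l) + 3 * l"
  "l * (2 * (2 * 2 ^ j + 2 * l) + 2 * l + 3) = 4 * (2 ^ j * l) + 6 * (l * l) + 3 * l" by (simp_all add: algebra_simps)
 then show "l * (2 * (2 * 2 ^ j) + 2 * l + 3) <= 9 * next_cost j g"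
  "l * (2 * (2 * 2 ^ j + 2 * l) + 2 * l + 3) <= 13 * next_cost j g"
  using products by linarith+
qed

lemma computes_Pair_naive_mult:
 assumes "computes D (%x. (f x, g x)) T"
 shows "computes D (%x. (f x, g x, naive_mult (f x) (g x))) (%x. T x + length (f x) * (2 * length (g x) + 2 * length (f x) + 3))"
proof -
 have "computes (%_. True) (%z. (fst z, snd z, naive_mult (fst z) (snd z)))
   (%z. length (fst z) * (2 * length (snd z) + 2 * length (fst z) + 3))"
  by (rule computes_bound[where K = 1], (rule computes_intros)+) simp
 from computes_comp[OF this assms TrueI] show ?thesis by simp
qed

lemma computes_next_power:
 "computes next_input (%x. next_power (fst (fst x)) (arg2 (fst x)) (snd x)) (%x. next_cost (fst (fst x)) (rst3 (fst x)))"
proof -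
 let ?T = "%x. next_cost (fst (fst x)) (rst3 (fst x))"
 let ?Q = "%x. fast_mult (fst (fst x)) (arg2 (snd x)) (arg2 (snd x))"
 let ?D = "%y. next_input (fst y) \<and> length (snd y :: bool list) = 2 * 2 ^ fst (fst (fst y))"
 let ?bb = "%y. fst (snd (fst y))" and ?h = "%y. arg2 (fst (fst y))"
 let ?U = "%y. if all_zero (drop (2 * ?h y) (naive_mult (?bb y) (snd y))) then take (2 * ?h y) (naive_mult (?bb y) (snd y))
   else snd y"
 have square: "computes next_input (%x. (x, ?Q x)) ?T"
 proof (rule computes_bound[where K = 1], (rule computes_fast_mult computes_intros | simp; fail)+, goal_cases)
  case (1 x)
  then show ?case using next_cost_bounds(2)[of "length (fst (snd x))" "rst3 (fst x)" "fst (fst x)"] by simp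
 qed
 have power: "computes ?D (%y. (?bb y, ?U y)) (%y. ?T (fst y))"
 proof (rule computes_bound[where K = 60], (rule computes_intros)+, goal_cases)
  case (1 y)
  obtain n where n: "length (naive_mult (?bb y) (snd y)) = n" "n <= 2 * ?h y + 2 * length (?bb y)"
   using length_naive_mult[of "?bb y" "snd y"] 1 by auto
  have "n - 2 * ?h y <= 2 * length (?bb y)" using n by simp
  then show ?case
   using next_cost_bounds(1,3,4)[of "length (?bb y)" "rst3 (fst (fst y))" "fst (fst (fst y))"] 1 n(2)
    unfolding length_drop n(1) by simp
 qed
 have entry: "computes ?D (%y. (?bb y, ?U y, naive_mult (?bb y) (?U y))) (%y. ?T (fst y))"
 proof (rule computes_bound[OF computes_Pair_naive_mult[OF power], where K = 20])
  fix y assume y: "?D y"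
  then have "length (?U y) <= 2 * 2 ^ fst (fst (fst y))" by simp
  then have "length (?bb y) * (2 * length (?U y) + 2 * length (?bb y) + 3)
    <= length (?bb y) * (2 * (2 * 2 ^ fst (fst (fst y))) + 2 * length (?bb y) + 3)" by (intro mult_le_mono2) simp
  also have "... <= 9 * ?T (fst y)" using y by (intro next_cost_bounds) simp
  finally show "?T (fst y) + length (?bb y) * (2 * length (?U y) + 2 * length (?bb y) + 3) <= 20 * (?T (fst y) + 1)" by simp
 qed
 have dom: "?D (x, ?Q x)" if "next_input x" for x using that by (simp add: fast_mult)
 show ?thesis
 proof (rule computes_cong)
  show "computes next_input (%x. (?bb (x, ?Q x), ?U (x, ?Q x), naive_mult (?bb (x, ?Q x)) (?U (x, ?Q x)))) ?T"
   by (rule computes_bound[OF computes_comp[OF entry square, OF dom], where K = 2]) simp_all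
 qed (simp add: next_power_def Let_def)
qed

abbreviation bases_input :: "bool list list \<times> nat => bool" where
 "bases_input x \<equiv> \<forall>bb\<in>set (fst x). 2 <= val bb \<and> length bb <= length (fst x) + 1"

definition table_level_cost :: "nat => nat => nat" where
 "table_level_cost j g = mult_cost j * (g + 3) ^ 3"

lemma table_level_cost_bounds:
 "g + 3 <= table_level_cost j g" "2 ^ j <= table_level_cost j g"
 "2 * table_level_cost j g <= table_level_cost (Suc j) g" "g * (next_cost j (g + 1) + 1) <= 2 * table_level_cost j g"
proof -
 have V: "1 <= mult_cost j" "2 ^ j <= mult_cost j" using mult_cost_bounds(3)[of j] by (auto intro: order_trans[rotated])
 have "1 * (g + 3) <= table_level_cost j g" unfolding table_level_cost_def using V by (intro mult_le_mono self_le_power) auto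
 then show "g + 3 <= table_level_cost j g" by simp
 have "2 ^ j * 1 <= table_level_cost j g" unfolding table_level_cost_def using V by (intro mult_le_mono) auto
 then show "2 ^ j <= table_level_cost j g" by simp
 have "2 * mult_cost j = 2 ^ Suc j * (j + 1) ^ 15" by (simp add: mult_cost_def)
 also have "... <= mult_cost (Suc j)" unfolding mult_cost_def by (intro mult_le_mono2 power_mono) auto
 finally have "2 * mult_cost j * (g + 3) ^ 3 <= mult_cost (Suc j) * (g + 3) ^ 3" by (rule mult_le_mono1)
 then show "2 * table_level_cost j g <= table_level_cost (Suc j) g" by (simp only: table_level_cost_def mult.assoc)
 have next_eq: "next_cost j (g + 1) = mult_cost j * (g + 3)\<^sup>2" by (simp add: next_cost_def numeral_3_eq_3)
 have "1 * 1 <= mult_cost j * (g + 3)\<^sup>2" using V by (intro mult_le_mono) auto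
 then have "g * (next_cost j (g + 1) + 1) <= (g + 3) * (2 * (mult_cost j * (g + 3)\<^sup>2))"
  unfolding next_eq by (intro mult_le_mono) auto
 also have "... = 2 * table_level_cost j g" by (simp add: table_level_cost_def power2_eq_square power3_eq_cube)
 finally show "g * (next_cost j (g + 1) + 1) <= 2 * table_level_cost j g" .
qed

lemma computes_power_table_uncurried:
 "computes bases_input (%x. power_table (fst x) (snd x)) (%x. 4 * table_level_cost (snd x) (length (fst x)))"
 (is "computes ?D ?F ?S")
proof -
 let ?W = "%x. table_level_cost (snd x) (length (fst x))"
 let ?s = "%x. (fst x, snd x - Suc 0)"
 let ?base = "%x. [(0, 1, map (%bb. (bb, [True], bb)) (fst x))]"
 let ?post = "%y. (snd (fst y), 2 * arg2 (hd (snd y)), map ((%c. next_power (fst c) (arg2 c))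
   (snd (fst y) - Suc 0, arg2 (hd (snd y)), length (fst (fst y)) + 1)) (rst3 (hd (snd y)))) # snd y"
 let ?E = "%y. ?D (fst y) \<and> snd (fst y) \<noteq> 0 \<and> snd y = ?F (?s (fst y))"
 have top: "hd (snd y) = (snd (fst y) - Suc 0, 2 ^ (snd (fst y) - Suc 0), powers (fst (fst y)) (snd (fst y) - Suc 0))"
  "snd y \<noteq> []"
  if "?E y" for y
  using that hd_power_table[of "fst (fst y)" "snd (fst y) - Suc 0"] by auto
 have entries: "next_input ((snd (fst y) - Suc 0, arg2 (hd (snd y)), length (fst (fst y)) + 1), e)"
  if "?E y" "e \<in> set (rst3 (hd (snd y)))" for y e
  using that top(1)[OF that(1)] length_powers_entry[of "fst (fst y)" e "snd (fst y) - Suc 0"] by auto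
 have entry: "computes (%_. True) (%bb::bool list. (bb, [True], bb)) (%_. 0)"
  by (rule computes_bound[where K = 1], (rule computes_intros)+) simp
 have base: "computes (%x. ?D x \<and> snd x = 0) ?base ?W"
 proof (rule computes_bound[where K = 3], (rule computes_map_const[OF entry] computes_intros TrueI)+, goal_cases)
  case (1 x)
  then show ?case using table_level_cost_bounds(1)[of "length (fst x)" "snd x"] by (simp add: sum_list_triv)
 qed
 have post: "computes ?E ?post (%y. ?W (fst y))"
 proof (rule computes_bound[where K = 20],
   (rule computes_map[OF computes_next_power] computes_intros | erule top(2) | rule entries; assumption)+, goal_cases)
  case (1 y)
  then obtain j where j: "snd (fst y) = Suc j" by (cases "snd (fst y)") auto
  define g where "g = length (fst (fst y))"
  have l: "length (powers (fst (fst y)) j) = g" using 1 power_entry_powers(1)[of "fst (fst y)" j] by (simp add: g_def)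
  show ?case using table_level_cost_bounds[where j = "Suc j" and g = g] table_level_cost_bounds[where j = j and g = g]
   unfolding top(1)[OF 1] by (simp add: sum_list_triv l j g_def)
 qed
 show ?thesis
 proof (rule computes_recursion[where p = "%x. snd x = 0" and base = ?base and s = ?s and K = 1, OF _ base _ post])
  fix x :: "bool list list \<times> nat"
  show "?F x = (if snd x = 0 then ?base x else ?post (x, ?F (?s x)))"
   using hd_power_table[of "fst x" "snd x - 1"] by (cases "snd x") (auto simp: Let_def)
  show "?W x + ?S (?s x) + 1 <= ?S x" if "snd x \<noteq> 0"
   using that table_level_cost_bounds(1)[of "length (fst x)" "snd x"] table_level_cost_bounds(3)[of "snd x - 1" "length (fst x)"]
   by (cases "snd x") auto
 qed ((rule computes_intros)+ | force)+
qed

lemma computes_left_state: "computes (%_. True) (%p. left_state (fst p) (snd p)) (%p. fst p)"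
 unfolding left_state_def by (rule computes_bound[where K = 20], (rule computes_intros)+) simp

lemma right_cost_bounds:
 "mult_cost (j + 2) <= mult_cost (j + 3)" "8 * 2 ^ j <= mult_cost (j + 3)" "j <= mult_cost (j + 3)"
 using mult_cost_mono[of "j + 2" "j + 3"] mult_cost_bounds(2,3)[of "j + 3"] by (simp_all add: power_add)

abbreviation right_args :: "(nat \<times> nat \<times> bool list) \<times> entry \<times> state => bool" where
 "right_args p \<equiv> right_input (fst (fst p)) (arg2 (fst p)) (rst3 (fst p)) (fst (snd p)) (snd (snd p))"

lemma computes_right_product:
 assumes f: "computes D f (%_. 0)" and D: "\<And>p. D p ==> right_args p \<and> length (f p) <= 4 * arg2 (fst p)"
 shows "computes D (%p. fast_mult (fst (fst p) + 2) (rst3 (snd p)) (f p)) (%p. mult_cost (fst (fst p) + 3))"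
proof (rule computes_bound[where K = 3], (rule computes_fast_mult f computes_intros)+, goal_cases)
 case (1 p)
 then show ?case using D[of p] by (simp add: power_add)
next
 case (2 p)
 show ?case using right_cost_bounds(1,3)[of "fst (fst p)"] by simp
qed

lemma computes_right_factor:
 "computes right_args (%p. right_factor (fst (fst p)) (arg2 (fst p)) (rst3 (snd p)) (fst (snd p)))
   (%p. mult_cost (fst (fst p) + 3))"
 unfolding right_factor_def
proof (rule computes_bound[where K = 30], (rule computes_right_product computes_intros | simp; fail)+, goal_cases)
 case (1 p)
 then show ?case using right_cost_bounds(2)[of "fst (fst p)"] fast_mult_right(2)[of "arg2 (fst p)" "fst (fst p)"
  "rst3 (snd p)" "rst3 (fst (snd p))"]
  by (simp del: add_2_eq_Suc')
qed

lemma computes_right_state: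
 "computes right_args (%p. right_state (fst (fst p)) (arg2 (fst p)) (rst3 (fst p)) (snd p)) (%p. mult_cost (fst (fst p) + 3))"
proof -
 let ?T = "%p. mult_cost (fst (fst p) + 3)"
 let ?j = "%p. fst (fst p)" and ?h = "%p. arg2 (fst p)" and ?K = "%p. rst3 (snd p)"
 let ?X = "%p. take (8 * ?h p) (add_bits False (replicate (?h p) False
   @ arg2 (snd p)) (fast_mult (?j p + 2) (?K p) (rst3 (fst p))))"
 let ?F = "%p. right_factor (?j p) (?h p) (?K p) (fst (snd p))"
 have factors: "computes right_args (%p. ((?j p, ?h p), ?X p, ?K p, ?F p)) ?T"
 proof (rule computes_bound[where K = 60], (rule computes_right_product computes_right_factor computes_intros | simp;
  fail)+, goal_cases)
  case (1 p)
  then show ?case using right_cost_bounds(2)[of "?j p"] fast_mult_right(2)[of "?h p" "?j p" "?K p" "rst3 (fst p)"]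
   by (simp del: add_2_eq_Suc')
 qed
 let ?D = "%q. snd (fst q) = 2 ^ fst (fst q) \<and> length (arg1 (snd q)) <= 8 * snd (fst q) \<and> length (arg2 (snd q))
   <= 4 * snd (fst q) \<and> length (rst3 (snd q)) <= 4 * snd (fst q)"
 have products: "computes ?D (%q. (take (2 * snd (fst q))
   (drop (3 * snd (fst q)) (fast_mult (fst (fst q) + 3) (arg1 (snd q)) (rst3 (snd q)))),
   take (2 * snd (fst q)) (drop (3 * snd (fst q)) (fast_mult (fst (fst q) + 2) (arg2 (snd q)) (rst3 (snd q))))))
    (%q. mult_cost (fst (fst q) + 3))"
 proof (rule computes_bound[where K = 50], (rule computes_fast_mult computes_intros | simp add: power_add; fail)+, goal_cases)
  case (1 q)
  then show ?case using right_cost_bounds[of "fst (fst q)"] by simp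
 qed
 have dom: "?D ((?j p, ?h p), ?X p, ?K p, ?F p)" if "right_args p" for p using that length_right_factor[OF that] by simp
 have "computes right_args (%p. right_state (?j p) (?h p) (rst3 (fst p)) (snd p)) (%p. ?T p + ?T p)"
  unfolding right_state_def Let_def using computes_comp[OF products factors, OF dom, unfolded fst_conv snd_conv] .
 then show ?thesis by (rule computes_bound[where K = 2]) simp
qed

fun valid_table :: "nat => nat => table => bool" where
 "valid_table lam g [] = True"
| "valid_table lam g ((j, h, ps) # tab) \<longleftrightarrow> h = 2 ^ j \<and> h = lam * 2 ^ length tab \<and> length ps <= g \<and>
  (\<forall>e\<in>set ps. length (arg2 e) <= h \<and> length (rst3 e) <= 4 * h) \<and> valid_table lam g tab"

type_synonym node = "nat \<times> nat \<times> table \<times> state list"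

text \<open>The second component bounds the number of states.\<close>
abbreviation solve_input :: "node => bool" where
 "solve_input x \<equiv> 2 <= arg1 x \<and> valid_table (arg1 x) (arg2 x) (arg3 x) \<and> length (rst4 x) <= arg2 x \<and> arg2 x + 1 <= 2 ^ arg1 x \<and>
  (\<forall>w\<in>set (rst4 x). length (fst w) <= 2 * (arg1 x * 2 ^ length (arg3 x)) \<and> length (snd w) <= 2 * (arg1 x * 2 ^ length (arg3 x)))"

definition node_cost :: "nat => nat => nat => nat" where
 "node_cost lam g t = (g + 1) * lam * (lam + t + 4) ^ 15"

definition solve_cost :: "nat => nat => nat => nat" where
 "solve_cost lam g t = 2 ^ t * ((2 ^ lam) ^ 16 + 2 + t * (node_cost lam g t + 2))"

lemma solve_cost_Suc: "2 ^ Suc t * node_cost lam g (Suc t) + 2 * solve_cost lam g t + 2 <= solve_cost lam g (Suc t)"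
proof -
 define L where "L = (2 ^ lam) ^ 16 + (2::nat)"
 define Q where "Q = node_cost lam g (Suc t)"
 have "node_cost lam g t <= Q" unfolding Q_def node_cost_def by (intro mult_le_mono power_mono) auto
 then have "solve_cost lam g t <= 2 ^ t * (L + t * (Q + 2))"
  unfolding solve_cost_def L_def by (intro mult_le_mono2 add_mono) auto
 moreover have "solve_cost lam g (Suc t) = 2 ^ Suc t * Q + 2 * (2 ^ t * (L + t * (Q + 2))) + 4 * 2 ^ t"
  by (simp add: solve_cost_def L_def Q_def algebra_simps)
 moreover have "1 <= (2::nat) ^ t" by simp
 ultimately show ?thesis unfolding Q_def[symmetric] by linarith
qed

abbreviation local_cost :: "node => nat" where
 "local_cost x \<equiv> if arg3 x = [] then (2 ^ arg1 x) ^ 16 else 2 ^ length (arg3 x) * node_cost (arg1 x) (arg2 x) (length (arg3 x))"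

lemma local_cost_bounds:
 assumes input: "solve_input x" and x: "arg3 x = (j, h, ps) # tab"
 shows "(length (rst4 x) + 1) * mult_cost (j + 3) <= 8 * local_cost x" "(length (rst4 x) + 1) * h <= local_cost x"
  "arg2 x + 1 <= local_cost x"
proof -
 have h: "h = 2 ^ j" "h = arg1 x * 2 ^ length tab" using input by (auto simp: x)
 have cost: "local_cost x = 2 * h * ((arg2 x + 1) * (arg1 x + Suc (length tab) + 4) ^ 15)"
  unfolding h(2) by (simp add: x node_cost_def algebra_simps)
 have "(2::nat) ^ j <= 2 ^ arg1 x * 2 ^ length tab" unfolding h(1)[symmetric] h(2)
  by (intro mult_le_mono1) (simp add: less_imp_le)
 then have "(2::nat) ^ j <= 2 ^ (arg1 x + length tab)" by (simp add: power_add)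
 then have j: "j <= arg1 x + length tab" by simp
 have "(length (rst4 x) + 1) * mult_cost (j + 3) = 8 * (h * ((length (rst4 x) + 1) * (j + 4) ^ 15))"
  by (simp add: mult_cost_def h(1) power_add algebra_simps)
 also have "... <= 8 * (2 * h * ((arg2 x + 1) * (arg1 x + Suc (length tab) + 4) ^ 15))"
  using input j by (intro mult_le_mono power_mono) auto
 finally show "(length (rst4 x) + 1) * mult_cost (j + 3) <= 8 * local_cost x" unfolding cost .
 have "(length (rst4 x) + 1) * h = h * ((length (rst4 x) + 1) * 1)" by simp
 also have "... <= 2 * h * ((arg2 x + 1) * (arg1 x + Suc (length tab) + 4) ^ 15)"
  using input by (intro mult_le_mono) auto
 finally show "(length (rst4 x) + 1) * h <= local_cost x" unfolding cost .
 have "1 * ((arg2 x + 1) * 1) <= 2 * h * ((arg2 x + 1) * (arg1 x + Suc (length tab) + 4) ^ 15)"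
  using h(1) by (intro mult_le_mono) (auto simp: Suc_le_eq)
 then show "arg2 x + 1 <= local_cost x" unfolding cost by simp
qed

lemma solve_input_node:
 assumes "solve_input x" "arg3 x \<noteq> []"
 obtains j h ps tab where "arg3 x = (j, h, ps) # tab" "h = 2 ^ j" "h = arg1 x * 2 ^ length tab" "length ps <= arg2 x"
  "\<forall>e\<in>set ps. length (arg2 e) <= h \<and> length (rst3 e) <= 4 * h" "valid_table (arg1 x) (arg2 x) tab"
  "\<forall>w\<in>set (rst4 x). length (fst w) <= 4 * h \<and> length (snd w) <= 4 * h"
proof -
 obtain j h ps tab where x: "arg3 x = (j, h, ps) # tab" using assms(2) by (cases "arg3 x") auto
 then show thesis using assms(1) by (intro that[of j h ps tab]) auto
qed

abbreviation left_call :: "node => node" where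
 "left_call x \<equiv> (arg1 x, arg2 x, tl (arg3 x), map (left_state (arg2 (hd (arg3 x)))) (rst4 x))"

abbreviation right_call :: "node \<times> bool list => node" where
 "right_call y \<equiv> (arg1 (fst y), arg2 (fst y), tl (arg3 (fst y)), map ((%c. right_state (fst c) (arg2 c) (rst3 c))
   (fst (hd (arg3 (fst y))), arg2 (hd (arg3 (fst y))), snd y)) (zip (rst3 (hd (arg3 (fst y)))) (rst4 (fst y))))"

lemma computes_left_call: "computes (%x. solve_input x \<and> arg3 x \<noteq> []) left_call local_cost"
proof (rule computes_bound[where K = 20], (rule computes_map[OF computes_left_state] computes_intros TrueI | simp; fail)+,
 goal_cases)
 case (1 x)
 then have input: "solve_input x" by blast
 from 1 obtain j h ps tab where x: "arg3 x = (j, h, ps) # tab" by (cases "arg3 x") auto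
 obtain W where W: "local_cost x = W" by blast
 have "length (rst4 x) * (h + 1) <= (length (rst4 x) + 1) * h + arg2 x" using 1 by simp
 then show ?case using local_cost_bounds(2,3)[OF input x] unfolding W x by (simp add: sum_list_triv)
qed

abbreviation solved :: "node => bool list" where
 "solved x \<equiv> solve (arg1 x) (arg3 x) (rst4 x)"

lemma right_args_call:
 assumes y: "solve_input (fst y) \<and> arg3 (fst y) \<noteq> [] \<and> snd y = solved (left_call (fst y))"
  and q: "q \<in> set (zip (rst3 (hd (arg3 (fst y)))) (rst4 (fst y)))"
 shows "right_args ((fst (hd (arg3 (fst y))), arg2 (hd (arg3 (fst y))), snd y), q)"
proof -
 obtain j h ps tab where x: "arg3 (fst y) = (j, h, ps) # tab" "h = 2 ^ j" "h = arg1 (fst y) * 2 ^ length tab"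
  "\<forall>e\<in>set ps. length (arg2 e) <= h \<and> length (rst3 e) <= 4 * h"
   "\<forall>w\<in>set (rst4 (fst y)). length (fst w) <= 4 * h \<and> length (snd w) <= 4 * h"
  using y by (metis solve_input_node)
 have "length (snd y) = h" using y x(1,3) by (simp add: length_solve)
 moreover have "fst q \<in> set ps" "snd q \<in> set (rst4 (fst y))"
  using q x(1) set_zip_leftD[of "fst q" "snd q"] set_zip_rightD[of "fst q" "snd q"] by auto
 ultimately show ?thesis using x by auto
qed

lemma computes_right_call:
 "computes (%y. solve_input (fst y) \<and> arg3 (fst y) \<noteq> [] \<and> snd y = solved (left_call (fst y))) right_call (%y. local_cost (fst y))"
proof (rule computes_bound[where K = 40],
  (rule computes_map[OF computes_right_state] computes_intros | rule right_args_call; assumption | simp; fail)+, goal_cases)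
 case (1 y)
 then have input: "solve_input (fst y)" by blast
 from 1 obtain j h ps tab where y: "arg3 (fst y) = (j, h, ps) # tab" "length ps <= arg2 (fst y)" by (cases "arg3 (fst y)") auto
 note cost = local_cost_bounds(1,3)[OF input y(1)]
 obtain W where W: "local_cost (fst y) = W" by blast
 obtain V where V: "mult_cost (j + 3) = V" by blast
 define n where "n = length (zip ps (rst4 (fst y)))"
 have n: "n <= length (rst4 (fst y))" by (simp add: n_def)
 have "n * (V + 1) = n * V + n" by simp
 also have "... <= (length (rst4 (fst y)) + 1) * V + arg2 (fst y)" using n input by (intro add_mono mult_le_mono1) auto
 finally have "n * (V + 1) <= 9 * W" using cost unfolding W V by simp
 then show ?case using cost(2) y(2) unfolding W unfolding y(1) list.sel fst_conv snd_conv V by (simp add: sum_list_triv n_def)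
qed

lemma computes_solve: "computes solve_input solved (%x. solve_cost (arg1 x) (arg2 x) (length (arg3 x)))" (is "computes _ _ ?S")
proof (rule computes_double_recursion[where p = "%x. arg3 x = []" and base = "%x. leaf_block (arg1 x) (rst4 x)"
  and s = left_call and t = right_call and post = "%y. snd y @ snd (fst y)" and W = local_cost])
 show "computes (%x. solve_input x \<and> arg3 x = []) (%x. leaf_block (arg1 x) (rst4 x)) local_cost"
 proof -
  have "computes (%x. solve_input x \<and> arg3 x = []) (%x. (arg1 x, rst4 x)) (%_. 0)"
   by (rule computes_bound[where K = 1], (rule computes_intros)+) simp
  from computes_comp[OF computes_leaf_block this]
  have "computes (%x. solve_input x \<and> arg3 x = []) (%x. leaf_block (arg1 x) (rst4 x)) (%x. (2 ^ arg1 x) ^ 16)" by fastforce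
  then show ?thesis by (rule computes_bound[where K = 1]) simp
 qed
 show "computes (%y. solve_input (fst (fst y)) \<and> arg3 (fst (fst y)) \<noteq> [] \<and> snd (fst y) = solved (left_call (fst (fst y)))
   \<and> snd y = solved (right_call (fst y))) (%y. snd y @ snd (fst y)) (%y. local_cost (fst (fst y)))"
 proof (rule computes_bound[where K = 1], (rule computes_intros)+, goal_cases)
  case (1 y)
  then have input: "solve_input (fst (fst y))" by blast
  from 1 obtain j h ps tab where x: "arg3 (fst (fst y)) = (j, h, ps) # tab" "h = arg1 (fst (fst y)) * 2 ^ length tab"
   by (cases "arg3 (fst (fst y))") auto
  have "length (snd y) = h" using 1 x by (simp add: length_solve)
  then show ?case using local_cost_bounds(2)[OF input x(1)] by simp
 qed
 fix x assume input: "solve_input x"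
 show "solved x = (if arg3 x = [] then leaf_block (arg1 x) (rst4 x)
   else snd ((x, solved (left_call x)), solved (right_call (x, solved (left_call x))))
   @ snd (fst ((x, solved (left_call x)), solved (right_call (x, solved (left_call x))))))"
  by (cases "arg3 x") (auto simp: Let_def)
 assume node: "arg3 x \<noteq> []"
 obtain j h ps tab where x: "arg3 x = (j, h, ps) # tab" "h = arg1 x * 2 ^ length tab" "valid_table (arg1 x) (arg2 x) tab"
  "\<forall>w\<in>set (rst4 x). length (fst w) <= 4 * h \<and> length (snd w) <= 4 * h" using solve_input_node[OF input node] by metis
 show "solve_input (left_call x)" using x input by (auto simp: left_state_def)
 show "solve_input (right_call (x, solved (left_call x)))" using x input by (auto simp: right_state_def Let_def)
 show "local_cost x + ?S (left_call x) + ?S (right_call (x, solved (left_call x))) + 2 <= ?S x"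
  using solve_cost_Suc[of "length tab" "arg1 x" "arg2 x"] by (simp add: x(1))
qed ((rule computes_left_call computes_right_call) | (rule computes_bound[where K = 1], (rule computes_intros)+, force) |
 force simp: solve_cost_def)+

section \<open>Digit frequencies of the constructed number\<close>

lemma square_le_power: "4 <= k ==> k * k <= (2::nat) ^ k"
proof (induction k rule: nat_induct_at_least)
 case (Suc k)
 have "4 * k <= k * k" using Suc(1) by (rule mult_le_mono1)
 moreover have "Suc k * Suc k = k * k + 2 * k + 1" by simp
 ultimately have "Suc k * Suc k <= 2 * (k * k)" using Suc(1) by linarith
 then show ?case using Suc by simp
qed simp

lemma digits_known_growth:
 assumes "2 <= b" "4 <= k"
 shows "k * k <= b * Suc (digits_known b k)"
proof -
 have "(2::nat) ^ 2 ^ k <= b ^ Suc (digits_known b k)" using digits_known assms by blast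
 also have "... <= (2 ^ b) ^ Suc (digits_known b k)" by (rule power_mono) (simp_all add: less_imp_le)
 also have "... = 2 ^ (b * Suc (digits_known b k))" by (simp only: power_mult)
 finally have "2 ^ k <= b * Suc (digits_known b k)" by (simp only: power_increasing_iff)
 then show ?thesis using square_le_power[OF assms(2)] by linarith
qed

lemma digits_known_window:
 assumes b: "2 <= b" and k0: "4 <= k0" "digits_known b k0 <= N"
 obtains k where "k0 <= k" "digits_known b k <= N" "N < digits_known b (Suc k)"
proof -
 define K where "K = k0 + b * (N + 2)"
 have "b * (N + 2) * 1 <= Suc K * Suc K" by (intro mult_le_mono) (auto simp: K_def)
 also have "... <= b * Suc (digits_known b (Suc K))" by (rule digits_known_growth[OF b]) (use k0 in \<open>simp add: K_def\<close>)
 finally have "N + 2 <= Suc (digits_known b (Suc K))" unfolding mult_1_right mult_le_cancel1 using b by simp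
 then have "\<exists>k. k0 <= k \<and> N < digits_known b (Suc k)" by (intro exI[of _ K]) (auto simp: K_def)
 then obtain k where k: "k0 <= k" "N < digits_known b (Suc k)" and least: "\<And>i. i < k ==> \<not> (k0 <= i \<and> N < digits_known b (Suc i))"
  using exists_least_iff[of "%k. k0 <= k \<and> N < digits_known b (Suc k)"] by blast
 have "digits_known b k <= N" using least[of "k - 1"] k k0 by (cases "k = k0") auto
 then show thesis using that k by blast
qed

lemma fair_count_le:
 assumes count: "j * b * n <= (j + 6) * L + j * b * c" and j: "6 <= \<epsilon> * real j"
 shows "real b * real n <= (1 + \<epsilon>) * real L + real b * real c"
proof -
 have pos: "0 < real j" using j by (cases "j = 0") auto
 have "real (j * b * n) <= real ((j + 6) * L + j * b * c)" using count by (simp only: of_nat_le_iff)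
 then have "real j * (real b * real n) <= (real j + 6) * real L + real j * (real b * real c)" by (simp add: algebra_simps)
 also have "... <= (real j + \<epsilon> * real j) * real L + real j * (real b * real c)" using j by (intro add_mono mult_right_mono) auto
 also have "... = real j * ((1 + \<epsilon>) * real L + real b * real c)" by (simp add: algebra_simps)
 finally show ?thesis using pos by (simp only: mult_le_cancel_left_pos)
qed

lemma fair_chain_digit_count_le:
 assumes d: "d < b" and k: "k0 <= k" and fair: "\<And>k. k0 <= k ==> \<exists>j. 6 <= \<epsilon> * real j \<and> fair j b z (x k) (x (Suc k))"
 shows "x k0 <= x k" "real b * real (digit_count b d z (x k0) (x k)) <= (1 + \<epsilon>) * real (x k - x k0)"
proof -
 have "x k0 <= x k \<and> real b * real (digit_count b d z (x k0) (x k)) <= (1 + \<epsilon>) * real (x k - x k0)"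
  using k
 proof (induction k rule: nat_induct_at_least)
  case base
  then show ?case using digit_count_le[of b d z "x k0" "x k0"] by simp
 next
  case (Suc k)
  obtain j where j: "6 <= \<epsilon> * real j" "fair j b z (x k) (x (Suc k))" using fair[OF Suc(1)] by blast
  have mono: "x k <= x (Suc k)" using j(2) by (simp add: fair_def)
  have "real b * real (digit_count b d z (x k) (x (Suc k))) <= (1 + \<epsilon>) * real (x (Suc k) - x k)"
   using fair_count_le[of j b "digit_count b d z (x k) (x (Suc k))" "x (Suc k) - x k" 0, OF _ j(1)] j(2) d by (simp add: fair_def)
  moreover have "real b * real (digit_count b d z (x k0) (x (Suc k)))
    = real b * real (digit_count b d z (x k0) (x k)) + real b * real (digit_count b d z (x k) (x (Suc k)))"
   using digit_count_split[of "x k0" "x k" "x (Suc k)"] Suc(2) mono by (simp add: distrib_left)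
  moreover have "(1 + \<epsilon>) * real (x k - x k0) + (1 + \<epsilon>) * real (x (Suc k) - x k) = (1 + \<epsilon>) * real (x (Suc k) - x k0)"
   using Suc(2) mono by (simp add: of_nat_diff algebra_simps)
  ultimately show ?case using Suc(2) mono by linarith
 qed
 then show "x k0 <= x k" "real b * real (digit_count b d z (x k0) (x k)) <= (1 + \<epsilon>) * real (x k - x k0)" by auto
qed

lemma stage_index_negligible:
 fixes b k N :: nat
 assumes b: "2 <= b" and \<epsilon>: "0 < \<epsilon>" and k: "16 * (real b)\<^sup>2 <= \<epsilon> * real k" "4 <= k" and N: "digits_known b k <= N" "1 <= N"
 shows "8 * real b * real k <= \<epsilon> * real N"
proof -
 have "k * k <= b * (N + 1)"
  using order_trans[OF digits_known_growth[OF b k(2)] mult_le_mono2[of "Suc (digits_known b k)" "N + 1" b]] N by simp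
 then have "real (k * k) <= real (b * (N + 1))" by (simp only: of_nat_le_iff)
 then have "\<epsilon> * (real k * real k) <= \<epsilon> * (real b * (real N + 1))" using \<epsilon> by (intro mult_left_mono) (auto simp: algebra_simps)
 moreover have "16 * (real b)\<^sup>2 * real k <= \<epsilon> * real k * real k" using k(1) by (rule mult_right_mono) simp
 ultimately have "real b * (16 * real b * real k) <= real b * (\<epsilon> * (real N + 1))" by (simp add: power2_eq_square algebra_simps)
 then have "16 * real b * real k <= \<epsilon> * (real N + 1)" using b by simp
 also have "... <= \<epsilon> * (2 * real N)" using \<epsilon> N by (intro mult_left_mono) auto
 finally show ?thesis by simp
qed

lemma partial_stage_digit_count_le:
 assumes fair: "fair (leaf_level k) b z m m'" and level: "6 <= \<epsilon> * real (leaf_level k)" "4 <= k"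
  and d: "d < b" and N: "m <= N" "N <= m'"
 shows "real b * real (digit_count b d z m N) <= (1 + \<epsilon>) * real (N - m) + 8 * real b * real k + 5 * real b"
proof -
 have "leaf_level k * b * digit_count b d z m N <= (leaf_level k + 6) * (N - m) + leaf_level k * b * (2 ^ leaf_level k + 5)"
  using fair d N by (simp add: fair_def)
 then have "real b * real (digit_count b d z m N) <= (1 + \<epsilon>) * real (N - m) + real b * real (2 ^ leaf_level k + 5)"
  by (rule fair_count_le[OF _ level(1)])
 moreover have "real (2 ^ leaf_level k + 5) <= real (8 * k + 5)"
  using leaf_level_le(1)[OF level(2)] by (simp only: of_nat_le_iff add_right_mono)
 then have "real b * real (2 ^ leaf_level k + 5) <= real b * real (8 * k + 5)" by (rule mult_left_mono) simp
 then have "real b * real (2 ^ leaf_level k + 5) <= 8 * real b * real k + 5 * real b" by (simp add: algebra_simps)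
 ultimately show ?thesis by linarith
qed

lemma leaf_level_large:
 fixes b :: nat
 assumes \<epsilon>: "0 < (\<epsilon> :: real)"
 obtains k0 where "4 <= k0" "\<And>k. k0 <= k ==> 100 <= leaf_level k" "\<And>k. k0 <= k ==> b <= leaf_level k + 1"
  "\<And>k. k0 <= k ==> 6 <= \<epsilon> * real (leaf_level k)" "\<And>k. k0 <= k ==> 16 * (real b)\<^sup>2 <= \<epsilon> * real k"
proof -
 obtain a :: nat where a: "6 / \<epsilon> < real a" using reals_Archimedean2 by blast
 obtain q :: nat where q: "16 * (real b)\<^sup>2 / \<epsilon> < real q" using reals_Archimedean2 by blast
 let ?k0 = "2 ^ 2 ^ (a + 100 + b) + q + 4"
 show thesis
 proof (rule that[of ?k0])
  show "4 <= ?k0" by simp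
  fix k assume k: "?k0 <= k"
  have large: "a + 100 + b + 3 <= leaf_level k" using k by (intro leaf_level_ge) simp
  then show "100 <= leaf_level k" "b <= leaf_level k + 1" by auto
  have "6 < \<epsilon> * real a" using a \<epsilon> by (simp add: divide_less_eq mult.commute)
  also have "... <= \<epsilon> * real (leaf_level k)" using large \<epsilon> by (intro mult_left_mono) auto
  finally show "6 <= \<epsilon> * real (leaf_level k)" by simp
  have "16 * (real b)\<^sup>2 <= \<epsilon> * real q" using q \<epsilon> by (simp add: divide_less_eq mult.commute)
  also have "... <= \<epsilon> * real k" using k \<epsilon> by (intro mult_left_mono) auto
  finally show "16 * (real b)\<^sup>2 <= \<epsilon> * real k" .
 qed
qed

lemma eventually_digit_count_le:
 fixes z :: real and b :: nat
 assumes b: "2 <= b" and d: "d < b" and \<epsilon>: "0 < \<epsilon>"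
  and fair: "\<And>k. 4 <= k ==> 100 <= leaf_level k ==> b <= leaf_level k + 1 ==>
   fair (leaf_level k) b z (digits_known b k) (digits_known b (Suc k))"
 shows "\<forall>\<^sub>F N in sequentially. real b * real (digit_count b d z 0 N) <= (1 + 3 * \<epsilon>) * real N"
proof -
 obtain k0 where k0: "4 <= k0" and level: "\<And>k. k0 <= k ==> 100 <= leaf_level k" "\<And>k. k0 <= k ==> b <= leaf_level k + 1"
   "\<And>k. k0 <= k ==> 6 <= \<epsilon> * real (leaf_level k)" "\<And>k. k0 <= k ==> 16 * (real b)\<^sup>2 <= \<epsilon> * real k"
  using leaf_level_large[OF \<epsilon>, of b] by blast
 let ?x = "digits_known b" and ?D = "%m N. real b * real (digit_count b d z m N)"
 have fair': "fair (leaf_level k) b z (?x k) (?x (Suc k))" if "k0 <= k" for k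
  using level[OF that] that k0 by (intro fair) auto
 then have chain: "\<exists>j. 6 <= \<epsilon> * real j \<and> fair j b z (?x k) (?x (Suc k))" if "k0 <= k" for k using level(3) that by blast
 define c where "c = real b * real (?x k0) + 5 * real b"
 obtain n0 :: nat where n0: "c / \<epsilon> < real n0" using reals_Archimedean2 by blast
 show ?thesis using eventually_ge_at_top[of "n0 + ?x k0 + 1"]
 proof eventually_elim
  case (elim N)
  obtain k where k: "k0 <= k" "?x k <= N" "N < ?x (Suc k)" using digits_known_window[OF b k0, of N] elim by auto
  note stages = fair_chain_digit_count_le[of d b k0 k \<epsilon> z ?x, OF d k(1) chain]
  have index: "8 * real b * real k <= \<epsilon> * real N"
   using k k0 level(4)[OF k(1)] elim by (intro stage_index_negligible b \<epsilon>) auto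
  have "?D (?x k) N <= (1 + \<epsilon>) * real (N - ?x k) + 8 * real b * real k + 5 * real b"
   using k k0 by (intro partial_stage_digit_count_le[OF fair'[OF k(1)] level(3)[OF k(1)] _ d]) auto
  moreover have "?D 0 N = ?D 0 (?x k0) + ?D (?x k0) (?x k) + ?D (?x k) N"
   using digit_count_split[of 0 "?x k0" N] digit_count_split[of "?x k0" "?x k" N] stages(1) k(2) by (simp add: distrib_left)
  moreover have "?D 0 (?x k0) <= real b * real (?x k0)"
   using digit_count_le[of b d z 0 "?x k0"] by (intro mult_left_mono) auto
  moreover have "(1 + \<epsilon>) * real (?x k - ?x k0) + (1 + \<epsilon>) * real (N - ?x k) <= (1 + \<epsilon>) * real N"
   unfolding distrib_left[symmetric] using \<epsilon> stages(1) k(2) by (intro mult_left_mono) auto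
  moreover have "c <= \<epsilon> * real N"
  proof -
   have "c <= \<epsilon> * real n0" using n0 \<epsilon> by (simp add: divide_less_eq mult.commute)
   also have "... <= \<epsilon> * real N" using elim \<epsilon> by (intro mult_left_mono) auto
   finally show ?thesis .
  qed
  ultimately have "?D 0 N <= (1 + \<epsilon>) * real N + \<epsilon> * real N + \<epsilon> * real N"
   using stages(2) index unfolding c_def by linarith
  then show ?case by (simp add: algebra_simps)
 qed
qed

definition encodes :: "real => bool" where
 "encodes z \<longleftrightarrow> (\<forall>t. truncation z (2 ^ (t + 4)) (val (prefix_bits t)))"

lemma encodes_fair:
 assumes z: "0 <= z" "encodes z" and b: "2 <= b" and k: "4 <= k" "100 <= leaf_level k" "b <= leaf_level k + 1"
 shows "fair (leaf_level k) b z (digits_known b k) (digits_known b (Suc k))"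
proof -
 obtain t where t: "k = t + 4" using k(1) by (metis le_add_diff_inverse2)
 have len: "length (prefix_bits t) = 2 ^ k" by (simp add: length_prefix_bits t)
 have double: "(2::nat) ^ (Suc t + 4) = 2 ^ k + 2 ^ k" by (simp add: t power_add)
 have "val (prefix_bits (Suc t)) = val (prefix_bits t) * 2 ^ 2 ^ k + val (stage k (prefix_bits t))"
  using length_stage[OF k(1), of "prefix_bits t"] by (simp add: t)
 then have "truncation z (2 ^ k + 2 ^ k) (val (prefix_bits t) * 2 ^ 2 ^ k + val (stage k (prefix_bits t)))"
  using z(2)[unfolded encodes_def, rule_format, of "Suc t"] unfolding double by simp
 then show ?thesis by (rule fair_stage[OF k(1) refl k(2) b k(3) len z(1)])
qed

lemma sum_digit_count:
 assumes b: "0 < b"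
 shows "(\<Sum>d<b. digit_count b d z 0 N) = N"
proof -
 have "(\<Sum>d<b. digit_count b d z 0 N) = (\<Sum>d<b. \<Sum>i\<in>{i \<in> {..<N}. digit b z i = d}. 1)" by (simp add: digit_count_def)
 also have "... = (\<Sum>i<N. 1)" by (rule sum.group) (use b in \<open>auto simp: digit_def nat_less_iff\<close>)
 finally show ?thesis by simp
qed

theorem encodes_absolutely_normal:
 assumes z: "0 <= z" and encodes: "encodes z"
 shows "absolutely_normal z"
proof (rule absolutely_normal_if_simply_normal)
 fix b d :: nat
 assume b: "2 <= b" and d: "d < b"
 have "(%N. real (digit_count b d z 0 N) / real N) \<longlonglongrightarrow> 1 / real b"
 proof (rule frequencies_tendsto_uniform[where \<sigma> = 1 and M = b and f = "%d N. real (digit_count b d z 0 N) / real N"])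
  show "(\<Sum>W<b. real (digit_count b W z 0 N) / real N) = 1" if "0 < N" for N
   using sum_digit_count[of b z N] that b by (simp add: sum_divide_distrib[symmetric] flip: of_nat_sum)
  fix V :: nat and \<epsilon> :: real assume V: "V < b" and \<epsilon>: "0 < \<epsilon>"
  have "\<forall>\<^sub>F N in sequentially. real b * real (digit_count b V z 0 N) <= (1 + 3 * (\<epsilon> / 3)) * real N"
   using \<epsilon> by (intro eventually_digit_count_le[OF b V _ encodes_fair[OF z encodes b]]) auto
  then show "\<forall>\<^sub>F N in sequentially. 1 * (real (digit_count b V z 0 N) / real N - 1 / real b) <= \<epsilon>"
   using eventually_gt_at_top[of 0]
  proof eventually_elim
   case (elim N)
   have "real (digit_count b V z 0 N) <= (1 + \<epsilon>) / real b * real N" using elim(1) b by (simp add: field_simps)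
   then have "real (digit_count b V z 0 N) / real N <= (1 + \<epsilon>) / real b" using elim(2) by (simp add: divide_le_eq)
   also have "... = 1 / real b + \<epsilon> / real b" by (simp add: add_divide_distrib)
   also have "... <= 1 / real b + \<epsilon>" using b \<epsilon> by (simp add: divide_le_eq)
   finally show ?case by simp
  qed
 qed (use b d in auto)
 then show "(%N. real (card {i. i < N \<and> digit b z i = d}) / real N) \<longlonglongrightarrow> 1 / real b" by (simp add: digit_count_def)
qed

lemma nested_truncations:
 assumes mono: "\<And>t. n t <= n (Suc t)" and prefix: "\<And>t. v t = v (Suc t) div 2 ^ (n (Suc t) - n t)"
 shows "\<exists>z. \<forall>t. truncation z (n t) (v t)"
proof -
 define lower where "lower t = real (v t) / 2 ^ n t" for t
 define upper where "upper t = real (v t + 1) / 2 ^ n t" for t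
 have pos: "(0::real) < 2 ^ k" for k by simp
 have scale: "x / 2 ^ n t = x * 2 ^ (n (Suc t) - n t) / 2 ^ n (Suc t)" for x :: real and t
  using mono[of t] by (simp add: power_diff)
 have "lower t <= lower (Suc t)" for t
 proof -
  have "v t * 2 ^ (n (Suc t) - n t) <= v (Suc t)" unfolding prefix[of t] by (rule div_times_less_eq_dividend)
  then have "real (v t) * 2 ^ (n (Suc t) - n t) <= real (v (Suc t))"
   by (metis of_nat_le_iff of_nat_mult of_nat_numeral of_nat_power)
  then show ?thesis unfolding lower_def scale[of "real (v t)"] by (intro divide_right_mono) auto
 qed
 then have lower_mono: "lower s <= lower t" if "s <= t" for s t using lift_Suc_mono_le[of lower] that by blast
 have "upper (Suc t) <= upper t" for t
 proof -
  have "v (Suc t) + 1 <= (v t + 1) * 2 ^ (n (Suc t) - n t)"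
   unfolding prefix[of t] using dividend_less_div_times[of "2 ^ (n (Suc t) - n t)" "v (Suc t)"] by (simp add: Suc_le_eq)
  then have "real (v (Suc t) + 1) <= real (v t + 1) * 2 ^ (n (Suc t) - n t)"
   by (metis of_nat_le_iff of_nat_mult of_nat_numeral of_nat_power)
  then show ?thesis unfolding upper_def scale[of "real (v t + 1)"] by (intro divide_right_mono) auto
 qed
 then have upper_mono: "upper t <= upper s" if "s <= t" for s t using lift_Suc_antimono_le[of upper] that by blast
 have lower_le_upper: "lower s <= upper t" for s t
 proof -
  have "lower s <= lower (max s t)" by (rule lower_mono) simp
  also have "... <= upper (max s t)" unfolding lower_def upper_def by (intro divide_right_mono) auto
  also have "... <= upper t" by (rule upper_mono) simp
  finally show ?thesis .
 qed
 have "truncation (Sup (range lower)) (n t) (v t)" for t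
 proof -
  have "lower t <= Sup (range lower)" by (rule cSup_upper) (auto intro!: bdd_aboveI[of _ "upper 0"] lower_le_upper)
  moreover have "Sup (range lower) <= upper t" by (rule cSup_least) (auto intro: lower_le_upper)
  ultimately show ?thesis by (simp add: truncation_def lower_def upper_def divide_le_eq le_divide_eq)
 qed
 then show ?thesis by blast
qed

lemma encodes_exists: "\<exists>z. 0 <= z \<and> z < 1 \<and> encodes z"
proof -
 have "\<exists>z. \<forall>t. truncation z (2 ^ (t + 4)) (val (prefix_bits t))"
 proof (rule nested_truncations)
  fix t
  have "(2::nat) ^ (Suc t + 4) - 2 ^ (t + 4) = 2 ^ (t + 4)" by (simp add: power_add)
  then show "val (prefix_bits t) = val (prefix_bits (Suc t)) div 2 ^ (2 ^ (Suc t + 4) - 2 ^ (t + 4))"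
   using val_less[of "stage (t + 4) (prefix_bits t)"] by (simp add: length_stage)
 qed simp
 then obtain z where z: "encodes z" by (auto simp: encodes_def)
 have "val (prefix_bits 0) = 0" by simp
 then have "0 <= z * 2 ^ 2 ^ 4" "z * 2 ^ 2 ^ 4 <= 1"
  using z[unfolded encodes_def, rule_format, of 0] unfolding truncation_def by simp_all
 then have "0 <= z" "z < 1" by simp_all
 then show ?thesis using z by blast
qed

lemma nth_iff_val_div:
 assumes "i < length xs"
 shows "xs ! i \<longleftrightarrow> val xs div 2 ^ i mod 2 = 1"
proof -
 have "val (drop i xs) = of_bool (xs ! i) + 2 * val (drop (Suc i) xs)" using assms by (simp flip: Cons_nth_drop_Suc)
 then show ?thesis unfolding val_drop by (cases "xs ! i") auto
qed

lemma absolutely_normal_not_dyadic: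
 assumes normal: "absolutely_normal z"
 shows "z * 2 ^ L \<noteq> real a"
proof
 assume dyadic: "z * 2 ^ L = real a"
 have zeros: "digit 2 z i = 0" if "L <= i" for i
 proof -
  have "z * 2 ^ (i + 1) = z * 2 ^ L * 2 ^ (i + 1 - L)" using that by (simp add: power_add[symmetric] mult.assoc)
  also have "... = real (a * 2 ^ Suc (i - L))" unfolding dyadic using that by (simp add: Suc_diff_le)
  finally have "\<lfloor>z * 2 ^ (i + 1)\<rfloor> = int (a * 2 ^ Suc (i - L))" by (simp only: floor_of_nat)
  then show ?thesis by (simp add: digit_def)
 qed
 have "{i. i < N \<and> (\<forall>j<length [1]. digit 2 z (i + j) = [1] ! j)} \<subseteq> {..<L}" for N
 proof
  fix i assume "i \<in> {i. i < N \<and> (\<forall>j<length [1]. digit 2 z (i + j) = [1] ! j)}"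
  then have "digit 2 z i = 1" by simp
  then show "i \<in> {..<L}" using zeros[of i] by (cases "L <= i") auto
 qed
 then have occ: "occ 2 z [1] N <= L" for N unfolding occ_def using card_mono[of "{..<L}"] by fastforce
 have "(%N. real (occ 2 z [1] N) / real N) \<longlonglongrightarrow> 0"
 proof (rule real_tendsto_sandwich[of "%_. 0"])
  show "\<forall>\<^sub>F N in sequentially. real (occ 2 z [1] N) / real N <= real L / real N"
   using occ by (intro always_eventually allI divide_right_mono) auto
  show "(%N. real L / real N) \<longlonglongrightarrow> 0" using tendsto_mult_right_zero[OF lim_1_over_n, of "real L"] by simp
 qed auto
 moreover have "normal_in_base 2 z" using normal by (simp add: absolutely_normal_def)
 then have "(%N. real (occ 2 z [1] N) / real N) \<longlonglongrightarrow> 1 / real 2 ^ length [1::nat]"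
  unfolding normal_in_base_def by (elim allE[of _ "[1]"]) simp
 ultimately have "1 / real 2 ^ length [1::nat] = 0" by (metis LIMSEQ_unique)
 then show False by simp
qed

lemma truncation_digit:
 assumes trunc: "truncation z L a" and not_upper: "z * 2 ^ L \<noteq> real (a + 1)" and n: "n < L"
 shows "digit 2 z n = a div 2 ^ (L - Suc n) mod 2"
proof -
 have "\<lfloor>z * 2 ^ L\<rfloor> = int a" using trunc not_upper by (auto simp: truncation_def floor_eq_iff)
 then have "\<lfloor>z * real 2 ^ (n + 1)\<rfloor> = int a div int (2 ^ (L - Suc n))"
  using floor_mult_power_div[of 2 z "n + 1" "L - Suc n"] n by simp
 then show ?thesis unfolding digit_def by (metis nat_int of_nat_numeral zdiv_int zmod_int)
qed

lemma encodes_digits: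
 assumes z: "0 <= z" "encodes z" and n: "n < 2 ^ (t + 4)"
 shows "rev (prefix_bits t) ! n \<longleftrightarrow> digit 2 z n = 1"
proof -
 define L :: nat where "L = 2 ^ (t + 4)"
 have len: "length (prefix_bits t) = L" by (simp add: length_prefix_bits L_def)
 have "truncation z L (val (prefix_bits t))" using z(2) by (simp add: encodes_def L_def)
 then have "digit 2 z n = val (prefix_bits t) div 2 ^ (L - Suc n) mod 2"
  using n unfolding L_def[symmetric] by (intro truncation_digit absolutely_normal_not_dyadic encodes_absolutely_normal z)
 moreover have "rev (prefix_bits t) ! n = prefix_bits t ! (L - Suc n)" using n len by (simp add: rev_nth L_def)
 moreover have "L - Suc n < length (prefix_bits t)" using n len by (simp add: L_def)
 ultimately show ?thesis using nth_iff_val_div by simp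
qed

section \<open>Cost of a stage\<close>

lemma computes_base_list: "computes (%x. snd x \<noteq> []) (%x. base_list (fst x) (snd x)) (%x. fst x * (length (snd x) + fst x + 3))"
proof (rule computes_recursion[where p = "%x. fst x = 0" and base = "%x. []"
  and s = "%x. (fst x - Suc 0, add_bits False (snd x) [True])"
  and post = "%y. snd (fst y) # snd y" and W = "%x. if fst x = 0 then 0 else length (snd x) + 1" and K = 3],
   (rule computes_intros)+, goal_cases)
 case (5 x)
 then show ?case by (cases "fst x") auto
next
 case (8 x)
 then obtain n where n: "fst x = Suc n" by (cases "fst x") auto
 have "max (length (snd x)) (Suc 0) = length (snd x)" using 8(1) by (cases "snd x") auto
 then show ?case by (simp add: n)
qed auto

lemma computes_start_state:
 "computes (%p. arg2 (fst p) = 2 ^ fst (fst p) \<and> length (rst3 (fst p)) <= 2 ^ fst (fst p) \<and> length (arg2 (snd p))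
   <= 2 ^ fst (fst p))
  (%p. start_state (fst (fst p)) (arg2 (fst p)) (rst3 (fst p)) (snd p)) (%p. mult_cost (fst (fst p)))"
 unfolding start_state_def
proof (rule computes_bound[where K = 20], (rule computes_fast_mult computes_intros | simp; fail)+, goal_cases)
 case (1 p)
 then show ?case using mult_cost_bounds(3)[of "fst (fst p)"] by simp
qed

lemma computes_leaf_level: "computes (%_. True) leaf_level (%k. k)"
 unfolding leaf_level_def
proof (rule computes_bound[where K = 40], (rule computes_intros)+, goal_cases)
 case (1 k)
 have "floor_log 2 X <= X" for X
 proof (cases "X = 0")
  case True
  then show ?thesis by (simp add: floor_log.simps[of 2 0])
 next
  case False
  then have "2 ^ floor_log 2 X <= X" using floor_log_bounds[of 2 X] by simp
  then show ?thesis using less_exp[of "floor_log 2 X"] by linarith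
 qed
 then have "floor_log 2 k <= k" "floor_log 2 (floor_log 2 k) <= floor_log 2 k" by blast+
 then show ?case by simp
qed

lemma valid_table_lower_powers: "valid_table (2 ^ j) j (lower_powers j t)"
proof (induction t)
 case (Suc t)
 have "j < 2 ^ (j + t)" using less_le_trans[OF less_exp[of j], of "2 ^ (j + t)"] by (simp add: power_increasing)
 then have "length (arg2 e) <= 2 ^ (j + t) \<and> length (rst3 e) <= 4 * 2 ^ (j + t)" if "e \<in> set (base_powers j (j + t))" for e
  using length_base_powers_entry[OF that] by auto
 then show ?case using Suc by (simp add: power_add)
qed simp

lemma power_table_base_list:
 "hd (power_table (base_list j [False, True]) k) = (k, 2 ^ k, base_powers j k)" "power_table (base_list j [False, True]) k \<noteq> []"
 using hd_power_table by (auto simp: base_powers_def)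

definition stage_unit :: "nat => nat" where
 "stage_unit k = 2 ^ k * (k + 1) ^ 18"

lemma stage_unit_bounds:
 "k <= stage_unit k" "2 ^ k <= stage_unit k" "k * k <= stage_unit k" "(k + 1) * mult_cost k <= stage_unit k"
  "stage_unit k <= 2 ^ k * (k + 1) ^ 128"
 "j <= k ==> table_level_cost k j <= 27 * stage_unit k"
proof -
 have "1 * (k + 1) <= stage_unit k" unfolding stage_unit_def by (intro mult_le_mono self_le_power) auto
 then show "k <= stage_unit k" by simp
 have "2 ^ k * 1 <= stage_unit k" unfolding stage_unit_def by (intro mult_le_mono2) simp
 then show "2 ^ k <= stage_unit k" by simp
 have "1 * (k + 1) ^ 2 <= stage_unit k" unfolding stage_unit_def by (intro mult_le_mono power_increasing) auto
 then show "k * k <= stage_unit k" by (simp add: power2_eq_square)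
 have "(k + 1) * mult_cost k = 2 ^ k * ((k + 1) * (k + 1) ^ 15)" by (simp only: mult_cost_def mult.left_commute)
 also have "(k + 1) * (k + 1) ^ 15 = (k + 1) ^ 16" by (simp only: power_Suc[symmetric]) simp
 also have "2 ^ k * (k + 1) ^ 16 <= stage_unit k" unfolding stage_unit_def by (intro mult_le_mono2 power_increasing) auto
 finally show "(k + 1) * mult_cost k <= stage_unit k" .
 show "stage_unit k <= 2 ^ k * (k + 1) ^ 128" unfolding stage_unit_def by (intro mult_le_mono2 power_increasing) auto
 show "table_level_cost k j <= 27 * stage_unit k" if "j <= k"
 proof -
  have "table_level_cost k j <= mult_cost k * (3 * (k + 1)) ^ 3"
   unfolding table_level_cost_def using that by (intro mult_le_mono2 power_mono) auto
  also have "... = 27 * (2 ^ k * ((k + 1) ^ 15 * (k + 1) ^ 3))" by (simp only: mult_cost_def power_mult_distrib) simp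
  also have "(k + 1) ^ 15 * (k + 1) ^ 3 = (k + 1) ^ 18" by (simp only: power_add[symmetric]) simp
  finally show ?thesis by (simp add: stage_unit_def)
 qed
qed

abbreviation stage_input :: "nat \<times> bool list => bool" where
 "stage_input x \<equiv> 4 <= fst x \<and> length (snd x) = 2 ^ fst x"

abbreviation stage_table :: "nat => nat => table" where
 "stage_table j k \<equiv> power_table (base_list j [False, True]) k"

lemma computes_stage_table:
 "computes (%x. stage_input (fst x) \<and> snd x = leaf_level (fst (fst x))) (%x. (x, stage_table (snd x) (fst (fst x))))
   (%x. stage_unit (fst (fst x)))"
 (is "computes ?D _ _")
proof -
 have level: "snd x <= fst (fst x)" "4 <= fst (fst x)" if "?D x" for x using that leaf_level_le(2)[of "fst (fst x)"] by auto
 have "computes ?D (%x. (snd x, [False, True])) (%_. 0)" by (rule computes_bound[where K = 1], (rule computes_intros)+) simp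
 from computes_comp[OF computes_base_list this]
 have bases: "computes ?D (%x. base_list (snd x) [False, True]) (%x. snd x * (snd x + 5))" by (simp add: add.commute)
 have input: "computes ?D (%x. (base_list (snd x) [False, True], fst (fst x))) (%x. stage_unit (fst (fst x)))"
 proof (rule computes_bound[where K = 20], (rule bases computes_intros)+, goal_cases)
  case (1 x)
  have "snd x * (snd x + 5) <= fst (fst x) * (fst (fst x) + 5)" using level[OF 1] by (intro mult_le_mono) auto
  also have "... <= fst (fst x) * (3 * fst (fst x))" using level[OF 1] by (intro mult_le_mono2) simp
  finally show ?case using stage_unit_bounds(3)[of "fst (fst x)"] by simp
 qed
 have dom: "bases_input (base_list (snd x) [False, True], fst (fst x))" for x :: "(nat \<times> bool list) \<times> nat"
  using in_base_list by auto
 from computes_comp[OF computes_power_table_uncurried input, OF dom]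
 have "computes ?D (%x. stage_table (snd x) (fst (fst x))) (%x. stage_unit (fst (fst x)) + 4
   * table_level_cost (fst (fst x)) (snd x))" by simp
 then have "computes ?D (%x. stage_table (snd x) (fst (fst x))) (%x. stage_unit (fst (fst x)))"
 proof (rule computes_bound[where K = 200])
  fix x assume "?D x"
  then show "stage_unit (fst (fst x)) + 4 * table_level_cost (fst (fst x)) (snd x) <= 200 * (stage_unit (fst (fst x)) + 1)"
   using stage_unit_bounds(6)[OF level(1), of x] by simp
 qed
 from computes_Pair[OF computes_id this] show ?thesis by simp
qed

abbreviation staged :: "((nat \<times> bool list) \<times> nat) \<times> table => bool" where
 "staged z \<equiv> stage_input (fst (fst z)) \<and> snd (fst z) = leaf_level (fst (fst (fst z)))
   \<and> snd z = stage_table (snd (fst z)) (fst (fst (fst z)))"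

abbreviation stage_args :: "((nat \<times> bool list) \<times> nat) \<times> table => node" where
 "stage_args z \<equiv> (2 ^ snd (fst z), snd (fst z), take (fst (fst (fst z)) - snd (fst z)) (tl (snd z)),
  map ((%c. start_state (fst c) (arg2 c) (rst3 c)) (fst (fst (fst z)), arg2 (hd (snd z)), snd (fst (fst z))))
   (rst3 (hd (snd z))))"

lemma computes_stage_args: "computes staged stage_args (%z. stage_unit (fst (fst (fst z))))"
proof -
 have start: "arg2 (hd (snd z)) = 2 ^ fst (fst (fst z)) \<and> length (snd (fst (fst z))) <= 2 ^ fst (fst (fst z))
   \<and> length (arg2 e) <= 2 ^ fst (fst (fst z))"
  if "staged z" "e \<in> set (rst3 (hd (snd z)))" for z e
  using that length_base_powers_entry by (auto simp: power_table_base_list)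
 have nonempty: "snd z \<noteq> []" if "staged z" for z using that by (simp add: power_table_base_list)
 show ?thesis
 proof (rule computes_bound[where K = 60],
   (rule computes_map[OF computes_start_state] computes_intros | erule nonempty | unfold fst_conv snd_conv, rule start;
    assumption)+, goal_cases)
  case (1 z)
  define k where "k = fst (fst (fst z))"
  define j where "j = snd (fst z)"
  have k: "4 <= k" using 1 by (simp add: k_def)
  have j: "j <= k" "2 ^ j <= 8 * k" using 1 leaf_level_le(1,2)[OF k] by (auto simp: k_def j_def)
  have hd: "hd (snd z) = (k, 2 ^ k, base_powers j k)" using 1 power_table_base_list by (simp add: k_def j_def)
  have "j * (2 ^ j + 5) <= k * (8 * k + 5)" using j by (intro mult_le_mono) auto
  also have "... <= k * (10 * k)" using k by (intro mult_le_mono2) simp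
  finally have power: "j * (2 ^ j + 5) <= 10 * stage_unit k" using stage_unit_bounds(3)[of k] by simp
  have "j * mult_cost k <= (k + 1) * mult_cost k" using j by (intro mult_le_mono1) simp
  then have states: "j * mult_cost k <= stage_unit k" using stage_unit_bounds(4)[of k] by linarith
  show ?case using power states stage_unit_bounds(1,2)[of k] j(1) unfolding hd fst_conv snd_conv k_def[symmetric] j_def[symmetric]
   by (simp add: sum_list_triv algebra_simps)
 qed
qed

lemma solve_input_stage_args:
 assumes z: "staged z"
 shows "solve_input (stage_args z)"
proof -
 define k where "k = fst (fst (fst z))"
 define j where "j = snd (fst z)"
 have "4 <= k" using z by (simp add: k_def)
 then have j: "j <= k" "4 <= j" using z leaf_level_le(2,3)[of k] by (auto simp: k_def j_def)
 have table: "snd z = power_table (base_list j [False, True]) k" using z by (simp add: k_def j_def)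
 have hd: "hd (snd z) = (k, 2 ^ k, base_powers j k)" unfolding table by (rule power_table_base_list)
 have lower: "take (k - j) (tl (snd z)) = lower_powers j (k - j)" using j(1) by (simp add: table lower_powers_def)
 have "(2::nat) ^ 1 <= 2 ^ j" using j by (intro power_increasing) auto
 moreover have "j + 1 <= 2 ^ j" "2 ^ j + 1 <= (2::nat) ^ 2 ^ j" by (simp_all add: Suc_le_eq)
 then have "j + 1 <= 2 ^ 2 ^ j" by linarith
 moreover have "length (fst (start_state k (2 ^ k) P e)) <= 2 * 2 ^ k \<and> length (snd (start_state k (2 ^ k) P e)) <= 2 * 2 ^ k"
  if "e \<in> set (base_powers j k)" for P e
  using length_base_powers_entry(1)[OF that] by (auto simp: start_state_def)
 moreover have "2 ^ j * 2 ^ (k - j) = (2::nat) ^ k" using j(1) by (simp flip: power_add)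
 ultimately show ?thesis
  unfolding fst_conv snd_conv k_def[symmetric] j_def[symmetric] hd lower using valid_table_lower_powers[of j "k - j"] by auto
qed

lemma solve_cost_stage_le:
 assumes k: "4 <= k" and j: "j = leaf_level k"
 shows "solve_cost (2 ^ j) j (k - j) <= (8 * 13 ^ 15 + 5) * (2 ^ k * (k + 1) ^ 128)"
proof -
 define lam :: nat where "lam = 2 ^ j"
 have leaf_bounds: "j <= k" "lam <= 8 * k" "lam <= 8 * floor_log 2 k" using leaf_level_le[OF k] j by (auto simp: lam_def)
 have "(2::nat) ^ lam <= 2 ^ (8 * floor_log 2 k)" using leaf_bounds by (intro power_increasing) auto
 also have "... = (2 ^ floor_log 2 k) ^ 8" by (simp only: power_mult[symmetric] mult.commute)
 also have "... <= (k + 1) ^ 8" using floor_log_bounds[of 2 k] k by (intro power_mono) auto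
 finally have "(2 ^ lam) ^ 16 <= ((k + 1) ^ 8) ^ 16" by (rule power_mono) simp
 then have leaf: "(2 ^ lam) ^ 16 <= (k + 1) ^ 128" by (simp only: power_mult[symmetric]) simp
 have "node_cost lam j (k - j) <= (k + 1) * (8 * (k + 1)) * (13 * (k + 1)) ^ 15"
  unfolding node_cost_def using leaf_bounds by (intro mult_le_mono power_mono) auto
 also have "... = 8 * 13 ^ 15 * ((k + 1) * (k + 1) * (k + 1) ^ 15)" by (simp only: power_mult_distrib ac_simps)
 also have "(k + 1) * (k + 1) * (k + 1) ^ 15 = (k + 1) ^ 17" by (simp only: mult.assoc power_Suc[symmetric]) simp
 finally have "node_cost lam j (k - j) + 2 <= (8 * 13 ^ 15 + 2) * (k + 1) ^ 17"
  using one_le_power[of "k + 1" 17] unfolding add_mult_distrib by linarith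
 then have "(k - j) * (node_cost lam j (k - j) + 2) <= (k + 1) * ((8 * 13 ^ 15 + 2) * (k + 1) ^ 17)" by (intro mult_le_mono) auto
 also have "... = (8 * 13 ^ 15 + 2) * ((k + 1) * (k + 1) ^ 17)" by (simp only: ac_simps)
 also have "... <= (8 * 13 ^ 15 + 2) * (k + 1) ^ 128" unfolding power_Suc[symmetric]
  by (intro mult_le_mono2 power_increasing) auto
 finally have nodes: "(k - j) * (node_cost lam j (k - j) + 2) <= (8 * 13 ^ 15 + 2) * (k + 1) ^ 128" .
 have "(2 ^ lam) ^ 16 + 2 + (k - j) * (node_cost lam j (k - j) + 2) <= (8 * 13 ^ 15 + 5) * (k + 1) ^ 128"
  using leaf nodes one_le_power[of "k + 1" 128] unfolding add_mult_distrib by linarith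
 then have "solve_cost lam j (k - j) <= 2 ^ k * ((8 * 13 ^ 15 + 5) * (k + 1) ^ 128)"
  unfolding solve_cost_def by (intro mult_le_mono power_increasing) auto
 then show ?thesis by (simp only: lam_def ac_simps)
qed

lemma computes_stage: "computes stage_input (%x. stage (fst x) (snd x)) (%x. 2 ^ fst x * (fst x + 1) ^ 128)"
 (is "computes _ _ ?T")
proof -
 let ?z = "%x. ((x, leaf_level (fst x)), stage_table (leaf_level (fst x)) (fst x))"
 have level: "computes stage_input (%x. (x, leaf_level (fst x))) (%x. stage_unit (fst x))"
 proof (rule computes_bound[where K = 2], (rule computes_total_comp[OF computes_leaf_level] computes_intros)+, goal_cases)
  case (1 x)
  show ?case using stage_unit_bounds(1)[of "fst x"] by simp
 qed
 have table: "computes stage_input ?z (%x. stage_unit (fst x) + stage_unit (fst x))"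
  using computes_comp[OF computes_stage_table level] by simp
 have staged: "staged (?z x)" if "stage_input x" for x using that by simp
 have "computes stage_input (%x. stage_args (?z x)) (%x. stage_unit (fst x) + stage_unit (fst x)
   + stage_unit (fst (fst (fst (?z x)))))"
  by (rule computes_comp[OF computes_stage_args table, OF staged])
 note args = computes_comp[OF computes_solve this, OF solve_input_stage_args[OF staged]]
 show ?thesis
 proof (rule computes_cong[OF computes_bound[OF args, where K = "8 * 13 ^ 15 + 8"]])
  fix x assume x: "stage_input x"
  obtain C :: nat where C: "8 * 13 ^ 15 = C" by blast
  have "solve_cost (2 ^ leaf_level (fst x)) (leaf_level (fst x)) (fst x - leaf_level (fst x)) <= (8 * 13 ^ 15 + 5) * ?T x"
   using x by (intro solve_cost_stage_le) auto
  moreover have "length (arg3 (stage_args (?z x))) = fst x - leaf_level (fst x)" using leaf_level_le(2) x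
   by (simp add: length_power_table)
  ultimately show "stage_unit (fst x) + stage_unit (fst x) + stage_unit (fst (fst (fst (?z x))))
    + solve_cost (arg1 (stage_args (?z x))) (arg2 (stage_args (?z x))) (length (arg3 (stage_args (?z x))))
     <= (8 * 13 ^ 15 + 8) * (?T x + 1)"
   using stage_unit_bounds(5)[of "fst x"] unfolding C fst_conv snd_conv by (simp add: algebra_simps)
 next
  fix x :: "nat \<times> bool list"
  show "solved (stage_args (?z x)) = stage (fst x) (snd x)" by (simp add: stage_def Let_def)
 qed
qed

section \<open>The main loop\<close>

definition emit_step :: "ins list" where
 "emit_step = [IPush, IHd, IOut, ISwap, ITl, ISwap, ICons, IHd, ICall]"

definition emit_loop :: "ins list" where
 "emit_loop = [IPush, IBr emit_step []]"

lemma moves_emit_step: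
 "moves 9 (machine_state (enc_code emit_step) (Node v w) s f, u)
  (machine_state f w (Node (Node (enc_code []) f) s) f, u @ [v \<noteq> Leaf])"
proof -
 have "moves (1 + (1 + (1 + (1 + (1 + (1 + (1 + (1 + 1)))))))) (machine_state (enc_code emit_step) (Node v w) s f, u)
  (machine_state f (left (Node (right (Node v w)) (left (Node v w)))) (Node (Node (enc_code []) f) s) f,
   u @ [left (Node v w) \<noteq> Leaf])"
  unfolding emit_step_def by (rule moves_trans moves_ins)+
 then show ?thesis by (simp add: numeral_eq_Suc)
qed

lemma moves_return: "moves 2 (machine_state (enc_code []) v (Node (Node (enc_code []) f) (Node (Node q g) s)) f, u)
   (machine_state q v s g, u)"
 using moves_trans[OF moves_ins(11) moves_ins(11)] by (simp add: numeral_eq_Suc)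

lemma moves_emit_loop:
 "\<exists>n \<le> 20 * (length xs + 1). moves n (machine_state (enc_code emit_loop) (enc xs) (Node (Node q g) s) (enc_code emit_loop), u)
  (machine_state q Leaf s g, u @ (xs :: bool list))"
proof (induction xs arbitrary: q g s u)
 case Nil
 let ?f = "enc_code emit_loop"
 have "moves (1 + (1 + 2)) (machine_state ?f Leaf (Node (Node q g) s) ?f, u) (machine_state q Leaf s g, u)"
  by (subst (1) emit_loop_def, rule moves_trans[OF moves_ins(4)],
   rule moves_trans[OF moves_ins(7)[of _ _ _ Leaf, unfolded if_P[OF refl]] moves_return])
 then show ?case by (intro exI[of _ "1 + (1 + 2)"]) simp
next
 case (Cons x xs)
 let ?f = "enc_code emit_loop"
 let ?s = "Node (Node (enc_code []) ?f) (Node (Node q g) s)"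
 obtain n where n: "n <= 20 * (length xs + 1)"
  "moves n (machine_state ?f (enc xs) (Node (Node (enc_code []) ?f) ?s) ?f, u @ [x])
    (machine_state (enc_code []) Leaf ?s ?f, (u @ [x]) @ xs)"
  using Cons.IH by blast
 have "moves (1 + 1) (machine_state ?f (enc (x # xs)) (Node (Node q g) s) ?f, u)
   (machine_state (enc_code emit_step) (enc (x # xs)) ?s ?f, u)"
  using moves_trans[OF moves_ins(4)[of "[IBr emit_step []]" "enc (x # xs)" "Node (Node q g) s" ?f u]
   moves_ins(7)[of emit_step "[]" "[]" "enc (x # xs)" "enc (x # xs)" "Node (Node q g) s" ?f u]]
  by (simp add: emit_loop_def)
 also have "moves 9 (machine_state (enc_code emit_step) (enc (x # xs)) ?s ?f, u)
   (machine_state ?f (enc xs) (Node (Node (enc_code []) ?f) ?s) ?f, u @ [x])"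
  using moves_emit_step[of "enc x" "enc xs" ?s ?f u] by simp
 also note n(2)
 also note moves_return
 finally show ?case using n(1) by (intro exI[of _ "1 + 1 + 9 + n + 2"]) simp
qed

lemma moves_emit:
 "\<exists>n \<le> 20 * (length xs + 2). moves n (machine_state (enc_code (IFix emit_loop # r)) (enc xs) s f, u)
   (machine_state (enc_code r) Leaf s f, u @ (xs :: bool list))"
proof -
 obtain n where n: "n <= 20 * (length xs + 1)"
  "moves n (machine_state (enc_code emit_loop) (enc xs) (Node (Node (enc_code r) f) s) (enc_code emit_loop), u)
  (machine_state (enc_code r) Leaf s f, u @ xs)" using moves_emit_loop by blast
 from moves_trans[OF moves_ins(8) n(2)] n(1) show ?thesis by (intro exI[of _ "1 + n"]) simp
qed

lemma output_loop_exists: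
 assumes out: "computes D out T" and advance: "computes D advance T"
  and T: "\<And>x. D x ==> length (out x :: bool list) <= T x" "\<And>x. D x ==> 1 <= T x"
 obtains F K where "\<And>x s u. D x ==> \<exists>n s'. n <= K * T x \<and>
  moves n (machine_state F (enc x) s F, u) (machine_state F (enc (advance x)) s' F, u @ out x)"
proof -
 obtain c J where c: "\<And>f x. D x ==> evals f c x (out x) (J * (T x + 1))" using out by (rule computesE) blast
 obtain d L where d: "\<And>f x. D x ==> evals f d x (advance x) (L * (T x + 1))" using advance by (rule computesE) blast
 define F where "F = enc_code (IPush # c @ (IFix emit_loop # (ISwap # d @ [ICall])))"
 have "\<exists>n s'. n <= (2 * J + 2 * L + 100) * T x \<and>
   moves n (machine_state F (enc x) s F, u) (machine_state F (enc (advance x)) s' F, u @ out x)" if D: "D x" for x s u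
 proof -
  obtain n where n: "n <= J * (T x + 1)" "runs F c (enc x) (enc (out x)) n" using c[OF D] by (auto simp: evals_def)
  obtain m where m: "m <= L * (T x + 1)" "runs F d (enc x) (enc (advance x)) m" using d[OF D] by (auto simp: evals_def)
  obtain k where k: "k <= 20 * (length (out x) + 2)"
   "moves k (machine_state (enc_code (IFix emit_loop # (ISwap # d @ [ICall]))) (enc (out x)) (Node (enc x) s) F, u)
    (machine_state (enc_code (ISwap # d @ [ICall])) Leaf (Node (enc x) s) F, u @ out x)"
   using moves_emit by blast
  have "moves (1 + (n + (k + (1 + (m + 1))))) (machine_state F (enc x) s F, u)
   (machine_state F (enc (advance x)) (Node (Node (enc_code []) F) (Node Leaf s)) F, u @ out x)"
   by (subst (1) F_def, rule moves_trans[OF moves_ins(4)], rule moves_trans[OF runsD[OF n(2)]], rule moves_trans[OF k(2)],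
    rule moves_trans[OF moves_ins(5)], rule moves_trans[OF runsD[OF m(2)]], rule moves_ins(9))
  moreover have "1 + (n + (k + (1 + (m + 1)))) <= (2 * J + 2 * L + 100) * T x"
  proof -
   have "J * 1 <= J * T x" "L * 1 <= L * T x" using T(2)[OF D] by (intro mult_le_mono2; simp)+
   moreover have "n <= J * T x + J * 1" "m <= L * T x + L * 1" using n(1) m(1) unfolding distrib_left .
   moreover have "k <= 20 * length (out x) + 40" using k(1) by simp
   then have "k <= 60 * T x" using T[OF D] by linarith
   ultimately have "n <= 2 * (J * T x)" "m <= 2 * (L * T x)" "k + 3 <= 100 * T x" using T(2)[OF D] by linarith+
   then show ?thesis unfolding distrib_right mult.assoc by linarith
  qed
  ultimately show ?thesis by blast
 qed
 then show thesis by (rule that)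
qed

lemma output_loop_iterate:
 assumes loop: "\<And>x s u. D x ==> \<exists>n s'. n <= K * T x \<and>
   moves n (machine_state F (enc x) s F, u) (machine_state F (enc (advance x)) s' F, u @ out x)"
  and x: "\<And>i. D (x i)" "\<And>i. x (Suc i) = advance (x i)"
 shows "\<exists>N s. N <= K * (\<Sum>i<n. T (x i)) \<and>
  moves N (machine_state F (enc (x 0)) Leaf F, []) (machine_state F (enc (x n)) s F, concat (map (%i. out (x i)) [0..<n]))"
proof (induction n)
 case 0
 have "moves 0 (machine_state F (enc (x 0)) Leaf F, []) (machine_state F (enc (x 0)) Leaf F, [])" by (simp add: moves_def)
 then show ?case by auto
next
 case (Suc n)
 then obtain N s where N: "N <= K * (\<Sum>i<n. T (x i))"
  "moves N (machine_state F (enc (x 0)) Leaf F, []) (machine_state F (enc (x n)) s F, concat (map (%i. out (x i)) [0..<n]))"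
   by blast
 obtain m s' where m: "m <= K * T (x n)" "moves m (machine_state F (enc (x n)) s F, concat (map (%i. out (x i)) [0..<n]))
  (machine_state F (enc (x (Suc n))) s' F, concat (map (%i. out (x i)) [0..<n]) @ out (x n))" using loop[OF x(1)] x(2) by metis
 have "N + m <= K * (\<Sum>i<Suc n. T (x i))" using N(1) m(1) by (simp add: distrib_left)
 then show ?case using moves_trans[OF N(2) m(2)] by auto
qed

primrec stage_output :: "nat => bool list" where
 "stage_output 0 = prefix_bits 0"
| "stage_output (Suc i) = stage (i + 4) (prefix_bits i)"

lemma length_stage_output: "length (stage_output i) <= 2 ^ (i + 4)"
 by (cases i) (auto simp: length_stage power_add)

lemma concat_stage_outputs: "concat (map (%i. rev (stage_output i)) [0..<Suc n]) = rev (prefix_bits n)"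
 by (induction n) auto

lemma sum_stage_costs: "(\<Sum>i<n. 2 ^ (i + 4) * (i + 5) ^ 128) <= 2 ^ (n + 4) * (n + 5 :: nat) ^ 128"
proof (induction n)
 case (Suc n)
 have "(\<Sum>i<Suc n. 2 ^ (i + 4) * (i + 5) ^ 128) <= 2 * (2 ^ (n + 4) * (n + 5 :: nat) ^ 128)" using Suc by simp
 also have "... = 2 ^ (Suc n + 4) * (n + 5) ^ 128" by (simp add: power_add)
 also have "... <= 2 ^ (Suc n + 4) * (Suc n + 5) ^ 128" by (intro mult_le_mono2 power_mono) auto
 finally show ?case .
qed simp

abbreviation loop_input :: "nat \<times> bool list \<times> bool list => bool" where
 "loop_input x \<equiv> 4 <= fst x \<and> length (arg2 x) = 2 ^ fst x \<and> length (rst3 x) <= 2 ^ fst x"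

abbreviation loop_step :: "nat \<times> bool list \<times> bool list => nat \<times> bool list \<times> bool list" where
 "loop_step x \<equiv> (Suc (fst x), stage (fst x) (arg2 x) @ arg2 x, stage (fst x) (arg2 x))"

lemma computes_loop_step: "computes loop_input loop_step (%x. 2 ^ fst x * (fst x + 1) ^ 128)" (is "computes _ _ ?T")
proof -
 have "computes loop_input (%x. (fst x, arg2 x)) (%_. 0)" by (rule computes_bound[where K = 1], (rule computes_intros)+) simp
 from computes_comp[OF computes_stage this] have "computes loop_input (%x. stage (fst x) (arg2 x)) ?T" by simp
 from computes_Pair[OF computes_id this] have stage: "computes loop_input (%x. (x, stage (fst x) (arg2 x))) ?T" by simp
 have "computes (%y. length (snd y) = 2 ^ fst (fst y)) (%y. (Suc (fst (fst y)), snd y @ arg2 (fst y), snd y))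
   (%y. 2 ^ fst (fst y))"
  by (rule computes_bound[where K = 1], (rule computes_intros)+) simp
 from computes_comp[OF this stage] have "computes loop_input loop_step (%x. ?T x + 2 ^ fst x)" by (simp add: length_stage)
 then show ?thesis
 proof (rule computes_bound[where K = 2])
  fix x :: "nat \<times> bool list \<times> bool list"
  have "t + p <= 2 * (t + 1)" if "p <= t" for t p :: nat using that by simp
  then show "?T x + 2 ^ fst x <= 2 * (?T x + 1)" by this simp
 qed
qed

lemma eval_expr_surj: "\<exists>x. eval_expr x Leaf = t"
 by (induction t) (metis eval_expr.simps(2), metis eval_expr.simps(3))

theorem machine_output:
 "\<exists>e K. \<forall>i. \<exists>N. snd ((dtree_step machine ^^ N) (eval_expr e Leaf, [])) = rev (prefix_bits i)
   \<and> N <= K * (2 ^ (i + 5) * (i + 6) ^ 128)"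
proof -
 let ?T = "%x::nat \<times> bool list \<times> bool list. 2 ^ fst x * (fst x + 1) ^ 128"
 let ?x = "%i. (i + 4, prefix_bits i, stage_output i)"
 have power_le: "2 ^ k <= 2 ^ k * (k + 1 :: nat) ^ 128" for k by simp
 have out: "computes loop_input (%x. rev (rst3 x)) ?T"
 proof (rule computes_bound[where K = 1], (rule computes_intros)+, goal_cases)
  case (1 x)
  then have "length (rst3 x) <= 2 ^ fst x" by blast
  also note power_le
  finally show ?case by simp
 qed
 obtain F K where loop: "\<And>x s u. loop_input x ==> \<exists>n s'. n <= K * ?T x \<and>
   moves n (machine_state F (enc x) s F, u) (machine_state F (enc (loop_step x)) s' F, u @ rev (rst3 x))"
  by (rule output_loop_exists[OF out computes_loop_step]) (use power_le in \<open>auto intro: order_trans\<close>)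
 have input: "loop_input (?x i)" for i using length_stage_output[of i] by (simp add: length_prefix_bits)
 have step: "?x (Suc i) = loop_step (?x i)" for i by simp
 obtain e where e: "eval_expr e Leaf = machine_state F (enc (?x 0)) Leaf F" using eval_expr_surj by blast
 have "\<exists>N. snd ((dtree_step machine ^^ N) (eval_expr e Leaf, [])) = rev (prefix_bits i)
   \<and> N <= K * (2 ^ (i + 5) * (i + 6) ^ 128)" for i
 proof -
  obtain N s where N: "N <= K * (\<Sum>i<Suc i. ?T (?x i))"
   "moves N (machine_state F (enc (?x 0)) Leaf F, []) (machine_state F (enc (?x (Suc i))) s F,
     concat (map (%i. rev (rst3 (?x i))) [0..<Suc i]))"
   using output_loop_iterate[where D = loop_input and x = ?x and T = ?T and n = "Suc i", OF loop input step] by blast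
  have "(\<Sum>i<Suc i. ?T (?x i)) = (\<Sum>i<Suc i. 2 ^ (i + 4) * (i + 5) ^ 128)" by (intro sum.cong) (auto simp: add.commute)
  also have "... <= 2 ^ (Suc i + 4) * (Suc i + 5) ^ 128" by (rule sum_stage_costs)
  also have "... = 2 ^ (i + 5) * (i + 6) ^ 128"
   by (simp only: add_Suc add_Suc_right[symmetric] numeral_eq_Suc pred_numeral_simps BitM.simps arith_simps)
  finally have "K * (\<Sum>i<Suc i. ?T (?x i)) <= K * (2 ^ (i + 5) * (i + 6) ^ 128)" by (rule mult_le_mono2)
  moreover have "snd ((dtree_step machine ^^ N) (machine_state F (enc (?x 0)) Leaf F, [])) = rev (prefix_bits i)"
   using N(2) concat_stage_outputs[of i] unfolding moves_def snd_conv by simp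
  ultimately show ?thesis using N(1) unfolding e by (intro exI[of _ N]) linarith
 qed
 then show ?thesis by blast
qed

lemma blen_le: "x < 2 ^ m ==> blen x <= m + 1"
proof (induction m arbitrary: x)
 case 0
 then show ?case by (simp add: blen.simps)
next
 case (Suc m)
 have "x div 2 < 2 ^ m" using Suc.prems by (simp add: less_mult_imp_div_less mult.commute)
 then show ?case using Suc.IH[of "x div 2"] by (subst blen.simps) auto
qed

lemma log_cost_nat_bound:
 assumes i: "2 ^ i <= n + 2" and T: "T <= K * (2 ^ (i + 5) * (i + 6) ^ 128)"
 shows "C * (T + 1) * blen (C * (T + 1)) <= C * (K + 1) * 32 * (C + K + 130) * (n + 2) * (i + 6) ^ 129"
proof -
 define X where "X = 2 ^ (i + 5) * (i + 6) ^ 128"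
 have "1 <= X" by (simp add: X_def Suc_le_eq)
 then have TX: "T + 1 <= (K + 1) * X" using T unfolding X_def[symmetric] by simp
 have "(i + 6) ^ 128 <= (2 ^ (i + 6)) ^ 128" using less_exp[of "i + 6"] by (intro power_mono) auto
 then have "X <= 2 ^ (i + 5) * (2 ^ (i + 6)) ^ 128" unfolding X_def by (rule mult_le_mono2)
 also have "... = 2 ^ (i + 5 + (i + 6) * 128)" by (simp only: power_mult power_add)
 finally have X: "X <= 2 ^ (i + 5 + (i + 6) * 128)" .
 have "C * (T + 1) <= C * ((K + 1) * X)" using TX by (rule mult_le_mono2)
 also have "... <= 2 ^ C * (2 ^ (K + 1) * 2 ^ (i + 5 + (i + 6) * 128))" by (intro mult_le_mono less_imp_le[OF less_exp] X)
 also have "... = 2 ^ (C + (K + 1 + (i + 5 + (i + 6) * 128)))" by (simp only: power_add)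
 also have "... < 2 ^ (C + K + 129 * (i + 6) + 1)" by (rule power_strict_increasing) auto
 finally have "blen (C * (T + 1)) <= C + K + 129 * (i + 6) + 1 + 1" by (rule blen_le)
 also have "... <= (C + K + 130) * (i + 6)" by (simp add: algebra_simps)
 finally have "C * (T + 1) * blen (C * (T + 1)) <= C * ((K + 1) * X) * ((C + K + 130) * (i + 6))"
  using TX by (intro mult_le_mono) auto
 also have "... = C * (K + 1) * (C + K + 130) * (X * (i + 6))" by (simp only: ac_simps)
 also have "X * (i + 6) = 2 ^ (i + 5) * (i + 6) ^ 129" by (simp only: X_def mult.assoc power_Suc2[symmetric]) simp
 also have "... = 32 * 2 ^ i * (i + 6) ^ 129" by (simp add: power_add)
 also have "C * (K + 1) * (C + K + 130) * (32 * 2 ^ i * (i + 6) ^ 129) <= C * (K + 1) * (C + K + 130)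
   * (32 * (n + 2) * (i + 6) ^ 129)"
  using i by (intro mult_le_mono2 mult_le_mono1)
 also have "... = C * (K + 1) * 32 * (C + K + 130) * (n + 2) * (i + 6) ^ 129" by (simp only: ac_simps)
 finally show ?thesis .
qed

lemma log_index_le:
 assumes "2 ^ i <= n + 2"
 shows "real (i + 6) <= 14 * ln (real (n + 2))"
proof -
 have half: "1 / 2 <= ln (2::real)" using ln_le_minus_one[of "1 / 2 :: real"] by (simp add: ln_div)
 have "ln 2 <= ln (real (n + 2))" by (subst ln_le_cancel_iff) auto
 moreover have "real (2 ^ i) <= real (n + 2)" using assms by (simp only: of_nat_le_iff)
 then have "ln (real (2 ^ i)) <= ln (real (n + 2))" by (subst ln_le_cancel_iff) auto
 then have "real i * ln 2 <= ln (real (n + 2))" by (simp add: ln_realpow)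
 moreover have "real i * (1 / 2) <= real i * ln 2" using half by (rule mult_left_mono) simp
 ultimately show ?thesis using half unfolding of_nat_add of_nat_numeral by linarith
qed

lemma log_cost_bound:
 assumes i: "2 ^ i <= n + 2" and T: "T <= K * (2 ^ (i + 5) * (i + 6) ^ 128)"
 shows "real (C * (T + 1) * blen (C * (T + 1))) <= real (C * (K + 1) * 32 * (C + K + 130)) * 14 ^ 129 * real (n + 2)
   * ln (real (n + 2)) powr 129"
proof -
 define A where "A = C * (K + 1) * 32 * (C + K + 130)"
 define L where "L = ln (real (n + 2))"
 have L: "real (i + 6) <= 14 * L" unfolding L_def by (rule log_index_le[OF i])
 have "real (C * (T + 1) * blen (C * (T + 1))) <= real (A * (n + 2) * (i + 6) ^ 129)"
  unfolding of_nat_le_iff A_def by (rule log_cost_nat_bound[OF i T])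
 also have "... = real A * real (n + 2) * real (i + 6) ^ 129" by (simp only: of_nat_mult of_nat_power)
 also have "... <= real A * real (n + 2) * (14 * L) ^ 129" using L by (intro mult_left_mono power_mono) auto
 also have "... = real A * 14 ^ 129 * real (n + 2) * L powr 129" using L by (simp add: power_mult_distrib powr_numeral)
 finally show ?thesis by (simp only: A_def L_def)
qed

theorem mainTheorem11:
  shows "\<exists>(P :: instr list) (z :: real) (c :: real) (C :: real).
           0 \<le> z \<and> z < 1 \<and> absolutely_normal z \<and>
           (\<forall>n. \<exists>t. n < length (outp (run P t)) \<and>
                  outp (run P t) ! n = (digit 2 z n = 1) \<and>
                  real (cost P t) \<le> C * real (n + 2) * ln (real (n + 2)) powr c)"
proof -
 obtain z where z: "0 <= z" "z < 1" "encodes z" using encodes_exists by blast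
 obtain x0 K where machine: "\<And>i. \<exists>N. snd ((dtree_step machine ^^ N) (eval_expr x0 Leaf, [])) = rev (prefix_bits i)
   \<and> N <= K * (2 ^ (i + 5) * (i + 6) ^ 128)"
  using machine_output by blast
 obtain P C where ram: "\<And>T. \<exists>t. outp (run P t) = snd ((dtree_step machine ^^ T) (eval_expr x0 Leaf, [])) \<and> cost P t
   <= C * (T + 1) * blen (C * (T + 1))"
  using ram_simulates_dtree[of machine x0] by blast
 have "\<exists>t. n < length (outp (run P t)) \<and> outp (run P t) ! n = (digit 2 z n = 1) \<and>
  real (cost P t) <= real (C * (K + 1) * 32 * (C + K + 130)) * 14 ^ 129 * real (n + 2) * ln (real (n + 2)) powr 129" for n
 proof -
  define i where "i = floor_log 2 (n + 2)"
  have i: "2 ^ i <= n + 2" "n + 2 < 2 ^ Suc i" using floor_log_bounds[of 2 "n + 2"] by (auto simp: i_def)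
  have n: "n < 2 ^ (i + 4)" using i(2) by (simp add: power_add)
  obtain T where T: "snd ((dtree_step machine ^^ T) (eval_expr x0 Leaf, [])) = rev (prefix_bits i)"
   "T <= K * (2 ^ (i + 5) * (i + 6) ^ 128)" using machine by blast
  obtain t where t: "outp (run P t) = rev (prefix_bits i)" "cost P t <= C * (T + 1) * blen (C * (T + 1))" using ram[of T] T(1)
   by auto
  have "real (cost P t) <= real (C * (T + 1) * blen (C * (T + 1)))" using t(2) by (simp only: of_nat_le_iff)
  also note log_cost_bound[OF i(1) T(2)]
  finally show ?thesis using t(1) n encodes_digits[OF z(1,3) n] by (intro exI[of _ t]) (simp add: length_prefix_bits)
 qed
 then show ?thesis using z encodes_absolutely_normal by blast
qed

end
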